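(* For any $T\in p\,\mathrm{Sym}_3(\mathbb{Z}_p)$ with $\det(T)\neq0$, and for any $\boldsymbol\beta\in(V''_p)^3$ with $T=p\,Q''(\boldsymbol\beta)$, $$|\mathcal{T}(\boldsymbol\beta)_0|=(1-p^{-4})^{-1}\cdot\alpha_p(S,p^{-1}T),$$ where $\alpha_p(S,p^{-1}T)$ is the representation density of the quadratic form $p^{-1}T$ by the quadratic form $Q''$ on the lattice $N_0$ (with matrix $S$).
   Context: Let $p$ be an odd prime, $\mathbb{Q}_{p^2}$ the unramified quadratic extension of $\mathbb{Q}_p$ with ring of integers $\mathbb{Z}_{p^2}$ and Galois automorphism $\sigma$. Let $U$ be a two-dimensional $\mathbb{Q}_{p^2}$-vector space with a nondegenerate alternating form $\langle\ ,\ \rangle$. Let $V''_p$ be the four-dimensional $\mathbb{Q}_p$-vector space of $\sigma$-linear endomorphisms $\beta$ of $U$ with $\beta^*=\beta$, where $\langle\beta x,y\rangle=\langle x,\beta^*y\rangle^\sigma$; the quadratic form $Q''$ is defined by $\beta^2=Q''(\beta)\cdot1_U$, $Q''(\beta)\in\mathbb{Q}_p$. For a tuple $\boldsymbol\beta=(\beta_1,\dots,\beta_n)$, $Q''(\boldsymbol\beta)=\frac12((\beta_i,\beta_l))_{i,l}$ with $(\beta,\beta')=Q''(\beta+\beta')-Q''(\beta)-Q''(\beta')$. $\mathcal{B}$ is the Bruhat–Tits tree of $PGL(U)$ with edge length $1$; its vertices are homothety classes $[\Lambda]$ of $\mathbb{Z}_{p^2}$-lattices in $U$. Each $\beta\in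 V''_p$ with $Q''(\beta)\ne0$ acts on $\mathcal{B}$ as an involution with fixed point set $\mathcal{B}^\beta$, and $\mathcal{T}(\beta)=\{x\in\mathcal{B}: d(x,\mathcal{B}^\beta)\le\frac12\mathrm{ord}_pQ''(\beta)\}$. For $\boldsymbol\beta$ with $\det Q''(\boldsymbol\beta)\neq0$, $\mathcal{T}(\boldsymbol\beta)=\bigcap_i\mathcal{T}(\beta'_i)$, where $\beta'_1,\dots,\beta'_n$ is an orthogonal $\mathbb{Z}_p$-basis of the $\mathbb{Z}_p$-span of the components of $\boldsymbol\beta$, and $\mathcal{T}(\boldsymbol\beta)_0$ is its set of vertices. (Equivalently, $\mathcal{T}(\boldsymbol\beta)_0$ is the set of $[\Lambda]$ with $\beta_i(\Lambda)\subset\Lambda$ for all $i$.) Fix a $\mathbb{Z}_{p^2}$-lattice $\Lambda_0\subset U$, put $N_0=\{\beta\in V''_p:\beta(\Lambda_0)\subset\Lambda_0\}$, a free $\mathbb{Z}_p$-module of rank $4$, and let $S$ be the symmetric matrix with $Q''$ in coordinates $x$ with respect to a $\mathbb{Z}_p$-basis of $N_0$ given by ${}^txSx$. For $T'\in\mathrm{Sym}_3(\mathbb{Z}_p)$, $$\alpha_p(S,T')=\lim_{t\to\infty}p^{t(6-12)}\,\#\{x\in M_{4,3}(\mathbb{Z}/p^t): {}^txSx\equiv T'\bmod p^t\}.$$ *)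

theory Defs
  imports "HOL-Analysis.Analysis"
begin

text \<open>
  The field of \<open>p\<close>-adic numbers and its unramified quadratic extension are given through their
  defining properties, with the big field as a type \<open>'k\<close> and \<open>\<rat>\<^sub>p\<close> as a subfield \<open>Qp\<close> of it:
  \<open>Qp\<close> is the completion of \<open>\<rat>\<close> for the \<open>p\<close>-adic absolute value, \<open>'k\<close> has degree 2 over \<open>Qp\<close>,
  and the extension of the absolute value takes no new values.  The ultrametric inequality and
  the value at \<open>p\<close> determine \<open>absv\<close> on \<open>\<rat>\<close>.
\<close>

locale unramified_quadratic_extension =
  fixes p :: nat
    and absv :: "'k::field_char_0 \<Rightarrow> real"
    and Qp :: "'k set"
    and \<sigma> :: "'k \<Rightarrow> 'k"
  assumes prime_p: "prime p" and odd_p: "odd p"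
    and absv_nonneg: "\<And>x. 0 \<le> absv x"
    and absv_eq_0: "\<And>x. absv x = 0 \<longleftrightarrow> x = 0"
    and absv_mult: "\<And>x y. absv (x * y) = absv x * absv y"
    and absv_add: "\<And>x y. absv (x + y) \<le> max (absv x) (absv y)"
    and absv_p: "absv (of_nat p) = 1 / real p"
    and Qp_1: "1 \<in> Qp"
    and Qp_diff: "\<And>x y. x \<in> Qp \<Longrightarrow> y \<in> Qp \<Longrightarrow> x - y \<in> Qp"
    and Qp_mult: "\<And>x y. x \<in> Qp \<Longrightarrow> y \<in> Qp \<Longrightarrow> x * y \<in> Qp"
    and Qp_inverse: "\<And>x. x \<in> Qp \<Longrightarrow> inverse x \<in> Qp"
    and Rats_dense: "\<And>x e. x \<in> Qp \<Longrightarrow> 0 < e \<Longrightarrow> \<exists>r\<in>\<rat>. absv (x - r) < e"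
    and Qp_complete: "\<And>X :: nat \<Rightarrow> 'k.
          (\<And>n. X n \<in> Qp) \<Longrightarrow>
          (\<And>e. 0 < e \<Longrightarrow> \<exists>N. \<forall>m\<ge>N. \<forall>n\<ge>N. absv (X m - X n) < e) \<Longrightarrow>
          \<exists>l\<in>Qp. (\<lambda>n. absv (X n - l)) \<longlonglongrightarrow> 0"
    and quadratic: "\<exists>w. w \<notin> Qp \<and> (\<forall>x. \<exists>a\<in>Qp. \<exists>b\<in>Qp. x = a + b * w)"
    and unramified: "\<And>x. x \<noteq> 0 \<Longrightarrow> \<exists>n::int. absv x = real p powi n"
    and \<sigma>_bij: "bij \<sigma>"
    and \<sigma>_add: "\<And>x y. \<sigma> (x + y) = \<sigma> x + \<sigma> y"
    and \<sigma>_mult: "\<And>x y. \<sigma> (x * y) = \<sigma> x * \<sigma> y"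
    and \<sigma>_Qp: "\<And>x. x \<in> Qp \<Longrightarrow> \<sigma> x = x"
    and \<sigma>_nontrivial: "\<sigma> \<noteq> id"
begin

definition Zp :: "'k set" where
  "Zp = {x \<in> Qp. absv x \<le> 1}"

definition Zp2 :: "'k set" where
  "Zp2 = {x. absv x \<le> 1}"

definition ord_p :: "'k \<Rightarrow> int" where
  "ord_p x = (THE n. absv x = real p powi (- n))"

definition Sym_Zp :: "('k^'n^'n) set" where
  "Sym_Zp = {M. transpose M = M \<and> (\<forall>i j. M $ i $ j \<in> Zp)}"

text \<open>
  The elements of \<open>\<int>/p\<^sup>t\<close> are represented by the integers \<open>0, \<dots>, p\<^sup>t - 1\<close>; the congruence
  is modulo the ideal \<open>p\<^sup>t \<int>\<^sub>p\<close>, entry by entry.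
\<close>

definition representations :: "'k^4^4 \<Rightarrow> 'k^3^3 \<Rightarrow> nat \<Rightarrow> (int^3^4) set" where
  "representations S T t =
     {x. (\<forall>i j. x $ i $ j \<in> {0..<int p ^ t}) \<and>
         (let X = map_matrix of_int x in
          \<forall>i j. \<exists>z\<in>Zp. (transpose X ** S ** X) $ i $ j - T $ i $ j = of_nat p ^ t * z)}"

definition density_seq :: "'k^4^4 \<Rightarrow> 'k^3^3 \<Rightarrow> nat \<Rightarrow> real" where
  "density_seq S T t = real p powi (int t * (6 - 12)) * real (card (representations S T t))"

definition rep_density :: "'k^4^4 \<Rightarrow> 'k^3^3 \<Rightarrow> real" where
  "rep_density S T = lim (density_seq S T)"

end


locale symplectic_plane =
  unramified_quadratic_extension p absv Qp \<sigma> + vector_space scale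
  for p :: nat and absv :: "'k::field_char_0 \<Rightarrow> real" and Qp :: "'k set" and \<sigma> :: "'k \<Rightarrow> 'k"
    and scale :: "'k \<Rightarrow> 'u::ab_group_add \<Rightarrow> 'u" +
  fixes form :: "'u \<Rightarrow> 'u \<Rightarrow> 'k"
  assumes dim_2: "dim (UNIV :: 'u set) = 2"
    and form_add_left: "\<And>x y z. form (x + y) z = form x z + form y z"
    and form_add_right: "\<And>x y z. form x (y + z) = form x y + form x z"
    and form_scale_left: "\<And>c x y. form (scale c x) y = c * form x y"
    and form_scale_right: "\<And>c x y. form x (scale c y) = c * form x y"
    and form_alternating: "\<And>x. form x x = 0"
    and form_nondegenerate: "\<And>x. (\<And>y. form x y = 0) \<Longrightarrow> x = 0"
begin

definition semilinear :: "('u \<Rightarrow> 'u) \<Rightarrow> bool" where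
  "semilinear \<beta> \<longleftrightarrow>
     (\<forall>u v. \<beta> (u + v) = \<beta> u + \<beta> v) \<and> (\<forall>c u. \<beta> (scale c u) = scale (\<sigma> c) (\<beta> u))"

text \<open>\<open>is_adjoint \<beta> \<gamma>\<close> says \<open>\<gamma> = \<beta>\<^sup>*\<close>; by nondegeneracy it determines \<open>\<gamma>\<close>.\<close>

definition is_adjoint :: "('u \<Rightarrow> 'u) \<Rightarrow> ('u \<Rightarrow> 'u) \<Rightarrow> bool" where
  "is_adjoint \<beta> \<gamma> \<longleftrightarrow> (\<forall>x y. form (\<beta> x) y = \<sigma> (form x (\<gamma> y)))"

definition Vpp :: "('u \<Rightarrow> 'u) set" where
  "Vpp = {\<beta>. semilinear \<beta> \<and> is_adjoint \<beta> \<beta>}"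

definition Q :: "('u \<Rightarrow> 'u) \<Rightarrow> 'k" where
  "Q \<beta> = (THE c. c \<in> Qp \<and> (\<forall>u. \<beta> (\<beta> u) = scale c u))"

definition bil :: "('u \<Rightarrow> 'u) \<Rightarrow> ('u \<Rightarrow> 'u) \<Rightarrow> 'k" where
  "bil \<beta> \<gamma> = Q (\<lambda>u. \<beta> u + \<gamma> u) - Q \<beta> - Q \<gamma>"

definition Q_matrix :: "('n \<Rightarrow> 'u \<Rightarrow> 'u) \<Rightarrow> 'k^'n^'n" where
  "Q_matrix \<beta> = (\<chi> i l. 1 / 2 * bil (\<beta> i) (\<beta> l))"

definition comb :: "'k^'n \<Rightarrow> ('n \<Rightarrow> 'u \<Rightarrow> 'u) \<Rightarrow> 'u \<Rightarrow> 'u" where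
  "comb c e = (\<lambda>u. \<Sum>i\<in>UNIV. scale (c $ i) (e i u))"

definition Zp_span :: "('n::finite \<Rightarrow> 'u \<Rightarrow> 'u) \<Rightarrow> ('u \<Rightarrow> 'u) set" where
  "Zp_span e = {comb c e | c. \<forall>i. c $ i \<in> Zp}"

definition Zp_basis :: "('n::finite \<Rightarrow> 'u \<Rightarrow> 'u) \<Rightarrow> ('u \<Rightarrow> 'u) set \<Rightarrow> bool" where
  "Zp_basis e N \<longleftrightarrow>
     Zp_span e = N \<and> (\<forall>c. (\<forall>i. c $ i \<in> Zp) \<and> comb c e = (\<lambda>u. 0) \<longrightarrow> c = 0)"

definition orthogonal_Zp_basis :: "('n::finite \<Rightarrow> 'u \<Rightarrow> 'u) \<Rightarrow> ('u \<Rightarrow> 'u) set \<Rightarrow> bool" where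
  "orthogonal_Zp_basis e N \<longleftrightarrow> Zp_basis e N \<and> (\<forall>i j. i \<noteq> j \<longrightarrow> bil (e i) (e j) = 0)"

definition lattice :: "'u set \<Rightarrow> bool" where
  "lattice \<Lambda> \<longleftrightarrow>
     (\<exists>A. finite A \<and> independent A \<and> span A = UNIV \<and>
          \<Lambda> = {\<Sum>a\<in>A. scale (c a) a | c. \<forall>a\<in>A. c a \<in> Zp2})"

definition N :: "'u set \<Rightarrow> ('u \<Rightarrow> 'u) set" where
  "N \<Lambda> = {\<beta> \<in> Vpp. \<beta> ` \<Lambda> \<subseteq> \<Lambda>}"

definition form_matrix :: "('u \<Rightarrow> 'u) set \<Rightarrow> 'k^'n^'n \<Rightarrow> bool" where
  "form_matrix M S \<longleftrightarrow>
     transpose S = S \<and>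
     (\<exists>e :: 'n \<Rightarrow> 'u \<Rightarrow> 'u. Zp_basis e M \<and>
        (\<forall>x. (\<forall>i. x $ i \<in> Zp) \<longrightarrow>
             Q (comb x e) = (\<Sum>i\<in>UNIV. \<Sum>j\<in>UNIV. x $ i * S $ i $ j * x $ j)))"

subsection \<open>The Bruhat--Tits tree\<close>

definition homothety_class :: "'u set \<Rightarrow> 'u set set" where
  "homothety_class \<Lambda> = {scale c ` \<Lambda> | c. c \<noteq> 0}"

definition vertices :: "'u set set set" where
  "vertices = {homothety_class \<Lambda> | \<Lambda>. lattice \<Lambda>}"

definition adjacent :: "'u set set \<Rightarrow> 'u set set \<Rightarrow> bool" where
  "adjacent v w \<longleftrightarrow>
     v \<in> vertices \<and> w \<in> vertices \<and>
     (\<exists>\<Lambda>\<in>v. \<exists>\<Lambda>'\<in>w. scale (of_nat p) ` \<Lambda> \<subset> \<Lambda>' \<and> \<Lambda>' \<subset> \<Lambda>)"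

definition vertex_dist :: "'u set set \<Rightarrow> 'u set set \<Rightarrow> nat" where
  "vertex_dist v w = (LEAST n. (adjacent ^^ n) v w)"

text \<open>
  Points of the geometric realization are given by their barycentric coordinates: nonnegative
  functions on the vertices, supported in a vertex or an edge, with sum 1.
\<close>

definition simplices :: "'u set set set set" where
  "simplices = {{v} | v. v \<in> vertices} \<union> {{v, w} | v w. adjacent v w}"

definition supp :: "('u set set \<Rightarrow> real) \<Rightarrow> 'u set set set" where
  "supp x = {v. x v \<noteq> 0}"

definition tree :: "('u set set \<Rightarrow> real) set" where
  "tree = {x. (\<forall>v. 0 \<le> x v) \<and> (\<exists>s\<in>simplices. supp x \<subseteq> s) \<and> (\<Sum>v\<in>supp x. x v) = 1}"

definition vertex_point :: "'u set set \<Rightarrow> 'u set set \<Rightarrow> real" where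
  "vertex_point v = indicator {v}"

text \<open>
  The path metric for which every edge is a segment of length 1: a shortest path either stays
  in one closed edge, or leaves the simplex of \<open>x\<close> at a vertex \<open>a\<close> and enters that of \<open>y\<close> at a
  vertex \<open>b\<close>.  The distance from \<open>x\<close> to a vertex \<open>a\<close> of its simplex is \<open>1 - x a\<close>.
\<close>

definition tree_dist :: "('u set set \<Rightarrow> real) \<Rightarrow> ('u set set \<Rightarrow> real) \<Rightarrow> real" where
  "tree_dist x y =
     Inf ({\<bar>x a - y a\<bar> | a b. adjacent a b \<and> supp x \<union> supp y \<subseteq> {a, b}} \<union>
          {(1 - x a) + real (vertex_dist a b) + (1 - y b) | a b. a \<in> supp x \<and> b \<in> supp y})"

definition act_vertex :: "('u \<Rightarrow> 'u) \<Rightarrow> 'u set set \<Rightarrow> 'u set set" where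
  "act_vertex \<beta> v = (\<lambda>\<Lambda>. \<beta> ` \<Lambda>) ` v"

text \<open>The affine extension of the action on vertices.\<close>

definition act_point :: "('u \<Rightarrow> 'u) \<Rightarrow> ('u set set \<Rightarrow> real) \<Rightarrow> 'u set set \<Rightarrow> real" where
  "act_point \<beta> x = (\<lambda>v. \<Sum>w\<in>{w \<in> supp x. act_vertex \<beta> w = v}. x w)"

definition fixed_points :: "('u \<Rightarrow> 'u) \<Rightarrow> ('u set set \<Rightarrow> real) set" where
  "fixed_points \<beta> = {x \<in> tree. act_point \<beta> x = x}"

definition tree_locus1 :: "('u \<Rightarrow> 'u) \<Rightarrow> ('u set set \<Rightarrow> real) set" where
  "tree_locus1 \<beta> =
     {x \<in> tree. (INF y\<in>fixed_points \<beta>. tree_dist x y) \<le> 1 / 2 * real_of_int (ord_p (Q \<beta>))}"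

text \<open>The locus does not depend on the orthogonal basis, so any choice will do.\<close>

definition tree_locus :: "('n::finite \<Rightarrow> 'u \<Rightarrow> 'u) \<Rightarrow> ('u set set \<Rightarrow> real) set" where
  "tree_locus \<beta> =
     (let \<beta>' = (SOME \<beta>' :: 'n \<Rightarrow> 'u \<Rightarrow> 'u. orthogonal_Zp_basis \<beta>' (Zp_span \<beta>))
      in \<Inter>i. tree_locus1 (\<beta>' i))"

definition tree_locus_vertices :: "('n::finite \<Rightarrow> 'u \<Rightarrow> 'u) \<Rightarrow> 'u set set set" where
  "tree_locus_vertices \<beta> = {v \<in> vertices. vertex_point v \<in> tree_locus \<beta>}"

end

end

theory Submission
  imports Defs
begin

text \<open>
  Both sides count the same objects, split in the same way.

  The left side counts lattices.  For a lattice \<open>L\<close> choose a basis with \<open>L = \<langle>e, f\<rangle>\<close> and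
  \<open>\<beta> L = c \<langle>e, p\<^sup>m f\<rangle>\<close>.  The involution \<open>\<beta>\<close> reverses the path of length \<open>m\<close> from \<open>[L]\<close> to \<open>[\<beta> L]\<close>, so the
  distance from \<open>[L]\<close> to the fixed points is \<open>m/2\<close>; as \<open>\<bar>Q \<beta>\<bar> = \<bar>c\<bar>\<^sup>2 p\<^sup>-\<^sup>m\<close>, the vertex lies in the locus of
  \<open>\<beta>\<close> if and only if \<open>\<beta> L \<subseteq> L\<close> (\<open>vertex_in_locus_iff\<close>).  Stability under an orthogonal basis
  of the span of \<open>\<beta>\<^sub>1, \<beta>\<^sub>2, \<beta>\<^sub>3\<close> is stability under the \<open>\<beta>\<^sub>i\<close> themselves, so the vertices in question are
  the classes of lattices stable under the three \<open>\<beta>\<^sub>i\<close> (\<open>tree_locus_vertices_stable\<close>).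

  The right side counts matrices.  In suitable coordinates the quadratic space is \<open>\<rat>\<^sub>p\<^sup>4\<close> with the form
  \<open>x\<^sub>1\<^sup>2 - D x\<^sub>2\<^sup>2 + x\<^sub>3 x\<^sub>4\<close>, the norm form of the unramified extension plus a hyperbolic plane, and the
  endomorphisms preserving the given lattice are \<open>\<int>\<^sub>p\<^sup>4\<close>.  The density counts the \<open>3 \<times> 4\<close> matrices \<open>Y\<close>
  modulo \<open>p\<^sup>t\<close> whose rows have the prescribed Gram matrix (\<open>card_representations\<close>).

  Attach to a stable lattice \<open>L\<close> the module of all \<open>v\<close> in \<open>\<rat>\<^sub>p\<^sup>3\<close> such that the combination of the \<open>\<beta>\<^sub>i\<close> with
  coefficients \<open>v\<close> preserves \<open>L\<close>; and to \<open>Y\<close> the module of all \<open>v\<close> for which \<open>v Y\<close> is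
  integral.  Both modules contain \<open>\<int>\<^sub>p\<^sup>3\<close>, and the same modules \<open>M\<close> occur on both sides.  A rational matrix
  which takes \<open>M\<close> to \<open>\<int>\<^sub>p\<^sup>3\<close> reduces the two counts for \<open>M\<close> to triples that are linearly independent
  modulo \<open>p\<close>, and the Gram matrix of such a triple can be brought to the form \<open>diag (1, -D, u)\<close>
  (\<open>prim_diag\<close>, \<open>prim_cong_diag\<close>).  For this normal form:

  \<^item> The lattices belong to an eigenbasis of the product of the first two endomorphisms, and there are
    one or two classes according as \<open>u\<close> is a unit or not (\<open>card_lclass_dg\<close>).

  \<^item> Modulo \<open>p\<close> there are \<open>p\<^sup>2 (p\<^sup>4 - 1)\<close> matrices for a unit \<open>u\<close> and twice as many otherwise
    (\<open>ncos_primset_dg\<close>): the only difference is that a hyperbola \<open>x y = u\<close> modulo \<open>p\<close> has \<open>p - 1\<close> points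
    different from the origin in the first case and \<open>2 (p - 1)\<close> in the second.  They are equidistributed
    modulo higher powers of \<open>p\<close>, because the Gram matrix is a submersion at a primitive matrix
    (\<open>ncos_primset_Suc\<close>, \<open>ncos_primset_weighted\<close>).

  So each lattice class accounts for \<open>p\<^sup>6\<^sup>(\<^sup>t\<^sup>-\<^sup>1\<^sup>) p\<^sup>2 (p\<^sup>4 - 1) = p\<^sup>6\<^sup>t (1 - p\<^sup>-\<^sup>4)\<close> matrices modulo \<open>p\<^sup>t\<close>
  (\<open>ncos_sat_class_lclass\<close>, \<open>ncos_reps_stable\<close>), as soon as \<open>p\<^sup>t\<close> is beyond the determinant; the sequence
  defining the density is eventually constant (\<open>density_seq_limit\<close>).
\<close>

section \<open>The field and its absolute value\<close>

context unramified_quadratic_extension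
begin

abbreviation \<pi> :: 'k where "\<pi> \<equiv> of_nat p"

lemma p_gt_1: "1 < real p"
  using prime_gt_1_nat[OF prime_p] by simp

lemma p_pos [simp]: "0 < real p" "0 < p" "p \<noteq> 0"
  using p_gt_1 by auto

lemma absv_0 [simp]: "absv 0 = 0"
  using absv_eq_0 by simp

lemma absv_1 [simp]: "absv 1 = 1"
proof -
  have "absv 1 * absv 1 = absv 1" using absv_mult[of 1 1] by simp
  moreover have "absv 1 \<noteq> 0" using absv_eq_0 by simp
  ultimately show ?thesis by simp
qed

lemma absv_minus [simp]: "absv (- x) = absv x"
proof -
  have "absv (-1) * absv (-1) = 1" using absv_mult[of "-1" "-1"] by simp
  then have "absv (-1) = 1"
    using absv_nonneg[of "-1"] by (metis abs_of_nonneg abs_mult_self_eq real_sqrt_abs2 real_sqrt_one)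
  then show ?thesis using absv_mult[of "-1" x] by simp
qed

lemma absv_diff: "absv (x - y) \<le> max (absv x) (absv y)"
  using absv_add[of x "- y"] by simp

lemma absv_commute: "absv (x - y) = absv (y - x)"
  using absv_minus[of "x - y"] by simp

lemma absv_power: "absv (x ^ n) = absv x ^ n"
  by (induction n) (auto simp: absv_mult)

lemma absv_inverse: "absv (inverse x) = inverse (absv x)"
proof (cases "x = 0")
  case False
  then have "absv x * absv (inverse x) = 1" using absv_mult[of x "inverse x"] by simp
  then show ?thesis by (simp add: inverse_unique)
qed simp

lemma absv_divide: "absv (x / y) = absv x / absv y"
  by (simp add: divide_inverse absv_mult absv_inverse)

lemma absv_pos: "x \<noteq> 0 \<Longrightarrow> 0 < absv x"
  using absv_nonneg[of x] absv_eq_0[of x] by simp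

lemma absv_sum_le:
  assumes "\<And>i. i \<in> A \<Longrightarrow> absv (f i) \<le> c" "0 \<le> c"
  shows "absv (sum f A) \<le> c"
  using assms(1)
proof (induction A rule: infinite_finite_induct)
  case (insert x F)
  then show ?case using absv_add[of "f x" "sum f F"] by (auto intro: order_trans)
qed (use assms(2) in auto)

text \<open>An ultrametric triangle is isosceles.\<close>

lemma absv_add_eq: "absv (x + y) = absv x" if "absv y < absv x"
proof (rule antisym)
  show "absv (x + y) \<le> absv x" using absv_add[of x y] that by simp
  show "absv x \<le> absv (x + y)" using absv_diff[of "x + y" y] that by simp
qed

lemma absv_add_lt: "absv x < c \<Longrightarrow> absv y < c \<Longrightarrow> absv (x + y) < c"
  using absv_add[of x y] by simp

lemma absv_diff_lt: "absv x < c \<Longrightarrow> absv y < c \<Longrightarrow> absv (x - y) < c"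
  using absv_diff[of x y] by simp

lemma absv_add_le: "absv x \<le> c \<Longrightarrow> absv y \<le> c \<Longrightarrow> absv (x + y) \<le> c"
  using absv_add[of x y] by simp

lemma absv_diff_le: "absv x \<le> c \<Longrightarrow> absv y \<le> c \<Longrightarrow> absv (x - y) \<le> c"
  using absv_diff[of x y] by simp

lemma absv_mult_le: "absv x \<le> a \<Longrightarrow> absv y \<le> b \<Longrightarrow> absv (x * y) \<le> a * b"
  by (simp add: absv_mult mult_mono absv_nonneg order_trans[OF absv_nonneg])

lemma absv_mult_lt1: "absv x < 1 \<Longrightarrow> absv y \<le> 1 \<Longrightarrow> absv (x * y) < 1"
  using mult_left_le[of "absv y" "absv x"] absv_nonneg[of x] by (simp add: absv_mult)

lemma absv_mult_lt1': "absv x \<le> 1 \<Longrightarrow> absv y < 1 \<Longrightarrow> absv (x * y) < 1"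
  using absv_mult_lt1[of y x] by (simp add: mult.commute)

lemma absv_unit_cong: "absv x = 1 \<Longrightarrow> absv (x - y) < 1 \<Longrightarrow> absv y = 1"
  using absv_add_eq[of "y - x" x] absv_commute[of x y] by simp

lemma absv_of_int_le: "absv (of_int n) \<le> 1"
proof -
  have "absv (of_nat m) \<le> 1" for m
    by (induction m) (auto intro: absv_add_le)
  then show ?thesis by (cases n rule: int_cases2) simp_all
qed

lemma absv_of_nat_le: "absv (of_nat n) \<le> 1"
  using absv_of_int_le[of "int n"] by simp

lemma absv_numeral_le: "absv (numeral n) \<le> 1"
  using absv_of_nat_le[of "numeral n"] by simp

lemma absv_p_power: "absv (\<pi> ^ t) = (1 / real p) ^ t"
  by (simp add: absv_power absv_p)

lemma absv_coprime:
  assumes "coprime n (int p)" shows "absv (of_int n) = 1"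
proof (rule antisym[OF absv_of_int_le], rule ccontr)
  assume "\<not> 1 \<le> absv (of_int n)"
  then have n: "absv (of_int n) < 1" by simp
  obtain a b where ab: "a * n + b * int p = 1"
    using assms bezout_int[of n "int p"] by auto
  have "absv (of_int (a * n) + of_int (b * int p)) < 1"
  proof (rule absv_add_lt)
    show "absv (of_int (a * n)) < 1"
      using absv_mult_lt1'[OF absv_of_int_le n, of a] by simp
    show "absv (of_int (b * int p)) < 1"
      using absv_mult_lt1'[OF absv_of_int_le, of \<pi> b] p_gt_1 by (simp add: absv_p)
  qed
  then show False using ab by (metis absv_1 less_irrefl of_int_1 of_int_add)
qed

lemma absv_2 [simp]: "absv 2 = 1"
proof -
  have "coprime (2::int) (int p)" using odd_p by (simp add: coprime_commute)
  from absv_coprime[OF this] show ?thesis by simp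
qed

lemma absv_4 [simp]: "absv 4 = 1"
  using absv_mult[of 2 2] by simp

lemma absv_of_int_dvd_iff: "absv (of_int n) \<le> (1 / real p) ^ t \<longleftrightarrow> int p ^ t dvd n"
proof
  assume "int p ^ t dvd n"
  then obtain m where "n = int p ^ t * m" by blast
  then have "absv (of_int n) = (1 / real p) ^ t * absv (of_int m)"
    by (simp add: absv_mult absv_p_power)
  then show "absv (of_int n) \<le> (1 / real p) ^ t"
    using absv_of_int_le[of m] by (simp add: mult_left_le)
next
  show "absv (of_int n) \<le> (1 / real p) ^ t \<Longrightarrow> int p ^ t dvd n"
  proof (induction t arbitrary: n)
    case (Suc t)
    have "(1 / real p) ^ Suc t < 1" using p_gt_1 by (intro power_Suc_less_one) auto
    then have "absv (of_int n) < 1" using Suc.prems by linarith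
    then have "\<not> coprime n (int p)" using absv_coprime by fastforce
    then have "int p dvd n"
      using prime_p by (metis coprime_commute prime_imp_coprime prime_nat_int_transfer)
    then obtain m where m: "n = int p * m" by blast
    have "absv (of_int n) = 1 / real p * absv (of_int m)" by (simp add: m absv_mult absv_p)
    then have "absv (of_int m) \<le> (1 / real p) ^ t"
      using Suc.prems p_gt_1 mult_le_cancel_left_pos[of "1 / real p" "absv (of_int m)" "(1 / real p) ^ t"]
      by simp
    then show ?case using Suc.IH m by simp
  qed simp
qed

lemma absv_lt_imp_le:
  assumes "absv x < (1 / real p) ^ t" shows "absv x \<le> (1 / real p) ^ Suc t"
proof (cases "x = 0")
  case False
  then obtain n :: int where n: "absv x = real p powi n" using unramified by blast
  have e: "(1 / real p) ^ t = real p powi (- int t)" for t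
    by (simp add: power_int_minus power_one_over inverse_eq_divide)
  have "n < - int t" using assms p_gt_1 unfolding e n
    by (meson leI not_less power_int_increasing less_imp_le)
  then have "n \<le> - int (Suc t)" by simp
  then show ?thesis unfolding e n using p_gt_1 by (intro power_int_increasing) auto
qed (use p_gt_1 in simp)

lemma absv_lt1_iff: "absv x < 1 \<longleftrightarrow> absv x \<le> 1 / real p"
proof
  assume "absv x \<le> 1 / real p"
  moreover have "1 / real p < 1" using p_gt_1 by simp
  ultimately show "absv x < 1" by linarith
qed (use absv_lt_imp_le[of x 0] in simp)

subsection \<open>The small field\<close>

lemma Qp_0 [simp]: "0 \<in> Qp" using Qp_diff[OF Qp_1 Qp_1] by simp
lemma Qp_uminus: "x \<in> Qp \<Longrightarrow> - x \<in> Qp" using Qp_diff[OF Qp_0] by fastforce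
lemma Qp_add: "x \<in> Qp \<Longrightarrow> y \<in> Qp \<Longrightarrow> x + y \<in> Qp"
  using Qp_diff[of x "- y"] Qp_uminus by simp
lemma Qp_of_nat [simp]: "of_nat n \<in> Qp" by (induction n) (auto intro: Qp_add Qp_1)
lemma Qp_of_int [simp]: "of_int n \<in> Qp" by (cases n rule: int_cases2) (auto intro: Qp_uminus)
lemma Qp_numeral [simp]: "numeral n \<in> Qp" using Qp_of_nat[of "numeral n"] by simp
lemma Qp_divide: "x \<in> Qp \<Longrightarrow> y \<in> Qp \<Longrightarrow> x / y \<in> Qp"
  by (simp add: divide_inverse Qp_mult Qp_inverse)
lemma Qp_power: "x \<in> Qp \<Longrightarrow> x ^ n \<in> Qp" by (induction n) (auto intro: Qp_mult Qp_1)
lemma Qp_sum: "(\<And>i. i \<in> A \<Longrightarrow> f i \<in> Qp) \<Longrightarrow> sum f A \<in> Qp"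
  by (induction A rule: infinite_finite_induct) (auto intro: Qp_add)

lemmas Qp_closed = Qp_1 Qp_add Qp_diff Qp_uminus Qp_mult Qp_divide Qp_inverse Qp_power Qp_sum

lemma Zp_0 [simp]: "0 \<in> Zp" by (simp add: Zp_def)
lemma Zp_1 [simp]: "1 \<in> Zp" by (simp add: Zp_def Qp_1)
lemma Zp_uminus: "x \<in> Zp \<Longrightarrow> - x \<in> Zp" by (simp add: Zp_def Qp_uminus)
lemma Zp_add: "x \<in> Zp \<Longrightarrow> y \<in> Zp \<Longrightarrow> x + y \<in> Zp" by (auto simp: Zp_def Qp_add absv_add_le)
lemma Zp_diff: "x \<in> Zp \<Longrightarrow> y \<in> Zp \<Longrightarrow> x - y \<in> Zp" by (auto simp: Zp_def Qp_diff absv_diff_le)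
lemma Zp_mult: "x \<in> Zp \<Longrightarrow> y \<in> Zp \<Longrightarrow> x * y \<in> Zp"
  using absv_mult_le[of x 1 y 1] by (auto simp: Zp_def Qp_mult)
lemma Zp_of_int [simp]: "of_int n \<in> Zp" by (simp add: Zp_def absv_of_int_le)
lemma Zp_of_nat [simp]: "of_nat n \<in> Zp" by (simp add: Zp_def absv_of_nat_le)
lemma Zp_numeral [simp]: "numeral n \<in> Zp" by (simp add: Zp_def absv_numeral_le)
lemma Zp_power: "x \<in> Zp \<Longrightarrow> x ^ n \<in> Zp" by (induction n) (auto intro: Zp_mult)
lemma Zp_sum: "(\<And>i. i \<in> A \<Longrightarrow> f i \<in> Zp) \<Longrightarrow> sum f A \<in> Zp"
  by (induction A rule: infinite_finite_induct) (auto intro: Zp_add)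
lemma Zp_divide: "x \<in> Zp \<Longrightarrow> y \<in> Zp \<Longrightarrow> absv y = 1 \<Longrightarrow> x / y \<in> Zp"
  by (simp add: Zp_def absv_divide Qp_divide)

lemmas Zp_closed = Zp_add Zp_diff Zp_uminus Zp_mult Zp_power Zp_sum

definition pideal :: "nat \<Rightarrow> 'k set" where
  "pideal t = {x \<in> Qp. absv x \<le> (1 / real p) ^ t}"

lemma pideal_iff: "x \<in> pideal t \<longleftrightarrow> (\<exists>z\<in>Zp. x = \<pi> ^ t * z)"
proof
  assume x: "x \<in> pideal t"
  have "x / \<pi> ^ t \<in> Zp"
    using x p_gt_1 by (auto simp: pideal_def Zp_def absv_divide absv_p_power Qp_closed field_simps)
  then show "\<exists>z\<in>Zp. x = \<pi> ^ t * z" by (intro bexI[of _ "x / \<pi> ^ t"]) auto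
next
  assume "\<exists>z\<in>Zp. x = \<pi> ^ t * z"
  then obtain z where z: "z \<in> Zp" "x = \<pi> ^ t * z" by blast
  have "(1 / real p) ^ t * absv z \<le> (1 / real p) ^ t * 1"
    by (rule mult_left_mono) (use z in \<open>auto simp: Zp_def\<close>)
  then show "x \<in> pideal t"
    using z by (simp add: Zp_def pideal_def absv_mult absv_p_power Qp_closed)
qed

lemma pideal_0: "pideal 0 = Zp" by (simp add: pideal_def Zp_def)
lemma zero_pideal [simp]: "0 \<in> pideal t" by (simp add: pideal_def)
lemma pideal_add: "x \<in> pideal t \<Longrightarrow> y \<in> pideal t \<Longrightarrow> x + y \<in> pideal t"
  by (auto simp: pideal_def Qp_add absv_add_le)
lemma pideal_diff: "x \<in> pideal t \<Longrightarrow> y \<in> pideal t \<Longrightarrow> x - y \<in> pideal t"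
  by (auto simp: pideal_def Qp_diff absv_diff_le)
lemma pideal_uminus: "x \<in> pideal t \<Longrightarrow> - x \<in> pideal t"
  by (auto simp: pideal_def Qp_uminus)
lemma pideal_mult: "x \<in> pideal s \<Longrightarrow> y \<in> pideal t \<Longrightarrow> x * y \<in> pideal (s + t)"
  by (auto simp: pideal_def Qp_mult power_add absv_mult_le)
lemma pideal_mult_left: "x \<in> Zp \<Longrightarrow> y \<in> pideal t \<Longrightarrow> x * y \<in> pideal t"
  using pideal_mult[of x 0 y t] by (simp add: pideal_0)
lemma pideal_mult_right: "x \<in> pideal t \<Longrightarrow> y \<in> Zp \<Longrightarrow> x * y \<in> pideal t"
  using pideal_mult_left[of y x t] by (simp add: mult.commute)
lemma pideal_sum: "(\<And>i. i \<in> A \<Longrightarrow> f i \<in> pideal t) \<Longrightarrow> sum f A \<in> pideal t"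
  by (induction A rule: infinite_finite_induct) (auto intro: pideal_add)
lemma pideal_antimono: "s \<le> t \<Longrightarrow> pideal t \<subseteq> pideal s"
  using p_gt_1 by (auto simp: pideal_def intro!: power_decreasing elim!: order_trans)
lemma pideal_Zp: "x \<in> pideal t \<Longrightarrow> x \<in> Zp"
  using pideal_antimono[of 0 t] by (auto simp: pideal_0)
lemma pideal_1_iff: "x \<in> pideal 1 \<longleftrightarrow> x \<in> Qp \<and> absv x < 1"
  by (auto simp: pideal_def absv_lt1_iff)
lemma p_power_pideal [simp]: "\<pi> ^ t \<in> pideal t"
  by (simp add: pideal_def absv_p_power Qp_closed)
lemma pideal_scale_iff: "\<pi> ^ s * x \<in> pideal (s + t) \<longleftrightarrow> x \<in> pideal t"
proof -
  have "\<pi> ^ s * x \<in> Qp \<longleftrightarrow> x \<in> Qp"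
    using Qp_divide[of "\<pi> ^ s * x" "\<pi> ^ s"] by (auto simp: Qp_closed)
  then show ?thesis
    by (auto simp: pideal_def absv_mult absv_p_power power_add)
qed

lemma of_int_pideal_iff: "of_int n \<in> pideal t \<longleftrightarrow> int p ^ t dvd n"
  by (simp add: pideal_def absv_of_int_dvd_iff)

text \<open>
  Density of \<open>\<rat>\<close> makes \<open>\<int>\<close> dense in \<open>\<int>\<^sub>p\<close>: a nearby rational has a denominator prime to \<open>p\<close>,
  which can be inverted modulo \<open>p\<^sup>t\<close>.
\<close>

lemma Zp_residue:
  assumes "x \<in> Zp"
  obtains n :: int where "0 \<le> n" "n < int p ^ t" "x - of_int n \<in> pideal t"
proof -
  obtain r where r: "r \<in> \<rat>" "absv (x - r) < (1 / real p) ^ t"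
    using Rats_dense[of x "(1 / real p) ^ t"] assms p_gt_1 by (auto simp: Zp_def)
  obtain a b :: int where ab: "b > 0" "coprime a b" "r = of_int a / of_int b"
    using r(1) by (elim Rats_cases') auto
  have "(1 / real p) ^ t \<le> 1" using p_gt_1 by (intro power_le_one) auto
  then have "absv r \<le> 1"
    using absv_diff_le[of x 1 "x - r"] assms r(2) by (simp add: Zp_def)
  have "coprime b (int p)"
  proof (rule ccontr)
    assume "\<not> coprime b (int p)"
    then have pb: "int p dvd b"
      using prime_p by (metis coprime_commute prime_imp_coprime prime_nat_int_transfer)
    have "\<not> int p dvd a"
    proof
      assume "int p dvd a"
      then have "int p dvd 1" using ab(2) pb by (metis coprime_common_divisor)
      then show False using prime_gt_1_nat[OF prime_p] by simp
    qed
    then have "absv (of_int a) = 1"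
      using prime_p by (metis absv_coprime coprime_commute prime_imp_coprime prime_nat_int_transfer)
    moreover have "absv (of_int b) \<le> 1 / real p"
      using pb absv_of_int_dvd_iff[of b 1] by simp
    moreover have "0 < absv (of_int b)" using ab by (intro absv_pos) simp
    moreover have "1 / real p < 1" using p_gt_1 by simp
    ultimately have "absv (of_int a) > absv (of_int b :: 'k)" "absv (of_int a) \<le> absv (of_int b :: 'k)"
      using \<open>absv r \<le> 1\<close> ab(3) by (linarith, simp add: absv_divide)
    then show False by simp
  qed
  then have "coprime b (int p ^ t)" by simp
  then obtain c d where cd: "c * b + d * int p ^ t = 1"
    using bezout_int[of b "int p ^ t"] by auto
  define n where "n = (a * c) mod (int p ^ t)"
  have "absv (of_int b) = 1" using \<open>coprime b (int p)\<close> by (rule absv_coprime)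
  have "int p ^ t dvd a * c - n"
    by (simp add: n_def dvd_minus_mod)
  moreover have "int p ^ t dvd a - a * c * b"
  proof
    have "a = a * (c * b + d * int p ^ t)" using cd by simp
    then show "a - a * c * b = int p ^ t * (a * d)" by (simp add: algebra_simps)
  qed
  moreover have "a - n * b = (a - a * c * b) + (a * c - n) * b" by (simp add: algebra_simps)
  ultimately have "int p ^ t dvd a - n * b" by (simp only: dvd_add dvd_mult2)
  then have "absv (of_int (a - n * b)) \<le> (1 / real p) ^ t" by (simp only: absv_of_int_dvd_iff)
  moreover have "r - of_int n = of_int (a - n * b) / of_int b"
    using ab by (simp add: field_simps)
  ultimately have "absv (r - of_int n) \<le> (1 / real p) ^ t"
    using \<open>absv (of_int b) = 1\<close> by (simp add: absv_divide)
  then have "absv ((x - r) + (r - of_int n)) \<le> (1 / real p) ^ t"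
    using r(2) by (intro absv_add_le) auto
  then have "x - of_int n \<in> pideal t" using assms by (simp add: pideal_def Zp_def Qp_diff)
  moreover have "0 \<le> n" "n < int p ^ t" by (simp_all add: n_def)
  ultimately show thesis using that by blast
qed

text \<open>The iteration \<open>y \<mapsto> y - (y\<^sup>2 - a)/2\<close> contracts towards a square root of \<open>a\<close>.\<close>

lemma sqrt_exists:
  assumes "a \<in> Qp" "absv (a - 1) < 1"
  obtains s where "s \<in> Qp" "s ^ 2 = a" "absv (s - 1) < 1"
proof -
  define f where "f y = y - (y ^ 2 - a) / 2" for y
  define X where "X n = (f ^^ n) 1" for n
  have X_Suc: "X (Suc n) = f (X n)" for n by (simp add: X_def)
  have inv: "X n \<in> Qp \<and> absv (X n - 1) < 1 \<and> absv (X n ^ 2 - a) \<le> (1 / real p) ^ Suc n" for n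
  proof (induction n)
    case 0
    have "absv (1 - a) \<le> 1 / real p" using assms(2) absv_lt1_iff absv_commute by metis
    then show ?case by (simp add: X_def Qp_1)
  next
    case (Suc n)
    define y e where "y = X n" and "e = y ^ 2 - a"
    have y: "y \<in> Qp" "absv (y - 1) < 1" "absv e \<le> (1 / real p) ^ Suc n"
      using Suc by (auto simp: y_def e_def)
    have e1: "absv e < 1" using y(3) p_gt_1
      by (smt (verit) power_Suc_less_one divide_less_eq_1_pos zero_less_divide_iff)
    have "f y \<in> Qp" unfolding f_def using y assms by (intro Qp_closed) auto
    moreover have "absv (f y - 1) < 1"
    proof -
      have "f y - 1 = (y - 1) - e / 2" by (simp add: f_def e_def)
      then show ?thesis using absv_diff_lt[of "y - 1" 1 "e / 2"] y e1
        by (simp only:) (simp add: absv_divide)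
    qed
    moreover have "absv (f y ^ 2 - a) \<le> (1 / real p) ^ Suc (Suc n)"
    proof -
      have "f y ^ 2 - a = e * (e / 4 - (y - 1))"
        by (simp add: f_def e_def power2_eq_square field_simps)
      moreover have "absv (e / 4 - (y - 1)) < 1"
        using y e1 absv_diff_lt[of "e / 4" 1 "y - 1"] by (simp add: absv_divide)
      ultimately have "absv (f y ^ 2 - a) \<le> (1 / real p) ^ Suc n * (1 / real p)"
        using absv_mult_le[OF y(3)] absv_lt1_iff by metis
      then show ?thesis by (simp add: mult.commute)
    qed
    ultimately show ?case by (simp add: X_Suc y_def)
  qed
  have step: "absv (X (n + k) - X n) \<le> (1 / real p) ^ Suc n" for n k
  proof (induction k)
    case (Suc k)
    have "absv (X (Suc (n + k)) - X (n + k)) = absv (X (n + k) ^ 2 - a)"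
      unfolding X_Suc f_def by (simp add: absv_divide)
    also have "\<dots> \<le> (1 / real p) ^ Suc (n + k)" using inv by blast
    also have "\<dots> \<le> (1 / real p) ^ Suc n" using p_gt_1 by (intro power_decreasing) auto
    finally have "absv ((X (Suc (n + k)) - X (n + k)) + (X (n + k) - X n)) \<le> (1 / real p) ^ Suc n"
      using Suc by (intro absv_add_le)
    then show ?case by simp
  qed simp
  have to0: "(\<lambda>n. (1 / real p) ^ n) \<longlonglongrightarrow> 0"
    using p_gt_1 by (intro LIMSEQ_realpow_zero) auto
  have small: "\<exists>n. (1 / real p) ^ Suc n < e" if "0 < e" for e
  proof -
    obtain n where "(1 / real p) ^ n < e"
      using real_arch_pow_inv[of e "1 / real p"] p_gt_1 \<open>0 < e\<close> by auto
    moreover have "(1 / real p) ^ Suc n \<le> (1 / real p) ^ n"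
      using p_gt_1 by (intro power_decreasing) auto
    ultimately show ?thesis by (meson le_less_trans)
  qed
  have "\<exists>l\<in>Qp. (\<lambda>n. absv (X n - l)) \<longlonglongrightarrow> 0"
  proof (rule Qp_complete)
    show "X n \<in> Qp" for n using inv by blast
    fix e :: real assume "0 < e"
    then obtain M where M: "(1 / real p) ^ Suc M < e" using small by blast
    have "absv (X m - X n) < e" if "m \<ge> M" "n \<ge> M" for m n
    proof -
      have "absv ((X m - X M) - (X n - X M)) \<le> (1 / real p) ^ Suc M"
        using step[of M "m - M"] step[of M "n - M"] that by (intro absv_diff_le[of "X m - X M"]) auto
      then show ?thesis using M by simp
    qed
    then show "\<exists>M. \<forall>m\<ge>M. \<forall>n\<ge>M. absv (X m - X n) < e" by blast
  qed
  then obtain l where l: "l \<in> Qp" "(\<lambda>n. absv (X n - l)) \<longlonglongrightarrow> 0" by blast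
  have near: "\<exists>n. absv (X n - l) < e \<and> (1 / real p) ^ Suc n < e" if "0 < e" for e
  proof -
    obtain n1 where n1: "(1 / real p) ^ Suc n1 < e" using small[OF \<open>0 < e\<close>] by blast
    obtain n2 where n2: "\<forall>n\<ge>n2. absv (X n - l) < e"
      using l(2) \<open>0 < e\<close> absv_nonneg unfolding LIMSEQ_iff by fastforce
    have "(1 / real p) ^ Suc (max n1 n2) \<le> (1 / real p) ^ Suc n1"
      using p_gt_1 by (intro power_decreasing) auto
    then show ?thesis using n1 n2 by (intro exI[of _ "max n1 n2"]) auto
  qed
  have l1: "absv (l - 1) < 1"
  proof -
    obtain n where "absv (X n - l) < 1" using near[of 1] by auto
    then have "absv ((X n - 1) - (X n - l)) < 1" using inv[of n] by (intro absv_diff_lt[of "X n - 1"]) auto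
    then show ?thesis by simp
  qed
  have "absv (l ^ 2 - a) < e" if "0 < e" for e
  proof -
    obtain n where n: "absv (X n - l) < e" "(1 / real p) ^ Suc n < e" using near \<open>0 < e\<close> by blast
    have "absv ((X n - 1) + (l - 1) + 2) \<le> 1"
      using inv[of n] l1 by (intro absv_add_le) auto
    then have "absv ((X n - l) * (X n + l)) < e"
      using n(1) mult_left_le[of "absv (X n + l)" "absv (X n - l)"] absv_nonneg[of "X n - l"]
      by (simp add: absv_mult)
    moreover have "absv (X n ^ 2 - a) < e" using inv[of n] n(2) by linarith
    ultimately have "absv ((X n ^ 2 - a) - (X n - l) * (X n + l)) < e" by (intro absv_diff_lt[of "X n ^ 2 - a"])
    then show ?thesis by (simp add: power2_eq_square algebra_simps)
  qed
  then have "l ^ 2 = a" using absv_pos[of "l ^ 2 - a"] by force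
  then show thesis using that l l1 by blast
qed

subsection \<open>A square root of a nonresidue generating the extension\<close>

text \<open>
  Completing the square in the equation of a generator gives a square root of an element of \<open>\<rat>\<^sub>p\<close>, which
  a power of \<open>p\<close> turns into a unit because the extension is unramified.
\<close>

lemma delta_exists:
  "\<exists>d. absv d = 1 \<and> d ^ 2 \<in> Qp \<and> d \<notin> Qp \<and> \<sigma> d = - d \<and> (\<forall>x. \<exists>a\<in>Qp. \<exists>b\<in>Qp. x = a + b * d)"
proof -
  obtain w where w: "w \<notin> Qp" "\<And>x. \<exists>a\<in>Qp. \<exists>b\<in>Qp. x = a + b * w" using quadratic by blast
  obtain a b where ab: "a \<in> Qp" "b \<in> Qp" "w ^ 2 = a + b * w" using w(2) by blast
  define v where "v = 2 * w - b"
  have v2: "v ^ 2 = 4 * a + b ^ 2"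
  proof -
    have "v ^ 2 = 4 * w ^ 2 - 4 * b * w + b ^ 2" by (simp add: v_def power2_eq_square algebra_simps)
    then show ?thesis using ab(3) by (simp add: algebra_simps)
  qed
  have v0: "v \<notin> Qp"
  proof
    assume "v \<in> Qp"
    then have "(v + b) / 2 \<in> Qp" using ab by (intro Qp_closed) auto
    then show False using w(1) by (simp add: v_def)
  qed
  then have "v \<noteq> 0" by auto
  then obtain n :: int where n: "absv v = real p powi n" using unramified by blast
  define d where "d = v * \<pi> powi n"
  have pn: "\<pi> powi n \<in> Qp" by (cases n rule: int_cases2) (auto simp: power_int_minus Qp_closed)
  have pn0: "\<pi> powi n \<noteq> 0" by simp
  have "absv (\<pi> powi n) = inverse (real p powi n)"
    by (cases n rule: int_cases2)
       (auto simp: power_int_minus absv_inverse absv_p_power power_one_over divide_inverse power_inverse)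
  then have d1: "absv d = 1" by (simp add: d_def absv_mult n)
  have d2: "d ^ 2 \<in> Qp" using pn ab by (auto simp: d_def power_mult_distrib v2 intro!: Qp_closed)
  have d0: "d \<notin> Qp"
  proof
    assume "d \<in> Qp"
    then have "d / \<pi> powi n \<in> Qp" using pn by (intro Qp_closed) auto
    then show False using v0 by (simp add: d_def)
  qed
  have gen: "\<exists>a\<in>Qp. \<exists>b\<in>Qp. x = a + b * d" for x
  proof -
    obtain s t where st: "s \<in> Qp" "t \<in> Qp" "x = s + t * w" using w(2) by blast
    have "x = (s + t * b / 2) + (t / 2 / \<pi> powi n) * d" using pn0 by (simp add: st v_def d_def field_simps)
    moreover have "s + t * b / 2 \<in> Qp" "t / 2 / \<pi> powi n \<in> Qp"
      using st ab pn by (auto intro!: Qp_closed)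
    ultimately show ?thesis by blast
  qed
  have "(\<sigma> d) ^ 2 = d ^ 2" using \<sigma>_Qp[OF d2] by (simp add: power2_eq_square \<sigma>_mult)
  then have "\<sigma> d = d \<or> \<sigma> d = - d" by (simp add: power2_eq_iff)
  moreover have "\<sigma> d \<noteq> d"
  proof
    assume "\<sigma> d = d"
    then have "\<sigma> x = x" for x using gen[of x] by (auto simp: \<sigma>_add \<sigma>_mult \<sigma>_Qp)
    then show False using \<sigma>_nontrivial by auto
  qed
  ultimately show ?thesis using d0 d1 d2 gen by blast
qed

definition \<delta> :: 'k where
  "\<delta> = (SOME d. absv d = 1 \<and> d ^ 2 \<in> Qp \<and> d \<notin> Qp \<and> \<sigma> d = - d \<and>
                  (\<forall>x. \<exists>a\<in>Qp. \<exists>b\<in>Qp. x = a + b * d))"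

abbreviation D :: 'k where "D \<equiv> \<delta> ^ 2"

lemma \<delta>_props: "absv \<delta> = 1" "D \<in> Qp" "\<delta> \<notin> Qp" "\<sigma> \<delta> = - \<delta>"
  "\<exists>a\<in>Qp. \<exists>b\<in>Qp. x = a + b * \<delta>"
  using someI_ex[OF delta_exists] unfolding \<delta>_def by blast+

lemma \<delta>_nonzero [simp]: "\<delta> \<noteq> 0" using \<delta>_props(3) by auto
lemma D_Zp [simp]: "D \<in> Zp" by (simp add: Zp_def \<delta>_props absv_power)
lemma absv_D [simp]: "absv D = 1" by (simp add: \<delta>_props absv_power)

text \<open>
  The residue of \<open>D\<close> is not a square: by the lemma on square roots, \<open>D\<close> would be one itself.
\<close>

lemma absv_coords:
  assumes "x \<in> Qp" "y \<in> Qp" shows "absv (x + y * \<delta>) = max (absv x) (absv y)"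
proof -
  have *: "absv (z + \<delta>) = 1" if z: "z \<in> Qp" "absv z \<le> 1" for z
  proof (rule ccontr)
    assume "absv (z + \<delta>) \<noteq> 1"
    moreover have "absv (z + \<delta>) \<le> 1" using z by (intro absv_add_le) (auto simp: \<delta>_props)
    ultimately have lt: "absv (z + \<delta>) < 1" by linarith
    have sub: "- \<delta> - z = - (z + \<delta>)" by simp
    have "absv z = 1"
      using absv_unit_cong[of "- \<delta>" z] lt absv_minus[of "z + \<delta>"] by (simp add: sub \<delta>_props)
    then have z0: "z \<noteq> 0" by auto
    have "absv ((\<delta> - z) * (z + \<delta>)) < 1"
      using lt z by (intro absv_mult_lt1' absv_diff_le) (auto simp: \<delta>_props)
    moreover have "D / z ^ 2 - 1 = ((\<delta> - z) * (z + \<delta>)) / z ^ 2"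
      using z0 by (simp add: field_simps power2_eq_square)
    ultimately have "absv (D / z ^ 2 - 1) < 1"
      using \<open>absv z = 1\<close> by (simp add: absv_divide absv_power)
    moreover have "D / z ^ 2 \<in> Qp" using z \<delta>_props(2) by (intro Qp_divide Qp_power[of z])
    ultimately obtain s where s: "s \<in> Qp" "s ^ 2 = D / z ^ 2" using sqrt_exists by blast
    then have "D = (s * z) ^ 2" using z0 by (simp add: power_mult_distrib)
    then have "\<delta> = s * z \<or> \<delta> = - (s * z)" by (simp add: power2_eq_iff)
    then show False using \<delta>_props(3) s(1) z(1) Qp_closed by metis
  qed
  have ay: "absv (y * \<delta>) = absv y" by (simp add: absv_mult \<delta>_props)
  show ?thesis
  proof (cases "absv y < absv x")
    case True
    then show ?thesis using absv_add_eq[of "y * \<delta>" x] ay by simp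
  next
    case False
    show ?thesis
    proof (cases "y = 0")
      case y0: False
      have "x + y * \<delta> = y * (x / y + \<delta>)" using y0 by (simp add: field_simps)
      moreover have "absv (x / y + \<delta>) = 1"
        using False y0 assms by (intro *) (auto simp: Qp_closed absv_divide absv_pos)
      ultimately show ?thesis using False by (simp add: absv_mult)
    qed (use False absv_nonneg in auto)
  qed
qed

lemma \<sigma>_coords: "x \<in> Qp \<Longrightarrow> y \<in> Qp \<Longrightarrow> \<sigma> (x + y * \<delta>) = x - y * \<delta>"
  by (simp add: \<sigma>_add \<sigma>_mult \<sigma>_Qp \<delta>_props)

lemma absv_\<sigma> [simp]: "absv (\<sigma> x) = absv x"
proof -
  obtain a b where "a \<in> Qp" "b \<in> Qp" "x = a + b * \<delta>" using \<delta>_props(5) by blast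
  then show ?thesis
    using absv_coords[of a b] absv_coords[of a "- b"] by (simp add: \<sigma>_coords Qp_uminus)
qed

lemma \<sigma>_\<sigma> [simp]: "\<sigma> (\<sigma> x) = x"
proof -
  obtain a b where "a \<in> Qp" "b \<in> Qp" "x = a + b * \<delta>" using \<delta>_props(5) by blast
  then show ?thesis
    using \<sigma>_coords[of a b] \<sigma>_coords[of a "- b"] by (simp add: Qp_uminus)
qed

lemma \<sigma>_0 [simp]: "\<sigma> 0 = 0" by (simp add: \<sigma>_Qp)
lemma \<sigma>_1 [simp]: "\<sigma> 1 = 1" by (simp add: \<sigma>_Qp Qp_1)
lemma \<sigma>_minus [simp]: "\<sigma> (- x) = - \<sigma> x"
  using \<sigma>_add[of x "- x"] by (simp add: add_eq_0_iff)
lemma \<sigma>_diff: "\<sigma> (x - y) = \<sigma> x - \<sigma> y"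
  using \<sigma>_add[of x "- y"] by simp
lemma \<sigma>_inverse: "\<sigma> (inverse x) = inverse (\<sigma> x)"
proof (cases "x = 0")
  case False
  then have "\<sigma> x * \<sigma> (inverse x) = 1" by (simp flip: \<sigma>_mult)
  then show ?thesis by (simp add: inverse_unique)
qed simp

lemma \<sigma>_fixed_iff: "\<sigma> x = x \<longleftrightarrow> x \<in> Qp"
proof
  assume "\<sigma> x = x"
  obtain a b where ab: "a \<in> Qp" "b \<in> Qp" "x = a + b * \<delta>" using \<delta>_props(5) by blast
  then have "2 * (b * \<delta>) = 0" using \<open>\<sigma> x = x\<close> by (simp add: \<sigma>_coords)
  then show "x \<in> Qp" using ab by simp
qed (rule \<sigma>_Qp)

text \<open>\<open>x\<^sup>2 - D y\<^sup>2\<close> is the norm of \<open>x + y\<delta>\<close>.\<close>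

lemma norm_anisotropic:
  assumes "x \<in> Qp" "y \<in> Qp" shows "absv (x ^ 2 - D * y ^ 2) = (max (absv x) (absv y)) ^ 2"
proof -
  have "x ^ 2 - D * y ^ 2 = (x + y * \<delta>) * \<sigma> (x + y * \<delta>)"
    using assms by (simp add: \<sigma>_coords power2_eq_square algebra_simps)
  then show ?thesis using absv_coords[OF assms] by (simp add: absv_mult power2_eq_square)
qed

end

section \<open>Counting cosets\<close>

definition coset_of :: "'a::ab_group_add set \<Rightarrow> 'a \<Rightarrow> 'a set" where
  "coset_of D x = {y. y - x \<in> D}"

text \<open>
  \<open>ncos D A\<close> is the number of cosets of the subgroup \<open>D\<close> that meet \<open>A\<close>.  With \<open>D\<close> the multiples of \<open>p\<^sup>t\<close> it
  counts solutions modulo \<open>p\<^sup>t\<close> without passing to a quotient.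
\<close>

definition ncos :: "'a::ab_group_add set \<Rightarrow> 'a set \<Rightarrow> nat" where
  "ncos D A = card (coset_of D ` A)"

definition fincos :: "'a::ab_group_add set \<Rightarrow> 'a set \<Rightarrow> bool" where
  "fincos D A \<longleftrightarrow> finite (coset_of D ` A)"

definition subgp :: "'a::ab_group_add set \<Rightarrow> bool" where
  "subgp D \<longleftrightarrow> 0 \<in> D \<and> (\<forall>x\<in>D. \<forall>y\<in>D. x - y \<in> D)"

lemma subgp_0: "subgp D \<Longrightarrow> 0 \<in> D"
  and subgp_diff: "subgp D \<Longrightarrow> x \<in> D \<Longrightarrow> y \<in> D \<Longrightarrow> x - y \<in> D"
  by (auto simp: subgp_def)

lemma subgp_minus: "subgp D \<Longrightarrow> x \<in> D \<Longrightarrow> - x \<in> D"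
  using subgp_diff[of D 0 x] subgp_0[of D] by simp

lemma subgp_add: "subgp D \<Longrightarrow> x \<in> D \<Longrightarrow> y \<in> D \<Longrightarrow> x + y \<in> D"
  using subgp_diff[of D x "- y"] subgp_minus[of D y] by simp

lemma subgp_commute: "subgp D \<Longrightarrow> x - y \<in> D \<Longrightarrow> y - x \<in> D"
  using subgp_minus[of D "x - y"] by simp

lemma subgp_trans: "subgp D \<Longrightarrow> x - y \<in> D \<Longrightarrow> y - z \<in> D \<Longrightarrow> x - z \<in> D"
  using subgp_add[of D "x - y" "y - z"] by simp

lemma subgp_trans': "subgp D \<Longrightarrow> x - y \<in> D \<Longrightarrow> x - z \<in> D \<Longrightarrow> y - z \<in> D"
  using subgp_trans subgp_commute by metis

lemma coset_of_eq_iff: "subgp D \<Longrightarrow> coset_of D x = coset_of D y \<longleftrightarrow> x - y \<in> D"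
proof
  assume D: "subgp D" and "coset_of D x = coset_of D y"
  moreover have "x \<in> coset_of D x" using subgp_0[OF D] by (simp add: coset_of_def)
  ultimately show "x - y \<in> D" by (auto simp: coset_of_def)
next
  assume D: "subgp D" and xy: "x - y \<in> D"
  show "coset_of D x = coset_of D y"
    unfolding coset_of_def using subgp_trans[OF D _ xy] subgp_trans[OF D _ subgp_commute[OF D xy]]
    by blast
qed

lemma ncos_empty [simp]: "ncos D {} = 0" "fincos D {}" by (auto simp: ncos_def fincos_def)

lemma fincos_subset: "fincos D A \<Longrightarrow> B \<subseteq> A \<Longrightarrow> fincos D B"
  unfolding fincos_def by (meson finite_subset image_mono)

lemma ncos_bij:
  assumes D: "subgp D" "subgp D'"
    and f: "\<And>a. a \<in> A \<Longrightarrow> f a \<in> B"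
    and cong: "\<And>a a'. a \<in> A \<Longrightarrow> a' \<in> A \<Longrightarrow> f a - f a' \<in> D' \<longleftrightarrow> a - a' \<in> D"
    and surj: "\<And>b. b \<in> B \<Longrightarrow> \<exists>a\<in>A. f a - b \<in> D'"
  shows "ncos D A = ncos D' B" "fincos D A \<longleftrightarrow> fincos D' B"
proof -
  have eq: "coset_of D' ` B = (coset_of D' \<circ> f) ` A"
  proof (intro equalityI subsetI)
    fix c assume "c \<in> coset_of D' ` B"
    then obtain b where b: "b \<in> B" "c = coset_of D' b" by blast
    then obtain a where a: "a \<in> A" "f a - b \<in> D'" using surj by blast
    then have "c = coset_of D' (f a)" using b coset_of_eq_iff[OF D(2), of "f a" b] by simp
    then show "c \<in> (coset_of D' \<circ> f) ` A" using a by simp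
  qed (use f in auto)
  define g where "g c = coset_of D' (f (SOME a. a \<in> A \<and> coset_of D a = c))" for c
  have g: "g (coset_of D a) = coset_of D' (f a)" if "a \<in> A" for a
  proof -
    have "(SOME a'. a' \<in> A \<and> coset_of D a' = coset_of D a) \<in> A \<and>
          coset_of D (SOME a'. a' \<in> A \<and> coset_of D a' = coset_of D a) = coset_of D a"
      by (rule someI[of _ a]) (use that in auto)
    then show ?thesis using cong that D by (auto simp: g_def coset_of_eq_iff)
  qed
  have "bij_betw g (coset_of D ` A) (coset_of D' ` B)"
    unfolding bij_betw_def eq
  proof
    show "inj_on g (coset_of D ` A)"
      using D cong by (auto simp: inj_on_def g coset_of_eq_iff)
    show "g ` coset_of D ` A = (coset_of D' \<circ> f) ` A" using g by (auto simp: image_iff)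
  qed
  then show "ncos D A = ncos D' B" "fincos D A \<longleftrightarrow> fincos D' B"
    unfolding ncos_def fincos_def by (auto simp: bij_betw_same_card bij_betw_finite)
qed

lemma ncos_Union:
  assumes I: "finite I" and D: "subgp D" and fin: "\<And>i. i \<in> I \<Longrightarrow> fincos D (A i)"
    and disj: "\<And>i j x y. i \<in> I \<Longrightarrow> j \<in> I \<Longrightarrow> x \<in> A i \<Longrightarrow> y \<in> A j \<Longrightarrow> x - y \<in> D \<Longrightarrow> i = j"
  shows "ncos D (\<Union>i\<in>I. A i) = (\<Sum>i\<in>I. ncos D (A i))" "fincos D (\<Union>i\<in>I. A i)"
proof -
  have "card (\<Union>i\<in>I. coset_of D ` A i) = (\<Sum>i\<in>I. card (coset_of D ` A i))"
    using I fin disj D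
    by (intro card_UN_disjoint) (auto simp: fincos_def coset_of_eq_iff)
  then show "ncos D (\<Union>i\<in>I. A i) = (\<Sum>i\<in>I. ncos D (A i))" "fincos D (\<Union>i\<in>I. A i)"
    using I fin by (auto simp: ncos_def fincos_def image_UN)
qed

lemma ncos_split:
  assumes D: "subgp D" and fin: "fincos D A"
    and inv: "\<And>x y. x \<in> A \<Longrightarrow> y \<in> A \<Longrightarrow> x - y \<in> D \<Longrightarrow> P x \<Longrightarrow> P y"
  shows "ncos D A = ncos D {x \<in> A. P x} + ncos D {x \<in> A. \<not> P x}"
proof -
  define B where "B = (\<lambda>b. {x \<in> A. P x = b})"
  have "ncos D (\<Union>b\<in>UNIV. B b) = (\<Sum>b\<in>UNIV. ncos D (B b))"
  proof (rule ncos_Union(1))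
    show "fincos D (B b)" for b using fin by (rule fincos_subset) (auto simp: B_def)
    show "i = j" if "x \<in> B i" "y \<in> B j" "x - y \<in> D" for i j x y
      using that inv[of x y] inv[of y x] D subgp_commute[of D x y] by (cases i; cases j) (auto simp: B_def)
  qed (use D in auto)
  moreover have "(\<Union>b\<in>UNIV. B b) = A" by (auto simp: B_def)
  ultimately show ?thesis by (simp add: UNIV_bool B_def add.commute)
qed

text \<open>
  Solutions are counted along a tower of such fibrations: over the rows of a matrix, and over the successive
  powers of \<open>p\<close>.
\<close>

lemma ncos_fibration:
  assumes D: "subgp D" "subgp D'" and B: "fincos D' B"
    and f: "\<And>a. a \<in> A \<Longrightarrow> f a \<in> B"
    and cong: "\<And>a a'. a \<in> A \<Longrightarrow> a' \<in> A \<Longrightarrow> a - a' \<in> D \<Longrightarrow> f a - f a' \<in> D'"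
    and fib: "\<And>b. b \<in> B \<Longrightarrow> ncos D {a \<in> A. f a - b \<in> D'} = c"
    and fibfin: "\<And>b. b \<in> B \<Longrightarrow> fincos D {a \<in> A. f a - b \<in> D'}"
  shows "ncos D A = c * ncos D' B" "fincos D A"
proof -
  define I where "I = coset_of D' ` B"
  define F where "F i = {a \<in> A. coset_of D' (f a) = i}" for i
  have F: "ncos D (F i) = c \<and> fincos D (F i)" if "i \<in> I" for i
  proof -
    obtain b where "b \<in> B" "i = coset_of D' b" using \<open>i \<in> I\<close> by (auto simp: I_def)
    then show ?thesis using fib[of b] fibfin[of b] D by (simp add: F_def coset_of_eq_iff)
  qed
  have A: "A = (\<Union>i\<in>I. F i)" using f by (auto simp: F_def I_def)
  have fI: "finite I" using B by (simp add: I_def fincos_def)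
  have disj: "i = j" if "x \<in> F i" "y \<in> F j" "x - y \<in> D" for i j x y
    using that cong[of x y] coset_of_eq_iff[OF D(2), of "f x" "f y"] unfolding F_def by simp
  have "ncos D (\<Union>i\<in>I. F i) = (\<Sum>i\<in>I. ncos D (F i))" "fincos D (\<Union>i\<in>I. F i)"
    by (rule ncos_Union[OF fI D(1)]; use F disj in blast)+
  then show "ncos D A = c * ncos D' B" "fincos D A"
    unfolding A[symmetric] using F by (simp_all add: ncos_def[of D' B] I_def[symmetric])
qed

lemma ncos_transversal:
  assumes D: "subgp D" and R: "finite R" "\<And>r. r \<in> R \<Longrightarrow> f r \<in> A"
    "\<And>r r'. r \<in> R \<Longrightarrow> r' \<in> R \<Longrightarrow> f r - f r' \<in> D \<Longrightarrow> r = r'"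
    "\<And>a. a \<in> A \<Longrightarrow> \<exists>r\<in>R. f r - a \<in> D"
  shows "ncos D A = card R" "fincos D A"
proof -
  have eq: "coset_of D ` A = (\<lambda>r. coset_of D (f r)) ` R"
  proof (intro equalityI subsetI)
    fix c assume "c \<in> coset_of D ` A"
    then obtain a where a: "a \<in> A" "c = coset_of D a" by blast
    then obtain r where r: "r \<in> R" "f r - a \<in> D" using R(4)[of a] by blast
    then have "c = coset_of D (f r)" using a coset_of_eq_iff[OF D, of "f r" a] by simp
    then show "c \<in> (\<lambda>r. coset_of D (f r)) ` R" using r by blast
  qed (use R(2) in auto)
  have "inj_on (\<lambda>r. coset_of D (f r)) R"
    using R(3) by (intro inj_onI) (simp add: coset_of_eq_iff[OF D])
  then show "ncos D A = card R" "fincos D A"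
    unfolding ncos_def fincos_def eq using R(1) by (simp_all add: card_image)
qed

lemma ncos_single: "subgp D \<Longrightarrow> x \<in> A \<Longrightarrow> (\<And>y. y \<in> A \<Longrightarrow> y - x \<in> D) \<Longrightarrow> ncos D A = 1"
  using ncos_transversal(1)[of D "{()}" "\<lambda>_. x" A] subgp_commute[of D] by auto

lemma subgp_Times: "subgp D \<Longrightarrow> subgp D' \<Longrightarrow> subgp (D \<times> D')"
  by (auto simp: subgp_def zero_prod_def)

lemma ncos_Times:
  assumes D: "subgp D" "subgp D'" and fin: "fincos D A" "fincos D' B"
  shows "ncos (D \<times> D') (A \<times> B) = ncos D A * ncos D' B" "fincos (D \<times> D') (A \<times> B)"
proof -
  have *: "ncos (D \<times> D') {a \<in> A \<times> B. fst a - b \<in> D} = ncos D' B \<and>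
        fincos (D \<times> D') {a \<in> A \<times> B. fst a - b \<in> D}" if "b \<in> A" for b
  proof -
    have eq: "snd a - snd a' \<in> D' \<longleftrightarrow> a - a' \<in> D \<times> D'" if "fst a - b \<in> D" "fst a' - b \<in> D" for a a'
      using subgp_trans[OF D(1) that(1) subgp_commute[OF D(1) that(2)]] by (simp add: mem_Times_iff)
    have sur: "\<exists>a\<in>{a \<in> A \<times> B. fst a - b \<in> D}. snd a - y \<in> D'" if "y \<in> B" for y
      using \<open>b \<in> A\<close> that subgp_0[OF D(1)] subgp_0[OF D(2)] by (intro bexI[of _ "(b, y)"]) auto
    have "ncos (D \<times> D') {a \<in> A \<times> B. fst a - b \<in> D} = ncos D' B"
      "fincos (D \<times> D') {a \<in> A \<times> B. fst a - b \<in> D} \<longleftrightarrow> fincos D' B"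
      by (rule ncos_bij[where f = snd, OF subgp_Times[OF D] D(2)]; use eq sur in force)+
    then show ?thesis using fin by simp
  qed
  have "ncos (D \<times> D') (A \<times> B) = ncos D' B * ncos D A" "fincos (D \<times> D') (A \<times> B)"
    by (rule ncos_fibration[where f = fst and c = "ncos D' B", OF subgp_Times[OF D] D(1) fin(1)];
        use * in force)+
  then show "ncos (D \<times> D') (A \<times> B) = ncos D A * ncos D' B" "fincos (D \<times> D') (A \<times> B)"
    by simp_all
qed

lemma vector_4 [simp]:
  "(vector [x, y, z, w] :: ('a::zero)^4) $ 1 = x" "(vector [x, y, z, w] :: ('a::zero)^4) $ 2 = y"
  "(vector [x, y, z, w] :: ('a::zero)^4) $ 3 = z" "(vector [x, y, z, w] :: ('a::zero)^4) $ 4 = w"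
  unfolding vector_def by simp_all

lemma finite_vec_box: "finite A \<Longrightarrow> finite {x :: 'a^'n. \<forall>i. x $ i \<in> A}"
  for A :: "'a set"
proof -
  assume "finite A"
  moreover have "{x :: 'a^'n. \<forall>i. x $ i \<in> A} \<subseteq> vec_lambda ` (UNIV \<rightarrow>\<^sub>E A)"
    by (auto intro!: image_eqI[where x = "vec_nth _"])
  ultimately show ?thesis by (meson finite_PiE finite finite_imageI finite_subset)
qed

section \<open>Vectors and matrices over the ring of integers\<close>

context unramified_quadratic_extension
begin

definition pvec :: "nat \<Rightarrow> ('k^'n) set" where "pvec t = {v. \<forall>i. v $ i \<in> pideal t}"
definition pmat :: "nat \<Rightarrow> ('k^'n^'m) set" where "pmat t = {A. \<forall>i j. A $ i $ j \<in> pideal t}"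

lemma pmat_rows: "A \<in> pmat t \<longleftrightarrow> (\<forall>i. A $ i \<in> pvec t)" by (simp add: pmat_def pvec_def)

lemma subgp_pideal [simp]: "subgp (pideal t)" by (auto simp: subgp_def pideal_diff)
lemma subgp_pvec [simp]: "subgp (pvec t)" by (auto simp: subgp_def pvec_def pideal_diff)
lemma subgp_pmat [simp]: "subgp (pmat t)" by (auto simp: subgp_def pmat_def pideal_diff)

lemma pvec_antimono: "s \<le> t \<Longrightarrow> pvec t \<subseteq> pvec s"
  using pideal_antimono[of s t] by (auto simp: pvec_def)
lemma pmat_antimono: "s \<le> t \<Longrightarrow> pmat t \<subseteq> pmat s"
  using pideal_antimono[of s t] by (auto simp: pmat_def)
lemma pvec_0I: "v \<in> pvec t \<Longrightarrow> v \<in> pvec 0" using pvec_antimono[of 0 t] by auto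
lemma pmat_0I: "v \<in> pmat t \<Longrightarrow> v \<in> pmat 0" using pmat_antimono[of 0 t] by auto

lemma pmat_mult: "A \<in> pmat s \<Longrightarrow> B \<in> pmat t \<Longrightarrow> A ** B \<in> pmat (s + t)"
  by (auto simp: pmat_def matrix_matrix_mult_def intro!: pideal_sum pideal_mult)
lemma pmat_mult_left: "A \<in> pmat 0 \<Longrightarrow> B \<in> pmat t \<Longrightarrow> A ** B \<in> pmat t"
  using pmat_mult[of A 0 B t] by simp
lemma pmat_mult_right: "A \<in> pmat t \<Longrightarrow> B \<in> pmat 0 \<Longrightarrow> A ** B \<in> pmat t"
  using pmat_mult[of A t B 0] by simp
lemma pmat_transpose: "transpose A \<in> pmat t \<longleftrightarrow> A \<in> pmat t"
  by (auto simp: pmat_def transpose_def)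
lemma pvec_mult: "v \<in> pvec s \<Longrightarrow> B \<in> pmat t \<Longrightarrow> v v* B \<in> pvec (s + t)"
  by (auto simp: pvec_def pmat_def vector_matrix_mult_def intro!: pideal_sum pideal_mult)
lemma pvec_mult_left: "v \<in> pvec 0 \<Longrightarrow> B \<in> pmat t \<Longrightarrow> v v* B \<in> pvec t"
  using pvec_mult[of v 0 B t] by simp
lemma pvec_mult_right: "v \<in> pvec t \<Longrightarrow> B \<in> pmat 0 \<Longrightarrow> v v* B \<in> pvec t"
  using pvec_mult[of v t B 0] by simp
lemma mat_1_pmat [simp]: "mat 1 \<in> pmat 0" by (simp add: pmat_def mat_def pideal_0)

lemma ncos_residues:
  "ncos (pideal t) Zp = p ^ t" "fincos (pideal t) Zp"
proof -
  have inj: "r = r'" if "r \<in> {0..<int p ^ t}" "r' \<in> {0..<int p ^ t}"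
    "(of_int r - of_int r' :: 'k) \<in> pideal t" for r r'
  proof -
    have "int p ^ t dvd r - r'" using that(3) of_int_pideal_iff[of "r - r'" t] by simp
    then have "r mod int p ^ t = r' mod int p ^ t" by (simp add: mod_eq_dvd_iff)
    then show ?thesis using that by simp
  qed
  have surj: "\<exists>r\<in>{0..<int p ^ t}. of_int r - a \<in> pideal t" if "a \<in> Zp" for a
    using Zp_residue[OF that, of t] subgp_commute[OF subgp_pideal] by (metis atLeastLessThan_iff)
  have "ncos (pideal t) Zp = card {0..<int p ^ t} \<and> fincos (pideal t) Zp"
    using ncos_transversal[of "pideal t" "{0..<int p ^ t}" of_int Zp] inj surj by auto
  then show "ncos (pideal t) Zp = p ^ t" "fincos (pideal t) Zp" by (simp_all add: nat_power_eq)
qed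

end

lemma finite_max_exists:
  fixes f :: "'a \<Rightarrow> real"
  assumes "finite S" "S \<noteq> {}" shows "\<exists>x\<in>S. \<forall>y\<in>S. f y \<le> f x"
proof -
  have "Max (f ` S) \<in> f ` S" using assms by (intro Max_in) auto
  then obtain x where "x \<in> S" "f x = Max (f ` S)" by auto
  then show ?thesis using assms by (intro bexI[of _ x]) auto
qed

context unramified_quadratic_extension
begin

subsection \<open>The group of integral invertible matrices\<close>

definition GLz :: "('k^3^3) set" where "GLz = {G \<in> pmat 0. absv (det G) = 1}"

definition adj3 :: "'k^3^3 \<Rightarrow> 'k^3^3" where
  "adj3 A = vector [
     vector [A$2$2 * A$3$3 - A$2$3 * A$3$2, A$1$3 * A$3$2 - A$1$2 * A$3$3, A$1$2 * A$2$3 - A$1$3 * A$2$2],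
     vector [A$2$3 * A$3$1 - A$2$1 * A$3$3, A$1$1 * A$3$3 - A$1$3 * A$3$1, A$1$3 * A$2$1 - A$1$1 * A$2$3],
     vector [A$2$1 * A$3$2 - A$2$2 * A$3$1, A$1$2 * A$3$1 - A$1$1 * A$3$2, A$1$1 * A$2$2 - A$1$2 * A$2$1]]"

lemma adj3_mult: "A ** adj3 A = mat (det A)" "adj3 A ** A = mat (det A)"
  by (simp_all add: vec_eq_iff forall_3 matrix_matrix_mult_def sum_3 mat_def det_3 adj3_def algebra_simps)

lemma GLz_pmat: "G \<in> GLz \<Longrightarrow> G \<in> pmat 0" by (simp add: GLz_def)

lemma GLz_mult: "G \<in> GLz \<Longrightarrow> H \<in> GLz \<Longrightarrow> G ** H \<in> GLz"
  by (auto simp: GLz_def det_mul absv_mult intro: pmat_mult_left)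

lemma GLz_1 [simp]: "mat 1 \<in> GLz" by (simp add: GLz_def det_I)

lemma GLz_I:
  assumes "G \<in> pmat 0" "G ** H = mat 1" "H \<in> pmat 0" shows "G \<in> GLz"
proof -
  have *: "absv (det A) \<le> 1" if "A \<in> pmat 0" for A :: "'k^3^3"
  proof -
    have "det A \<in> Zp" using that by (auto simp: det_3 pmat_def pideal_0 intro!: Zp_closed)
    then show ?thesis by (simp add: Zp_def)
  qed
  have "absv (det G) * absv (det H) = 1"
    using arg_cong[OF assms(2), of det] by (simp add: det_mul det_I flip: absv_mult)
  moreover have "absv (det G) * absv (det H) \<le> absv (det G)"
    using *[OF assms(3)] by (simp add: mult_left_le absv_nonneg)
  ultimately show ?thesis using *[OF assms(1)] assms(1) by (simp add: GLz_def)
qed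

lemma GLz_inverse:
  assumes "G \<in> GLz"
  obtains H where "H \<in> GLz" "G ** H = mat 1" "H ** G = mat 1"
proof -
  define H where "H = (\<chi> i j. adj3 G $ i $ j / det G)"
  have d: "det G \<noteq> 0" using assms by (auto simp: GLz_def)
  have *: "G ** H = mat 1" "H ** G = mat 1"
  proof -
    have "(G ** H) $ i $ j = (G ** adj3 G) $ i $ j / det G"
      "(H ** G) $ i $ j = (adj3 G ** G) $ i $ j / det G" for i j
      by (simp_all add: H_def matrix_matrix_mult_def sum_divide_distrib)
    then show "G ** H = mat 1" "H ** G = mat 1"
      using d by (simp_all add: adj3_mult vec_eq_iff mat_def)
  qed
  have Z: "G $ i $ j \<in> Zp" for i j using assms by (auto simp: GLz_def pmat_def pideal_0)
  have "det G \<in> Zp" unfolding det_3 by (intro Zp_closed Z)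
  moreover have "adj3 G $ i $ j \<in> Zp" for i j
    using exhaust_3[of i] exhaust_3[of j] by (elim disjE) (auto simp: adj3_def intro!: Zp_closed Z)
  ultimately have "H \<in> pmat 0" using assms by (auto simp: H_def pmat_def pideal_0 GLz_def intro!: Zp_divide)
  then have "H \<in> GLz" using GLz_I[of H G] * GLz_pmat[OF assms] by simp
  then show thesis using that * by blast
qed

lemma GLz_vec_eq_0: "G \<in> GLz \<Longrightarrow> v v* G = 0 \<Longrightarrow> v = 0"
  by (erule GLz_inverse) (metis vector_matrix_mul_assoc vector_matrix_mul_rid vector_matrix_mult_0)

lemma GLz_vec_pvec: "G \<in> GLz \<Longrightarrow> v v* G \<in> pvec t \<longleftrightarrow> v \<in> pvec t"
proof
  assume G: "G \<in> GLz" and v: "v v* G \<in> pvec t"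
  obtain H where H: "H \<in> GLz" "G ** H = mat 1" using GLz_inverse[OF G] by blast
  have "(v v* G) v* H \<in> pvec t" using pvec_mult_right[OF v GLz_pmat[OF H(1)]] .
  then show "v \<in> pvec t" by (simp add: vector_matrix_mul_assoc H)
qed (auto intro: pvec_mult_right GLz_pmat)

lemma GLz_conj_pmat:
  assumes G: "G \<in> GLz" shows "G ** A ** transpose G \<in> pmat t \<longleftrightarrow> A \<in> pmat t"
proof
  assume A: "G ** A ** transpose G \<in> pmat t"
  obtain H where H: "H \<in> GLz" "G ** H = mat 1" "H ** G = mat 1" using GLz_inverse[OF G] by blast
  have tr: "transpose G ** transpose H = mat 1" using H by (simp flip: matrix_transpose_mul)
  have "H ** (G ** A ** transpose G) ** transpose H = (H ** G) ** A ** (transpose G ** transpose H)"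
    by (simp add: matrix_mul_assoc)
  then have "H ** (G ** A ** transpose G) ** transpose H = A" by (simp add: H tr)
  moreover have "H ** (G ** A ** transpose G) ** transpose H \<in> pmat t"
    by (intro pmat_mult_right pmat_mult_left A) (auto simp: GLz_pmat H pmat_transpose)
  ultimately show "A \<in> pmat t" by simp
next
  assume A: "A \<in> pmat t"
  have "G ** A \<in> pmat t" by (rule pmat_mult_left[OF GLz_pmat[OF G] A])
  then show "G ** A ** transpose G \<in> pmat t"
    by (rule pmat_mult_right) (simp add: pmat_transpose GLz_pmat G)
qed

text \<open>Elementary row operations and transpositions of rows are instances of the next lemma.\<close>

lemma GLz_rows:
  assumes "{a1,a2,a3,b1,b2,b3,c1,c2,c3} \<subseteq> Zp"
    and "absv (a1*(b2*c3 - b3*c2) - a2*(b1*c3 - b3*c1) + a3*(b1*c2 - b2*c1)) = 1"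
  shows "(vector [vector [a1,a2,a3], vector [b1,b2,b3], vector [c1,c2,c3]] :: 'k^3^3) \<in> GLz"
proof -
  have "a1 * b2 * c3 + a2 * b3 * c1 + a3 * b1 * c2 - a1 * b3 * c2 - a2 * b1 * c3 - a3 * b2 * c1
     = a1*(b2*c3 - b3*c2) - a2*(b1*c3 - b3*c1) + a3*(b1*c2 - b2*c1)" by (simp add: algebra_simps)
  then show ?thesis using assms by (simp add: GLz_def pmat_def forall_3 det_3 pideal_0)
qed

lemma rows3_mult:
  "((vector [vector [a1,a2,a3], vector [b1,b2,b3], vector [c1,c2,c3]] :: 'k^3^3) ** Y) $ 1 $ j
     = a1 * Y$1$j + a2 * Y$2$j + a3 * Y$3$j"
  "((vector [vector [a1,a2,a3], vector [b1,b2,b3], vector [c1,c2,c3]] :: 'k^3^3) ** Y) $ 2 $ j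
     = b1 * Y$1$j + b2 * Y$2$j + b3 * Y$3$j"
  "((vector [vector [a1,a2,a3], vector [b1,b2,b3], vector [c1,c2,c3]] :: 'k^3^3) ** Y) $ 3 $ j
     = c1 * Y$1$j + c2 * Y$2$j + c3 * Y$3$j"
  by (simp_all add: matrix_matrix_mult_def sum_3)

lemma conj_entry:
  "(G ** A ** transpose G) $ i $ j = (\<Sum>k\<in>UNIV. \<Sum>l\<in>UNIV. G$i$k * A$k$l * G$j$l)" for A :: "'k^'n^'n"
  by (simp add: matrix_matrix_mult_def transpose_def sum_distrib_left sum_distrib_right)
     (rule sum.swap)

lemma conj_symmetric: "transpose A = A \<Longrightarrow> transpose (G ** A ** transpose G) = G ** A ** transpose G"
  for A :: "'k^'n^'n"
  by (simp add: matrix_transpose_mul matrix_mul_assoc)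

lemma symmetric_entry: "transpose A = A \<Longrightarrow> A $ i $ j = A $ j $ i" for A :: "'k^'n^'n"
  by (metis transpose_def vec_lambda_beta)

text \<open>
  Since 2 is a unit, an entry of largest absolute value can be brought to the diagonal: if
  all diagonal entries are smaller than \<open>t\<^sub>i\<^sub>j\<close>, then \<open>t\<^sub>i\<^sub>i + 2 t\<^sub>i\<^sub>j + t\<^sub>j\<^sub>j\<close> has its absolute value.
\<close>

lemma diagonal_pivot:
  assumes "absv a \<le> m" "absv b \<le> m" "absv c \<le> m" "absv a = m \<or> absv b = m \<or> absv c = m"
  shows "absv a = m \<or> absv b = m \<or> absv (a + 2 * c + b) = m"
proof (rule ccontr)
  assume "\<not> ?thesis"
  then have *: "absv a < m" "absv b < m" "absv c = m" "absv (a + 2 * c + b) \<noteq> m" using assms by auto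
  have "absv (2 * c + (a + b)) = absv (2 * c)"
    using * by (intro absv_add_eq) (simp add: absv_mult absv_add_lt)
  then show False using * by (simp add: absv_mult algebra_simps)
qed

text \<open>
  An entry of largest absolute value is moved to the upper left corner; the multiples of the first row needed to clear
  the first column are then integral.
\<close>

lemma diagonalise_first:
  fixes A :: "'k^3^3"
  assumes A: "transpose A = A" "\<And>i j. A $ i $ j \<in> Qp"
  shows "\<exists>G\<in>GLz. \<exists>B. B = G ** A ** transpose G \<and> B$1$2 = 0 \<and> B$1$3 = 0"
proof -
  define m where "m = Max (range (\<lambda>(i, j). absv (A $ i $ j)))"
  have le: "absv (A $ i $ j) \<le> m" for i j
    unfolding m_def by (rule Max_ge) (auto intro: rev_image_eqI[of "(i, j)"])
  have "m \<in> range (\<lambda>(i, j). absv (A $ i $ j))" unfolding m_def by (rule Max_in) auto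
  then obtain i j where ij: "m = absv (A $ i $ j)" by auto
  have sym: "A $ j $ i = A $ i $ j" for i j using symmetric_entry[OF A(1)] .
  have piv: "absv (A$i$i) = m \<or> absv (A$j$j) = m \<or> (i \<noteq> j \<and> absv (A$i$i + 2 * A$i$j + A$j$j) = m)"
    using diagonal_pivot[of "A$i$i" m "A$j$j" "A$i$j"] le ij by (cases "i = j") auto
  have "\<exists>G\<in>GLz. absv ((G ** A ** transpose G)$1$1) = m"
  proof -
    define G1 :: "'k^3^3" where "G1 = vector [vector [1,0,0], vector [0,1,0], vector [0,0,1]]"
    define G2 :: "'k^3^3" where "G2 = vector [vector [0,1,0], vector [1,0,0], vector [0,0,1]]"
    define G3 :: "'k^3^3" where "G3 = vector [vector [0,0,1], vector [0,1,0], vector [1,0,0]]"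
    define G4 :: "'k^3^3" where "G4 = vector [vector [1,1,0], vector [0,1,0], vector [0,0,1]]"
    define G5 :: "'k^3^3" where "G5 = vector [vector [1,0,1], vector [0,1,0], vector [0,0,1]]"
    define G6 :: "'k^3^3" where "G6 = vector [vector [0,1,1], vector [1,0,0], vector [0,0,1]]"
    note defs = G1_def G2_def G3_def G4_def G5_def G6_def
    have mem: "G1 \<in> GLz" "G2 \<in> GLz" "G3 \<in> GLz" "G4 \<in> GLz" "G5 \<in> GLz" "G6 \<in> GLz"
      unfolding defs by (rule GLz_rows; simp)+
    have val: "(G1 ** A ** transpose G1)$1$1 = A$1$1" "(G2 ** A ** transpose G2)$1$1 = A$2$2"
      "(G3 ** A ** transpose G3)$1$1 = A$3$3"
      "(G4 ** A ** transpose G4)$1$1 = A$1$1 + 2 * A$1$2 + A$2$2"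
      "(G5 ** A ** transpose G5)$1$1 = A$1$1 + 2 * A$1$3 + A$3$3"
      "(G6 ** A ** transpose G6)$1$1 = A$2$2 + 2 * A$2$3 + A$3$3"
      by (simp_all add: defs conj_entry sum_3 sym[of 2 1] sym[of 3 1] sym[of 3 2])
    consider "absv (A$1$1) = m" | "absv (A$2$2) = m" | "absv (A$3$3) = m"
      | "absv (A$1$1 + 2 * A$1$2 + A$2$2) = m" | "absv (A$1$1 + 2 * A$1$3 + A$3$3) = m"
      | "absv (A$2$2 + 2 * A$2$3 + A$3$3) = m"
      using piv exhaust_3[of i] exhaust_3[of j]
      by (auto simp: sym[of 2 1] sym[of 3 1] sym[of 3 2] add.commute add.left_commute)
    then show ?thesis using mem val by cases metis+
  qed
  then obtain G where G: "G \<in> GLz" "absv ((G ** A ** transpose G)$1$1) = m" by blast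
  define B where "B = G ** A ** transpose G"
  have Bs: "transpose B = B" unfolding B_def by (rule conj_symmetric[OF A(1)])
  have sB: "B $ j $ i = B $ i $ j" for i j using symmetric_entry[OF Bs] .
  have m0: "0 \<le> m" using le[of 1 1] absv_nonneg[of "A$1$1"] by linarith
  have GZ: "G $ i $ j \<in> Zp" for i j using G by (auto simp: GLz_def pmat_def pideal_0)
  have Bm: "absv (B $ i $ j) \<le> m" for i j
  proof -
    have "absv (G$i$k * A$k$l * G$j$l) \<le> 1 * m * 1" for k l
      using GZ le by (intro absv_mult_le) (auto simp: Zp_def)
    then show ?thesis unfolding B_def conj_entry using m0 by (intro absv_sum_le) auto
  qed
  have BQ: "B $ i $ j \<in> Qp" for i j
    unfolding B_def conj_entry using GZ A(2) by (intro Qp_sum Qp_mult) (auto simp: Zp_def)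
  show ?thesis
  proof (cases "m = 0")
    case True
    then have "B $ i $ j = 0" for i j using Bm[of i j] absv_nonneg[of "B$i$j"] absv_eq_0[of "B$i$j"] by simp
    then show ?thesis using G(1) B_def by blast
  next
    case False
    then have b0: "B$1$1 \<noteq> 0" using G(2) by (auto simp: B_def)
    define E :: "'k^3^3" where
      "E = vector [vector [1,0,0], vector [- (B$2$1/B$1$1),1,0], vector [- (B$3$1/B$1$1),0,1]]"
    have q: "B$i$1/B$1$1 \<in> Zp" for i
      using BQ[of i 1] BQ[of 1 1] Bm[of i 1] G(2) b0 absv_pos[OF b0]
      by (auto simp: Zp_def Qp_divide absv_divide B_def[symmetric])
    have E: "E \<in> GLz" unfolding E_def using q by (intro GLz_rows) (auto simp: Zp_uminus)
    have "(E ** B ** transpose E)$1$2 = 0" "(E ** B ** transpose E)$1$3 = 0"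
      using b0 by (simp_all add: E_def conj_entry sum_3 sB[of 2 1] sB[of 3 1])
    moreover have "E ** B ** transpose E = (E ** G) ** A ** transpose (E ** G)"
      by (simp add: B_def matrix_transpose_mul matrix_mul_assoc)
    ultimately show ?thesis using GLz_mult[OF E G(1)] by metis
  qed
qed

lemma diagonalise:
  fixes A :: "'k^3^3"
  assumes A: "transpose A = A" "\<And>i j. A $ i $ j \<in> Qp"
  shows "\<exists>G\<in>GLz. \<forall>i j. i \<noteq> j \<longrightarrow> (G ** A ** transpose G) $ i $ j = 0"
proof -
  obtain G B where G: "G \<in> GLz" "B = G ** A ** transpose G" "B$1$2 = 0" "B$1$3 = 0"
    using diagonalise_first[OF A] by blast
  have Bs: "transpose B = B" unfolding G by (rule conj_symmetric[OF A(1)])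
  have sB: "B $ j $ i = B $ i $ j" for i j using symmetric_entry[OF Bs] .
  have GZ: "G $ i $ j \<in> Zp" for i j using G by (auto simp: GLz_def pmat_def pideal_0)
  have BQ: "B $ i $ j \<in> Qp" for i j
    unfolding G conj_entry using GZ A(2) by (intro Qp_sum Qp_mult) (auto simp: Zp_def)
  define m where "m = max (absv (B$2$2)) (max (absv (B$3$3)) (absv (B$2$3)))"
  have le: "absv (B$2$2) \<le> m" "absv (B$3$3) \<le> m" "absv (B$2$3) \<le> m" by (auto simp: m_def)
  have piv: "absv (B$2$2) = m \<or> absv (B$3$3) = m \<or> absv (B$2$2 + 2 * B$2$3 + B$3$3) = m"
    by (rule diagonal_pivot) (use m_def in linarith)+
  have ex: "\<exists>G'\<in>GLz. \<forall>i j. i \<noteq> j \<longrightarrow> (G' ** A ** transpose G') $ i $ j = 0"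
    if E: "E \<in> GLz" and "\<forall>i j. i \<noteq> j \<longrightarrow> (E ** B ** transpose E) $ i $ j = 0" for E
  proof -
    have "E ** B ** transpose E = (E ** G) ** A ** transpose (E ** G)"
      by (simp add: G matrix_transpose_mul matrix_mul_assoc)
    then show ?thesis using GLz_mult[OF E G(1)] that(2) by metis
  qed
  show ?thesis
  proof (cases "m = 0")
    case True
    then have "B$2$3 = 0" using le(3) absv_nonneg[of "B$2$3"] absv_eq_0[of "B$2$3"] by simp
    then show ?thesis using G sB by (intro ex[of "mat 1"]) (auto simp: forall_3)
  next
    case False
    then have m0: "0 < m" using le(1) absv_nonneg[of "B$2$2"] by linarith
    have q: "x / y \<in> Zp" if "x \<in> Qp" "y \<in> Qp" "absv x \<le> m" "absv y = m" for x y
      using that m0 by (auto simp: Zp_def Qp_divide absv_divide)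
    from piv show ?thesis
    proof (elim disjE)
      assume m: "absv (B$2$2) = m"
      then have nz: "B$2$2 \<noteq> 0" using m0 by auto
      have "B$2$3/B$2$2 \<in> Zp" using le m BQ by (intro q) auto
      then show ?thesis using nz G(3,4) sB
        by (intro ex[of "vector [vector [1,0,0], vector [0,1,0], vector [0,- (B$2$3/B$2$2),1]]"] GLz_rows)
           (auto simp: forall_3 conj_entry sum_3 sB[of 2 1] sB[of 3 1] sB[of 3 2] Zp_uminus)
    next
      assume m: "absv (B$3$3) = m"
      then have nz: "B$3$3 \<noteq> 0" using m0 by auto
      have "B$2$3/B$3$3 \<in> Zp" using le m BQ by (intro q) auto
      then show ?thesis using nz G(3,4) sB
        by (intro ex[of "vector [vector [1,0,0], vector [0,1,- (B$2$3/B$3$3)], vector [0,0,1]]"] GLz_rows)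
           (auto simp: forall_3 conj_entry sum_3 sB[of 2 1] sB[of 3 1] sB[of 3 2] Zp_uminus)
    next
      define c where "c = B$2$2 + 2 * B$2$3 + B$3$3"
      assume "absv (B$2$2 + 2 * B$2$3 + B$3$3) = m"
      then have m: "absv c = m" by (simp add: c_def)
      then have nz: "c \<noteq> 0" using m0 by auto
      define r where "r = (B$2$3 + B$3$3) / c"
      have "c \<in> Qp" unfolding c_def by (intro Qp_closed BQ Qp_numeral)
      then have r: "r \<in> Zp" unfolding r_def using le m BQ by (intro q absv_add_le) (auto intro: Qp_closed)
      have rc: "r * c = B$2$3 + B$3$3" using nz by (simp add: r_def)
      have "- r * (B$2$2 + B$2$3) + (1 - r) * (B$2$3 + B$3$3) = (B$2$3 + B$3$3) - r * c"
        by (simp add: c_def algebra_simps)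
      then have z: "- r * (B$2$2 + B$2$3) + (1 - r) * (B$2$3 + B$3$3) = 0" using rc by simp
      define E :: "'k^3^3" where "E = vector [vector [1,0,0], vector [0,1,1], vector [0,- r,1 - r]]"
      have E: "E \<in> GLz" unfolding E_def using r by (intro GLz_rows) (auto intro: Zp_closed)
      have "(E ** B ** transpose E)$2$3 = - r * (B$2$2 + B$2$3) + (1 - r) * (B$2$3 + B$3$3)"
        "(E ** B ** transpose E)$3$2 = - r * (B$2$2 + B$2$3) + (1 - r) * (B$2$3 + B$3$3)"
        by (simp_all add: E_def conj_entry sum_3 sB[of 3 2] algebra_simps)
      then show ?thesis using z G(3,4) sB[of 2 1] sB[of 3 1]
        by (intro ex[OF E]) (auto simp: forall_3, auto simp: E_def conj_entry sum_3)
    qed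
  qed
qed

subsection \<open>Primitive matrices and elementary divisors\<close>

text \<open>The rows of \<open>Y\<close> are independent modulo \<open>p\<close>.\<close>

definition prim :: "'k^'m^3 \<Rightarrow> bool" where
  "prim Y \<longleftrightarrow> Y \<in> pmat 0 \<and> (\<forall>v\<in>pvec 0. v v* Y \<in> pvec 1 \<longrightarrow> v \<in> pvec 1)"

text \<open>
  The combinations of the rows of \<open>Y\<close> that are integral, described by their coefficients.  This module contains
  \<open>\<int>\<^sub>p\<^sup>3\<close> if \<open>Y\<close> is integral, and equals it exactly for primitive \<open>Y\<close>.
\<close>

definition sat :: "'k^'m^3 \<Rightarrow> ('k^3) set" where
  "sat Y = {v. (\<forall>i. v $ i \<in> Qp) \<and> v v* Y \<in> pvec 0}"

definition diagp :: "(3 \<Rightarrow> nat) \<Rightarrow> 'k^3^3" where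
  "diagp a = (\<chi> i j. if i = j then \<pi> ^ a i else 0)"

lemma diagp_mult: "(diagp a ** Y) $ i $ j = \<pi> ^ a i * Y $ i $ j"
  by (simp add: diagp_def matrix_matrix_mult_def if_distrib[where f = "\<lambda>x. x * _"] sum.delta cong: if_cong)

lemma scaled_vec_mult: "(c *s v) v* A = c *s (v v* A)" for v :: "'k^'n"
  by (simp add: vec_eq_iff vector_matrix_mult_def sum_distrib_left mult.assoc mult.left_commute)

lemma prim_iff_sat: "prim Y \<longleftrightarrow> Y \<in> pmat 0 \<and> sat Y = pvec 0" for Y :: "'k^'m^3"
proof (intro iffI conjI)
  assume Y: "prim Y"
  then show Y0: "Y \<in> pmat 0" by (simp add: prim_def)
  show "sat Y = pvec 0"
  proof (intro equalityI subsetI)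
    fix v :: "'k^3" assume "v \<in> pvec 0"
    then show "v \<in> sat Y" using pvec_mult_left[of v Y 0] Y0 by (auto simp: sat_def pvec_def pideal_0 Zp_def)
  next
    fix v :: "'k^3" assume v: "v \<in> sat Y"
    have *: "\<pi> ^ k *s v \<in> pvec 0 \<Longrightarrow> v \<in> pvec 0" for k
    proof (induction k)
      case (Suc k)
      define w where "w = \<pi> ^ Suc k *s v"
      have "v v* Y \<in> pvec 0" using v by (simp add: sat_def)
      then have "w v* Y \<in> pvec 1" unfolding w_def scaled_vec_mult
        using pideal_antimono[of 1 "Suc k"] pideal_mult_right[OF p_power_pideal[of "Suc k"]]
        by (auto simp: pvec_def pideal_0 simp del: power_Suc)
      then have "w \<in> pvec 1" using Y Suc.prems by (auto simp: prim_def w_def)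
      then have "\<pi> ^ 1 * (\<pi> ^ k * v $ i) \<in> pideal (1 + 0)" for i
        by (simp add: pvec_def w_def mult.assoc)
      then have "\<pi> ^ k *s v \<in> pvec 0" unfolding pideal_scale_iff by (simp add: pvec_def)
      then show ?case by (rule Suc.IH)
    qed simp
    obtain B where B: "absv (v $ i) \<le> B" for i
      using finite_max_exists[of UNIV "\<lambda>i. absv (v $ i)"] by auto
    obtain k where "B < real p ^ k" using real_arch_pow[OF p_gt_1] by blast
    then have "absv (\<pi> ^ k * v $ i) \<le> 1" for i
      using B[of i] by (simp add: absv_mult absv_p_power power_one_over field_simps)
    then show "v \<in> pvec 0" using v by (intro *[of k]) (auto simp: sat_def pvec_def pideal_0 Zp_def Qp_closed)
  qed
next
  assume Y: "Y \<in> pmat 0 \<and> sat Y = pvec 0"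
  have "v \<in> pvec 1" if v: "v \<in> pvec 0" "v v* Y \<in> pvec 1" for v
  proof -
    define w where "w = inverse \<pi> *s v"
    have e: "\<pi> ^ 1 * w $ i = v $ i" for i by (simp add: w_def)
    have "\<pi> ^ 1 * (w v* Y) $ i = (v v* Y) $ i" for i by (simp add: w_def scaled_vec_mult)
    then have "(w v* Y) $ i \<in> pideal 0" for i
      using v(2) pideal_scale_iff[of 1 "(w v* Y) $ i" 0] by (simp add: pvec_def)
    then have "w \<in> sat Y" using v(1) by (auto simp: sat_def pvec_def w_def pideal_0 Zp_def Qp_closed)
    then have "w \<in> pvec 0" using Y by simp
    then show ?thesis using e pideal_scale_iff[of 1 _ 0] by (simp add: pvec_def) (metis power_one_right)
  qed
  then show "prim Y" using Y by (auto simp: prim_def)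
qed

lemma prim_GLz: "prim (G ** Y) \<longleftrightarrow> prim Y" if G: "G \<in> GLz" for Y :: "'k^'m^3"
proof -
  have imp: "prim (G ** Y)" if "G \<in> GLz" "prim Y" for G and Y :: "'k^'m^3"
    using that GLz_vec_pvec[OF that(1)]
    by (auto simp: prim_def pmat_mult_left GLz_pmat simp flip: vector_matrix_mul_assoc)
  obtain H where "H \<in> GLz" "H ** G = mat 1" using GLz_inverse[OF G] by blast
  then show ?thesis using imp[OF G, of Y] imp[of H "G ** Y"] by (auto simp: matrix_mul_assoc)
qed

lemma Zp_power_exists:
  assumes "x \<in> Zp" "x \<noteq> 0" obtains a where "absv x = (1 / real p) ^ a"
proof -
  obtain n :: int where n: "absv x = real p powi n" using unramified[OF assms(2)] by blast
  have "n \<le> 0"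
  proof (rule ccontr)
    assume "\<not> n \<le> 0"
    then have "real p powi 1 \<le> real p powi n" using p_gt_1 by (intro power_int_increasing) auto
    then show False using n assms(1) p_gt_1 by (simp add: Zp_def)
  qed
  then obtain a where "n = - int a" by (metis nonpos_int_cases)
  then show thesis using that n by (simp add: power_int_minus power_one_over inverse_eq_divide)
qed

text \<open>
  Row reduction with the largest entry as pivot, first of the whole matrix and then of the
  remaining rows, leaves rows whose primitive parts are triangular modulo \<open>p\<close>.
\<close>

lemma elementary_divisors:
  fixes Y :: "'k^'m^3"
  assumes Y: "Y \<in> pmat 0" and indep: "\<And>v. v v* Y = 0 \<Longrightarrow> v = 0"
  obtains U a W where "U \<in> GLz" "prim W" "U ** Y = diagp a ** W"
proof -
  have max_entry: "\<exists>i\<in>I. \<exists>k. \<forall>j\<in>I. \<forall>l. absv (X$j$l) \<le> absv (X$i$k)" if "I \<noteq> {}" for X :: "'k^'m^3" and I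
  proof -
    have "\<exists>x\<in>I \<times> UNIV. \<forall>y\<in>I \<times> UNIV. absv (X $ fst y $ snd y) \<le> absv (X $ fst x $ snd x)"
      using that by (intro finite_max_exists) auto
    then show ?thesis by fastforce
  qed
  have quot: "x / y \<in> Zp" if "x \<in> Zp" "y \<in> Zp" "absv x \<le> absv y" for x y
    using that absv_nonneg[of y] by (cases "y = 0") (auto simp: Zp_def absv_divide Qp_divide absv_pos)
  have ind: "(U ** Y) $ r \<noteq> 0" if "U \<in> GLz" for U r
  proof
    assume "(U ** Y) $ r = 0"
    then have "axis r 1 v* (U ** Y) = 0"
      by (simp add: vec_eq_iff vector_matrix_mult_def axis_def if_distrib[where f = "\<lambda>x. x * _"] cong: if_cong)
    then have "(axis r 1 v* U) v* Y = 0" by (simp add: vector_matrix_mul_assoc)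
    then have "axis r 1 = (0 :: 'k^3)" using indep GLz_vec_eq_0[OF that] by blast
    then show False by simp
  qed
  have Zent: "(U ** Y) $ i $ j \<in> Zp" if "U \<in> GLz" for U i j
    using pmat_mult_left[OF GLz_pmat[OF that] Y] by (auto simp: pmat_def pideal_0)
  obtain i k where ik: "\<And>j l. absv (Y$j$l) \<le> absv (Y$i$k)" using max_entry[of UNIV Y] by auto
  have "\<exists>P\<in>GLz. \<forall>j l. absv ((P ** Y)$j$l) \<le> absv ((P ** Y)$1$k)"
  proof -
    define P1 :: "'k^3^3" where "P1 = vector [vector [1,0,0], vector [0,1,0], vector [0,0,1]]"
    define P2 :: "'k^3^3" where "P2 = vector [vector [0,1,0], vector [1,0,0], vector [0,0,1]]"
    define P3 :: "'k^3^3" where "P3 = vector [vector [0,0,1], vector [0,1,0], vector [1,0,0]]"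
    note defs = P1_def P2_def P3_def
    have "P1 \<in> GLz" "P2 \<in> GLz" "P3 \<in> GLz" unfolding defs by (rule GLz_rows; simp)+
    moreover have "i = 1 \<Longrightarrow> \<forall>j l. absv ((P1 ** Y)$j$l) \<le> absv ((P1 ** Y)$1$k)"
      "i = 2 \<Longrightarrow> \<forall>j l. absv ((P2 ** Y)$j$l) \<le> absv ((P2 ** Y)$1$k)"
      "i = 3 \<Longrightarrow> \<forall>j l. absv ((P3 ** Y)$j$l) \<le> absv ((P3 ** Y)$1$k)"
      using ik unfolding defs by (simp_all add: forall_3 rows3_mult)
    ultimately show ?thesis using exhaust_3[of i] by blast
  qed
  then obtain P where P: "P \<in> GLz" "\<And>j l. absv ((P ** Y)$j$l) \<le> absv ((P ** Y)$1$k)" by blast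
  define Y1 where "Y1 = P ** Y"
  have Y1: "Y1$j$l \<in> Zp" "absv (Y1$j$l) \<le> absv (Y1$1$k)" for j l
    using P(2) Zent[OF P(1)] by (auto simp: Y1_def)
  have y1: "Y1$1$k \<noteq> 0"
  proof
    assume "Y1$1$k = 0"
    then have "Y1$1 = 0" using Y1(2)[of 1] absv_nonneg absv_eq_0
      by (simp add: vec_eq_iff) (metis absv_nonneg order_antisym)
    then show False using ind[OF P(1)] by (simp add: Y1_def)
  qed
  define E where "E = (vector [vector [1,0,0], vector [- (Y1$2$k/Y1$1$k),1,0], vector [- (Y1$3$k/Y1$1$k),0,1]] :: 'k^3^3)"
  have E: "E \<in> GLz" unfolding E_def using quot Y1 by (intro GLz_rows) (auto simp: Zp_uminus)
  define Y2 where "Y2 = E ** Y1"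
  have U2: "E ** P \<in> GLz" "Y2 = (E ** P) ** Y" using GLz_mult[OF E P(1)] by (simp_all add: Y2_def Y1_def matrix_mul_assoc)
  have Y2: "Y2$1 = Y1$1" "Y2$2$k = 0" "Y2$3$k = 0"
    using y1 by (simp_all add: Y2_def E_def rows3_mult vec_eq_iff)
  obtain i2 l where i2: "i2 = 2 \<or> i2 = 3" "\<And>j q. j = 2 \<or> j = 3 \<Longrightarrow> absv (Y2$j$q) \<le> absv (Y2$i2$l)"
    using max_entry[of "{2,3}" Y2] by auto
  have "\<exists>P\<in>GLz. (P ** Y2)$1 = Y2$1 \<and> (P ** Y2)$2$k = 0 \<and> (P ** Y2)$3$k = 0 \<and>
          (\<forall>j q. j = 2 \<or> j = 3 \<longrightarrow> absv ((P ** Y2)$j$q) \<le> absv ((P ** Y2)$2$l))"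
    (is "\<exists>P\<in>GLz. ?good P")
  proof -
    define P1 :: "'k^3^3" where "P1 = vector [vector [1,0,0], vector [0,1,0], vector [0,0,1]]"
    define P2 :: "'k^3^3" where "P2 = vector [vector [1,0,0], vector [0,0,1], vector [0,1,0]]"
    have "P1 \<in> GLz" "P2 \<in> GLz" unfolding P1_def P2_def by (rule GLz_rows; simp)+
    moreover have "i2 = 2 \<Longrightarrow> ?good P1" "i2 = 3 \<Longrightarrow> ?good P2"
      using i2(2) Y2(2,3) unfolding P1_def P2_def by (auto simp: rows3_mult vec_eq_iff)
    ultimately show ?thesis using i2(1) by blast
  qed
  then obtain P' where P': "P' \<in> GLz" "?good P'" by blast
  define Y3 where "Y3 = P' ** Y2"
  have U3: "P' ** (E ** P) \<in> GLz" "Y3 = (P' ** (E ** P)) ** Y"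
    using GLz_mult[OF P'(1) U2(1)] by (simp_all add: Y3_def U2(2) matrix_mul_assoc)
  have Y3: "Y3$1 = Y1$1" "Y3$2$k = 0" "Y3$3$k = 0"
    "absv (Y3$2$q) \<le> absv (Y3$2$l)" "absv (Y3$3$q) \<le> absv (Y3$2$l)" for q
    using P'(2) Y2 by (auto simp: Y3_def)
  have Z3: "Y3$j$q \<in> Zp" for j q using Zent[OF U3(1)] by (simp add: U3)
  have y3: "Y3$2$l \<noteq> 0"
  proof
    assume "Y3$2$l = 0"
    then have "Y3$2 = 0" using Y3(4) by (simp add: vec_eq_iff) (metis absv_eq_0 absv_nonneg order_antisym)
    then show False using ind[OF U3(1)] by (simp add: U3)
  qed
  define E' where "E' = (vector [vector [1,0,0], vector [0,1,0], vector [0,- (Y3$3$l/Y3$2$l),1]] :: 'k^3^3)"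
  have E': "E' \<in> GLz" unfolding E'_def using quot Y3 Z3 by (intro GLz_rows) (auto simp: Zp_uminus)
  define Y4 where "Y4 = E' ** Y3"
  define U where "U = E' ** (P' ** (E ** P))"
  have U: "U \<in> GLz" "Y4 = U ** Y"
    using GLz_mult[OF E' U3(1)] by (simp_all add: Y4_def U3(2) U_def matrix_mul_assoc)
  have Y4: "Y4$1 = Y1$1" "Y4$2 = Y3$2" "Y4$3$k = 0" "Y4$3$l = 0"
    using y3 Y3 by (simp_all add: Y4_def E'_def rows3_mult vec_eq_iff)
  have Z4: "Y4$j$q \<in> Zp" for j q using Zent[OF U(1)] by (simp add: U)
  obtain q where q: "\<And>j. absv (Y4$3$j) \<le> absv (Y4$3$q)" using max_entry[of "{3}" Y4] by auto
  have y4: "Y4$3$q \<noteq> 0"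
  proof
    assume "Y4$3$q = 0"
    then have "Y4$3 = 0" using q by (simp add: vec_eq_iff) (metis absv_eq_0 absv_nonneg order_antisym)
    then show False using ind[OF U(1)] by (simp add: U)
  qed
  define c :: "3 \<Rightarrow> 'm" where "c = (\<lambda>r. if r = 1 then k else if r = 2 then l else q)"
  have c: "c 1 = k" "c 2 = l" "c 3 = q" by (simp_all add: c_def)
  have piv: "Y4$r$(c r) \<noteq> 0" "absv (Y4$r$j) \<le> absv (Y4$r$(c r))" for r j
    using exhaust_3[of r] y1 y3 y4 Y1(2) Y3(4) q by (auto simp: c Y4)
  have "\<exists>a. absv (Y4$r$(c r)) = (1 / real p) ^ a" for r
    using Zp_power_exists[OF Z4 piv(1)] by metis
  then obtain a where a: "absv (Y4$r$(c r)) = (1 / real p) ^ a r" for r by metis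
  define W where "W = (\<chi> r j. Y4$r$j / \<pi> ^ a r)"
  have W0: "W \<in> pmat 0"
  proof -
    have "absv (W$r$j) \<le> 1" for r j
      using piv(2)[of r j] p_gt_1 unfolding a by (simp add: W_def absv_divide absv_p_power field_simps)
    then show ?thesis using Z4 by (auto simp: pmat_def W_def pideal_0 Zp_def Qp_closed)
  qed
  have Wp: "absv (W$r$(c r)) = 1" for r using p_gt_1 by (simp add: W_def absv_divide absv_p_power a)
  have Wz: "W$2$k = 0" "W$3$k = 0" "W$3$l = 0" using Y4 Y3 by (simp_all add: W_def)
  have "prim W"
    unfolding prim_def
  proof (intro conjI W0 ballI impI)
    fix v :: "'k^3" assume v: "v \<in> pvec 0" "v v* W \<in> pvec 1"
    have sum: "v$1 * W$1$j + v$2 * W$2$j + v$3 * W$3$j \<in> pideal 1" for j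
      using v(2) by (simp add: pvec_def vector_matrix_mult_def sum_3 mult.commute)
    have unit: "x \<in> pideal 1" if "x * w \<in> pideal 1" "absv w = 1" "x \<in> Qp" for x w
      using that unfolding pideal_1_iff by (simp add: absv_mult)
    have vQ: "v$i \<in> Qp" for i using v(1) by (auto simp: pvec_def pideal_0 Zp_def)
    have WZ: "W$i$j \<in> Zp" for i j using W0 by (auto simp: pmat_def pideal_0)
    have 1: "v$1 \<in> pideal 1" using sum[of k] Wz by (intro unit[OF _ Wp[of 1, unfolded c] vQ]) simp
    have "(v$1 * W$1$l + v$2 * W$2$l + v$3 * W$3$l) - v$1 * W$1$l \<in> pideal 1"
      by (intro pideal_diff sum pideal_mult_right 1 WZ)
    then have 2: "v$2 \<in> pideal 1" using Wz by (intro unit[OF _ Wp[of 2, unfolded c] vQ]) simp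
    have "(v$1 * W$1$q + v$2 * W$2$q + v$3 * W$3$q) - (v$1 * W$1$q + v$2 * W$2$q) \<in> pideal 1"
      by (intro pideal_diff sum pideal_add pideal_mult_right 1 2 WZ)
    then have 3: "v$3 \<in> pideal 1" by (intro unit[OF _ Wp[of 3, unfolded c] vQ]) simp
    show "v \<in> pvec 1" using 1 2 3 by (simp add: pvec_def forall_3)
  qed
  moreover have "U ** Y = diagp a ** W"
    unfolding U(2)[symmetric] by (simp add: vec_eq_iff diagp_mult) (simp add: W_def)
  ultimately show thesis using that U(1) by blast
qed

end

section \<open>The quaternary form and its integral isometries\<close>

lemma matrix_sub_ldistrib: "A ** (B - C) = A ** B - A ** C" for A :: "'a::comm_ring_1^'n^'m"
  by (simp add: vec_eq_iff matrix_matrix_mult_def right_diff_distrib sum_subtractf)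

lemma matrix_sub_rdistrib: "(A - B) ** C = A ** C - B ** C" for A :: "'a::comm_ring_1^'n^'m"
  by (simp add: vec_eq_iff matrix_matrix_mult_def left_diff_distrib sum_subtractf)

context unramified_quadratic_extension
begin

text \<open>
  \<open>q\<close> is the norm form of the unramified extension plus a hyperbolic plane, and \<open>h\<close> its polar
  form with \<open>h x x = q x\<close>.
\<close>

definition h :: "'k^4 \<Rightarrow> 'k^4 \<Rightarrow> 'k" where
  "h x y = x$1 * y$1 - D * x$2 * y$2 + (x$3 * y$4 + x$4 * y$3) / 2"

definition q :: "'k^4 \<Rightarrow> 'k" where
  "q x = x$1 ^ 2 - D * x$2 ^ 2 + x$3 * x$4"

definition gram :: "'k^4^'n \<Rightarrow> 'k^'n^'n" where
  "gram Y = (\<chi> i j. h (Y$i) (Y$j))"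

definition hmat :: "'k^4^4" where
  "hmat = vector [vector [1,0,0,0], vector [0,-D,0,0], vector [0,0,0,1/2], vector [0,0,1/2,0]]"

lemma h_self: "h x x = q x"
  by (simp add: h_def q_def power2_eq_square algebra_simps)

lemma h_commute: "h x y = h y x" by (simp add: h_def algebra_simps)
lemma h_add_left: "h (x + y) z = h x z + h y z" by (simp add: h_def algebra_simps add_divide_distrib)
lemma h_add_right: "h x (y + z) = h x y + h x z" by (simp add: h_def algebra_simps add_divide_distrib)
lemma h_diff_left: "h (x - y) z = h x z - h y z" by (simp add: h_def algebra_simps add_divide_distrib diff_divide_distrib)
lemma h_diff_right: "h x (y - z) = h x y - h x z" by (simp add: h_def algebra_simps add_divide_distrib diff_divide_distrib)
lemma h_scale_left: "h (c *s x) y = c * h x y" by (simp add: h_def algebra_simps add_divide_distrib)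
lemma h_scale_right: "h x (c *s y) = c * h x y" by (simp add: h_def algebra_simps add_divide_distrib)

lemma hmat_entry: "(A ** hmat ** transpose B) $ i $ j = h (A $ i) (B $ j)"
  by (simp add: matrix_matrix_mult_def transpose_def hmat_def sum_4 h_def algebra_simps add_divide_distrib)

lemma gram_hmat: "gram Y = Y ** hmat ** transpose Y"
  by (simp add: vec_eq_iff hmat_entry gram_def)

lemma gram_mult: "gram (G ** Y) = G ** gram Y ** transpose G"
  by (simp add: gram_hmat matrix_transpose_mul matrix_mul_assoc)

lemma gram_symmetric: "transpose (gram Y) = gram Y"
  by (simp add: vec_eq_iff gram_def transpose_def h_commute)

lemma pideal_half: "x / 2 \<in> pideal t \<longleftrightarrow> x \<in> pideal t"
proof -
  have "x / 2 \<in> Qp \<longleftrightarrow> x \<in> Qp" using Qp_mult[of "x / 2" 2] by (auto intro: Qp_divide)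
  then show ?thesis by (simp add: pideal_def absv_divide)
qed

lemma h_pideal: "x \<in> pvec s \<Longrightarrow> y \<in> pvec t \<Longrightarrow> h x y \<in> pideal (s + t)"
  unfolding h_def
  by (intro pideal_add pideal_diff)
     (auto simp: pvec_def pideal_half mult.assoc intro!: pideal_mult pideal_add pideal_mult_left[OF D_Zp]
        intro: pideal_mult[of _ t _ s, simplified add.commute])

lemma h_Zp: "x \<in> pvec 0 \<Longrightarrow> y \<in> pvec 0 \<Longrightarrow> h x y \<in> Zp"
  using h_pideal[of x 0 y 0] by (simp add: pideal_0)

lemma q_Zp: "x \<in> pvec 0 \<Longrightarrow> q x \<in> Zp"
  using h_Zp[of x x] by (simp add: h_self)

lemma h_cong:
  assumes "x \<in> pvec 0" "y' \<in> pvec 0" "x - x' \<in> pvec t" "y - y' \<in> pvec t"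
  shows "h x y - h x' y' \<in> pideal t"
proof -
  have "h x y - h x' y' = h x (y - y') + h (x - x') y'" by (simp add: h_diff_left h_diff_right)
  then show ?thesis using h_pideal[OF assms(1,4)] h_pideal[OF assms(3,2)] by (simp add: pideal_add)
qed

lemma gram_pmat: "Y \<in> pmat 0 \<Longrightarrow> gram Y \<in> pmat 0"
  by (simp add: gram_def pmat_rows h_Zp) (simp add: pvec_def pideal_0 h_Zp)

lemma gram_cong: "Y \<in> pmat 0 \<Longrightarrow> Y' \<in> pmat 0 \<Longrightarrow> Y - Y' \<in> pmat t \<Longrightarrow> gram Y - gram Y' \<in> pmat t"
  by (simp add: gram_def pmat_def) (simp add: h_cong pvec_def)

text \<open>The norm form and one further entry: the shape to which the Gram matrix of a primitive triple is brought.\<close>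

definition dg :: "'k \<Rightarrow> 'k^3^3" where
  "dg u = vector [vector [1,0,0], vector [0,-D,0], vector [0,0,u]]"

lemma dg_entries [simp]:
  "dg u $ 1 $ 1 = 1" "dg u $ 1 $ 2 = 0" "dg u $ 1 $ 3 = 0"
  "dg u $ 2 $ 1 = 0" "dg u $ 2 $ 2 = - D" "dg u $ 2 $ 3 = 0"
  "dg u $ 3 $ 1 = 0" "dg u $ 3 $ 2 = 0" "dg u $ 3 $ 3 = u"
  by (simp_all add: dg_def)

definition isom :: "'k^4^4 \<Rightarrow> bool" where
  "isom M \<longleftrightarrow> M \<in> pmat 0 \<and> (\<forall>x y. h (x v* M) (y v* M) = h x y)"

lemma axis_mult: "axis i 1 v* M = M $ i" for M :: "'k^'n^'m"
  by (simp add: vec_eq_iff vector_matrix_mult_def axis_def if_distrib[where f = "\<lambda>x. x * _"] cong: if_cong)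

lemma isom_pmat: "isom M \<Longrightarrow> M \<in> pmat 0" by (simp add: isom_def)

lemma isom_hmat: "isom M \<Longrightarrow> M ** hmat ** transpose M = hmat"
proof -
  assume "isom M"
  then have "h (axis i 1 v* M) (axis j 1 v* M) = h (axis i 1) (axis j 1)" for i j by (simp add: isom_def)
  moreover have "(mat 1 ** hmat ** transpose (mat 1)) $ i $ j = h (mat 1 $ i) (mat 1 $ j)" for i j
    by (rule hmat_entry)
  moreover have "mat 1 $ i = (axis i 1 :: 'k^4)" for i by (simp add: vec_eq_iff mat_def axis_def eq_commute)
  ultimately show ?thesis by (simp add: vec_eq_iff hmat_entry axis_mult)
qed

lemma gram_isom: "isom M \<Longrightarrow> gram (Y ** M) = gram Y"
proof -
  assume M: "isom M"
  have "gram (Y ** M) = Y ** (M ** hmat ** transpose M) ** transpose Y"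
    by (simp add: gram_hmat matrix_transpose_mul matrix_mul_assoc)
  then show ?thesis by (simp add: isom_hmat[OF M] gram_hmat)
qed

lemma isom_inverse:
  assumes M: "isom M"
  obtains M' where "isom M'" "M ** M' = mat 1" "M' ** M = mat 1"
proof -
  define hinv :: "'k^4^4" where
    "hinv = vector [vector [1,0,0,0], vector [0,-1/D,0,0], vector [0,0,0,2], vector [0,0,2,0]]"
  have hi: "hmat ** hinv = mat 1"
    by (simp add: vec_eq_iff forall_4 matrix_matrix_mult_def sum_4 hmat_def hinv_def mat_def)
  have H0: "hinv \<in> pmat 0" "hmat \<in> pmat 0"
    using Zp_divide[of 1 2] Zp_divide[of 1 D]
    by (auto simp: pmat_def pideal_0 forall_4 hinv_def hmat_def Zp_uminus)
  define M' where "M' = hmat ** transpose M ** hinv"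
  have MM: "M ** M' = mat 1" using isom_hmat[OF M] hi by (simp add: M'_def matrix_mul_assoc)
  then have MM': "M' ** M = mat 1" using matrix_left_right_inverse by blast
  have "M' \<in> pmat 0"
    unfolding M'_def using isom_pmat[OF M] H0 by (intro pmat_mult_left pmat_mult_right) (auto simp: pmat_transpose)
  moreover have "h (x v* M') (y v* M') = h x y" for x y
  proof -
    have "h ((x v* M') v* M) ((y v* M') v* M) = h (x v* M') (y v* M')" using M by (simp add: isom_def)
    then show ?thesis by (simp add: vector_matrix_mul_assoc MM')
  qed
  ultimately have "isom M'" by (simp add: isom_def)
  then show thesis using that MM MM' by blast
qed

lemma isom_pvec: "isom M \<Longrightarrow> v v* M \<in> pvec t \<longleftrightarrow> v \<in> pvec t"
proof
  assume M: "isom M" and v: "v v* M \<in> pvec t"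
  obtain M' where M': "isom M'" "M ** M' = mat 1" using isom_inverse[OF M] by blast
  have "(v v* M) v* M' \<in> pvec t" by (rule pvec_mult_right[OF v isom_pmat[OF M'(1)]])
  then show "v \<in> pvec t" by (simp add: vector_matrix_mul_assoc M')
qed (auto intro: pvec_mult_right isom_pmat)

lemma rows_mult: "(Y ** M) $ i = Y $ i v* M" for Y :: "'k^'n^'m"
  by (simp add: vec_eq_iff matrix_matrix_mult_def vector_matrix_mult_def)

lemma isom_mult_pmat: "isom M \<Longrightarrow> Y ** M \<in> pmat t \<longleftrightarrow> Y \<in> pmat t"
  by (simp add: pmat_rows rows_mult isom_pvec)

lemma prim_isom: "isom M \<Longrightarrow> prim (Y ** M) \<longleftrightarrow> prim Y"
  by (simp add: prim_def isom_mult_pmat isom_pvec flip: vector_matrix_mul_assoc)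

subsection \<open>Minors of primitive matrices\<close>

definition cols :: "'k^'m^3 \<Rightarrow> 'm \<Rightarrow> 'm \<Rightarrow> 'm \<Rightarrow> 'k^3^3" where
  "cols Y k l m = vector [vector [Y$1$k, Y$1$l, Y$1$m], vector [Y$2$k, Y$2$l, Y$2$m],
                          vector [Y$3$k, Y$3$l, Y$3$m]]"

lemma cols_pmat: "Y \<in> pmat 0 \<Longrightarrow> cols Y k l m \<in> pmat 0"
  by (simp add: pmat_def cols_def forall_3)

lemma det_pmat_Zp: "A \<in> pmat 0 \<Longrightarrow> det A \<in> Zp" for A :: "'k^3^3"
  by (auto simp: det_3 pmat_def pideal_0 intro!: Zp_closed)

text \<open>
  If all maximal minors were divisible by \<open>p\<close>, the vector of \<open>2 \<times> 2\<close> minors of two columns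
  would annihilate all columns modulo \<open>p\<close>; so these minors, and by the same argument the
  entries, would be divisible by \<open>p\<close>.
\<close>

lemma prim_minor:
  fixes Y :: "'k^'m^3"
  assumes Y: "prim Y" shows "\<exists>k l m. absv (det (cols Y k l m)) = 1"
proof (rule ccontr)
  assume no: "\<not> ?thesis"
  have Y0: "Y \<in> pmat 0" and ker: "\<And>v. v \<in> pvec 0 \<Longrightarrow> v v* Y \<in> pvec 1 \<Longrightarrow> v \<in> pvec 1"
    using Y by (auto simp: prim_def)
  have YZ: "Y$i$j \<in> Zp" for i j using Y0 by (simp add: pmat_def pideal_0)
  have d: "det (cols Y k l m) \<in> pideal 1" for k l m
  proof -
    have "det (cols Y k l m) \<in> Zp" "absv (det (cols Y k l m)) \<noteq> 1"
      using det_pmat_Zp[OF cols_pmat[OF Y0]] no by blast+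
    then show ?thesis unfolding pideal_1_iff by (simp add: Zp_def)
  qed
  have two: "Y$1$k * Y$2$l - Y$2$k * Y$1$l \<in> pideal 1" "Y$3$k * Y$1$l - Y$1$k * Y$3$l \<in> pideal 1"
    for k l
  proof -
    define v :: "'k^3" where "v = vector [Y$2$k * Y$3$l - Y$3$k * Y$2$l,
      Y$3$k * Y$1$l - Y$1$k * Y$3$l, Y$1$k * Y$2$l - Y$2$k * Y$1$l]"
    have "v \<in> pvec 0" by (auto simp: v_def pvec_def forall_3 pideal_0 intro!: Zp_closed YZ)
    moreover have "(v v* Y) $ m = det (cols Y k l m)" for m
      by (simp add: vector_matrix_mult_def sum_3 v_def det_3 cols_def algebra_simps)
    then have "v v* Y \<in> pvec 1" using d by (simp add: pvec_def)
    ultimately have "v \<in> pvec 1" by (rule ker)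
    then show "Y$1$k * Y$2$l - Y$2$k * Y$1$l \<in> pideal 1" "Y$3$k * Y$1$l - Y$1$k * Y$3$l \<in> pideal 1"
      unfolding pvec_def forall_3 v_def by simp_all
  qed
  have "Y$1$k \<in> pideal 1" for k
  proof -
    define v :: "'k^3" where "v = vector [Y$2$k, - Y$1$k, 0]"
    have "v \<in> pvec 0" by (auto simp: v_def pvec_def forall_3 pideal_0 intro!: Zp_uminus YZ)
    moreover have "(v v* Y) $ m = - (Y$1$k * Y$2$m - Y$2$k * Y$1$m)" for m
      by (simp add: vector_matrix_mult_def sum_3 v_def)
    then have "v v* Y \<in> pvec 1" using two pideal_uminus by (simp add: pvec_def del: minus_diff_eq)
    ultimately have "v \<in> pvec 1" by (rule ker)
    then have "- Y$1$k \<in> pideal 1" unfolding pvec_def forall_3 v_def by simp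
    then show ?thesis using pideal_uminus by fastforce
  qed
  then have "axis 1 1 v* Y \<in> pvec 1" by (simp add: axis_mult pvec_def)
  moreover have "axis 1 1 \<in> (pvec 0 :: ('k^3) set)" by (simp add: pvec_def axis_def pideal_0)
  ultimately have "axis 1 1 \<in> (pvec 1 :: ('k^3) set)" using ker by blast
  then have "(axis 1 1 :: 'k^3) $ 1 \<in> pideal 1" unfolding pvec_def by blast
  then show False unfolding pideal_1_iff by simp
qed

lemma prim_right_inverse:
  fixes Y :: "'k^'m^3"
  assumes Y: "prim Y" obtains R where "R \<in> pmat 0" "Y ** R = mat 1"
proof -
  obtain k l m where klm: "absv (det (cols Y k l m)) = 1" using prim_minor[OF Y] by blast
  then have "cols Y k l m \<in> GLz" using Y by (simp add: GLz_def cols_pmat prim_def)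
  then obtain H where H: "H \<in> GLz" "cols Y k l m ** H = mat 1" using GLz_inverse by blast
  define R :: "'k^3^'m" where
    "R = (\<chi> r j. (if r = k then H$1$j else 0) + (if r = l then H$2$j else 0) + (if r = m then H$3$j else 0))"
  have "R \<in> pmat 0" using GLz_pmat[OF H(1)] by (auto simp: pmat_def R_def intro!: pideal_add)
  moreover have "(Y ** R) $ i $ j = (cols Y k l m ** H) $ i $ j" for i j
  proof -
    have "(Y ** R) $ i $ j = Y$i$k * H$1$j + Y$i$l * H$2$j + Y$i$m * H$3$j"
      by (simp add: matrix_matrix_mult_def R_def distrib_left sum.distrib if_distrib[where f = "(*) _"]
          cong: if_cong)
    also have "\<dots> = (cols Y k l m ** H) $ i $ j"
      using exhaust_3[of i] by (auto simp: matrix_matrix_mult_def sum_3 cols_def)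
    finally show ?thesis .
  qed
  then have "Y ** R = mat 1" by (simp add: vec_eq_iff H)
  ultimately show thesis using that by blast
qed

text \<open>The absolute value of a minor depends only on the set of its columns.\<close>

lemma minors_4:
  fixes Y :: "'k^4^3"
  shows "absv (det (cols Y k l m)) \<in> {0, absv (det (cols Y 1 2 3)), absv (det (cols Y 1 2 4)),
     absv (det (cols Y 1 3 4)), absv (det (cols Y 2 3 4))}"
proof -
  have s: "det (cols Y l k m) = - det (cols Y k l m)" "det (cols Y k m l) = - det (cols Y k l m)" for k l m
    by (simp_all add: det_3 cols_def algebra_simps)
  have z: "det (cols Y k k m) = 0" "det (cols Y k m m) = 0" "det (cols Y k m k) = 0" for k m
    by (simp_all add: det_3 cols_def algebra_simps)
  define f where "f k l m = absv (det (cols Y k l m))" for k l m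
  have f: "f l k m = f k l m" "f k m l = f k l m" "f k k m = 0" "f k m m = 0" "f k m k = 0" for k l m
    unfolding f_def by (subst s(1), simp, subst s(2), simp_all add: z)
  show ?thesis
    unfolding f_def[symmetric]
    using exhaust_4[of k] exhaust_4[of l] exhaust_4[of m]
    by (elim disjE; simp add: f(3-5); metis f(1,2))
qed

subsection \<open>Normal form of the Gram matrix of a primitive matrix\<close>

text \<open>
  Once columns 1, 2, 4 form the identity, column 3 does not contribute to the Gram matrix of the first two rows,
  which is the norm form, and multiples of them make the third row orthogonal to both.
\<close>

lemma prim_diag_124:
  assumes Y: "Y \<in> pmat 0" "absv (det (cols Y 1 2 4)) = 1"
  shows "\<exists>G\<in>GLz. \<exists>u\<in>Zp. gram (G ** Y) = dg u"
proof -
  have "cols Y 1 2 4 \<in> GLz" using Y by (simp add: GLz_def cols_pmat)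
  then obtain H where H: "H \<in> GLz" "H ** cols Y 1 2 4 = mat 1" using GLz_inverse by blast
  define Z where "Z = H ** Y"
  have Z0: "Z \<in> pmat 0" unfolding Z_def by (rule pmat_mult_left[OF GLz_pmat[OF H(1)] Y(1)])
  have "Z$i$1 = (mat 1 :: 'k^3^3) $ i $ 1" "Z$i$2 = (mat 1 :: 'k^3^3) $ i $ 2"
    "Z$i$4 = (mat 1 :: 'k^3^3) $ i $ 3" for i
    unfolding Z_def H(2)[symmetric] by (simp_all add: matrix_matrix_mult_def sum_3 cols_def)
  then have Z: "Z$1$1 = 1" "Z$2$1 = 0" "Z$3$1 = 0" "Z$1$2 = 0" "Z$2$2 = 1" "Z$3$2 = 0"
    "Z$1$4 = 0" "Z$2$4 = 0" "Z$3$4 = 1" by (simp_all add: mat_def)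
  define a b where "a = Z$1$3" and "b = Z$2$3"
  have ab: "a \<in> Zp" "b \<in> Zp" using Z0 by (auto simp: a_def b_def pmat_def pideal_0)
  define E :: "'k^3^3" where "E = vector [vector [1,0,0], vector [0,1,0], vector [- (a / 2), b / (2 * D), 1]]"
  have E: "E \<in> GLz" unfolding E_def using ab
    by (intro GLz_rows) (auto intro!: Zp_uminus Zp_divide Zp_mult simp: absv_mult simp del: absv_power)
  have G: "E ** H \<in> GLz" by (rule GLz_mult[OF E H(1)])
  define X where "X = E ** Z"
  have X: "X = (E ** H) ** Y" by (simp add: X_def Z_def matrix_mul_assoc)
  have X0: "X \<in> pmat 0" unfolding X by (rule pmat_mult_left[OF GLz_pmat[OF G] Y(1)])
  have "gram X = dg (q (X$3))"
    using Z by (simp add: vec_eq_iff forall_3 gram_def X_def E_def rows3_mult h_def q_def a_def[symmetric]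
        b_def[symmetric] power2_eq_square field_simps)
  moreover have "q (X$3) \<in> Zp" using X0 by (intro q_Zp) (simp add: pmat_rows)
  ultimately show ?thesis using G X by metis
qed

text \<open>
  The Eichler transvections of the hyperbolic plane, with parameter \<open>a + b\<delta>\<close>.  One of them makes the
  minor of columns 1, 2, 4 a unit, unless already a minor containing columns 1, 2 is a unit.
\<close>

definition eichler :: "'k \<Rightarrow> 'k \<Rightarrow> 'k^4^4" where
  "eichler a b = vector [vector [1,0,0,- 2 * a], vector [0,1,0,2 * D * b],
     vector [a,b,1,- (a^2 - D * b^2)], vector [0,0,0,1]]"

lemma eichler_isom: "a \<in> Zp \<Longrightarrow> b \<in> Zp \<Longrightarrow> isom (eichler a b)"
  unfolding isom_def
proof (intro conjI allI)
  show "h (x v* eichler a b) (y v* eichler a b) = h x y" for x y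
    by (simp add: h_def vector_matrix_mult_def sum_4 eichler_def power2_eq_square field_simps)
  assume "a \<in> Zp" "b \<in> Zp"
  then show "eichler a b \<in> pmat 0"
    by (auto simp: pmat_def forall_4 eichler_def pideal_0 intro!: Zp_closed D_Zp)
qed

lemma swap_isom: "isom (vector [vector [1,0,0,0], vector [0,1,0,0], vector [0,0,0,1], vector [0,0,1,0]])"
  unfolding isom_def
  by (auto simp: pmat_def forall_4 pideal_0 h_def vector_matrix_mult_def sum_4 algebra_simps)

lemma prim_diag:
  assumes Y: "prim Y" shows "\<exists>G\<in>GLz. \<exists>u\<in>Zp. gram (G ** Y) = dg u"
proof -
  have Y0: "Y \<in> pmat 0" using Y by (simp add: prim_def)
  have red: "\<exists>G\<in>GLz. \<exists>u\<in>Zp. gram (G ** Y) = dg u"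
    if M: "isom M" and d: "absv (det (cols (Y ** M) 1 2 4)) = 1" for M
  proof -
    obtain G u where "G \<in> GLz" "u \<in> Zp" "gram (G ** (Y ** M)) = dg u"
      using prim_diag_124[OF _ d] Y0 M by (auto simp: isom_mult_pmat)
    then show ?thesis using gram_isom[OF M, of "G ** Y"] by (auto simp: matrix_mul_assoc)
  qed
  define d123 where "d123 = det (cols Y 1 2 3)"
  define d124 where "d124 = det (cols Y 1 2 4)"
  define d134 where "d134 = det (cols Y 1 3 4)"
  define d234 where "d234 = det (cols Y 2 3 4)"
  note defs = d123_def d124_def d134_def d234_def
  have dZ: "d123 \<in> Zp" "d124 \<in> Zp" "d134 \<in> Zp" "d234 \<in> Zp"
    unfolding defs by (intro det_pmat_Zp cols_pmat Y0)+
  have e: "det (cols (Y ** eichler a b) 1 2 4) = d124 + b * d134 - a * d234 + (a^2 - D * b^2) * d123" for a b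
    by (simp add: defs det_3 cols_def matrix_matrix_mult_def sum_4 eichler_def power2_eq_square algebra_simps)
  consider "absv d124 = 1" | "absv d123 = 1" | "absv d124 < 1" "absv d123 < 1" "absv d234 = 1"
    | "absv d124 < 1" "absv d123 < 1" "absv d134 = 1"
  proof -
    obtain k l m where "absv (det (cols Y k l m)) = 1" using prim_minor[OF Y] by blast
    then have "absv d123 = 1 \<or> absv d124 = 1 \<or> absv d134 = 1 \<or> absv d234 = 1"
      using minors_4[of Y k l m] unfolding defs by auto
    then show thesis using that dZ by (auto simp: Zp_def less_le)
  qed
  then show ?thesis
  proof cases
    case 1
    then show ?thesis using prim_diag_124[OF Y0] by (simp add: defs)
  next
    case 2
    show ?thesis
      by (rule red[OF swap_isom]) (use 2 in \<open>simp add: defs det_3 cols_def matrix_matrix_mult_def sum_4\<close>)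
  next
    case 3
    have "absv (- d234 + (d124 + d123)) = absv (- d234)"
      using 3 by (intro absv_add_eq) (simp add: absv_add_lt)
    moreover have "det (cols (Y ** eichler 1 0) 1 2 4) = - d234 + (d124 + d123)" by (simp add: e)
    ultimately show ?thesis using 3 by (intro red[OF eichler_isom[of 1 0]]) auto
  next
    case 4
    have "absv (- D * d123) < 1" using 4 by (simp add: absv_mult)
    then have "absv (d134 + (d124 + - D * d123)) = absv d134"
      using 4 absv_add_lt[of d124 1 "- D * d123"] by (intro absv_add_eq) simp
    moreover have "det (cols (Y ** eichler 0 1) 1 2 4) = d134 + (d124 + - D * d123)" by (simp add: e)
    ultimately show ?thesis using 4 by (intro red[OF eichler_isom[of 0 1]]) auto
  qed
qed

text \<open>Congruence to \<open>dg u\<close> modulo \<open>p\<close> lifts to equivalence: squares near 1 are available.\<close>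

lemma dg_lift:
  assumes Z: "transpose Z = Z" "Z \<in> pmat 0" "Z - dg u \<in> pmat 1" and u: "u \<in> Zp"
  shows "\<exists>G\<in>GLz. \<exists>u'\<in>Zp. G ** Z ** transpose G = dg u' \<and> u' - u \<in> pideal 1"
proof -
  have ZZ: "Z$i$j \<in> Zp" for i j using Z(2) by (simp add: pmat_def pideal_0)
  have sZ: "Z$j$i = Z$i$j" for i j using symmetric_entry[OF Z(1)] .
  have c: "Z$i$j - dg u $i$j \<in> pideal 1" for i j using Z(3) unfolding pmat_def by simp
  have c': "Z$1$2 \<in> pideal 1" "Z$1$3 \<in> pideal 1" "Z$2$3 \<in> pideal 1"
    using c[of 1 2] c[of 1 3] c[of 2 3] by simp_all
  have "absv (Z$1$1 - 1) < 1" using c[of 1 1] unfolding pideal_1_iff by simp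
  then obtain s where s: "s \<in> Qp" "s^2 = Z$1$1" "absv (s - 1) < 1"
    using sqrt_exists[of "Z$1$1"] ZZ[of 1 1] by (auto simp: Zp_def)
  have s1: "absv s = 1" using absv_unit_cong[of 1 s] s(3) absv_commute[of 1 s] by simp
  then have sZp: "s \<in> Zp" "s \<noteq> 0" using s by (auto simp: Zp_def)
  have Z11: "absv (Z$1$1) = 1" "Z$1$1 \<noteq> 0" using s1 sZp s(2) by (auto simp: absv_power simp flip: s(2))
  define y where "y = Z$2$2 - Z$1$2^2 / Z$1$1"
  define w where "w = Z$2$3 - Z$1$2 * Z$1$3 / Z$1$1"
  define r where "r = Z$3$3 - Z$1$3^2 / Z$1$1"
  have quot: "x * z / Z$1$1 \<in> pideal 1" if "x \<in> pideal 1" "z \<in> Zp" for x z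
  proof -
    have "x * (z / Z$1$1) \<in> pideal 1" using that by (intro pideal_mult_right Zp_divide Z11 ZZ)
    then show ?thesis by simp
  qed
  have yc: "y + D \<in> pideal 1"
    using pideal_diff[OF c[of 2 2] quot[OF c'(1) ZZ[of 1 2]]] by (simp add: y_def power2_eq_square algebra_simps)
  have wc: "w \<in> pideal 1" unfolding w_def by (intro pideal_diff c' quot ZZ)
  have rc: "r - u \<in> pideal 1"
    using pideal_diff[OF c[of 3 3] quot[OF c'(2) ZZ[of 1 3]]] by (simp add: r_def power2_eq_square algebra_simps)
  have yD: "y / (- D) \<in> Qp"
  proof -
    have "y + D - D \<in> Qp" using yc D_Zp by (intro Qp_diff) (auto simp: pideal_def Zp_def)
    then show ?thesis using \<delta>_props(2) by (intro Qp_divide Qp_uminus) auto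
  qed
  have "absv (y / (- D) - 1) < 1"
  proof -
    have "y / (- D) - 1 = (y + D) / (- D)" by (simp add: field_simps)
    then show ?thesis using yc unfolding pideal_1_iff by (simp only: absv_divide) simp
  qed
  then obtain s' where s': "s' \<in> Qp" "s'^2 = y / (- D)" "absv (s' - 1) < 1" using sqrt_exists[OF yD] by blast
  have s1': "absv s' = 1" using absv_unit_cong[of 1 s'] s'(3) absv_commute[of 1 s'] by simp
  then have sZp': "s' \<in> Zp" "s' \<noteq> 0" using s' by (auto simp: Zp_def)
  have y: "y = - D * s'^2" using s'(2) by (simp add: field_simps)
  have y1: "absv y = 1" "y \<noteq> 0" using s1' sZp' by (auto simp: y absv_mult absv_power \<delta>_props)
  have yZ: "y \<in> Zp" unfolding y by (intro Zp_mult Zp_uminus D_Zp Zp_power sZp')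
  have wZ: "w \<in> Zp" using pideal_Zp[OF wc] .
  define E :: "'k^3^3" where "E = vector [vector [1/s,0,0], vector [- (Z$1$2/Z$1$1),1,0], vector [- (Z$1$3/Z$1$1),0,1]]"
  define F :: "'k^3^3" where "F = vector [vector [1,0,0], vector [0,1/s',0], vector [0,- (w/y),1]]"
  define B where "B = E ** Z ** transpose E"
  have E: "E \<in> GLz" unfolding E_def using sZp s1 ZZ Z11
    by (intro GLz_rows) (auto intro!: Zp_uminus Zp_divide simp: absv_divide)
  have F: "F \<in> GLz" unfolding F_def using sZp' s1' wZ yZ y1
    by (intro GLz_rows) (auto intro!: Zp_uminus Zp_divide simp: absv_divide)
  have B: "B$1$1 = 1" "B$1$2 = 0" "B$1$3 = 0" "B$2$1 = 0" "B$3$1 = 0"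
    "B$2$2 = y" "B$2$3 = w" "B$3$2 = w" "B$3$3 = r"
    using Z11(2) sZp(2)
    by (simp_all add: B_def E_def conj_entry sum_3 sZ[of 2 1] sZ[of 3 1] sZ[of 3 2] s(2)[symmetric]
        y_def w_def r_def field_simps power2_eq_square)
  have "F ** B ** transpose F = dg (r - w^2 / y)"
    using B y1(2) sZp'(2)
    by (simp add: vec_eq_iff forall_3 F_def conj_entry sum_3) (simp add: y field_simps power2_eq_square)
  then have "(F ** E) ** Z ** transpose (F ** E) = dg (r - w^2 / y)"
    by (simp add: B_def matrix_transpose_mul matrix_mul_assoc)
  moreover have "r - w^2 / y - u \<in> pideal 1"
  proof -
    have "w * (w / y) \<in> pideal 1" using wc wZ yZ y1 by (intro pideal_mult_right Zp_divide)
    then have "(r - u) - w * (w / y) \<in> pideal 1" by (intro pideal_diff rc)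
    then show ?thesis by (simp add: power2_eq_square algebra_simps)
  qed
  moreover from this have "r - w^2 / y \<in> Zp" using Zp_add[OF pideal_Zp u] by fastforce
  ultimately show ?thesis using GLz_mult[OF F E] by blast
qed

text \<open>The matrix \<open>Z\<close> is a Gram matrix only modulo \<open>p\<close>, which suffices by the lifting lemma.\<close>

lemma prim_cong_diag:
  assumes Y: "prim Y" and Z: "transpose Z = Z" "Z \<in> pmat 0" "gram Y - Z \<in> pmat 1"
  shows "\<exists>G\<in>GLz. \<exists>u\<in>Zp. G ** Z ** transpose G = dg u"
proof -
  obtain G u where G: "G \<in> GLz" "u \<in> Zp" "gram (G ** Y) = dg u" using prim_diag[OF Y] by blast
  define Z' where "Z' = G ** Z ** transpose G"
  have "G ** (gram Y - Z) ** transpose G \<in> pmat 1" using GLz_conj_pmat[OF G(1)] Z(3) by blast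
  moreover have "G ** (gram Y - Z) ** transpose G = dg u - Z'"
    unfolding G(3)[symmetric] gram_mult Z'_def by (simp add: matrix_sub_ldistrib matrix_sub_rdistrib)
  ultimately have "Z' - dg u \<in> pmat 1" using subgp_commute[OF subgp_pmat, of "dg u" Z' 1] by simp
  moreover have "transpose Z' = Z'" "Z' \<in> pmat 0"
    using conj_symmetric[OF Z(1)] GLz_conj_pmat[OF G(1)] Z(2) by (auto simp: Z'_def)
  ultimately obtain F u' where F: "F \<in> GLz" "u' \<in> Zp" "F ** Z' ** transpose F = dg u'"
    using dg_lift[OF _ _ _ G(2)] by blast
  have "(F ** G) ** Z ** transpose (F ** G) = dg u'"
    using F(3) by (simp add: Z'_def matrix_transpose_mul matrix_mul_assoc)
  then show ?thesis using GLz_mult[OF F(1) G(1)] F(2) by blast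
qed

end

section \<open>Counting primitive matrices modulo p\<close>

text \<open>Moduli of the form \<open>pideal 1\<close> are to keep the numeral.\<close>

declare One_nat_def [simp del]

context unramified_quadratic_extension
begin

definition cg :: "'k \<Rightarrow> 'k \<Rightarrow> bool" where
  "cg x y \<longleftrightarrow> x \<in> Zp \<and> y \<in> Zp \<and> x - y \<in> pideal 1"

lemma cg_iff: "cg x y \<longleftrightarrow> x \<in> Zp \<and> y \<in> Zp \<and> absv (x - y) < 1"
  unfolding cg_def pideal_1_iff by (auto simp: Zp_def Qp_diff)

lemma cg_refl: "x \<in> Zp \<Longrightarrow> cg x x" by (simp add: cg_def)
lemma cg_sym: "cg x y \<Longrightarrow> cg y x" by (auto simp: cg_def intro: subgp_commute[OF subgp_pideal])
lemma cg_trans: "cg x y \<Longrightarrow> cg y z \<Longrightarrow> cg x z"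
  by (auto simp: cg_def intro: subgp_trans[OF subgp_pideal])
lemma cg_add: "cg x y \<Longrightarrow> cg x' y' \<Longrightarrow> cg (x + x') (y + y')"
  using pideal_add[of "x - y" 1 "x' - y'"] by (auto simp: cg_def Zp_add algebra_simps)
lemma cg_uminus: "cg x y \<Longrightarrow> cg (- x) (- y)"
  using pideal_uminus[of "x - y" 1] by (auto simp: cg_def Zp_uminus)
lemma cg_diff: "cg x y \<Longrightarrow> cg x' y' \<Longrightarrow> cg (x - x') (y - y')"
  using cg_add[of x y "- x'" "- y'"] cg_uminus[of x' y'] by simp
lemma cg_mult: "cg x y \<Longrightarrow> cg x' y' \<Longrightarrow> cg (x * x') (y * y')"
proof -
  assume c: "cg x y" "cg x' y'"
  have "x * x' - y * y' = (x - y) * x' + y * (x' - y')" by (simp add: algebra_simps)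
  moreover have "(x - y) * x' + y * (x' - y') \<in> pideal 1"
    using c by (intro pideal_add pideal_mult_right pideal_mult_left) (auto simp: cg_def)
  ultimately show ?thesis using c by (simp add: cg_def Zp_mult)
qed
lemma cg_power: "cg x y \<Longrightarrow> cg (x ^ n) (y ^ n)"
  by (induction n) (auto intro: cg_mult cg_refl)
lemma cg_unit: "cg x y \<Longrightarrow> absv x = 1 \<Longrightarrow> absv y = 1"
  using absv_unit_cong[of x y] by (simp add: cg_iff)
lemma cg_div:
  assumes c: "cg x y" "cg x' y'" and u: "absv x' = 1" shows "cg (x / x') (y / y')"
proof -
  have u': "absv y' = 1" using cg_unit[OF c(2) u] .
  then have nz: "x' \<noteq> 0" "y' \<noteq> 0" using u by auto
  have "x / x' - y / y' = ((x * y' - y * x') / x') / y'" using nz by (simp add: field_simps)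
  moreover have "cg (x * y') (y * x')" using c by (intro cg_mult cg_sym[of x' y'])
  ultimately show ?thesis using c u u' by (simp add: cg_iff Zp_divide absv_divide absv_mult)
qed

definition Zu :: "'k set" where "Zu = {x \<in> Zp. absv x = 1}"

lemma unit_or_pideal: "x \<in> Zp \<Longrightarrow> x \<notin> pideal 1 \<longleftrightarrow> x \<in> Zu"
  unfolding pideal_1_iff by (auto simp: Zu_def Zp_def)

lemma cg_0_iff: "cg x 0 \<longleftrightarrow> x \<in> pideal 1"
  by (auto simp: cg_def pideal_Zp)

lemma cg_Zp: "cg x y \<Longrightarrow> x \<in> Zp" "cg x y \<Longrightarrow> y \<in> Zp" by (auto simp: cg_def)

lemma residues_p: "ncos (pideal 1) Zp = p" "fincos (pideal 1) Zp"
  using ncos_residues[of 1] by simp_all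

lemma fincos_Zp: "A \<subseteq> Zp \<Longrightarrow> fincos (pideal 1) A"
  using fincos_subset[OF residues_p(2)] by blast

lemma ncos_pideal: "ncos (pideal 1) (pideal 1) = 1"
  by (rule ncos_single[of _ 0]) auto

lemma ncos_cg: "y \<in> Zp \<Longrightarrow> ncos (pideal 1) {x. cg x y} = 1"
  by (rule ncos_single[of _ y]) (auto simp: cg_def)

lemma ncos_units: "ncos (pideal 1) Zu = p - 1"
proof -
  have "ncos (pideal 1) Zp = ncos (pideal 1) {x \<in> Zp. x \<in> pideal 1} + ncos (pideal 1) {x \<in> Zp. x \<notin> pideal 1}"
    using residues_p(2) by (intro ncos_split subgp_pideal) (metis pideal_add diff_add_cancel pideal_diff subgp_commute subgp_pideal)+
  moreover have "{x \<in> Zp. x \<in> pideal 1} = pideal 1" using pideal_Zp by blast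
  moreover have "{x \<in> Zp. x \<notin> pideal 1} = Zu" using unit_or_pideal by (auto simp: Zu_def)
  ultimately show ?thesis using residues_p(1) ncos_pideal by simp
qed

abbreviation pid2 :: "('k \<times> 'k) set" where "pid2 \<equiv> pideal 1 \<times> pideal 1"

lemma subgp_pid2: "subgp pid2" by (intro subgp_Times subgp_pideal)

lemma residues_p2: "ncos pid2 (Zp \<times> Zp) = p * p" "fincos pid2 (Zp \<times> Zp)"
  using ncos_Times[OF subgp_pideal subgp_pideal residues_p(2) residues_p(2)] residues_p(1) by simp_all

lemma fincos_Zp2: "A \<subseteq> Zp \<times> Zp \<Longrightarrow> fincos pid2 A"
  using fincos_subset[OF residues_p2(2)] by blast

definition hyp :: "'k \<Rightarrow> ('k \<times> 'k) set" where
  "hyp s = {(x, y). x \<in> Zp \<and> y \<in> Zp \<and> cg (x * y) s}"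

lemma hyp_sub: "hyp s \<subseteq> Zp \<times> Zp" by (auto simp: hyp_def)

lemma hyp_cong: "cg s s' \<Longrightarrow> hyp s = hyp s'"
  by (auto simp: hyp_def intro: cg_trans cg_sym)

lemma hyp_unit_part:
  assumes s: "s \<in> Zp" shows "ncos pid2 {z \<in> hyp s. fst z \<notin> pideal 1} = p - 1"
proof -
  have "ncos pid2 {z \<in> hyp s. fst z \<notin> pideal 1} = 1 * ncos (pideal 1) Zu"
  proof (rule ncos_fibration(1)[where f = fst])
    show "fincos (pideal 1) Zu" by (rule fincos_Zp) (auto simp: Zu_def)
    show "fst a \<in> Zu" if "a \<in> {z \<in> hyp s. fst z \<notin> pideal 1}" for a
      using that unit_or_pideal[of "fst a"] by (auto simp: hyp_def)
    show "fst a - fst a' \<in> pideal 1" if "a - a' \<in> pid2" for a a'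
      using that by (auto simp: mem_Times_iff)
    fix b assume b: "b \<in> Zu"
    have b': "b \<in> Zp" "absv b = 1" "b \<noteq> 0" using b by (auto simp: Zu_def)
    show "ncos pid2 {a \<in> {z \<in> hyp s. fst z \<notin> pideal 1}. fst a - b \<in> pideal 1} = 1"
    proof (rule ncos_single[OF subgp_pid2, of "(b, s / b)"])
      show "(b, s / b) \<in> {a \<in> {z \<in> hyp s. fst z \<notin> pideal 1}. fst a - b \<in> pideal 1}"
        using b b' s unit_or_pideal[OF b'(1)] by (simp add: hyp_def Zp_divide cg_refl)
      fix y assume "y \<in> {a \<in> {z \<in> hyp s. fst z \<notin> pideal 1}. fst a - b \<in> pideal 1}"
      then obtain c d where y: "y = (c, d)" "c \<in> Zp" "d \<in> Zp" "cg (c * d) s" "c - b \<in> pideal 1" "c \<in> Zu"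
        using unit_or_pideal by (auto simp: hyp_def)
      have "cg c b" using y b' by (simp add: cg_def)
      then have "cg (c * d / c) (s / b)" using y by (intro cg_div) (auto simp: Zu_def)
      moreover have "c \<noteq> 0" using y by (auto simp: Zu_def)
      ultimately have "cg d (s / b)" by simp
      then show "y - (b, s / b) \<in> pid2" using y by (simp add: cg_def)
    qed
    show "fincos pid2 {a \<in> {z \<in> hyp s. fst z \<notin> pideal 1}. fst a - b \<in> pideal 1}"
      by (rule fincos_Zp2) (use hyp_sub in auto)
  qed (auto intro: subgp_pid2)
  then show ?thesis by (simp add: ncos_units)
qed

lemma hyp_split:
  assumes "A \<subseteq> hyp s"
  shows "ncos pid2 A = ncos pid2 {z \<in> A. fst z \<in> pideal 1} + ncos pid2 {z \<in> A. fst z \<notin> pideal 1}"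
proof (rule ncos_split[OF subgp_pid2])
  show "fincos pid2 A" by (rule fincos_Zp2) (use hyp_sub assms in blast)
  show "fst y \<in> pideal 1" if "x - y \<in> pid2" "fst x \<in> pideal 1" for x y
    using pideal_diff[OF that(2), of "fst x - fst y"] that(1) by (simp add: mem_Times_iff)
qed

text \<open>
  For a unit \<open>s\<close> the first coordinate is an arbitrary unit and determines the second.  Otherwise the
  hyperbola degenerates modulo \<open>p\<close> to the two axes.
\<close>

lemma ncos_hyp:
  assumes s: "s \<in> Zp"
  shows "ncos pid2 (hyp s) = (if absv s = 1 then p - 1 else 2 * p - 1)"
    and "ncos pid2 {z \<in> hyp s. z \<notin> pid2} = (if absv s = 1 then p - 1 else 2 * (p - 1))"
proof -
  have u: "absv s = 1 \<Longrightarrow> {z \<in> hyp s. fst z \<in> pideal 1} = {}"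
    using pideal_mult_right cg_unit[OF cg_sym] unfolding hyp_def pideal_1_iff
    by (fastforce simp: Zp_def absv_mult dest: absv_mult_lt1 cg_unit[OF cg_sym])
  have n: "{z \<in> hyp s. fst z \<in> pideal 1} = pideal 1 \<times> Zp" if "absv s \<noteq> 1"
  proof -
    have "s \<in> pideal 1" using that s unit_or_pideal[OF s] by (auto simp: Zu_def)
    then show ?thesis
      by (auto simp: hyp_def pideal_Zp cg_def Zp_mult s intro!: pideal_diff pideal_mult_right)
  qed
  have t: "ncos pid2 (pideal 1 \<times> Zp) = p" "ncos pid2 (pideal 1 \<times> Zu) = p - 1"
    using ncos_Times(1)[OF subgp_pideal[of 1] subgp_pideal[of 1], of "pideal 1"] residues_p ncos_pideal ncos_units
      fincos_Zp[of "pideal 1"] pideal_Zp fincos_Zp[of Zu] by (auto simp: Zu_def subset_iff)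
  show "ncos pid2 (hyp s) = (if absv s = 1 then p - 1 else 2 * p - 1)"
    using hyp_split[of "hyp s" s] hyp_unit_part[OF s] u n t(1) p_gt_1 by (cases "absv s = 1") auto
  have e1: "{z \<in> {z \<in> hyp s. z \<notin> pid2}. fst z \<in> pideal 1} = {z \<in> {z \<in> hyp s. fst z \<in> pideal 1}. snd z \<notin> pideal 1}"
    and e2: "{z \<in> {z \<in> hyp s. z \<notin> pid2}. fst z \<notin> pideal 1} = {z \<in> hyp s. fst z \<notin> pideal 1}"
    by (auto simp: mem_Times_iff)
  have e3: "{z \<in> pideal 1 \<times> Zp. snd z \<notin> pideal 1} = pideal 1 \<times> Zu"
    using unit_or_pideal by (fastforce simp: Zu_def)
  show "ncos pid2 {z \<in> hyp s. z \<notin> pid2} = (if absv s = 1 then p - 1 else 2 * (p - 1))"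
  proof (cases "absv s = 1")
    case True
    then show ?thesis
      using hyp_split[of "{z \<in> hyp s. z \<notin> pid2}" s] hyp_unit_part[OF s] unfolding e1 e2 u[OF True] by auto
  next
    case False
    then show ?thesis
      using hyp_split[of "{z \<in> hyp s. z \<notin> pid2}" s] hyp_unit_part[OF s] t(2)
      unfolding e1 e2 n[OF False] e3 by auto
  qed
qed

text \<open>
  The norm-one conic, projected from the point \<open>(-1, 0)\<close>; the denominators are units because the
  norm form is anisotropic modulo \<open>p\<close>.
\<close>

definition conic :: "('k \<times> 'k) set" where
  "conic = {(x, y). x \<in> Zp \<and> y \<in> Zp \<and> cg (x^2 - D * y^2) 1}"

lemma ncos_conic: "ncos pid2 conic = p + 1"
proof -
  have sub: "conic \<subseteq> Zp \<times> Zp" by (auto simp: conic_def)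
  have "ncos pid2 conic = ncos pid2 {z \<in> conic. fst z + 1 \<in> pideal 1} + ncos pid2 {z \<in> conic. fst z + 1 \<notin> pideal 1}"
  proof (rule ncos_split[OF subgp_pid2 fincos_Zp2[OF sub]])
    show "fst y + 1 \<in> pideal 1" if "x - y \<in> pid2" "fst x + 1 \<in> pideal 1" for x y
      using pideal_diff[OF that(2), of "fst x - fst y"] that(1) by (simp add: mem_Times_iff add.commute)
  qed
  moreover have "ncos pid2 {z \<in> conic. fst z + 1 \<in> pideal 1} = 1"
  proof (rule ncos_single[OF subgp_pid2, of "(-1, 0)"])
    show "(-1, 0) \<in> {z \<in> conic. fst z + 1 \<in> pideal 1}"
      by (simp add: conic_def Zp_uminus cg_refl)
    fix z assume "z \<in> {z \<in> conic. fst z + 1 \<in> pideal 1}"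
    then obtain x y where z: "z = (x, y)" "x \<in> Zp" "y \<in> Zp" "cg (x^2 - D * y^2) 1" "x + 1 \<in> pideal 1"
      by (auto simp: conic_def)
    have "(x + 1) * (x - 1) \<in> pideal 1" using z by (intro pideal_mult_right) (auto simp: Zp_diff)
    then have "(x + 1) * (x - 1) - (x^2 - D * y^2 - 1) \<in> pideal 1"
      by (rule pideal_diff) (use z(4) in \<open>simp add: cg_def\<close>)
    then have "D * y^2 \<in> pideal 1" by (simp add: power2_eq_square algebra_simps)
    then have "absv y ^ 2 < 1" unfolding pideal_1_iff by (simp add: absv_mult absv_power \<delta>_props)
    then have "absv y < 1" using absv_nonneg[of y] by (simp add: power_less_one_iff)
    then have "y \<in> pideal 1" unfolding pideal_1_iff using z by (simp add: Zp_def)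
    then show "z - (-1, 0) \<in> pid2" using z by simp
  qed
  moreover have "ncos (pideal 1) Zp = ncos pid2 {z \<in> conic. fst z + 1 \<notin> pideal 1}"
  proof -
    define g where "g m = ((1 + D * m^2) / (1 - D * m^2), 2 * m / (1 - D * m^2))" for m
    have u: "absv (1 - D * m^2) = 1" if "m \<in> Zp" for m
      using norm_anisotropic[of 1 m] that by (simp add: Zp_def Qp_1 max_absorb1)
    have dZ: "1 - D * m^2 \<in> Zp" "1 + D * m^2 \<in> Zp" "2 * m \<in> Zp" "1 - D * m^2 \<noteq> 0" if "m \<in> Zp" for m
      using u[OF that] that by (auto intro!: Zp_mult Zp_power[of m] D_Zp Zp_1 Zp_add Zp_diff)
    have g1: "fst (g m) + 1 = 2 / (1 - D * m^2)" "m = snd (g m) / (fst (g m) + 1)"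
      "fst (g m)^2 - D * snd (g m)^2 = 1" if "m \<in> Zp" for m
    proof -
      have nz: "1 - D * m^2 \<noteq> 0" by (rule dZ[OF that])
      show 1: "fst (g m) + 1 = 2 / (1 - D * m^2)" using nz by (simp add: g_def field_simps)
      show "m = snd (g m) / (fst (g m) + 1)" unfolding 1 using nz by (simp add: g_def)
      have "fst (g m)^2 - D * snd (g m)^2 = ((1 + D * m^2)^2 - D * (2 * m)^2) / (1 - D * m^2)^2"
        by (simp add: g_def power_divide diff_divide_distrib)
      also have "(1 + D * m^2)^2 - D * (2 * m)^2 = (1 - D * m^2)^2"
        by (simp add: power2_eq_square algebra_simps)
      finally show "fst (g m)^2 - D * snd (g m)^2 = 1" using nz by simp
    qed
    have gZ: "fst (g m) \<in> Zp" "snd (g m) \<in> Zp" if "m \<in> Zp" for m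
      using dZ[OF that] u[OF that] by (auto simp: g_def intro!: Zp_divide)
    have gu: "absv (fst (g m) + 1) = 1" if "m \<in> Zp" for m
      using u[OF that] by (simp add: g1(1)[OF that] absv_divide)
    have cD: "cg D D" "cg 1 1" "cg 2 2" by (simp_all add: cg_refl)
    show ?thesis
    proof (rule ncos_bij(1)[where f = g])
      fix m assume m: "m \<in> Zp"
      have "fst (g m) + 1 \<notin> pideal 1" unfolding pideal_1_iff using gu[OF m] by simp
      then show "g m \<in> {z \<in> conic. fst z + 1 \<notin> pideal 1}"
        using gZ[OF m] g1(3)[OF m] by (cases "g m") (simp add: conic_def cg_refl)
      fix m' assume m': "m' \<in> Zp"
      show "g m - g m' \<in> pid2 \<longleftrightarrow> m - m' \<in> pideal 1"
      proof
        assume "m - m' \<in> pideal 1"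
        then have c: "cg m m'" using m m' by (simp add: cg_def)
        have "cg (fst (g m)) (fst (g m'))" "cg (snd (g m)) (snd (g m'))"
          unfolding g_def fst_conv snd_conv using u[OF m]
          by (intro cg_div cg_add cg_diff cg_mult cg_power[OF c] c cD; simp)+
        then show "g m - g m' \<in> pid2" by (simp add: mem_Times_iff cg_def)
      next
        assume "g m - g m' \<in> pid2"
        then have "cg (fst (g m)) (fst (g m'))" "cg (snd (g m)) (snd (g m'))"
          using gZ[OF m] gZ[OF m'] by (simp_all add: mem_Times_iff cg_def)
        then have "cg (snd (g m) / (fst (g m) + 1)) (snd (g m') / (fst (g m') + 1))"
          using gu[OF m] by (intro cg_div cg_add cD)
        then show "m - m' \<in> pideal 1" using g1(2)[OF m] g1(2)[OF m'] by (simp add: cg_def)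
      qed
    next
      fix z assume "z \<in> {z \<in> conic. fst z + 1 \<notin> pideal 1}"
      then obtain x y where z: "z = (x, y)" "x \<in> Zp" "y \<in> Zp" "cg (x^2 - D * y^2) 1" "x + 1 \<in> Zu"
        using unit_or_pideal[OF Zp_add[OF _ Zp_1]] by (auto simp: conic_def)
      define m e where "m = y / (x + 1)" and "e = x^2 - D * y^2 - 1"
      have x1: "absv (x + 1) = 1" "x + 1 \<noteq> 0" using z(5) by (auto simp: Zu_def)
      have m: "m \<in> Zp" unfolding m_def using z x1 by (intro Zp_divide Zp_add Zp_1)
      have e: "e \<in> pideal 1" using z(4) by (simp add: e_def cg_def)
      have y: "y = m * (x + 1)" using x1 by (simp add: m_def)
      define w where "w = e / ((x + 1) * (1 - D * m^2))"
      have w: "w \<in> pideal 1"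
        using e x1 u[OF m] dZ[OF m] z m unfolding w_def pideal_1_iff
        by (auto simp: absv_divide absv_mult Zp_def intro!: Qp_divide Qp_mult Qp_add Qp_1)
      have "e = (x + 1) * ((x + 1) * (1 - D * m^2) - 2)"
        by (simp add: e_def y power2_eq_square algebra_simps)
      then have "w = ((x + 1) * (1 - D * m^2) - 2) / (1 - D * m^2)"
        using mult_divide_mult_cancel_left[OF x1(2)] unfolding w_def by metis
      then have we: "w = (x + 1) - 2 / (1 - D * m^2)"
        using dZ(4)[OF m] by (simp add: diff_divide_distrib)
      have f1: "fst (g m) - x = - w" using g1(1)[OF m] by (simp add: we algebra_simps)
      have f2: "snd (g m) - y = - (m * w)" by (simp add: g_def y we algebra_simps)
      have "g m - z \<in> pid2"
        using w m f1 f2 by (auto simp: z(1) mem_Times_iff intro!: pideal_uminus pideal_mult_left)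
      then show "\<exists>a\<in>Zp. g a - z \<in> pid2" using m by (intro bexI[of _ m])
    qed (auto intro: subgp_pid2)
  qed
  ultimately show ?thesis using residues_p(1) by simp
qed

lemma hyp_bundle:
  assumes D: "subgp E" and B: "fincos E B" and gZ: "\<And>b. b \<in> B \<Longrightarrow> g b \<in> Zp"
    and g: "\<And>b b'. b \<in> B \<Longrightarrow> b' \<in> B \<Longrightarrow> b - b' \<in> E \<Longrightarrow> cg (g b) (g b')"
    and c: "\<And>b. b \<in> B \<Longrightarrow> ncos pid2 (hyp (g b)) = c"
  shows "ncos (E \<times> pid2) {(b, z). b \<in> B \<and> z \<in> hyp (g b)} = c * ncos E B"
    and "fincos (E \<times> pid2) {(b, z). b \<in> B \<and> z \<in> hyp (g b)}"
proof -
  have S: "subgp (E \<times> pid2)" by (intro subgp_Times D subgp_pid2)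
  have fib: "ncos (E \<times> pid2) {a \<in> {(b, z). b \<in> B \<and> z \<in> hyp (g b)}. fst a - b \<in> E} = c \<and>
     fincos (E \<times> pid2) {a \<in> {(b, z). b \<in> B \<and> z \<in> hyp (g b)}. fst a - b \<in> E}" (is "ncos _ ?F = c \<and> _")
    if b: "b \<in> B" for b
  proof -
    have hb: "hyp (g b') = hyp (g b)" if "b' \<in> B" "b' - b \<in> E" for b'
      using g[OF that(1) b that(2)] by (rule hyp_cong)
    have 1: "snd a \<in> hyp (g b)" if "a \<in> ?F" for a using that hb by auto
    have 2: "snd a - snd a' \<in> pid2 \<longleftrightarrow> a - a' \<in> E \<times> pid2" if "a \<in> ?F" "a' \<in> ?F" for a a'
      using that subgp_trans[OF D _ subgp_commute[OF D, of "fst a'" b], of "fst a"] by (simp add: mem_Times_iff)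
    have 3: "\<exists>a\<in>?F. snd a - z \<in> pid2" if "z \<in> hyp (g b)" for z
      using that b subgp_0[OF D] by (intro bexI[of _ "(b, z)"]) (auto simp: mem_Times_iff)
    have "ncos (E \<times> pid2) ?F = ncos pid2 (hyp (g b))" "fincos (E \<times> pid2) ?F \<longleftrightarrow> fincos pid2 (hyp (g b))"
      by (rule ncos_bij[where f = snd, OF S subgp_pid2 1 2 3]; assumption)+
    then show ?thesis using c[OF b] fincos_Zp2[OF hyp_sub] by simp
  qed
  have 1: "fst a \<in> B" if "a \<in> {(b, z). b \<in> B \<and> z \<in> hyp (g b)}" for a using that by auto
  have 2: "fst a - fst a' \<in> E" if "a - a' \<in> E \<times> pid2" for a a' :: "'a \<times> ('k \<times> 'k)"
    using that by (simp add: mem_Times_iff)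
  show "ncos (E \<times> pid2) {(b, z). b \<in> B \<and> z \<in> hyp (g b)} = c * ncos E B"
    and "fincos (E \<times> pid2) {(b, z). b \<in> B \<and> z \<in> hyp (g b)}"
    by (rule ncos_fibration[where f = fst and c = c, OF S D B 1 2]; use fib in blast)+
qed

text \<open>
  \<open>sphere1\<close> and \<open>sphere2\<close> hold the possible first rows, and the possible second rows when the first row is the first
  basis vector.  Both are fibred by hyperbolas in the last two coordinates.
\<close>

definition sphere1 :: "('k^4) set" where
  "sphere1 = {x \<in> pvec 0. cg (q x) 1}"

definition sphere2 :: "('k^4) set" where
  "sphere2 = {x \<in> pvec 0. cg (x$1) 0 \<and> cg (q x) (- D)}"

lemma pvec4_iff: "x \<in> pvec t \<longleftrightarrow> x$1 \<in> pideal t \<and> x$2 \<in> pideal t \<and> x$3 \<in> pideal t \<and> x$4 \<in> pideal t"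
  for x :: "'k^4"
  unfolding pvec_def forall_4 by simp

lemma bundle_total:
  assumes D: "subgp E" and B: "fincos E B" and gZ: "\<And>b. b \<in> B \<Longrightarrow> g b \<in> Zp"
    and g: "\<And>b b'. b \<in> B \<Longrightarrow> b' \<in> B \<Longrightarrow> b - b' \<in> E \<Longrightarrow> cg (g b) (g b')"
  shows "ncos (E \<times> pid2) {(b, z). b \<in> B \<and> z \<in> hyp (g b)}
     = (2 * p - 1) * ncos E {b \<in> B. g b \<in> pideal 1} + (p - 1) * ncos E {b \<in> B. g b \<notin> pideal 1}" (is "ncos _ ?A = _")
    and "fincos (E \<times> pid2) {(b, z). b \<in> B \<and> z \<in> hyp (g b)}"
proof -
  define B1 where "B1 = {b \<in> B. g b \<in> pideal 1}"
  define B2 where "B2 = {b \<in> B. g b \<notin> pideal 1}"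
  have 1: "ncos (E \<times> pid2) {(b, z). b \<in> B1 \<and> z \<in> hyp (g b)} = (2 * p - 1) * ncos E B1"
    "fincos (E \<times> pid2) {(b, z). b \<in> B1 \<and> z \<in> hyp (g b)}"
  proof -
    have "ncos pid2 (hyp (g b)) = 2 * p - 1" if "b \<in> B1" for b
      using that ncos_hyp(1)[OF gZ] unit_or_pideal[OF gZ] by (auto simp: B1_def Zu_def gZ)
    then show "ncos (E \<times> pid2) {(b, z). b \<in> B1 \<and> z \<in> hyp (g b)} = (2 * p - 1) * ncos E B1"
      "fincos (E \<times> pid2) {(b, z). b \<in> B1 \<and> z \<in> hyp (g b)}"
      using gZ g fincos_subset[OF B, of B1] by (intro hyp_bundle[OF D]; auto simp: B1_def)+
  qed
  have 2: "ncos (E \<times> pid2) {(b, z). b \<in> B2 \<and> z \<in> hyp (g b)} = (p - 1) * ncos E B2"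
    "fincos (E \<times> pid2) {(b, z). b \<in> B2 \<and> z \<in> hyp (g b)}"
  proof -
    have "ncos pid2 (hyp (g b)) = p - 1" if "b \<in> B2" for b
      using that ncos_hyp(1)[OF gZ] unit_or_pideal[OF gZ] by (auto simp: B2_def Zu_def gZ)
    then show "ncos (E \<times> pid2) {(b, z). b \<in> B2 \<and> z \<in> hyp (g b)} = (p - 1) * ncos E B2"
      "fincos (E \<times> pid2) {(b, z). b \<in> B2 \<and> z \<in> hyp (g b)}"
      using gZ g fincos_subset[OF B, of B2] by (intro hyp_bundle[OF D]; auto simp: B2_def)+
  qed
  define A where "A c = {(b, z). b \<in> (if c then B1 else B2) \<and> z \<in> hyp (g b)}" for c :: bool
  have U: "?A = (\<Union>c\<in>UNIV. A c)" by (auto simp: A_def B1_def B2_def UNIV_bool)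
  have S: "subgp (E \<times> pid2)" by (intro subgp_Times D subgp_pid2)
  have disj: "i = j" if "x \<in> A i" "y \<in> A j" "x - y \<in> E \<times> pid2" for i j x y
  proof -
    have xy: "fst x \<in> B" "fst y \<in> B" "g (fst x) \<in> pideal 1 \<longleftrightarrow> i" "g (fst y) \<in> pideal 1 \<longleftrightarrow> j"
      using that(1,2) by (auto simp: A_def B1_def B2_def split: if_splits)
    have "cg (g (fst x)) (g (fst y))" using that(3) xy by (intro g) (auto simp: mem_Times_iff)
    then have "g (fst x) \<in> pideal 1 \<longleftrightarrow> g (fst y) \<in> pideal 1" by (metis cg_0_iff cg_sym cg_trans)
    then show ?thesis using xy by blast
  qed
  have fin: "fincos (E \<times> pid2) (A c)" for c using 1 2 by (cases c) (simp_all add: A_def)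
  have "ncos (E \<times> pid2) ?A = (\<Sum>c\<in>UNIV. ncos (E \<times> pid2) (A c))" "fincos (E \<times> pid2) ?A"
    unfolding U by (rule ncos_Union[OF finite S fin disj]; assumption)+
  then show "ncos (E \<times> pid2) ?A
     = (2 * p - 1) * ncos E {b \<in> B. g b \<in> pideal 1} + (p - 1) * ncos E {b \<in> B. g b \<notin> pideal 1}"
    "fincos (E \<times> pid2) ?A"
    using 1(1) 2(1) by (simp_all add: UNIV_bool A_def B1_def B2_def)
qed

lemma ncos_sphere1: "ncos (pvec 1) sphere1 = p^3 + p" "fincos (pvec 1) sphere1"
proof -
  define g where "g = (\<lambda>(a, b). 1 - (a^2 - D * b^2))"
  define A where "A = {(b, z). b \<in> Zp \<times> Zp \<and> z \<in> hyp (g b)}"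
  have gZ: "g b \<in> Zp" if "b \<in> Zp \<times> Zp" for b
    using that by (auto simp: g_def intro!: Zp_diff Zp_mult Zp_power D_Zp Zp_1)
  have g: "cg (g b) (g b')" if "b \<in> Zp \<times> Zp" "b' \<in> Zp \<times> Zp" "b - b' \<in> pid2" for b b'
  proof -
    have "cg (fst b) (fst b')" "cg (snd b) (snd b')" using that by (auto simp: cg_def mem_Times_iff)
    then show ?thesis unfolding g_def split_def
      by (intro cg_diff cg_mult cg_power cg_refl) auto
  qed
  have e1: "{b \<in> Zp \<times> Zp. g b \<in> pideal 1} = conic"
    by (auto simp: conic_def g_def cg_def intro!: Zp_diff Zp_mult Zp_power D_Zp Zp_1
        dest: subgp_commute[OF subgp_pideal] pideal_uminus)
  have conic: "fincos pid2 conic" by (rule fincos_Zp2) (auto simp: conic_def)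
  have "ncos pid2 (Zp \<times> Zp) = ncos pid2 {b \<in> Zp \<times> Zp. g b \<in> pideal 1} + ncos pid2 {b \<in> Zp \<times> Zp. g b \<notin> pideal 1}"
    by (rule ncos_split[OF subgp_pid2 residues_p2(2)]) (metis g cg_0_iff cg_sym cg_trans)
  then have e2: "ncos pid2 {b \<in> Zp \<times> Zp. g b \<notin> pideal 1} = p * p - (p + 1)"
    by (simp add: e1 residues_p2(1) ncos_conic)
  have A: "ncos (pid2 \<times> pid2) A = (2 * p - 1) * (p + 1) + (p - 1) * (p * p - (p + 1))"
    "fincos (pid2 \<times> pid2) A"
    unfolding A_def using bundle_total[OF subgp_pid2 residues_p2(2) gZ g] by (simp_all add: e1 e2 ncos_conic)
  define f :: "'k^4 \<Rightarrow> ('k \<times> 'k) \<times> ('k \<times> 'k)" where "f x = ((x$1, x$2), (x$3, x$4))" for x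
  have mem: "f x \<in> A \<longleftrightarrow> x \<in> sphere1" for x
  proof -
    have "cg (x$3 * x$4) (1 - (x$1^2 - D * x$2^2)) \<longleftrightarrow> cg (q x) 1"
      if "x$1 \<in> Zp" "x$2 \<in> Zp" "x$3 \<in> Zp" "x$4 \<in> Zp"
    proof -
      have "q x \<in> Zp" using that by (intro q_Zp) (simp add: pvec4_iff pideal_0)
      then show ?thesis using that
        by (auto simp: cg_def q_def algebra_simps intro!: Zp_diff Zp_mult Zp_power D_Zp Zp_1 Zp_add)
    qed
    then show ?thesis by (auto simp: f_def A_def sphere1_def hyp_def g_def pvec4_iff pideal_0)
  qed
  have "ncos (pvec 1) sphere1 = ncos (pid2 \<times> pid2) A" "fincos (pvec 1) sphere1 \<longleftrightarrow> fincos (pid2 \<times> pid2) A"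
  proof -
    have 1: "f a - f a' \<in> pid2 \<times> pid2 \<longleftrightarrow> a - a' \<in> pvec 1" for a a'
      by (auto simp: f_def pvec4_iff)
    have 2: "\<exists>a\<in>sphere1. f a - b \<in> pid2 \<times> pid2" if "b \<in> A" for b
    proof -
      obtain a1 a2 a3 a4 where "b = f (vector [a1, a2, a3, a4])" by (cases b) (auto simp: f_def)
      then show ?thesis using that mem subgp_0[OF subgp_Times[OF subgp_pid2 subgp_pid2]] by (metis diff_self)
    qed
    show "ncos (pvec 1) sphere1 = ncos (pid2 \<times> pid2) A" "fincos (pvec 1) sphere1 \<longleftrightarrow> fincos (pid2 \<times> pid2) A"
      by (rule ncos_bij[where f = f, OF subgp_pvec subgp_Times[OF subgp_pid2 subgp_pid2] _ 1 2]; simp add: mem)+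
  qed
  moreover have "(2 * p - 1) * (p + 1) + (p - 1) * (p * p - (p + 1)) = p^3 + p"
  proof -
    obtain k where k: "p = k + 2" using prime_ge_2_nat[OF prime_p] by (metis add.commute le_iff_add)
    have "2 * p - 1 = 2 * k + 3" "p - 1 = k + 1" "p * p - (p + 1) = k * k + 3 * k + 1"
      by (simp_all add: k algebra_simps)
    then show ?thesis by (simp add: k power3_eq_cube algebra_simps)
  qed
  ultimately show "ncos (pvec 1) sphere1 = p^3 + p" "fincos (pvec 1) sphere1" using A by simp_all
qed

lemma ncos_sphere2: "ncos (pvec 1) sphere2 = p^2 + p" "fincos (pvec 1) sphere2"
proof -
  define g where "g b = D * (b^2 - 1)" for b
  define A where "A = {(b, z). b \<in> Zp \<and> z \<in> hyp (g b)}"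
  have gZ: "g b \<in> Zp" if "b \<in> Zp" for b
    using that by (auto simp: g_def intro!: Zp_diff Zp_mult Zp_power[of b] D_Zp Zp_1)
  have g: "cg (g b) (g b')" if "b \<in> Zp" "b' \<in> Zp" "b - b' \<in> pideal 1" for b b'
    unfolding g_def using that by (intro cg_diff cg_mult cg_power[of b] cg_refl) (auto simp: cg_def)
  have e1: "{b \<in> Zp. g b \<in> pideal 1} = (\<Union>c\<in>{True,False}. {b. cg b (if c then 1 else - 1)})"
  proof -
    have "g b \<in> pideal 1 \<longleftrightarrow> cg b 1 \<or> cg b (- 1)" if "b \<in> Zp" for b
    proof -
      have "(b - 1) * (b + 1) = b^2 - 1" by (simp add: power2_eq_square algebra_simps)
      then have "g b \<in> pideal 1 \<longleftrightarrow> absv ((b - 1) * (b + 1)) < 1"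
        using gZ[OF that] unfolding pideal_1_iff by (simp add: Zp_def g_def absv_mult[of D])
      also have "\<dots> \<longleftrightarrow> absv (b - 1) < 1 \<or> absv (b + 1) < 1"
        using Zp_diff[OF that Zp_1] Zp_add[OF that Zp_1] absv_mult_lt1[of "b - 1" "b + 1"] absv_mult_lt1'[of "b - 1" "b + 1"]
        by (auto simp: Zp_def absv_mult)
      finally show ?thesis using that by (simp add: cg_iff Zp_uminus)
    qed
    then show ?thesis by (auto simp: cg_Zp)
  qed
  have "ncos (pideal 1) (\<Union>c\<in>{True,False}. {b. cg b (if c then 1 else - 1)}) =
      (\<Sum>c\<in>{True,False}. ncos (pideal 1) {b. cg b (if c then 1 else - 1)})"
  proof (rule ncos_Union(1))
    show "fincos (pideal 1) {b. cg b (if c then 1 else - 1)}" for c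
      by (rule fincos_Zp) (auto simp: cg_Zp)
    have ne: "\<not> cg 1 (- 1)" by (simp add: cg_iff)
    show "i = j" if "x \<in> {b. cg b (if i then 1 else - 1)}" "y \<in> {b. cg b (if j then 1 else - 1)}" "x - y \<in> pideal 1"
      for i j x y
    proof -
      have "cg x y" using that by (auto simp: cg_def)
      then have "cg (if i then 1 else - 1) (if j then 1 else - 1)"
        using that(1,2) cg_trans cg_sym by blast
      then show ?thesis using ne cg_sym[of "-1" 1] by (cases i; cases j) auto
    qed
  qed auto
  then have e2: "ncos (pideal 1) {b \<in> Zp. g b \<in> pideal 1} = 2"
    unfolding e1 by (simp add: ncos_cg Zp_uminus)
  have "ncos (pideal 1) Zp = ncos (pideal 1) {b \<in> Zp. g b \<in> pideal 1} + ncos (pideal 1) {b \<in> Zp. g b \<notin> pideal 1}"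
    by (rule ncos_split[OF subgp_pideal residues_p(2)]) (metis g cg_0_iff cg_sym cg_trans)
  then have e3: "ncos (pideal 1) {b \<in> Zp. g b \<notin> pideal 1} = p - 2"
    using residues_p(1) e2 by simp
  have A: "ncos (pideal 1 \<times> pid2) A = (2 * p - 1) * 2 + (p - 1) * (p - 2)"
    "fincos (pideal 1 \<times> pid2) A"
    unfolding A_def using bundle_total[OF subgp_pideal residues_p(2) gZ g] by (simp_all only: e2 e3)
  define f :: "'k^4 \<Rightarrow> 'k \<times> ('k \<times> 'k)" where "f x = (x$2, (x$3, x$4))" for x
  have mem: "f x \<in> A" if "x \<in> sphere2" for x
  proof -
    have x: "x$2 \<in> Zp" "x$3 \<in> Zp" "x$4 \<in> Zp" "x$1 \<in> Zp" "cg (x$1) 0" "cg (q x) (- D)"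
      using that by (auto simp: sphere2_def pvec4_iff pideal_0)
    have "cg (q x - x$1^2 + D * x$2^2) (- D - 0^2 + D * x$2^2)"
      using x by (intro cg_add cg_diff cg_power[of "x$1"]) (auto intro!: cg_refl Zp_mult Zp_power[of "x$2"])
    then have "cg (x$3 * x$4) (g (x$2))" by (simp add: q_def g_def algebra_simps)
    then show ?thesis using x by (simp add: f_def A_def hyp_def)
  qed
  have "ncos (pvec 1) sphere2 = ncos (pideal 1 \<times> pid2) A" "fincos (pvec 1) sphere2 \<longleftrightarrow> fincos (pideal 1 \<times> pid2) A"
  proof -
    have 1: "f a - f a' \<in> pideal 1 \<times> pid2 \<longleftrightarrow> a - a' \<in> pvec 1" if "a \<in> sphere2" "a' \<in> sphere2" for a a'
    proof -
      have "a$1 - a'$1 \<in> pideal 1" using that by (auto simp: sphere2_def cg_0_iff intro: pideal_diff)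
      then show ?thesis by (auto simp: f_def pvec4_iff)
    qed
    have 2: "\<exists>a\<in>sphere2. f a - b \<in> pideal 1 \<times> pid2" if "b \<in> A" for b
    proof -
      obtain a2 a3 a4 where b: "b = (a2, (a3, a4))" by (cases b) auto
      have a: "a2 \<in> Zp" "a3 \<in> Zp" "a4 \<in> Zp" "cg (a3 * a4) (g a2)" using that by (auto simp: b A_def hyp_def)
      have "cg (a3 * a4 - D * a2^2) (g a2 - D * a2^2)"
        using a by (intro cg_diff) (auto intro!: cg_refl Zp_mult Zp_power[of a2])
      then have "cg (q (vector [0, a2, a3, a4])) (- D)" by (simp add: q_def g_def algebra_simps)
      then have "vector [0, a2, a3, a4] \<in> sphere2" using a by (simp add: sphere2_def pvec4_iff pideal_0 cg_refl)
      then show ?thesis by (intro bexI[of _ "vector [0, a2, a3, a4]"]) (auto simp: f_def b zero_prod_def)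
    qed
    show "ncos (pvec 1) sphere2 = ncos (pideal 1 \<times> pid2) A" "fincos (pvec 1) sphere2 \<longleftrightarrow> fincos (pideal 1 \<times> pid2) A"
      by (rule ncos_bij[where f = f, OF subgp_pvec subgp_Times[OF subgp_pideal subgp_pid2] mem 1 2]; assumption)+
  qed
  moreover have "(2 * p - 1) * 2 + (p - 1) * (p - 2) = p^2 + p"
  proof -
    obtain k where k: "p = k + 2" using prime_ge_2_nat[OF prime_p] by (metis add.commute le_iff_add)
    have "2 * p - 1 = 2 * k + 3" "p - 1 = k + 1" "p - 2 = k" by (simp_all add: k)
    then show ?thesis by (simp add: k power2_eq_square algebra_simps)
  qed
  ultimately show "ncos (pvec 1) sphere2 = p^2 + p" "fincos (pvec 1) sphere2" using A by simp_all
qed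

end

lemma ncos_vec:
  fixes A :: "'n::finite \<Rightarrow> 'a::ab_group_add set"
  assumes D: "\<And>i. subgp (D i)" and fin: "\<And>i. fincos (D i) (A i)"
  shows "ncos {x. \<forall>i. x $ i \<in> D i} {x :: 'a^'n. \<forall>i. x $ i \<in> A i} = (\<Prod>i\<in>UNIV. ncos (D i) (A i))"
    and "fincos {x. \<forall>i. x $ i \<in> D i} {x :: 'a^'n. \<forall>i. x $ i \<in> A i}"
proof -
  define R where "R = PiE (UNIV :: 'n set) (\<lambda>i. coset_of (D i) ` A i)"
  define s where "s i c = (SOME a. a \<in> A i \<and> coset_of (D i) a = c)" for i c
  have s: "s i c \<in> A i \<and> coset_of (D i) (s i c) = c" if "c \<in> coset_of (D i) ` A i" for i c
    unfolding s_def by (rule someI_ex) (use that in auto)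
  have S: "subgp {x :: 'a^'n. \<forall>i. x $ i \<in> D i}" using D by (auto simp: subgp_def)
  have 1: "finite R" unfolding R_def using fin by (intro finite_PiE) (auto simp: fincos_def)
  have 2: "(\<chi> i. s i (r i)) \<in> {x. \<forall>i. x $ i \<in> A i}" if "r \<in> R" for r
    using that s by (auto simp: R_def PiE_iff)
  have 3: "r = r'" if "r \<in> R" "r' \<in> R" "(\<chi> i. s i (r i)) - (\<chi> i. s i (r' i)) \<in> {x. \<forall>i. x $ i \<in> D i}" for r r'
  proof
    fix i
    have "r i \<in> coset_of (D i) ` A i" "r' i \<in> coset_of (D i) ` A i" using that(1,2) by (auto simp: R_def PiE_iff)
    moreover have "coset_of (D i) (s i (r i)) = coset_of (D i) (s i (r' i))"
      using that(3) by (simp add: coset_of_eq_iff[OF D])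
    ultimately show "r i = r' i" using s by metis
  qed
  have 4: "\<exists>r\<in>R. (\<chi> i. s i (r i)) - a \<in> {x. \<forall>i. x $ i \<in> D i}" if "a \<in> {x. \<forall>i. x $ i \<in> A i}" for a
  proof
    show "(\<lambda>i. coset_of (D i) (a $ i)) \<in> R" using that by (simp add: R_def PiE_iff)
    show "(\<chi> i. s i (coset_of (D i) (a $ i))) - a \<in> {x. \<forall>i. x $ i \<in> D i}"
      using s that by (simp add: coset_of_eq_iff[OF D, symmetric])
  qed
  note T = ncos_transversal[where f = "\<lambda>r. \<chi> i. s i (r i)", OF S 1 2 3 4]
  then show "ncos {x. \<forall>i. x $ i \<in> D i} {x :: 'a^'n. \<forall>i. x $ i \<in> A i} = (\<Prod>i\<in>UNIV. ncos (D i) (A i))"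
    "fincos {x. \<forall>i. x $ i \<in> D i} {x :: 'a^'n. \<forall>i. x $ i \<in> A i}"
    using T by (simp_all add: R_def card_PiE ncos_def)
qed

context unramified_quadratic_extension
begin

lemma ncos_pideal_pideal:
  assumes "s \<le> t" shows "ncos (pideal t) (pideal s) = p ^ (t - s)" "fincos (pideal t) (pideal s)"
proof -
  have t: "t = s + (t - s)" using assms by simp
  have 1: "\<pi> ^ s * a - \<pi> ^ s * a' \<in> pideal t \<longleftrightarrow> a - a' \<in> pideal (t - s)" for a a'
      using pideal_scale_iff[of s "a - a'" "t - s"] t by (simp add: algebra_simps)
  have 2: "\<exists>a\<in>Zp. \<pi> ^ s * a - b \<in> pideal t" if "b \<in> pideal s" for b
      using that pideal_iff[of b s] subgp_0[OF subgp_pideal] by (metis diff_self)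
  have 3: "\<pi> ^ s * a \<in> pideal s" if "a \<in> Zp" for a using that pideal_iff by auto
  have "ncos (pideal (t - s)) Zp = ncos (pideal t) (pideal s)"
    "fincos (pideal (t - s)) Zp \<longleftrightarrow> fincos (pideal t) (pideal s)"
    by (rule ncos_bij[where f = "(*) (\<pi> ^ s)", OF subgp_pideal subgp_pideal 3 1 2]; assumption)+
  then show "ncos (pideal t) (pideal s) = p ^ (t - s)" "fincos (pideal t) (pideal s)"
    by (simp_all add: ncos_residues)
qed

lemma ncos_pvec:
  assumes "s \<le> t"
  shows "ncos (pvec t) (pvec s :: ('k^'n) set) = p ^ ((t - s) * CARD('n))" "fincos (pvec t) (pvec s :: ('k^'n) set)"
  using ncos_vec[of "\<lambda>_. pideal t" "\<lambda>_. pideal s"] ncos_pideal_pideal[OF assms]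
  by (simp_all add: pvec_def power_mult)

lemma ncos_pmat_rows:
  fixes s :: "'m::finite \<Rightarrow> nat"
  assumes "\<And>i. s i \<le> t"
  shows "ncos (pmat t) {A :: 'k^'n^'m. \<forall>i. A $ i \<in> pvec (s i)} = p ^ ((\<Sum>i\<in>UNIV. t - s i) * CARD('n))"
    and "fincos (pmat t) {A :: 'k^'n^'m. \<forall>i. A $ i \<in> pvec (s i)}"
proof -
  have e: "pmat t = {A :: 'k^'n^'m. \<forall>i. A $ i \<in> pvec t}" by (auto simp: pmat_rows)
  note c = ncos_pvec[OF assms, where 'n = 'n]
  show "ncos (pmat t) {A :: 'k^'n^'m. \<forall>i. A $ i \<in> pvec (s i)} = p ^ ((\<Sum>i\<in>UNIV. t - s i) * CARD('n))"
    "fincos (pmat t) {A :: 'k^'n^'m. \<forall>i. A $ i \<in> pvec (s i)}"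
    unfolding e using ncos_vec[of "\<lambda>_. pvec t" "\<lambda>i. pvec (s i) :: ('k^'n) set"] c
    by (simp_all add: power_sum sum_distrib_right)
qed

lemma fincos_pmat: "A \<subseteq> pmat 0 \<Longrightarrow> fincos (pmat t) (A :: ('k^'n^'m) set)"
  by (rule fincos_subset[OF ncos_pmat_rows(2)[of "\<lambda>_. 0" t]]) (auto simp: pmat_rows)

subsection \<open>Reflections\<close>

definition reflection :: "'k^4 \<Rightarrow> 'k^4^4" where
  "reflection w = (\<chi> i j. (if i = j then 1 else 0) - 2 / q w * h (axis i 1) w * w $ j)"

lemma reflection_apply: "x v* reflection w = x - (2 / q w * h x w) *s w"
  unfolding vec_eq_iff forall_4
  by (simp add: vector_matrix_mult_def sum_4 reflection_def h_def axis_def algebra_simps)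

lemma reflection_isom:
  assumes "w \<in> pvec 0" "absv (q w) = 1" shows "isom (reflection w)"
proof -
  have c: "2 / q w \<in> Zp" using assms by (intro Zp_divide) (auto simp: q_Zp)
  have a: "axis i 1 \<in> pvec 0" for i :: 4 by (auto simp: pvec_def axis_def pideal_0)
  have "reflection w $ i $ j \<in> Zp" for i j
  proof -
    have "2 / q w * h (axis i 1) w * w $ j \<in> Zp"
      using c assms(1) h_Zp[OF a assms(1), of i] by (intro Zp_mult) (auto simp: pvec_def pideal_0)
    then show ?thesis unfolding reflection_def by (auto intro: Zp_diff Zp_uminus)
  qed
  then have 1: "reflection w \<in> pmat 0" by (simp add: pmat_def pideal_0)
  have 2: "h (x v* reflection w) (y v* reflection w) = h x y" for x y
  proof -
    define c where "c = 2 / q w"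
    have "q w \<noteq> 0" using assms(2) by auto
    then have c: "c * q w = 2" by (simp add: c_def)
    have "h (x v* reflection w) (y v* reflection w) = h x y - 2 * c * h x w * h y w + c * (c * q w) * h x w * h y w"
      unfolding reflection_apply c_def[symmetric]
      by (simp add: h_diff_left h_diff_right h_scale_left h_scale_right h_self h_commute[of w] algebra_simps)
    then show ?thesis by (simp add: c)
  qed
  show ?thesis using 1 2 by (simp add: isom_def)
qed

lemma diff_vec_mult: "(x - y) v* M = x v* M - y v* M" for x :: "'k^'n"
  by (simp add: vec_eq_iff vector_matrix_mult_def left_diff_distrib right_diff_distrib sum_subtractf)

lemma isom_mult: "isom M \<Longrightarrow> isom N \<Longrightarrow> isom (M ** N)"
  unfolding isom_def using pmat_mult_left[of M N 0]
  by (simp add: vector_matrix_mul_assoc[symmetric])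

text \<open>
  Vectors \<open>x\<close> and \<open>y\<close> of the same unit norm modulo \<open>p\<close> are exchanged by an isometry which keeps their
  common orthogonal complement: since \<open>q (x - y) + q (x + y) = 2 q x + 2 q y\<close> is a unit, either the
  reflection in \<open>x - y\<close> is defined, or the one in \<open>x + y\<close>, to be followed by the one in \<open>y\<close>.
\<close>

lemma isom_move:
  assumes x: "x \<in> pvec 0" and y: "y \<in> pvec 0" and c: "cg (q x) (q y)" and u: "absv (q y) = 1"
  shows "\<exists>M. isom M \<and> x v* M - y \<in> pvec 1 \<and>
    (\<forall>z\<in>pvec 0. h z x \<in> pideal 1 \<longrightarrow> h z y \<in> pideal 1 \<longrightarrow> z v* M - z \<in> pvec 1)"
proof -
  have xy: "x - y \<in> pvec 0" "x + y \<in> pvec 0" using x y by (auto simp: pvec_def intro: pideal_add pideal_diff)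
  have key: "w v* reflection w = - w" if "absv (q w) = 1" for w
  proof -
    have "q w \<noteq> 0" using that by auto
    then show ?thesis by (simp add: reflection_apply h_self vec_eq_iff)
  qed
  have scale: "(a / q w * b) *s w \<in> pvec 1" if "a \<in> Zp" "b \<in> pideal 1" "w \<in> pvec 0" "absv (q w) = 1" for a b w
  proof -
    have "a / q w \<in> Zp" using that by (intro Zp_divide q_Zp)
    then have "a / q w * b \<in> pideal 1" using that(2) by (rule pideal_mult_left)
    then show ?thesis using that(3) unfolding pvec_def pideal_0 mem_Collect_eq vector_smult_component
      by (blast intro: pideal_mult_right)
  qed
  have fix1: "z v* reflection w - z \<in> pvec 1" if "h z w \<in> pideal 1" "w \<in> pvec 0" "absv (q w) = 1" for z w
  proof -
    have "z v* reflection w - z = (- 2 / q w * h z w) *s w" by (simp add: reflection_apply vec_eq_iff)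
    then show ?thesis using scale[of "- 2", OF _ that] by (simp add: Zp_uminus)
  qed
  have qxy: "q x - q y \<in> pideal 1" using c by (simp add: cg_def)
  have q4: "q (x - y) + q (x + y) = 2 * (q x - q y) + 4 * q y"
    by (simp add: h_self[symmetric] h_diff_left h_diff_right h_add_left h_add_right h_commute algebra_simps)
  show ?thesis
  proof (cases "absv (q (x - y)) = 1")
    case True
    let ?w = "x - y"
    have "2 * h x ?w - q ?w = q x - q y"
      by (simp add: h_self[symmetric] h_diff_left h_diff_right h_commute algebra_simps)
    moreover have "x v* reflection ?w - y = (- 1 / q ?w * (2 * h x ?w - q ?w)) *s ?w"
    proof -
      have "q ?w \<noteq> 0" using True by auto
      then show ?thesis unfolding reflection_apply by (simp add: vec_eq_iff field_simps)
    qed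
    ultimately have "x v* reflection ?w - y \<in> pvec 1"
      using scale[OF _ qxy xy(1) True, of "-1"] by (simp add: Zp_uminus)
    moreover have "z v* reflection ?w - z \<in> pvec 1" if "h z x \<in> pideal 1" "h z y \<in> pideal 1" for z
      using fix1[OF _ xy(1) True] that by (simp add: h_diff_right pideal_diff)
    ultimately show ?thesis using reflection_isom[OF xy(1) True] by blast
  next
    case False
    let ?w = "x + y"
    have "absv (q (x - y)) < 1" using False q_Zp[OF xy(1)] by (simp add: Zp_def)
    moreover have "absv (2 * (q x - q y)) < 1" using qxy by (simp only: absv_mult) (simp add: pideal_1_iff)
    ultimately have "absv (2 * (q x - q y) - q (x - y)) < 1" by (intro absv_diff_lt)
    moreover have "q ?w = 4 * q y + (2 * (q x - q y) - q (x - y))" using q4 by (simp add: algebra_simps)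
    ultimately have True: "absv (q ?w) = 1"
      using u absv_add_eq[of "2 * (q x - q y) - q (x - y)" "4 * q y"] by (simp add: absv_mult)
    have "2 * h x ?w - q ?w = q x - q y"
      by (simp add: h_self[symmetric] h_add_left h_add_right h_commute algebra_simps)
    moreover have "x v* reflection ?w + y = (- 1 / q ?w * (2 * h x ?w - q ?w)) *s ?w"
    proof -
      have "q ?w \<noteq> 0" using True by auto
      then show ?thesis unfolding reflection_apply by (simp add: vec_eq_iff field_simps)
    qed
    ultimately have 1: "x v* reflection ?w + y \<in> pvec 1"
      using scale[OF _ qxy xy(2) True, of "-1"] by (simp add: Zp_uminus)
    have M: "isom (reflection ?w)" "isom (reflection y)" using reflection_isom xy(2) y u True by auto
    have "(x v* reflection ?w + y) v* reflection y = x v* (reflection ?w ** reflection y) - y"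
      by (simp add: vector_matrix_mul_assoc[symmetric] vector_matrix_left_distrib key[OF u])
    then have a: "x v* (reflection ?w ** reflection y) - y \<in> pvec 1"
      using isom_pvec[OF M(2)] 1 by metis
    have b: "z v* (reflection ?w ** reflection y) - z \<in> pvec 1" if "h z x \<in> pideal 1" "h z y \<in> pideal 1" for z
    proof -
      have "z v* reflection ?w - z \<in> pvec 1"
        using fix1[OF _ xy(2) True] that by (simp add: h_add_right pideal_add)
      then have "(z v* reflection ?w - z) v* reflection y \<in> pvec 1" using isom_pvec[OF M(2)] by blast
      moreover have "z v* reflection y - z \<in> pvec 1" using fix1[OF that(2) y u] .
      moreover have "z v* (reflection ?w ** reflection y) - z =
          (z v* reflection ?w - z) v* reflection y + (z v* reflection y - z)"
        by (simp add: vector_matrix_mul_assoc[symmetric] diff_vec_mult)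
      ultimately show ?thesis using subgp_add[OF subgp_pvec] by metis
    qed
    show ?thesis using isom_mult[OF M] a b by blast
  qed
qed

subsection \<open>Primitive representations modulo \<open>p\<close>\<close>

definition primset :: "nat \<Rightarrow> 'k^3^3 \<Rightarrow> ('k^4^3) set" where
  "primset t Z = {Y. prim Y \<and> gram Y - Z \<in> pmat t}"

lemma prim_pmat: "prim Y \<Longrightarrow> Y \<in> pmat 0" by (simp add: prim_def)

lemma primset_pmat: "primset t Z \<subseteq> pmat 0" by (auto simp: primset_def prim_pmat)

lemma primset_move:
  assumes M: "isom M" and P: "\<And>Y. Y \<in> primset t Z \<Longrightarrow> P Y \<longleftrightarrow> P' (Y ** M)"
  shows "ncos (pmat s) {Y \<in> primset t Z. P Y} = ncos (pmat s) {Y \<in> primset t Z. P' Y}"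
proof (rule ncos_bij(1)[where f = "\<lambda>Y. Y ** M"])
  show "Y ** M - Y' ** M \<in> pmat s \<longleftrightarrow> Y - Y' \<in> pmat s" for Y Y' :: "'k^4^3"
    by (simp add: matrix_sub_rdistrib[symmetric] isom_mult_pmat[OF M])
  have mem: "Y ** M \<in> primset t Z \<longleftrightarrow> Y \<in> primset t Z" for Y
    by (simp add: primset_def gram_isom[OF M] prim_isom[OF M])
  show "Y ** M \<in> {Y \<in> primset t Z. P' Y}" if "Y \<in> {Y \<in> primset t Z. P Y}" for Y
    using that P mem by blast
  show "\<exists>Y\<in>{Y \<in> primset t Z. P Y}. Y ** M - X \<in> pmat s" if X: "X \<in> {Y \<in> primset t Z. P' Y}" for X
  proof -
    obtain M' where "M' ** M = mat 1" using isom_inverse[OF M] by blast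
    then have e: "X ** M' ** M = X" by (simp add: matrix_mul_assoc[symmetric])
    then have "X ** M' \<in> primset t Z" using X mem[of "X ** M'"] by simp
    then have "X ** M' \<in> {Y \<in> primset t Z. P Y}" using X P[of "X ** M'"] by (simp add: e)
    then show ?thesis by (rule bexI[rotated]) (simp add: e subgp_0[OF subgp_pmat])
  qed
qed (rule subgp_pmat)+

lemma subgp_shift: "subgp K \<Longrightarrow> x - y \<in> K \<Longrightarrow> z - x \<in> K \<longleftrightarrow> z - y \<in> K"
  using subgp_trans subgp_commute by metis

lemma isom_vec_cong: "isom M \<Longrightarrow> x - y \<in> pvec t \<longleftrightarrow> x v* M - y v* M \<in> pvec t"
  by (simp add: isom_pvec flip: diff_vec_mult)

text \<open>
  The rows of \<open>Y\<close> with Gram matrix \<open>dg u\<close> modulo \<open>p\<close> are chosen one after the other: the first on the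
  sphere of norm 1, the second, after an isometry, on the sphere of norm \<open>-D\<close> in the orthogonal
  complement of the first basis vector, and the third in a hyperbolic plane.
\<close>

lemma ncos_primset_dg:
  assumes u: "u \<in> Zp"
  shows "ncos (pmat 1) (primset 1 (dg u)) = p^2 * (p^4 - 1) * (if absv u = 1 then 1 else 2)"
proof -
  define e1 e2 :: "'k^4" where "e1 = vector [1,0,0,0]" and "e2 = vector [0,1,0,0]"
  have e: "e1 \<in> pvec 0" "e2 \<in> pvec 0" "q e1 = 1" "q e2 = - D" "h x e1 = x$1" "h x e2 = - D * x$2" for x
    by (simp_all add: e1_def e2_def pvec4_iff pideal_0 q_def h_def)
  have gr: "h (Y$i) (Y$j) - dg u $ i $ j \<in> pideal 1" if "Y \<in> primset 1 (dg u)" for Y i j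
    using that by (simp add: primset_def pmat_def gram_def)
  have row: "Y$i \<in> pvec 0" if "Y \<in> primset 1 (dg u)" for Y i
    using that primset_pmat pmat_rows by blast
  define A1 where "A1 = {Y \<in> primset 1 (dg u). Y$1 - e1 \<in> pvec 1}"
  define A2 where "A2 = {Y \<in> A1. Y$2 - e2 \<in> pvec 1}"
  have sub: "fincos (pmat 1) {Y \<in> primset 1 (dg u). P Y}" for P
    using primset_pmat by (intro fincos_pmat) auto
  have rowcong: "Y$i - Y'$i \<in> pvec 1" if "Y - Y' \<in> pmat 1" for Y Y' :: "'k^4^3" and i
    using that by (simp add: pmat_rows)
  have c1: "ncos (pmat 1) (primset 1 (dg u)) = ncos (pmat 1) A1 * ncos (pvec 1) sphere1"
  proof (rule ncos_fibration(1)[where f = "\<lambda>Y. Y$1"])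
    show "Y$1 \<in> sphere1" if "Y \<in> primset 1 (dg u)" for Y
      using gr[OF that, of 1 1] row[OF that, of 1] by (simp add: sphere1_def cg_def h_self q_Zp)
    fix b assume b: "b \<in> sphere1"
    then obtain M where M: "isom M" "b v* M - e1 \<in> pvec 1"
      using isom_move[of b e1] e by (auto simp: sphere1_def)
    show "ncos (pmat 1) {Y \<in> primset 1 (dg u). Y$1 - b \<in> pvec 1} = ncos (pmat 1) A1"
      unfolding A1_def
    proof (rule primset_move[OF M(1)])
      show "Y$1 - b \<in> pvec 1 \<longleftrightarrow> (Y ** M)$1 - e1 \<in> pvec 1" for Y
        by (simp add: rows_mult subgp_shift[OF subgp_pvec M(2), symmetric] isom_vec_cong[OF M(1), symmetric])
    qed
    show "fincos (pmat 1) {Y \<in> primset 1 (dg u). Y$1 - b \<in> pvec 1}" by (rule sub)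
  qed (rule subgp_pmat subgp_pvec ncos_sphere1(2) rowcong, assumption?)+
  have y1: "Y$2$1 \<in> pideal 1" "Y$3$1 \<in> pideal 1" if "Y \<in> A1" for Y
  proof -
    have Y: "Y \<in> primset 1 (dg u)" "Y$1 - e1 \<in> pvec 1" using that by (auto simp: A1_def)
    have "h (Y$i) (Y$1) - h (Y$i) e1 \<in> pideal 1" for i
      using h_cong[of "Y$i" e1 "Y$i" 1 "Y$1"] row[OF Y(1), of i] row[OF Y(1), of 1] Y(2) e(1) subgp_0[OF subgp_pvec, of 1]
      by (simp add: h_commute)
    from subgp_trans'[OF subgp_pideal this[of 2], of 0] subgp_trans'[OF subgp_pideal this[of 3], of 0]
    show "Y$2$1 \<in> pideal 1" "Y$3$1 \<in> pideal 1"
      using gr[OF Y(1), of 2 1] gr[OF Y(1), of 3 1] by (simp_all add: e(5))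
  qed
  have c2: "ncos (pmat 1) A1 = ncos (pmat 1) A2 * ncos (pvec 1) sphere2"
  proof (rule ncos_fibration(1)[where f = "\<lambda>Y. Y$2"])
    show "Y$2 \<in> sphere2" if "Y \<in> A1" for Y
      using gr[of Y 2 2] row[of Y 2] that y1(1)[OF that] q_Zp
      by (auto simp: A1_def sphere2_def cg_def h_self Zp_uminus dest: pideal_Zp)
    fix b assume b: "b \<in> sphere2"
    then have ex: "\<exists>M. isom M \<and> b v* M - e2 \<in> pvec 1 \<and> (\<forall>z\<in>pvec 0. h z b \<in> pideal 1 \<longrightarrow> h z e2 \<in> pideal 1 \<longrightarrow> z v* M - z \<in> pvec 1)"
      using e by (intro isom_move) (auto simp: sphere2_def)
    obtain M where M: "isom M" "b v* M - e2 \<in> pvec 1" "e1 v* M - e1 \<in> pvec 1"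
    proof -
      have "h e1 b = b$1" "h e1 e2 = 0" by (simp_all add: h_def e1_def e2_def)
      then have "h e1 b \<in> pideal 1" "h e1 e2 \<in> pideal 1" using b by (simp_all add: sphere2_def cg_0_iff)
      then show ?thesis using that ex e(1) by blast
    qed
    have "{Y \<in> A1. Y$2 - b \<in> pvec 1} = {Y \<in> primset 1 (dg u). Y$1 - e1 \<in> pvec 1 \<and> Y$2 - b \<in> pvec 1}"
      by (auto simp: A1_def)
    moreover have "A2 = {Y \<in> primset 1 (dg u). Y$1 - e1 \<in> pvec 1 \<and> Y$2 - e2 \<in> pvec 1}"
      by (auto simp: A1_def A2_def)
    moreover have "(Y$1 - e1 \<in> pvec 1 \<and> Y$2 - b \<in> pvec 1) \<longleftrightarrow> ((Y ** M)$1 - e1 \<in> pvec 1 \<and> (Y ** M)$2 - e2 \<in> pvec 1)" for Y :: "'k^4^3"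
      by (simp add: rows_mult subgp_shift[OF subgp_pvec M(2), symmetric] subgp_shift[OF subgp_pvec M(3), symmetric] isom_vec_cong[OF M(1), symmetric])
    ultimately show "ncos (pmat 1) {Y \<in> A1. Y$2 - b \<in> pvec 1} = ncos (pmat 1) A2"
      using primset_move[OF M(1)] by simp
    show "fincos (pmat 1) {Y \<in> A1. Y$2 - b \<in> pvec 1}"
      unfolding A1_def by (rule fincos_subset[OF sub[of "\<lambda>Y. True"]]) blast
  qed (rule subgp_pmat subgp_pvec ncos_sphere2(2) rowcong, assumption?)+
  define f :: "'k^4^3 \<Rightarrow> 'k \<times> 'k" where "f Y = (Y$3$3, Y$3$4)" for Y
  have A2: "Y$1 - e1 \<in> pvec 1" "Y$2 - e2 \<in> pvec 1" "Y$3$1 \<in> pideal 1" "Y$3$2 \<in> pideal 1" if "Y \<in> A2" for Y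
  proof -
    have Y: "Y \<in> primset 1 (dg u)" "Y$2 - e2 \<in> pvec 1" using that by (auto simp: A1_def A2_def)
    then show "Y$1 - e1 \<in> pvec 1" "Y$2 - e2 \<in> pvec 1" "Y$3$1 \<in> pideal 1"
      using that y1(2)[of Y] by (auto simp: A2_def A1_def)
    have "h (Y$3) (Y$2) - h (Y$3) e2 \<in> pideal 1"
      using h_cong[of "Y$3" e2 "Y$3" 1 "Y$2"] row[OF Y(1), of 3] row[OF Y(1), of 2] Y(2) e(2) subgp_0[OF subgp_pvec, of 1]
      by (simp add: h_commute)
    from subgp_trans'[OF subgp_pideal this, of 0]
    have "- D * Y$3$2 \<in> pideal 1" using gr[OF Y(1), of 3 2] by (simp add: e(6))
    moreover have "Y$3$2 \<in> Zp" using row[OF Y(1), of 3] by (simp add: pvec_def pideal_0)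
    ultimately show "Y$3$2 \<in> pideal 1" by (simp add: pideal_1_iff absv_mult Zp_def)
  qed
  have c3: "ncos (pmat 1) A2 = ncos pid2 {z \<in> hyp u. z \<notin> pid2}"
  proof (rule ncos_bij(1)[where f = f])
    show "subgp pid2" by (rule subgp_pid2)
    show "f Y - f Y' \<in> pid2 \<longleftrightarrow> Y - Y' \<in> pmat 1" if "Y \<in> A2" "Y' \<in> A2" for Y Y'
    proof -
      have "Y$1 - Y'$1 \<in> pvec 1" "Y$2 - Y'$2 \<in> pvec 1"
        using A2[OF that(1)] A2[OF that(2)] subgp_commute[OF subgp_pvec] subgp_trans[OF subgp_pvec] by metis+
      moreover have "Y$3$1 - Y'$3$1 \<in> pideal 1" "Y$3$2 - Y'$3$2 \<in> pideal 1"
        using A2[OF that(1)] A2[OF that(2)] pideal_diff by auto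
      ultimately show ?thesis by (simp add: pmat_rows forall_3 f_def pvec4_iff[of "Y$3 - Y'$3"])
    qed
    show "f Y \<in> {z \<in> hyp u. z \<notin> pid2}" if Y: "Y \<in> A2" for Y
    proof -
      have P: "Y \<in> primset 1 (dg u)" using Y by (simp add: A2_def A1_def)
      have r: "Y$3$i \<in> Zp" for i using row[OF P, of 3] by (simp add: pvec_def pideal_0)
      have sq: "x^2 \<in> pideal 1" if "x \<in> pideal 1" for x
        using pideal_mult_left[OF pideal_Zp[OF that] that] by (simp add: power2_eq_square)
      have "Y$3$1^2 - D * Y$3$2^2 \<in> pideal 1"
        using A2[OF Y] by (intro pideal_diff sq pideal_mult_left[OF D_Zp])
      moreover have "q (Y$3) - u \<in> pideal 1" using gr[OF P, of 3 3] by (simp add: h_self)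
      moreover have "Y$3$3 * Y$3$4 - u = (q (Y$3) - u) - (Y$3$1^2 - D * Y$3$2^2)" by (simp add: q_def)
      ultimately have "Y$3$3 * Y$3$4 - u \<in> pideal 1" using pideal_diff by metis
      then have "cg (Y$3$3 * Y$3$4) u" using r u by (simp add: cg_def Zp_mult)
      then have "f Y \<in> hyp u" using r by (simp add: f_def hyp_def)
      moreover have "f Y \<notin> pid2"
      proof
        assume "f Y \<in> pid2"
        then have "axis 3 1 v* Y \<in> pvec 1" using A2[OF Y] by (simp add: axis_mult pvec4_iff f_def)
        moreover have "prim Y" using P by (simp add: primset_def)
        moreover have "axis 3 1 \<in> pvec 0" by (auto simp: pvec_def axis_def pideal_0)
        ultimately have "axis 3 1 \<in> (pvec 1 :: ('k^3) set)" unfolding prim_def by blast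
        then have "1 \<in> pideal 1" by (auto simp: pvec_def axis_def split: if_splits)
        then show False by (simp add: pideal_1_iff)
      qed
      ultimately show ?thesis by simp
    qed
    show "\<exists>Y\<in>A2. f Y - z \<in> pid2" if z: "z \<in> {z \<in> hyp u. z \<notin> pid2}" for z
    proof -
      obtain z1 z2 where zz: "z = (z1, z2)" by (cases z)
      have z': "z1 \<in> Zp" "z2 \<in> Zp" "z1 * z2 - u \<in> pideal 1" "z1 \<notin> pideal 1 \<or> z2 \<notin> pideal 1"
        using z by (auto simp: zz hyp_def cg_def)
      define Y :: "'k^4^3" where "Y = vector [e1, e2, vector [0, 0, z1, z2]]"
      have "prim Y"
        unfolding prim_def
      proof (intro conjI ballI impI)
        show "Y \<in> pmat 0" using e z' by (simp add: Y_def pmat_rows forall_3 pvec4_iff[of "vector [0,0,z1,z2]"] pideal_0)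
        fix v :: "'k^3" assume v: "v \<in> pvec 0" "v v* Y \<in> pvec 1"
        have "v$1 \<in> pideal 1" "v$2 \<in> pideal 1" "v$3 * z1 \<in> pideal 1" "v$3 * z2 \<in> pideal 1"
          using v(2) by (simp_all add: pvec4_iff vector_matrix_mult_def sum_3 Y_def e1_def e2_def mult.commute)
        moreover have "v$3 \<in> Zp" using v(1) by (simp add: pvec_def pideal_0)
        moreover have "x \<in> pideal 1" if "x * y \<in> pideal 1" "x \<in> Zp" "y \<in> Zp" "y \<notin> pideal 1" for x y
          using that unit_or_pideal[of y] by (simp add: pideal_1_iff Zp_def Zu_def absv_mult)
        ultimately have "v$3 \<in> pideal 1" using z'(1,2,4) by blast
        then show "v \<in> pvec 1" using \<open>v$1 \<in> pideal 1\<close> \<open>v$2 \<in> pideal 1\<close> by (simp add: pvec_def forall_3)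
      qed
      moreover have "gram Y - dg u \<in> pmat 1"
        using z'(3) by (simp add: pmat_def forall_3 gram_def Y_def e1_def e2_def h_def)
      ultimately have "Y \<in> A2" using subgp_0[OF subgp_pvec] by (simp add: A2_def A1_def primset_def Y_def)
      moreover have "f Y - z \<in> pid2" using subgp_0[OF subgp_pid2] by (simp add: f_def Y_def zz)
      ultimately show ?thesis by (rule bexI[rotated])
    qed
  qed (rule subgp_pmat)
  obtain m where m: "p = m + 1" using p_pos by (metis Suc_eq_plus1 not0_implies_Suc p_pos(3))
  have "p^4 = m * (p + 1) * (p^2 + 1) + 1"
    by (simp add: m power4_eq_xxxx power2_eq_square algebra_simps)
  then have "p^4 - 1 = m * (p + 1) * (p^2 + 1)" by simp
  moreover have "p^2 * (m * (p + 1) * (p^2 + 1)) = m * (p^2 + p) * (p^3 + p)"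
    by (simp add: power3_eq_cube power2_eq_square algebra_simps)
  moreover have "p - 1 = m" by (simp add: m)
  ultimately have n: "p^2 * (p^4 - 1) = (p - 1) * (p^2 + p) * (p^3 + p)" by (simp only:)
  have "ncos (pmat 1) (primset 1 (dg u)) = (if absv u = 1 then p - 1 else 2 * (p - 1)) * (p^2 + p) * (p^3 + p)"
    by (simp only: c1 c2 c3 ncos_hyp(2)[OF u] ncos_sphere1 ncos_sphere2)
  then show ?thesis by (simp only: n) (cases "absv u = 1"; simp)
qed

section \<open>Representations modulo powers of \<open>p\<close>\<close>

subsection \<open>Equidistribution of primitive representations\<close>

text \<open>The derivative of the Gram matrix at \<open>Y\<close> in the direction \<open>E\<close>.\<close>

definition dgram :: "'k^4^3 \<Rightarrow> 'k^4^3 \<Rightarrow> 'k^3^3" where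
  "dgram Y E = (\<chi> i j. h (E$i) (Y$j) + h (Y$i) (E$j))"

lemma dgram_diff: "dgram Y (E - E') = dgram Y E - dgram Y E'"
  by (simp add: dgram_def vec_eq_iff h_diff_left h_diff_right)

lemma dgram_symmetric: "transpose (dgram Y E) = dgram Y E"
  by (simp add: dgram_def vec_eq_iff transpose_def h_commute add.commute)

lemma dgram_pmat: "Y \<in> pmat 0 \<Longrightarrow> E \<in> pmat t \<Longrightarrow> dgram Y E \<in> pmat t"
  using h_pideal[of _ 0 _ t] h_pideal[of _ t _ 0]
  by (auto simp: dgram_def pmat_rows pmat_def[of t, where 'n = 3 and 'm = 3] intro!: pideal_add)

text \<open>Gram matrices can be varied arbitrarily to first order, because \<open>Y\<close> has a right inverse.\<close>

lemma dgram_onto: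
  assumes Y: "prim Y" and Z: "transpose Z = Z" "Z \<in> pmat 0"
  obtains E where "E \<in> pmat 0" "dgram Y E = Z"
proof -
  obtain R where R: "R \<in> pmat 0" "Y ** R = mat 1" using prim_right_inverse[OF Y] .
  define hi :: "'k^4^4" where
    "hi = vector [vector [1,0,0,0], vector [0,- 1 / D,0,0], vector [0,0,0,2], vector [0,0,2,0]]"
  have hi: "hi ** hmat = mat 1"
    unfolding vec_eq_iff forall_4 by (simp add: hi_def hmat_def matrix_matrix_mult_def sum_4 mat_def)
  have "- 1 / D \<in> Zp" by (intro Zp_divide) (auto intro: Zp_uminus)
  then have hi0: "hi \<in> pmat 0" by (simp add: pmat_def pideal_0 forall_4 hi_def)
  define Z2 where "Z2 = (\<chi> i j. Z$i$j / 2)"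
  have Z2: "Z2 \<in> pmat 0" using Z(2) by (simp add: Z2_def pmat_def pideal_half)
  define E where "E = Z2 ** transpose R ** hi"
  have E0: "E \<in> pmat 0"
    unfolding E_def using Z2 R(1) hi0 by (intro pmat_mult_left) (auto simp: pmat_transpose)
  have "E ** hmat ** transpose Y = Z2 ** (transpose R ** (hi ** hmat) ** transpose Y)"
    by (simp add: E_def matrix_mul_assoc)
  also have "\<dots> = Z2 ** transpose (Y ** R)" by (simp add: hi matrix_transpose_mul)
  finally have "E ** hmat ** transpose Y = Z2" by (simp add: R(2) transpose_mat)
  then have hE: "h (E$i) (Y$j) = Z2$i$j" for i j using hmat_entry[of E Y i j] by simp
  have "dgram Y E $i$j = Z$i$j" for i j
    using symmetric_entry[OF Z(1), of i j] by (simp add: dgram_def h_commute[of "Y$i"] hE Z2_def)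
  then have "dgram Y E = Z" by (simp add: vec_eq_iff)
  with E0 show ?thesis using that by blast
qed

lemma prod_3: "(\<Prod>i\<in>UNIV. f i) = f 1 * f 2 * f (3::3)" for f :: "3 \<Rightarrow> nat"
  unfolding UNIV_3 by (simp add: mult.assoc)

definition symbox :: "(3 \<Rightarrow> 3 \<Rightarrow> nat) \<Rightarrow> ('k^3^3) set" where
  "symbox s = {Z. transpose Z = Z \<and> (\<forall>i j. Z$i$j \<in> pideal (s i j))}"

lemma ncos_symbox:
  assumes s: "\<And>i j. s i j = s j i" "\<And>i j. s i j \<le> t"
  shows "ncos (pmat t) (symbox s)
    = p ^ ((t - s 1 1) + (t - s 2 2) + (t - s 3 3) + (t - s 1 2) + (t - s 1 3) + (t - s 2 3))"
    and "fincos (pmat t) (symbox s)"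
proof -
  define r1 r2 where "r1 = (\<lambda>i. s i i)"
    and "r2 = (\<lambda>i::3. if i = 1 then s 1 2 else if i = 2 then s 1 3 else s 2 3)"
  define A where "A r = {x :: 'k^3. \<forall>i. x$i \<in> pideal (r i)}" for r
  have A: "ncos (pvec t) (A r) = p ^ ((t - r 1) + (t - r 2) + (t - r 3))" "fincos (pvec t) (A r)"
    if that: "\<And>i. r i \<le> t" for r
  proof -
    note V = ncos_vec[of "\<lambda>_::3. pideal t" "\<lambda>i. pideal (r i)", OF subgp_pideal ncos_pideal_pideal(2)[OF that]]
    show "ncos (pvec t) (A r) = p ^ ((t - r 1) + (t - r 2) + (t - r 3))"
      unfolding A_def pvec_def V(1) ncos_pideal_pideal(1)[OF that] by (simp only: prod_3 power_add)
    show "fincos (pvec t) (A r)" unfolding A_def pvec_def by (rule V(2))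
  qed
  have r: "r1 i \<le> t" "r2 i \<le> t" for i using s(2) by (auto simp: r1_def r2_def)
  define f :: "'k^3^3 \<Rightarrow> ('k^3) \<times> ('k^3)" where
    "f Z = (vector [Z$1$1, Z$2$2, Z$3$3], vector [Z$1$2, Z$1$3, Z$2$3])" for Z
  have 1: "f Z - f Z' \<in> pvec t \<times> pvec t \<longleftrightarrow> Z - Z' \<in> pmat t" if "Z \<in> symbox s" "Z' \<in> symbox s" for Z Z'
  proof -
    have "Z$2$1 = Z$1$2" "Z$3$1 = Z$1$3" "Z$3$2 = Z$2$3" "Z'$2$1 = Z'$1$2" "Z'$3$1 = Z'$1$3" "Z'$3$2 = Z'$2$3"
      using that by (auto simp: symbox_def intro: symmetric_entry)
    then show ?thesis by (auto simp: f_def pvec_def pmat_def forall_3)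
  qed
  have 2: "f Z \<in> A r1 \<times> A r2" if "Z \<in> symbox s" for Z
    using that by (simp add: f_def A_def forall_3 r1_def r2_def symbox_def)
  have 3: "\<exists>Z\<in>symbox s. f Z - b \<in> pvec t \<times> pvec t" if "b \<in> A r1 \<times> A r2" for b
  proof -
    obtain x y where b: "b = (x, y)" by (cases b)
    let ?Z = "vector [vector [x$1, y$1, y$2], vector [y$1, x$2, y$3], vector [y$2, y$3, x$3]] :: 'k^3^3"
    have "?Z \<in> symbox s"
      using that s(1)[of 2 1] s(1)[of 3 1] s(1)[of 3 2]
      by (simp add: b symbox_def A_def forall_3 r1_def r2_def transpose_def vec_eq_iff)
    moreover have "f ?Z = b" by (simp add: f_def b vec_eq_iff forall_3)
    ultimately show ?thesis using subgp_0[OF subgp_Times[OF subgp_pvec subgp_pvec]] by (intro bexI[of _ ?Z]) simp_all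
  qed
  have "ncos (pmat t) (symbox s) = ncos (pvec t \<times> pvec t) (A r1 \<times> A r2)"
    "fincos (pmat t) (symbox s) \<longleftrightarrow> fincos (pvec t \<times> pvec t) (A r1 \<times> A r2)"
    by (rule ncos_bij[where f = f, OF subgp_pmat subgp_Times[OF subgp_pvec subgp_pvec] 2 1 3]; assumption)+
  then show "ncos (pmat t) (symbox s)
    = p ^ ((t - s 1 1) + (t - s 2 2) + (t - s 3 3) + (t - s 1 2) + (t - s 1 3) + (t - s 2 3))"
    "fincos (pmat t) (symbox s)"
    using ncos_Times(2)[OF subgp_pvec subgp_pvec A(2)[of r1, OF r(1)] A(2)[of r2, OF r(2)]]
    unfolding ncos_Times(1)[OF subgp_pvec subgp_pvec A(2)[of r1, OF r(1)] A(2)[of r2, OF r(2)]]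
      A(1)[of r1, OF r(1)] A(1)[of r2, OF r(2)]
    by (simp_all add: r1_def r2_def power_add mult_ac)
qed

text \<open>
  Modulo \<open>p\<close> the derivative is a linear map from dimension 12 onto the symmetric matrices, of dimension 6, so each of
  its fibres has \<open>p\<^sup>6\<close> elements.
\<close>

lemma ncos_dgram:
  assumes Y: "prim Y" and Z: "transpose Z = Z" "Z \<in> pmat 0"
  shows "ncos (pmat 1) {E \<in> pmat 0. dgram Y E - Z \<in> pmat 1} = p ^ 6"
proof -
  define c where "c = ncos (pmat 1) {E \<in> pmat 0. dgram Y E - 0 \<in> pmat 1}"
  have fib: "ncos (pmat 1) {E \<in> pmat 0. dgram Y E - Z \<in> pmat 1} = c" if Z: "Z \<in> symbox (\<lambda>_ _. 0)" for Z
  proof -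
    obtain E1 where E1: "E1 \<in> pmat 0" "dgram Y E1 = Z"
      using dgram_onto[OF Y, of Z] Z by (auto simp: symbox_def pmat_def)
    show ?thesis unfolding c_def
    proof (rule ncos_bij(1)[where f = "\<lambda>E. E - E1"])
      show "E - E1 \<in> {E \<in> pmat 0. dgram Y E - 0 \<in> pmat 1}" if "E \<in> {E \<in> pmat 0. dgram Y E - Z \<in> pmat 1}" for E
        using that E1 by (auto simp: dgram_diff intro: subgp_diff[OF subgp_pmat])
      show "\<exists>E\<in>{E \<in> pmat 0. dgram Y E - Z \<in> pmat 1}. E - E1 - F \<in> pmat 1"
        if "F \<in> {E \<in> pmat 0. dgram Y E - 0 \<in> pmat 1}" for F
      proof (rule bexI[of _ "F + E1"])
        show "F + E1 \<in> {E \<in> pmat 0. dgram Y E - Z \<in> pmat 1}"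
          using that E1 dgram_diff[of Y "F + E1" E1] by (auto intro: subgp_add[OF subgp_pmat])
      qed (simp add: subgp_0)
    qed (simp_all add: subgp_pmat)
  qed
  have "ncos (pmat 1) (pmat 0 :: ('k^4^3) set) = c * ncos (pmat 1) (symbox (\<lambda>_ _. 0))"
  proof (rule ncos_fibration(1)[where f = "dgram Y"])
    show "dgram Y E \<in> symbox (\<lambda>_ _. 0)" if "E \<in> pmat 0" for E
      using dgram_pmat[OF prim_pmat[OF Y] that] by (simp add: symbox_def dgram_symmetric pmat_def)
    show "dgram Y E - dgram Y E' \<in> pmat 1" if "E - E' \<in> pmat 1" for E E'
      using dgram_pmat[OF prim_pmat[OF Y] that] by (simp add: dgram_diff)
    show "fincos (pmat 1) {E \<in> pmat 0. dgram Y E - Z \<in> pmat 1}" for Z by (rule fincos_pmat) auto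
  qed (simp_all add: fib ncos_symbox)
  moreover have "ncos (pmat 1) (pmat 0 :: ('k^4^3) set) = p ^ 12"
  proof -
    have "ncos (pmat 1) {A :: 'k^4^3. \<forall>i. A $ i \<in> pvec 0} = p ^ ((\<Sum>i\<in>(UNIV :: 3 set). 1 - 0) * CARD(4))"
      by (rule ncos_pmat_rows(1)) simp
    moreover have "pmat 0 = {A :: 'k^4^3. \<forall>i. A $ i \<in> pvec 0}" by (auto simp: pmat_rows)
    ultimately show ?thesis by simp
  qed
  moreover have "p ^ 12 = p ^ 6 * p ^ 6" by (simp flip: power_add)
  moreover have "ncos (pmat 1) (symbox (\<lambda>_ _. 0)) = p ^ 6" by (simp add: ncos_symbox)
  ultimately have "c * p ^ 6 = p ^ 6 * p ^ 6" by (simp only:)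
  then have "c = p ^ 6" by (simp only: mult_cancel2) simp
  then show ?thesis using fib[of Z] Z by (simp add: symbox_def pmat_def)
qed

lemma prim_cong:
  assumes Y: "prim Y" and c: "Y' - Y \<in> pmat 1" shows "prim Y'"
  unfolding prim_def
proof (intro conjI ballI impI)
  have "Y + (Y' - Y) \<in> pmat 0" using Y pmat_0I[OF c] by (intro subgp_add[OF subgp_pmat]) (auto simp: prim_def)
  then show Y': "Y' \<in> pmat 0" by simp
  fix v :: "'k^3" assume v: "v \<in> pvec 0" "v v* Y' \<in> pvec 1"
  have "v v* Y = v v* Y' - v v* (Y' - Y)"
    by (simp add: vec_eq_iff vector_matrix_mult_def algebra_simps sum_subtractf)
  then have "v v* Y \<in> pvec 1" using v pvec_mult_left[OF v(1) c] subgp_diff[OF subgp_pvec] by metis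
  then show "v \<in> pvec 1" using Y v(1) by (simp add: prim_def)
qed

text \<open>
  For one more digit of precision, \<open>Y + p\<^sup>t E\<close> has Gram matrix \<open>gram Y + p\<^sup>t dgram Y E\<close> up to
  \<open>p\<^sup>2\<^sup>t\<close>, so that \<open>E\<close> has to solve a linear equation modulo \<open>p\<close>.
\<close>

lemma ncos_primset_Suc:
  assumes Z: "transpose Z = Z" "Z \<in> pmat 0" and t: "1 \<le> t"
  shows "ncos (pmat (t + 1)) (primset (t + 1) Z) = p ^ 6 * ncos (pmat t) (primset t Z)"
proof (rule ncos_fibration(1)[where f = "\<lambda>Y. Y"])
  show "Y \<in> primset t Z" if "Y \<in> primset (t + 1) Z" for Y
    using that pmat_antimono[of t "t + 1"] by (auto simp: primset_def)
  show "Y - Y' \<in> pmat t" if "Y - Y' \<in> pmat (t + 1)" for Y Y' :: "'k^4^3"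
    using that pmat_antimono[of t "t + 1"] by auto
  show "fincos (pmat t) (primset t Z)" by (rule fincos_pmat[OF primset_pmat])
  fix b assume b: "b \<in> primset t Z"
  show "fincos (pmat (t + 1)) {Y \<in> primset (t + 1) Z. Y - b \<in> pmat t}"
    using primset_pmat by (intro fincos_pmat) blast
  define Z1 where "Z1 = (\<chi> i j. - (gram b $i$j - Z$i$j) / \<pi> ^ t)"
  have b': "prim b" "b \<in> pmat 0" "gram b - Z \<in> pmat t" using b by (auto simp: primset_def prim_pmat)
  have gz: "gram b $i$j - Z$i$j = - (\<pi> ^ t * Z1$i$j)" for i j by (simp add: Z1_def)
  have Z1: "transpose Z1 = Z1" "Z1 \<in> pmat 0"
  proof -
    show "transpose Z1 = Z1"
      using symmetric_entry[OF Z(1)] symmetric_entry[OF gram_symmetric[of b]]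
      by (simp add: Z1_def vec_eq_iff transpose_def)
    have "- (\<pi> ^ t * Z1$i$j) \<in> pideal t" for i j using b'(3) by (simp add: pmat_def gz[symmetric])
    then have "\<pi> ^ t * Z1$i$j \<in> pideal t" for i j using pideal_uminus by fastforce
    then show "Z1 \<in> pmat 0" using pideal_scale_iff[of t _ 0] by (simp add: pmat_def)
  qed
  define f where "f E = (\<chi> i. b$i + \<pi> ^ t *s E$i)" for E :: "'k^4^3"
  have fd: "f E - b \<in> pmat t" if "E \<in> pmat 0" for E
    using that pideal_scale_iff[of t _ 0] by (simp add: f_def pmat_def pideal_0)
  have gr: "gram (f E) $i$j - Z$i$j = \<pi> ^ t * ((dgram b E - Z1)$i$j + \<pi> ^ t * h (E$i) (E$j))" for E i j
    using gz[of i j]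
    by (simp add: gram_def f_def h_add_left h_add_right h_scale_left h_scale_right dgram_def algebra_simps)
  have mem: "f E \<in> primset (t + 1) Z \<longleftrightarrow> dgram b E - Z1 \<in> pmat 1" if E: "E \<in> pmat 0" for E
  proof -
    have p1: "prim (f E)"
      by (rule prim_cong[OF b'(1)]) (use fd[OF E] pmat_antimono[OF t] in blast)
    have "\<pi> ^ t * h (E$i) (E$j) \<in> pideal 1" for i j
    proof -
      have "\<pi> ^ t * h (E$i) (E$j) \<in> pideal t"
        by (rule pideal_mult_right[OF p_power_pideal h_Zp]) (use E in \<open>auto simp: pmat_rows\<close>)
      then show ?thesis using pideal_antimono[OF t] by blast
    qed
    then have "(dgram b E - Z1)$i$j + \<pi> ^ t * h (E$i) (E$j) \<in> pideal 1 \<longleftrightarrow> (dgram b E - Z1)$i$j \<in> pideal 1" for i j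
      using pideal_add pideal_diff by (metis add_diff_cancel_right')
    moreover have "gram (f E) $i$j - Z$i$j \<in> pideal (t + 1) \<longleftrightarrow>
        (dgram b E - Z1)$i$j + \<pi> ^ t * h (E$i) (E$j) \<in> pideal 1" for i j
      unfolding gr by (rule pideal_scale_iff)
    ultimately show ?thesis using p1 unfolding primset_def pmat_def by simp
  qed
  have "ncos (pmat 1) {E \<in> pmat 0. dgram b E - Z1 \<in> pmat 1} =
      ncos (pmat (t + 1)) {Y \<in> primset (t + 1) Z. Y - b \<in> pmat t}"
  proof (rule ncos_bij(1)[where f = f])
    show "f E \<in> {Y \<in> primset (t + 1) Z. Y - b \<in> pmat t}" if "E \<in> {E \<in> pmat 0. dgram b E - Z1 \<in> pmat 1}" for E
      using that mem fd by blast
    show "f E - f E' \<in> pmat (t + 1) \<longleftrightarrow> E - E' \<in> pmat 1" for E E'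
    proof -
      have "(f E - f E')$i$j = \<pi> ^ t * (E - E')$i$j" for i j by (simp add: f_def algebra_simps)
      then show ?thesis unfolding pmat_def using pideal_scale_iff[of t _ 1] by simp
    qed
    fix Y assume Y: "Y \<in> {Y \<in> primset (t + 1) Z. Y - b \<in> pmat t}"
    define E where "E = (\<chi> i j. (Y$i$j - b$i$j) / \<pi> ^ t)"
    have fE: "f E = Y" by (simp add: f_def E_def vec_eq_iff)
    have "\<pi> ^ t * E$i$j \<in> pideal (t + 0)" for i j using Y by (simp add: E_def pmat_def)
    then have "E \<in> pmat 0" unfolding pideal_scale_iff by (simp add: pmat_def)
    then have "E \<in> {E \<in> pmat 0. dgram b E - Z1 \<in> pmat 1}" using mem[of E] Y by (simp add: fE)
    then show "\<exists>E\<in>{E \<in> pmat 0. dgram b E - Z1 \<in> pmat 1}. f E - Y \<in> pmat (t + 1)"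
      by (rule bexI[rotated]) (simp add: fE subgp_0)
  qed (simp_all add: subgp_pmat)
  then show "ncos (pmat (t + 1)) {Y \<in> primset (t + 1) Z. Y - b \<in> pmat t} = p ^ 6"
    using ncos_dgram[OF b'(1) Z1] by simp
qed (simp_all add: subgp_pmat)

lemma ncos_primset:
  assumes Z: "transpose Z = Z" "Z \<in> pmat 0"
  shows "ncos (pmat (Suc t)) (primset (Suc t) Z) = p ^ (6 * t) * ncos (pmat 1) (primset 1 Z)"
proof (induction t)
  case 0
  then show ?case by (simp add: One_nat_def)
next
  case (Suc t)
  then show ?case using ncos_primset_Suc[OF Z, of "Suc t"] by (simp add: power_add One_nat_def)
qed

lemma ncos_primset_GLz:
  assumes G: "G \<in> GLz"
  shows "ncos (pmat t) (primset t (G ** Z ** transpose G)) = ncos (pmat t) (primset t Z)"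
proof (rule ncos_bij(1)[where f = "(**) G", symmetric])
  obtain H where H: "H \<in> GLz" "G ** H = mat 1" "H ** G = mat 1" using GLz_inverse[OF G] .
  have pm: "G ** Y \<in> pmat t \<longleftrightarrow> Y \<in> pmat t" for Y :: "'k^4^3"
  proof
    assume "G ** Y \<in> pmat t"
    then have "H ** (G ** Y) \<in> pmat t" using pmat_mult_left[OF GLz_pmat[OF H(1)]] by blast
    then show "Y \<in> pmat t" by (simp add: matrix_mul_assoc H)
  qed (use pmat_mult_left[OF GLz_pmat[OF G]] in blast)
  then show "G ** Y - G ** Y' \<in> pmat t \<longleftrightarrow> Y - Y' \<in> pmat t" for Y Y' :: "'k^4^3"
    by (simp flip: matrix_sub_ldistrib)
  have mem: "G ** Y \<in> primset t (G ** Z ** transpose G) \<longleftrightarrow> Y \<in> primset t Z" for Y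
  proof -
    have "G ** gram Y ** transpose G - G ** Z ** transpose G = G ** (gram Y - Z) ** transpose G"
      by (simp add: matrix_sub_ldistrib matrix_sub_rdistrib)
    then show ?thesis by (simp add: primset_def prim_GLz[OF G] gram_mult GLz_conj_pmat[OF G])
  qed
  then show "G ** Y \<in> primset t (G ** Z ** transpose G)" if "Y \<in> primset t Z" for Y using that by blast
  fix X assume X: "X \<in> primset t (G ** Z ** transpose G)"
  have e: "G ** (H ** X) = X" by (simp add: matrix_mul_assoc H)
  then have "H ** X \<in> primset t Z" using mem[of "H ** X"] X by simp
  then show "\<exists>Y\<in>primset t Z. G ** Y - X \<in> pmat t" by (rule bexI[rotated]) (simp add: e subgp_0)
qed (simp_all add: subgp_pmat)

subsection \<open>Representations with a given saturation\<close>

lemma fincos_mono: "K \<subseteq> K' \<Longrightarrow> subgp K \<Longrightarrow> subgp K' \<Longrightarrow> fincos K A \<Longrightarrow> fincos K' A"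
proof -
  assume D: "K \<subseteq> K'" "subgp K" "subgp K'" and "fincos K A"
  have "coset_of K' x = {y. \<exists>z\<in>coset_of K x. y - z \<in> K'}" for x
  proof -
    have "y - x \<in> K' \<longleftrightarrow> (\<exists>z. z - x \<in> K \<and> y - z \<in> K')" for y
    proof
      assume "y - x \<in> K'"
      then show "\<exists>z. z - x \<in> K \<and> y - z \<in> K'" by (intro exI[of _ x]) (simp add: subgp_0[OF D(2)])
    next
      assume "\<exists>z. z - x \<in> K \<and> y - z \<in> K'"
      then show "y - x \<in> K'" using subgp_trans[OF D(3)] D(1) by blast
    qed
    then show ?thesis by (simp add: coset_of_def)
  qed
  then have "coset_of K' ` A = (\<lambda>c. {y. \<exists>z\<in>c. y - z \<in> K'}) ` coset_of K ` A" by (simp add: image_image)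
  then show "fincos K' A" using \<open>fincos K A\<close> by (simp add: fincos_def)
qed

text \<open>Multiplication by \<open>diagp a\<close> carries this group to \<open>p\<^sup>t\<close> times the integral matrices, if \<open>a\<close> is bounded by \<open>t\<close>.\<close>

definition rowbox :: "(3 \<Rightarrow> nat) \<Rightarrow> nat \<Rightarrow> ('k^4^3) set" where
  "rowbox a t = {E. \<forall>i. E$i \<in> pvec (t - a i)}"

lemma subgp_rowbox: "subgp (rowbox a t)"
  unfolding subgp_def rowbox_def by (auto intro: subgp_0[OF subgp_pvec] subgp_diff[OF subgp_pvec])

lemma pmat_rowbox: "pmat t \<subseteq> rowbox a t"
  unfolding rowbox_def by (auto simp: pmat_rows intro: subsetD[OF pvec_antimono[OF diff_le_self]])

lemma rowbox_pmat:
  assumes "\<And>i. a i < t" shows "rowbox a t \<subseteq> pmat 1"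
proof -
  have "1 \<le> t - a i" for i using assms[of i] by simp
  then show ?thesis unfolding rowbox_def using pvec_antimono by (fastforce simp: pmat_rows)
qed

text \<open>
  Both sides are compared with cosets of \<open>p\<^sup>t\<close>: each coset of the row box contains \<open>p\<^sup>4\<^sup>s\<close> of them, where
  \<open>s = a\<^sub>1 + a\<^sub>2 + a\<^sub>3\<close>, and the weaker congruence for the symmetric Gram matrix leaves the same number of
  possibilities modulo \<open>p\<^sup>t\<close>, among which the representations are equidistributed.
\<close>

lemma ncos_primset_weighted:
  fixes a :: "3 \<Rightarrow> nat"
  assumes Z: "transpose Z = Z" "Z \<in> pmat 0" and a: "\<And>i j. a i + a j \<le> t"
  shows "ncos (rowbox a (Suc t)) {W. prim W \<and> (\<forall>i j. (gram W - Z)$i$j \<in> pideal (Suc t - a i - a j))}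
    = p ^ (6 * t) * ncos (pmat 1) (primset 1 Z)"
proof -
  let ?t = "Suc t"
  define A where "A = {W. prim W \<and> (\<forall>i j. (gram W - Z)$i$j \<in> pideal (?t - a i - a j))}"
  define s where "s i j = ?t - a i - a j" for i j
  have s: "s i j = s j i" "s i j \<le> ?t" "1 \<le> s i j" "?t - s i j = a i + a j" for i j
    using a[of i j] by (auto simp: s_def)
  have a1: "a i < ?t" for i using a[of i i] by simp
  have A0: "A \<subseteq> pmat 0" by (auto simp: A_def prim_pmat)
  have sym: "transpose (Z' - Z'') = transpose Z' - transpose Z''" for Z' Z'' :: "'k^3^3"
    by (simp add: transpose_def vec_eq_iff)
  define B where "B = {Z'. Z' - Z \<in> symbox s}"
  have B: "ncos (pmat ?t) B = ncos (pmat ?t) (symbox s)" "fincos (pmat ?t) B \<longleftrightarrow> fincos (pmat ?t) (symbox s)"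
  proof -
    have 1: "Z' - Z - (Z'' - Z) \<in> pmat ?t \<longleftrightarrow> Z' - Z'' \<in> pmat ?t" for Z' Z'' by simp
    have 2: "\<exists>Z'\<in>B. Z' - Z - X \<in> pmat ?t" if "X \<in> symbox s" for X
      using that by (intro bexI[of _ "X + Z"]) (simp_all add: B_def subgp_0)
    have 3: "Z' - Z \<in> symbox s" if "Z' \<in> B" for Z' using that by (simp add: B_def)
    show "ncos (pmat ?t) B = ncos (pmat ?t) (symbox s)" "fincos (pmat ?t) B \<longleftrightarrow> fincos (pmat ?t) (symbox s)"
      by (rule ncos_bij[where f = "\<lambda>Z'. Z' - Z", OF subgp_pmat subgp_pmat 3 1 2]; assumption)+
  qed
  have cB: "ncos (pmat ?t) B = p ^ (4 * (a 1 + a 2 + a 3))" "fincos (pmat ?t) B"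
  proof -
    have "(?t - s 1 1) + (?t - s 2 2) + (?t - s 3 3) + (?t - s 1 2) + (?t - s 1 3) + (?t - s 2 3)
        = 4 * (a 1 + a 2 + a 3)" unfolding s(4) by simp
    then show "ncos (pmat ?t) B = p ^ (4 * (a 1 + a 2 + a 3))" "fincos (pmat ?t) B"
      using ncos_symbox[of s ?t, OF s(1,2)] B by simp_all
  qed
  have "ncos (pmat ?t) A = (p ^ (6 * t) * ncos (pmat 1) (primset 1 Z)) * ncos (pmat ?t) B"
  proof (rule ncos_fibration(1)[where f = gram])
    show "gram W \<in> B" if "W \<in> A" for W
      using that Z(1) by (auto simp: A_def B_def symbox_def s_def sym gram_symmetric)
    show "gram W - gram W' \<in> pmat ?t" if "W \<in> A" "W' \<in> A" "W - W' \<in> pmat ?t" for W W'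
      using gram_cong[OF _ _ that(3)] that(1,2) A0 by blast
    fix Z' assume Z': "Z' \<in> B"
    have "(Z' - Z)$i$j \<in> pideal 1" for i j
      using Z' pideal_antimono[OF s(3), of i j] by (auto simp: B_def symbox_def)
    then have c1: "Z' - Z \<in> pmat 1" by (simp add: pmat_def)
    have Z'2: "transpose Z' = Z'" "Z' \<in> pmat 0"
    proof -
      show "transpose Z' = Z'" using Z' Z(1) by (simp add: B_def symbox_def sym)
      have "Z' - Z + Z \<in> pmat 0" using pmat_0I[OF c1] Z(2) by (rule subgp_add[OF subgp_pmat])
      then show "Z' \<in> pmat 0" by simp
    qed
    have "gram W - Z' \<in> pmat 1 \<longleftrightarrow> gram W - Z \<in> pmat 1" for W :: "'k^4^3"
      by (rule subgp_shift[OF subgp_pmat c1])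
    then have p1: "primset 1 Z' = primset 1 Z" by (simp add: primset_def)
    have "{W \<in> A. gram W - Z' \<in> pmat ?t} = primset ?t Z'"
    proof -
      have "(gram W - Z)$i$j \<in> pideal (s i j)" if "gram W - Z' \<in> pmat ?t" for W :: "'k^4^3" and i j
      proof -
        have "(gram W - Z')$i$j \<in> pideal (s i j)" using that pideal_antimono[OF s(2), of i j] by (auto simp: pmat_def)
        moreover have "(Z' - Z)$i$j \<in> pideal (s i j)" using Z' by (simp add: B_def symbox_def)
        ultimately have "(gram W - Z')$i$j + (Z' - Z)$i$j \<in> pideal (s i j)" by (rule pideal_add)
        then show ?thesis by simp
      qed
      then show ?thesis by (auto simp: A_def primset_def s_def)
    qed
    then show "ncos (pmat ?t) {W \<in> A. gram W - Z' \<in> pmat ?t} = p ^ (6 * t) * ncos (pmat 1) (primset 1 Z)"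
      using ncos_primset[OF Z'2, of t] by (simp add: p1)
    show "fincos (pmat ?t) {W \<in> A. gram W - Z' \<in> pmat ?t}" using A0 by (intro fincos_pmat) auto
  qed (simp_all add: subgp_pmat cB)
  moreover have "ncos (pmat ?t) A = p ^ (4 * (a 1 + a 2 + a 3)) * ncos (rowbox a ?t) A"
  proof (rule ncos_fibration(1)[where f = "\<lambda>W. W"])
    show "fincos (rowbox a ?t) A"
      using fincos_mono[OF pmat_rowbox subgp_pmat subgp_rowbox fincos_pmat[OF A0]] .
    show "W - W' \<in> rowbox a ?t" if "W - W' \<in> pmat ?t" for W W' using that pmat_rowbox by blast
    fix b assume b: "b \<in> A"
    show "fincos (pmat ?t) {W \<in> A. W - b \<in> rowbox a ?t}" using A0 by (intro fincos_pmat) auto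
    have "ncos (pmat ?t) (rowbox a ?t) = ncos (pmat ?t) {W \<in> A. W - b \<in> rowbox a ?t}"
    proof (rule ncos_bij(1)[where f = "\<lambda>E. b + E"])
      show "b + E \<in> {W \<in> A. W - b \<in> rowbox a ?t}" if E: "E \<in> rowbox a ?t" for E
      proof -
        have "prim (b + E)"
          by (rule prim_cong[of b]) (use b E rowbox_pmat[of a ?t, OF a1] in \<open>auto simp: A_def\<close>)
        moreover have "(gram (b + E) - Z)$i$j \<in> pideal (s i j)" for i j
        proof -
          have b0: "b$k \<in> pvec 0" for k using b A0 by (auto simp: pmat_rows)
          have Ek: "E$k \<in> pvec (?t - a k)" for k using E by (simp add: rowbox_def)
          have le: "s i j \<le> ?t - a i + 0" "s i j \<le> 0 + (?t - a j)" unfolding s_def by arith+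
          have "h (E$i) (b$j + E$j) \<in> pideal (?t - a i + 0)"
            using b0[of j] Ek by (intro h_pideal) (auto intro: subgp_add[OF subgp_pvec] pvec_0I)
          then have 1: "h (E$i) (b$j + E$j) \<in> pideal (s i j)"
            using pideal_antimono[OF le(1)] by blast
          have "h (b$i) (E$j) \<in> pideal (0 + (?t - a j))" using b0 Ek by (intro h_pideal)
          then have 2: "h (b$i) (E$j) \<in> pideal (s i j)"
            using pideal_antimono[OF le(2)] by blast
          have 3: "(gram b - Z)$i$j \<in> pideal (s i j)" using b by (simp add: A_def s_def)
          have "(gram (b + E) - Z)$i$j = (gram b - Z)$i$j + h (b$i) (E$j) + h (E$i) (b$j + E$j)"
            by (simp add: gram_def h_add_left h_add_right)
          then show ?thesis using pideal_add[OF pideal_add[OF 3 2] 1] by (simp only:)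
        qed
        ultimately show ?thesis using E by (simp add: A_def s_def)
      qed
      show "\<exists>E\<in>rowbox a ?t. b + E - W \<in> pmat ?t" if "W \<in> {W \<in> A. W - b \<in> rowbox a ?t}" for W
        using that by (intro bexI[of _ "W - b"]) (auto simp: subgp_0)
    qed (simp_all add: subgp_pmat)
    moreover have "ncos (pmat ?t) (rowbox a ?t) = p ^ (4 * (a 1 + a 2 + a 3))"
    proof -
      have "?t - (?t - a i) = a i" for i using a1[of i] by simp
      then show ?thesis
        unfolding rowbox_def by (subst ncos_pmat_rows(1)) (simp_all add: sum_3 mult.commute)
    qed
    ultimately show "ncos (pmat ?t) {W \<in> A. W - b \<in> rowbox a ?t} = p ^ (4 * (a 1 + a 2 + a 3))" by simp
  qed (simp_all add: subgp_pmat subgp_rowbox)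
  ultimately have "ncos (rowbox a ?t) A = p ^ (6 * t) * ncos (pmat 1) (primset 1 Z)" by (simp add: cB)
  then show ?thesis by (simp add: A_def)
qed

lemma GLz_mult_pmat: "G \<in> GLz \<Longrightarrow> G ** Y \<in> pmat t \<longleftrightarrow> Y \<in> pmat t" for Y :: "'k^'m^3"
proof
  assume G: "G \<in> GLz" and "G ** Y \<in> pmat t"
  obtain H where H: "H \<in> GLz" "H ** G = mat 1" using GLz_inverse[OF G] by blast
  have "H ** (G ** Y) \<in> pmat t" using pmat_mult_left[OF GLz_pmat[OF H(1)] \<open>G ** Y \<in> pmat t\<close>] .
  then show "Y \<in> pmat t" by (simp add: matrix_mul_assoc H)
qed (use pmat_mult_left[OF GLz_pmat] in blast)

definition qmat :: "('k^'n^'m) set" where "qmat = {A. \<forall>i j. A$i$j \<in> Qp}"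

lemma qmat_mult: "A \<in> qmat \<Longrightarrow> B \<in> qmat \<Longrightarrow> A ** B \<in> qmat"
  by (auto simp: qmat_def matrix_matrix_mult_def intro!: Qp_sum Qp_mult)

lemma pmat_qmat: "A \<in> pmat t \<Longrightarrow> A \<in> qmat" by (simp add: pmat_def qmat_def pideal_def)

lemma sat_mult:
  fixes Y :: "'k^'m^3"
  assumes P: "P \<in> qmat"
  shows "sat (P ** Y) = {v. (\<forall>i. v$i \<in> Qp) \<and> v v* P \<in> sat Y}"
proof -
  have "(v v* P)$i \<in> Qp" if "\<forall>i. v$i \<in> Qp" for v i
    using that P by (auto simp: vector_matrix_mult_def qmat_def intro!: Qp_sum Qp_mult)
  then show ?thesis by (auto simp: sat_def vector_matrix_mul_assoc)
qed

lemma prim_iff_sat_eq: "prim Y \<longleftrightarrow> sat Y = pvec 0" for Y :: "'k^'m^3"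
proof -
  have "Y \<in> pmat 0" if "sat Y = pvec 0"
  proof -
    have "axis i 1 \<in> sat Y" for i :: 3 unfolding that by (auto simp: pvec_def axis_def pideal_0)
    then show ?thesis by (simp add: sat_def axis_mult pmat_rows)
  qed
  then show ?thesis by (auto simp: prim_iff_sat)
qed

text \<open>The saturation of \<open>Y\<close> tells which rational matrices turn \<open>Y\<close> into a primitive matrix.\<close>

lemma sat_eq_iff_prim:
  fixes Y :: "'k^'m^3"
  assumes P: "P \<in> qmat" "P' \<in> qmat" "P' ** P = mat 1" and Y: "prim (P ** Y1)"
  shows "sat Y = sat Y1 \<longleftrightarrow> prim (P ** Y)"
proof
  assume "sat Y = sat Y1"
  then have "sat (P ** Y) = sat (P ** Y1)" by (simp add: sat_mult[OF P(1)])
  then show "prim (P ** Y)" using Y by (simp add: prim_iff_sat_eq)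
next
  assume "prim (P ** Y)"
  then have "sat (P' ** (P ** Y)) = sat (P' ** (P ** Y1))" using Y by (simp add: sat_mult[OF P(2)] prim_iff_sat_eq)
  then show "sat Y = sat Y1" by (simp add: matrix_mul_assoc P(3))
qed

definition dinv :: "(3 \<Rightarrow> nat) \<Rightarrow> 'k^3^3" where
  "dinv a = (\<chi> i j. if i = j then inverse (\<pi> ^ a i) else 0)"

lemma dinv_mult: "(dinv a ** Y) $ i = inverse (\<pi> ^ a i) *s Y $ i"
  by (simp add: vec_eq_iff matrix_matrix_mult_def dinv_def if_distrib[of "\<lambda>x. x * _"] cong: if_cong)

lemma dinv_diagp: "dinv a ** diagp a = mat 1" "diagp a ** dinv a = mat 1"
  by (simp_all add: vec_eq_iff dinv_mult diagp_mult) (simp_all add: diagp_def dinv_def mat_def)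

lemma dinv_qmat: "dinv a \<in> qmat"
  by (auto simp: dinv_def qmat_def intro!: Qp_inverse Qp_power)

lemma diagp_pmat: "diagp a \<in> pmat 0"
  by (auto simp: diagp_def pmat_def pideal_0 intro!: Zp_power)

lemma pideal_divide_iff:
  assumes "a \<le> t" shows "inverse (\<pi> ^ a) * x \<in> pideal (t - a) \<longleftrightarrow> x \<in> pideal t"
  using pideal_scale_iff[of a "inverse (\<pi> ^ a) * x" "t - a"] assms by (simp flip: mult.assoc)

lemma dinv_rowbox:
  assumes "\<And>i. a i \<le> t" shows "dinv a ** E \<in> rowbox a t \<longleftrightarrow> E \<in> pmat t"
  unfolding rowbox_def pmat_def pvec_def mem_Collect_eq dinv_mult vector_smult_component
  using pideal_divide_iff[OF assms] by simp

lemma dinv_conj: "(dinv a ** X ** transpose (dinv a)) $ i $ j = inverse (\<pi> ^ (a i + a j)) * X $ i $ j"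
proof -
  have "(Z ** transpose (dinv a)) $ i $ j = inverse (\<pi> ^ a j) * Z $ i $ j" for Z :: "'k^3^3"
    by (simp add: matrix_matrix_mult_def transpose_def dinv_def if_distrib[of "\<lambda>x. _ * x"] mult.commute cong: if_cong)
  then show ?thesis by (simp add: dinv_mult power_add)
qed

definition cgt :: "nat \<Rightarrow> 'k \<Rightarrow> 'k \<Rightarrow> bool" where
  "cgt t x y \<longleftrightarrow> x \<in> Zp \<and> y \<in> Zp \<and> x - y \<in> pideal t"

lemma cgt_add: "cgt t x y \<Longrightarrow> cgt t x' y' \<Longrightarrow> cgt t (x + x') (y + y')"
  by (auto simp: cgt_def Zp_add add_diff_add intro: pideal_add)

lemma cgt_diff: "cgt t x y \<Longrightarrow> cgt t x' y' \<Longrightarrow> cgt t (x - x') (y - y')"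
  using pideal_diff[of "x - y" t "x' - y'"] by (auto simp: cgt_def Zp_diff algebra_simps)

lemma cgt_mult: "cgt t x y \<Longrightarrow> cgt t x' y' \<Longrightarrow> cgt t (x * x') (y * y')"
proof -
  assume c: "cgt t x y" "cgt t x' y'"
  have "x * x' - y * y' = x * (x' - y') + (x - y) * y'" by (simp add: algebra_simps)
  moreover have "x * (x' - y') \<in> pideal t" "(x - y) * y' \<in> pideal t"
    using c by (auto simp: cgt_def intro: pideal_mult_left pideal_mult_right)
  ultimately show ?thesis using c by (auto simp: cgt_def intro: Zp_mult pideal_add)
qed

lemma det_cong:
  fixes A B :: "'k^3^3"
  assumes "A \<in> pmat 0" "B \<in> pmat 0" "A - B \<in> pmat t"
  shows "det A - det B \<in> pideal t"
proof -
  have "cgt t (A$i$j) (B$i$j)" for i j using assms by (simp add: cgt_def pmat_def pideal_0)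
  then have "cgt t (det A) (det B)" unfolding det_3 by (intro cgt_add cgt_diff cgt_mult)
  then show ?thesis by (simp add: cgt_def)
qed

definition reps :: "nat \<Rightarrow> 'k^3^3 \<Rightarrow> ('k^4^3) set" where
  "reps t T = {Y \<in> pmat 0. gram Y - T \<in> pmat t}"

text \<open>
  At a precision beyond the determinant of \<open>T\<close>, the elementary divisors \<open>p\<^sup>a\<close> of a solution are bounded,
  since \<open>det (gram Y)\<close> has the valuation of \<open>det T\<close> and is divisible by the square of their product.
\<close>

lemma reps_primitive_factor:
  assumes T: "T \<in> pmat 0" "(1 / real p) ^ t < absv (det T)" and Y: "Y \<in> reps t T"
  obtains U a where "U \<in> GLz" "prim (dinv a ** U ** Y)" "\<forall>i j. a i + a j < t"
proof -
  have Y': "Y \<in> pmat 0" "gram Y - T \<in> pmat t" using Y by (auto simp: reps_def)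
  have "det (gram Y) - det T \<in> pideal t" using det_cong[OF gram_pmat[OF Y'(1)] T(1) Y'(2)] .
  then have "absv (det (gram Y) - det T) < absv (det T)" using T(2) by (simp add: pideal_def)
  then have dY: "absv (det (gram Y)) = absv (det T)"
    using absv_add_eq[of "det (gram Y) - det T" "det T"] by simp
  have "0 < (1 / real p) ^ t" by simp
  then have "0 < absv (det (gram Y))" using dY T(2) by linarith
  then have nz: "det (gram Y) \<noteq> 0" by auto
  have indep: "v = 0" if "v v* Y = 0" for v
  proof -
    obtain B where B: "gram Y ** B = mat 1" using nz by (meson invertible_det_nz invertible_def)
    have z: "0 v* M = 0" for M :: "'k^'n^'l" by (simp add: vec_eq_iff vector_matrix_mult_def)
    have "v v* gram Y = (v v* Y) v* (hmat ** transpose Y)"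
      by (simp add: gram_hmat vector_matrix_mul_assoc matrix_mul_assoc)
    then have "(v v* gram Y) v* B = 0" by (simp only: that z)
    then show "v = 0" by (simp add: vector_matrix_mul_assoc B)
  qed
  obtain U a W where U: "U \<in> GLz" "prim W" "U ** Y = diagp a ** W"
    using elementary_divisors[OF Y'(1) indep] by blast
  have "dinv a ** U ** Y = (dinv a ** diagp a) ** W"
    by (simp add: matrix_mul_assoc[symmetric] U(3))
  then have P: "prim (dinv a ** U ** Y)" using U(2) by (simp add: dinv_diagp)
  define s where "s = a 1 + a 2 + a 3"
  have "det (diagp a) = \<pi> ^ s" by (simp add: det_3 diagp_def s_def power_add)
  moreover have "det U * det (gram Y) * det U = det (diagp a) * det (gram W) * det (diagp a)"
    using arg_cong[OF U(3), of "\<lambda>X. det (gram X)"] by (simp add: gram_mult det_mul)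
  ultimately have "absv (det U * det (gram Y) * det U) = absv (\<pi> ^ s * det (gram W) * \<pi> ^ s)" by simp
  then have "absv (det T) = (1 / real p) ^ s * absv (det (gram W)) * (1 / real p) ^ s"
    using U(1) dY by (simp only: absv_mult absv_p_power) (simp add: GLz_def)
  also have "\<dots> \<le> (1 / real p) ^ s * 1 * (1 / real p) ^ s"
    using det_pmat_Zp[OF gram_pmat[OF prim_pmat[OF U(2)]]]
    by (intro mult_right_mono mult_left_mono) (auto simp: Zp_def)
  also have "\<dots> = (1 / real p) ^ (2 * s)" by (simp only: mult_2 power_add mult_1_right)
  finally have "(1 / real p) ^ t < (1 / real p) ^ (2 * s)" using T(2) by linarith
  then have "2 * s < t"
    using p_gt_1 power_decreasing[of t "2 * s" "1 / real p"] by (metis not_le p_pos(1) divide_nonneg_pos le_divide_eq_1_pos less_eq_real_def zero_le_one)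
  moreover have "a i \<le> s" for i using exhaust_3[of i] by (auto simp: s_def)
  ultimately have "\<forall>i j. a i + a j < t" using add_mono[of "a _" s "a _" s] by (metis mult_2 le_less_trans)
  with U(1) P show ?thesis using that by blast
qed

text \<open>The saturation has denominators bounded by the elementary divisors, so it is determined by \<open>Y\<close> modulo \<open>p\<^sup>t\<close>.\<close>

lemma sat_cong:
  assumes T: "T \<in> pmat 0" "(1 / real p) ^ t < absv (det T)"
    and Y: "Y \<in> reps t T" "Y' - Y \<in> pmat t"
  shows "sat Y' = sat Y"
proof -
  obtain U a where U: "U \<in> GLz" "prim (dinv a ** U ** Y)" "\<forall>i j. a i + a j < t"
    using reps_primitive_factor[OF T Y(1)] .
  have a: "a i < t" for i using U(3)[rule_format, of i i] by simp
  obtain V where V: "V \<in> GLz" "V ** U = mat 1" using GLz_inverse[OF U(1)] by blast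
  have "U ** (Y' - Y) \<in> pmat t" using Y(2) by (simp add: GLz_mult_pmat[OF U(1)])
  then have "dinv a ** (U ** (Y' - Y)) \<in> rowbox a t" using dinv_rowbox less_imp_le[OF a] by metis
  then have "dinv a ** U ** Y' - dinv a ** U ** Y \<in> pmat 1"
    using rowbox_pmat[of a t, OF a] by (auto simp: matrix_sub_ldistrib matrix_mul_assoc)
  then have "prim (dinv a ** U ** Y')" using prim_cong[OF U(2)] by blast
  moreover have "V ** diagp a ** (dinv a ** U) = mat 1"
  proof -
    have "V ** diagp a ** (dinv a ** U) = V ** (diagp a ** dinv a) ** U" by (simp only: matrix_mul_assoc)
    then show ?thesis by (simp add: dinv_diagp V)
  qed
  moreover have "dinv a ** U \<in> qmat" "V ** diagp a \<in> qmat"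
    using qmat_mult[OF dinv_qmat pmat_qmat[OF GLz_pmat[OF U(1)]]]
      pmat_qmat[OF pmat_mult_left[OF GLz_pmat[OF V(1)] diagp_pmat]] by simp_all
  ultimately show ?thesis using sat_eq_iff_prim U(2) by blast
qed

text \<open>
  The matrix \<open>R\<close> that makes \<open>Y\<^sub>1\<close> primitive and normalises its Gram matrix does so for all solutions with the
  saturation of \<open>Y\<^sub>1\<close>.  It has denominators \<open>p\<^sup>a\<close>, which is why the congruences become weighted.
\<close>

lemma ncos_sat_class:
  assumes T: "transpose T = T" "T \<in> pmat 0" "(1 / real p) ^ Suc t < absv (det T)"
    and Y: "Y1 \<in> reps (Suc t) T"
  obtains R R' u where "R \<in> qmat" "R' \<in> pmat 0" "R ** R' = mat 1" "R' ** R = mat 1" "prim (R ** Y1)"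
    "R ** T ** transpose R = dg u" "u \<in> Zp"
    "ncos (pmat (Suc t)) {Y \<in> reps (Suc t) T. sat Y = sat Y1} =
       p ^ (6 * t) * (p^2 * (p^4 - 1) * (if absv u = 1 then 1 else 2))"
proof -
  let ?t = "Suc t"
  obtain U a where  "U \<in> GLz" "prim (dinv a ** U ** Y1)" and "\<forall>i j. a i + a j < ?t"
    using reps_primitive_factor[OF T(2,3) Y] .
  then have U: "U \<in> GLz" "prim (dinv a ** U ** Y1)" "\<And>i j. a i + a j < ?t" by blast+
  have a: "a i < ?t" "a i \<le> ?t" for i using U(3)[of i i] by simp_all
  obtain V where V: "V \<in> GLz" "U ** V = mat 1" "V ** U = mat 1" using GLz_inverse[OF U(1)] by blast
  define P where "P = dinv a ** U"
  define P' where "P' = V ** diagp a"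
  have P: "P \<in> qmat" "P' \<in> pmat 0"
    using qmat_mult[OF dinv_qmat pmat_qmat[OF GLz_pmat[OF U(1)]]]
      pmat_mult_left[OF GLz_pmat[OF V(1)] diagp_pmat] by (simp_all add: P_def P'_def)
  have PP: "P' ** P = mat 1" "P ** P' = mat 1"
  proof -
    have "P' ** P = V ** (diagp a ** dinv a) ** U" by (simp only: P_def P'_def matrix_mul_assoc)
    then show "P' ** P = mat 1" by (simp add: dinv_diagp V)
    have "P ** P' = dinv a ** (U ** V) ** diagp a" by (simp only: P_def P'_def matrix_mul_assoc)
    then show "P ** P' = mat 1" by (simp add: dinv_diagp V)
  qed
  define Z where "Z = P ** T ** transpose P"
  have gz: "(gram (P ** Y) - Z)$i$j \<in> pideal (?t - a i - a j) \<longleftrightarrow> (U ** (gram Y - T) ** transpose U)$i$j \<in> pideal ?t" for Y i j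
  proof -
    have "gram (P ** Y) - Z = P ** (gram Y - T) ** transpose P"
      by (simp add: Z_def gram_mult matrix_sub_ldistrib matrix_sub_rdistrib)
    also have "\<dots> = dinv a ** (U ** (gram Y - T) ** transpose U) ** transpose (dinv a)"
      by (simp add: P_def matrix_transpose_mul matrix_mul_assoc)
    finally show ?thesis
      using pideal_divide_iff[of "a i + a j" ?t] U(3)[of i j] by (simp add: dinv_conj)
  qed
  have gz': "(\<forall>i j. (gram (P ** Y) - Z)$i$j \<in> pideal (?t - a i - a j)) \<longleftrightarrow> gram Y - T \<in> pmat ?t" for Y
    unfolding gz using GLz_conj_pmat[OF U(1), of "gram Y - T" ?t] by (simp add: pmat_def)
  have pY1: "prim (P ** Y1)" using U(2) by (simp add: P_def)
  have g1: "gram (P ** Y1) - Z \<in> pmat 1"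
  proof -
    have "(gram (P ** Y1) - Z)$i$j \<in> pideal 1" for i j
    proof -
      have "(gram (P ** Y1) - Z)$i$j \<in> pideal (?t - a i - a j)" using gz'[of Y1] Y by (simp add: reps_def)
      moreover have "1 \<le> ?t - a i - a j" using U(3)[of i j] by simp
      ultimately show ?thesis using pideal_antimono by blast
    qed
    then show ?thesis by (simp add: pmat_def)
  qed
  have Z: "transpose Z = Z" "Z \<in> pmat 0"
  proof -
    show "transpose Z = Z" unfolding Z_def by (rule conj_symmetric[OF T(1)])
    have "gram (P ** Y1) - (gram (P ** Y1) - Z) \<in> pmat 0"
      by (rule subgp_diff[OF subgp_pmat gram_pmat[OF prim_pmat[OF pY1]] pmat_0I[OF g1]])
    then show "Z \<in> pmat 0" by simp
  qed
  obtain G u where G: "G \<in> GLz" "u \<in> Zp" "G ** Z ** transpose G = dg u"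
    using prim_cong_diag[OF pY1 Z g1] by blast
  obtain H where H: "H \<in> GLz" "G ** H = mat 1" "H ** G = mat 1" using GLz_inverse[OF G(1)] .
  have "ncos (pmat ?t) {Y \<in> reps ?t T. sat Y = sat Y1} = ncos (rowbox a ?t)
      {W. prim W \<and> (\<forall>i j. (gram W - Z)$i$j \<in> pideal (?t - a i - a j))}"
  proof (rule ncos_bij(1)[where f = "(**) P"])
    have sat: "sat Y = sat Y1 \<longleftrightarrow> prim (P ** Y)" for Y
      by (rule sat_eq_iff_prim[OF P(1) pmat_qmat[OF P(2)] PP(1) pY1])
    show "P ** Y \<in> {W. prim W \<and> (\<forall>i j. (gram W - Z)$i$j \<in> pideal (?t - a i - a j))}"
      if "Y \<in> {Y \<in> reps ?t T. sat Y = sat Y1}" for Y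
      using that gz'[of Y] sat[of Y] unfolding reps_def by blast
    show "P ** Y - P ** Y' \<in> rowbox a ?t \<longleftrightarrow> Y - Y' \<in> pmat ?t" for Y Y'
    proof -
      have "P ** Y - P ** Y' = dinv a ** (U ** (Y - Y'))" by (simp add: P_def matrix_sub_ldistrib matrix_mul_assoc)
      then show ?thesis by (simp add: dinv_rowbox[OF a(2)] GLz_mult_pmat[OF U(1)])
    qed
    fix W assume W: "W \<in> {W. prim W \<and> (\<forall>i j. (gram W - Z)$i$j \<in> pideal (?t - a i - a j))}"
    have e: "P ** (P' ** W) = W" by (simp add: matrix_mul_assoc PP)
    have "P' ** W \<in> pmat 0" using W by (auto intro: pmat_mult_left[OF P(2)] prim_pmat)
    moreover have "gram (P' ** W) - T \<in> pmat ?t" using gz'[of "P' ** W"] W by (simp add: e)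
    moreover have "sat (P' ** W) = sat Y1" using sat[of "P' ** W"] W by (simp add: e)
    ultimately show "\<exists>Y\<in>{Y \<in> reps ?t T. sat Y = sat Y1}. P ** Y - W \<in> rowbox a ?t"
      by (intro bexI[of _ "P' ** W"]) (simp_all add: reps_def e subgp_0[OF subgp_rowbox])
  qed (simp_all add: subgp_rowbox)
  also have "\<dots> = p ^ (6 * t) * ncos (pmat 1) (primset 1 Z)"
    using U(3) by (intro ncos_primset_weighted[OF Z]) (simp add: less_Suc_eq_le)
  also have "ncos (pmat 1) (primset 1 Z) = p^2 * (p^4 - 1) * (if absv u = 1 then 1 else 2)"
    using ncos_primset_GLz[OF G(1), of 1 Z] ncos_primset_dg[OF G(2)] by (simp add: G(3))
  finally have c: "ncos (pmat ?t) {Y \<in> reps ?t T. sat Y = sat Y1} =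
      p ^ (6 * t) * (p^2 * (p^4 - 1) * (if absv u = 1 then 1 else 2))" .
  show ?thesis
  proof (rule that[of "G ** P" "P' ** H" u])
    show "G ** P \<in> qmat" using P(1) GLz_pmat[OF G(1)] by (auto intro: qmat_mult pmat_qmat)
    show "P' ** H \<in> pmat 0" using pmat_mult_left[OF P(2) GLz_pmat[OF H(1)]] .
    have "G ** P ** (P' ** H) = G ** (P ** P') ** H" by (simp only: matrix_mul_assoc)
    then show "G ** P ** (P' ** H) = mat 1" by (simp add: PP H)
    have "P' ** H ** (G ** P) = P' ** (H ** G) ** P" by (simp only: matrix_mul_assoc)
    then show "P' ** H ** (G ** P) = mat 1" by (simp add: PP H)
    show "prim (G ** P ** Y1)" using pY1 by (simp add: prim_GLz[OF G(1)] flip: matrix_mul_assoc)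
    show "G ** P ** T ** transpose (G ** P) = dg u"
      using G(3) by (simp add: Z_def matrix_transpose_mul matrix_mul_assoc)
  qed (use G(2) c in auto)
qed

lemma ncos_reps:
  assumes T: "T \<in> pmat 0" "(1 / real p) ^ t < absv (det T)"
  shows "finite (sat ` reps t T)"
    and "ncos (pmat t) (reps t T) = (\<Sum>M\<in>sat ` reps t T. ncos (pmat t) {Y \<in> reps t T. sat Y = M})"
proof -
  have eq: "sat Y = sat Y'" if "Y \<in> reps t T" "Y' \<in> reps t T" "Y - Y' \<in> pmat t" for Y Y'
    by (rule sat_cong[OF T that(2,3)])
  have fin: "fincos (pmat t) (reps t T)" by (rule fincos_pmat) (auto simp: reps_def)
  define g where "g c = sat (SOME Y. Y \<in> reps t T \<and> coset_of (pmat t) Y = c)" for c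
  have "sat Y = g (coset_of (pmat t) Y)" if "Y \<in> reps t T" for Y
  proof -
    let ?Y = "SOME Y'. Y' \<in> reps t T \<and> coset_of (pmat t) Y' = coset_of (pmat t) Y"
    have "?Y \<in> reps t T \<and> coset_of (pmat t) ?Y = coset_of (pmat t) Y" by (rule someI[of _ Y]) (simp add: that)
    then show ?thesis unfolding g_def
      using that by (intro eq) (simp_all add: coset_of_eq_iff[OF subgp_pmat, symmetric])
  qed
  then have "sat ` reps t T \<subseteq> g ` coset_of (pmat t) ` reps t T" by blast
  then show f: "finite (sat ` reps t T)" using fin unfolding fincos_def by (meson finite_imageI finite_subset)
  have U: "reps t T = (\<Union>M\<in>sat ` reps t T. {Y \<in> reps t T. sat Y = M})" by auto
  show "ncos (pmat t) (reps t T) = (\<Sum>M\<in>sat ` reps t T. ncos (pmat t) {Y \<in> reps t T. sat Y = M})"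
    by (subst U, rule ncos_Union(1)[OF f subgp_pmat])
       (use eq in \<open>auto intro: fincos_subset[OF fin]\<close>)
qed

end

section \<open>Lattices in the plane\<close>

context symplectic_plane
begin

definition vc :: "'u \<Rightarrow> 'u \<Rightarrow> 'k \<Rightarrow> 'k \<Rightarrow> 'u" where
  "vc e f a b = scale a e + scale b f"

lemma form_skew: "form y x = - form x y"
proof -
  have "form x y + form y x = 0"
    using form_alternating[of "x + y"]
    by (simp add: form_add_left form_add_right form_alternating[of x] form_alternating[of y] add.commute)
  then show ?thesis by (simp add: eq_neg_iff_add_eq_0 add.commute)
qed

lemma form_zero [simp]: "form 0 x = 0" "form x 0 = 0"
  using form_scale_left[of 0 0 x] form_scale_right[of x 0 0] by auto

lemma form_vc: "form (vc e f a b) (vc e f c d) = (a * d - b * c) * form e f"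
  by (simp add: vc_def form_add_left form_add_right form_scale_left form_scale_right form_alternating
      form_skew[of e f] algebra_simps)

lemma vc_add: "vc e f a b + vc e f c d = vc e f (a + c) (b + d)"
  by (simp add: vc_def scale_left_distrib algebra_simps)

lemma scale_vc: "scale c (vc e f a b) = vc e f (c * a) (c * b)"
  by (simp add: vc_def scale_right_distrib)

lemma vc_scaled: "vc (scale c e) (scale d f) a b = vc e f (a * c) (b * d)"
  by (simp add: vc_def)

lemma vc_simps [simp]: "vc e f 1 0 = e" "vc e f 0 1 = f" "vc e f 0 0 = 0"
  by (simp_all add: vc_def)

lemma vc_eq_iff: "form e f \<noteq> 0 \<Longrightarrow> vc e f a b = vc e f c d \<longleftrightarrow> a = c \<and> b = d"
  using form_vc[of e f a b 0 1] form_vc[of e f c d 0 1] form_vc[of e f 1 0 a b] form_vc[of e f 1 0 c d]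
  by auto

text \<open>
  In a symplectic plane the condition \<open>form e f \<noteq> 0\<close> expresses that \<open>e\<close> and \<open>f\<close> form a basis; it is used for
  this purpose throughout.
\<close>

lemma basis_independent:
  assumes "form e f \<noteq> 0" shows "independent {e, f}" "e \<noteq> f"
proof -
  show ne: "e \<noteq> f" using assms form_alternating by auto
  show "independent {e, f}"
  proof (rule independent_if_scalars_zero)
    show "finite {e, f}" by simp
    fix g x assume g: "(\<Sum>x\<in>{e, f}. scale (g x) x) = 0" and x: "x \<in> {e, f}"
    then have "vc e f (g e) (g f) = vc e f 0 0" using ne by (simp add: vc_def)
    then have "g e = 0 \<and> g f = 0" using vc_eq_iff[OF assms] by blast
    then show "g x = 0" using x by auto
  qed
qed

lemma basis_expand:
  assumes "form e f \<noteq> 0" shows "u = vc e f (form u f / form e f) (form e u / form e f)"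
proof -
  obtain B :: "'u set" where B: "independent B" "UNIV \<subseteq> span B" "card B = 2"
    using basis_exists[of UNIV] dim_2 by metis
  then have "finite B" by (metis card.infinite zero_neq_numeral)
  have "u \<in> span {e, f}"
  proof (rule ccontr)
    assume u: "u \<notin> span {e, f}"
    then have "independent (insert u {e, f})" using basis_independent(1)[OF assms] by (simp add: independent_insertI)
    then have "card (insert u {e, f}) \<le> 2"
      using independent_span_bound[OF \<open>finite B\<close>] B by (metis subset_UNIV subset_trans)
    moreover have "u \<notin> {e, f}" using u span_base by blast
    ultimately show False using basis_independent(2)[OF assms] by simp
  qed
  then obtain a where "u - scale a e \<in> span {f}" by (auto simp: span_breakdown_eq)
  then obtain b where "u - scale a e = scale b f" by (auto simp: span_breakdown_eq[of _ f "{}"])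
  then have u: "u = vc e f a b" by (simp add: vc_def algebra_simps)
  have "form u f = a * form e f" "form e u = b * form e f"
    using form_vc[of e f a b 0 1] form_vc[of e f 1 0 a b] by (simp_all add: u)
  then show ?thesis using assms u by simp
qed

lemma vc_exhaust:
  assumes "form e f \<noteq> 0" obtains a b where "u = vc e f a b"
  using basis_expand[OF assms] by blast

definition lat :: "'u \<Rightarrow> 'u \<Rightarrow> 'u set" where
  "lat e f = {vc e f a b | a b. absv a \<le> 1 \<and> absv b \<le> 1}"

lemma lat_I: "absv a \<le> 1 \<Longrightarrow> absv b \<le> 1 \<Longrightarrow> vc e f a b \<in> lat e f"
  unfolding lat_def by blast

lemma lat_sums:
  assumes "e \<noteq> f" shows "{\<Sum>a\<in>{e, f}. scale (c a) a | c. \<forall>a\<in>{e, f}. c a \<in> Zp2} = lat e f" (is "?S = _")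
proof (intro equalityI subsetI)
  fix u assume "u \<in> ?S"
  then show "u \<in> lat e f" using assms lat_I[of _ _ e f] by (auto simp: Zp2_def vc_def)
next
  fix u assume "u \<in> lat e f"
  then obtain a b where u: "u = vc e f a b" "absv a \<le> 1" "absv b \<le> 1" by (auto simp: lat_def)
  define c where "c x = (if x = e then a else b)" for x
  have "u = (\<Sum>a\<in>{e, f}. scale (c a) a)" "\<forall>a\<in>{e, f}. c a \<in> Zp2"
    using u assms by (auto simp: c_def vc_def Zp2_def)
  then show "u \<in> ?S" by blast
qed

lemma vc_lat: "form e f \<noteq> 0 \<Longrightarrow> vc e f a b \<in> lat e f \<longleftrightarrow> absv a \<le> 1 \<and> absv b \<le> 1"
  by (auto simp: lat_def vc_eq_iff)

lemma lat_E: "x \<in> lat e f \<Longrightarrow> (\<And>a b. x = vc e f a b \<Longrightarrow> absv a \<le> 1 \<Longrightarrow> absv b \<le> 1 \<Longrightarrow> P) \<Longrightarrow> P"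
  unfolding lat_def by blast

lemma lat_add: "x \<in> lat e f \<Longrightarrow> y \<in> lat e f \<Longrightarrow> x + y \<in> lat e f"
  by (elim lat_E) (simp add: vc_add lat_I absv_add_le)

lemma lat_scale: "x \<in> lat e f \<Longrightarrow> absv c \<le> 1 \<Longrightarrow> scale c x \<in> lat e f"
  using absv_mult_le[of c 1 _ 1] by (elim lat_E) (simp add: scale_vc lat_I)

lemma lat_scale_unit:
  assumes "absv c = 1" shows "scale c x \<in> lat e f \<longleftrightarrow> x \<in> lat e f"
proof
  assume "scale c x \<in> lat e f"
  then have "scale (inverse c) (scale c x) \<in> lat e f" by (rule lat_scale) (simp add: absv_inverse assms)
  moreover have "inverse c * c = 1" using assms by (intro left_inverse) auto
  ultimately show "x \<in> lat e f" by simp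
next
  assume "x \<in> lat e f"
  then show "scale c x \<in> lat e f" by (rule lat_scale) (simp add: assms)
qed

lemma lat_vc: "x \<in> lat e f \<Longrightarrow> y \<in> lat e f \<Longrightarrow> absv a \<le> 1 \<Longrightarrow> absv b \<le> 1 \<Longrightarrow> vc x y a b \<in> lat e f"
  unfolding vc_def by (rule lat_add; rule lat_scale)

lemma lat_basis [simp]: "e \<in> lat e f" "f \<in> lat e f"
  using lat_I[of 1 0 e f] lat_I[of 0 1 e f] by simp_all

lemma lat_subset_iff: "lat e' f' \<subseteq> lat e f \<longleftrightarrow> e' \<in> lat e f \<and> f' \<in> lat e f"
proof
  assume m: "e' \<in> lat e f \<and> f' \<in> lat e f"
  show "lat e' f' \<subseteq> lat e f"
  proof
    fix x assume "x \<in> lat e' f'"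
    then obtain a b where "x = vc e' f' a b" "absv a \<le> 1" "absv b \<le> 1" by (rule lat_E)
    then show "x \<in> lat e f" using lat_vc[of e' e f f' a b] m by simp
  qed
next
  assume "lat e' f' \<subseteq> lat e f"
  then show "e' \<in> lat e f \<and> f' \<in> lat e f" using lat_basis[of e' f'] by (simp add: subsetD)
qed

lemma lat_form_le:
  assumes "e' \<in> lat e f" "f' \<in> lat e f" shows "absv (form e' f') \<le> absv (form e f)"
proof -
  obtain a b c d where x: "e' = vc e f a b" "f' = vc e f c d" "absv a \<le> 1" "absv b \<le> 1" "absv c \<le> 1" "absv d \<le> 1"
    using assms by (auto simp: lat_def)
  then have "absv (a * d - b * c) \<le> 1"
    using absv_mult_le[of a 1 d 1] absv_mult_le[of b 1 c 1] by (auto intro: absv_diff_le)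
  then show ?thesis using absv_nonneg[of "form e f"] by (simp add: x form_vc absv_mult mult_left_le_one_le absv_nonneg)
qed

lemma lat_eqI:
  assumes ef: "form e f \<noteq> 0" and m: "e' \<in> lat e f" "f' \<in> lat e f" and d: "absv (form e' f') = absv (form e f)"
  shows "lat e' f' = lat e f"
proof
  show "lat e' f' \<subseteq> lat e f" using m by (simp add: lat_subset_iff)
  have nz: "form e' f' \<noteq> 0" using ef d by (metis absv_eq_0)
  have 1: "u \<in> lat e' f'" if "absv (form u f') \<le> absv (form e f)" "absv (form e' u) \<le> absv (form e f)" for u
  proof -
    have "absv (form u f' / form e' f') \<le> 1" "absv (form e' u / form e' f') \<le> 1"
      using that d absv_pos[OF nz] by (simp_all add: absv_divide)
    then show ?thesis using basis_expand[OF nz, of u] vc_lat[OF nz] by metis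
  qed
  show "lat e f \<subseteq> lat e' f'" unfolding lat_subset_iff
    using lat_form_le[OF _ m(2)] lat_form_le[OF m(1)] by (simp add: 1)
qed

lemma lat_eq_form: "lat e' f' = lat e f \<Longrightarrow> absv (form e' f') = absv (form e f)"
  using lat_form_le[of e' e f f'] lat_form_le[of e e' f' f] lat_basis by (metis order_antisym)

lemma scale_lat: "scale c ` lat e f = lat (scale c e) (scale c f)"
proof -
  have v: "vc (scale c e) (scale c f) a b = scale c (vc e f a b)" for a b
    by (simp add: scale_vc vc_scaled mult.commute)
  show ?thesis
  proof (intro equalityI subsetI)
    fix x assume "x \<in> scale c ` lat e f"
    then show "x \<in> lat (scale c e) (scale c f)" by (auto elim!: lat_E simp flip: v intro!: lat_I)
  next
    fix x assume "x \<in> lat (scale c e) (scale c f)"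
    then show "x \<in> scale c ` lat e f" by (auto elim!: lat_E simp: v intro!: imageI lat_I)
  qed
qed

lemma lat_unit: "form e f \<noteq> 0 \<Longrightarrow> absv a = 1 \<Longrightarrow> absv b = 1 \<Longrightarrow> lat (scale a e) (scale b f) = lat e f"
  by (rule lat_eqI) (auto simp: form_scale_left form_scale_right absv_mult intro!: lat_scale)

lemma lattice_iff: "lattice L \<longleftrightarrow> (\<exists>e f. form e f \<noteq> 0 \<and> L = lat e f)"
proof
  assume "lattice L"
  then obtain A where A: "finite A" "independent A" "span A = UNIV"
    "L = {\<Sum>a\<in>A. scale (c a) a | c. \<forall>a\<in>A. c a \<in> Zp2}" unfolding lattice_def by blast
  have "card A = 2" using dim_eq_card[of A UNIV] A dim_2 by (simp add: dim_span)
  then obtain e f where ef: "A = {e, f}" "e \<noteq> f" by (auto simp: card_2_iff)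
  have "form e f \<noteq> 0"
  proof
    assume z: "form e f = 0"
    have "form e u = 0" for u
    proof -
      have "u \<in> span {e, f}" using A(3) by (simp add: ef)
      then obtain k where "u - scale k e \<in> span {f}" by (auto simp: span_breakdown_eq)
      then obtain l where "u - scale k e = scale l f" by (auto simp: span_breakdown_eq[of _ f "{}"])
      then have "u = vc e f k l" by (simp add: vc_def algebra_simps)
      then show ?thesis using form_vc[of e f 1 0 k l] z by simp
    qed
    then have "e = 0" by (rule form_nondegenerate)
    then show False using A(2) dependent_zero by (auto simp: ef)
  qed
  moreover have "L = lat e f" using A(4) lat_sums[OF ef(2)] by (simp only: ef(1))
  ultimately show "\<exists>e f. form e f \<noteq> 0 \<and> L = lat e f" by blast
next
  assume "\<exists>e f. form e f \<noteq> 0 \<and> L = lat e f"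
  then obtain e f where ef: "form e f \<noteq> 0" "L = lat e f" by blast
  note ind = basis_independent[OF ef(1)]
  have "independent {e, f}" by (rule ind)
  moreover have "span {e, f} = UNIV"
  proof -
    have "u \<in> span {e, f}" for u
      using basis_expand[OF ef(1), of u] by (metis vc_def span_add span_scale span_base insertI1 insertI2)
    then show ?thesis by blast
  qed
  moreover have "L = {\<Sum>a\<in>{e, f}. scale (c a) a | c. \<forall>a\<in>{e, f}. c a \<in> Zp2}"
    using ef(2) lat_sums[OF ind(2)] by simp
  ultimately show "lattice L" unfolding lattice_def by (intro exI[of _ "{e, f}"]) auto
qed

lemma lattice_lat: "form e f \<noteq> 0 \<Longrightarrow> lattice (lat e f)" by (auto simp: lattice_iff)

lemma absv_power_int: "absv (x powi n) = absv x powi n"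
  by (simp add: power_int_def absv_power absv_inverse)

lemma p_power_decompose:
  assumes "x \<noteq> 0" obtains n :: int where "absv (x / \<pi> powi n) = 1" "absv x = real p powi (- n)"
proof -
  obtain m :: int where m: "absv x = real p powi m" using unramified[OF assms] by blast
  have "absv (\<pi> powi n) = real p powi (- n)" for n
    by (simp add: absv_power_int absv_p power_int_minus power_int_inverse flip: inverse_eq_divide)
  then have "absv (x / \<pi> powi (- m)) = 1" using m p_gt_1 by (simp add: absv_divide)
  then show ?thesis using that[of "- m"] m by simp
qed

lemma Qp_power_int: "x \<in> Qp \<Longrightarrow> x powi n \<in> Qp"
  by (simp add: power_int_def Qp_power Qp_inverse)

text \<open>The product of a basis is a unit times a power of \<open>p\<close>, and the unit can be moved into a basis vector.\<close>

lemma lattice_rational_basis: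
  assumes "lattice L" obtains e f where "form e f \<noteq> 0" "form e f \<in> Qp" "L = lat e f"
proof -
  obtain e f where ef: "form e f \<noteq> 0" "L = lat e f" using assms lattice_iff by blast
  obtain n :: int where n: "absv (form e f / \<pi> powi n) = 1" using p_power_decompose[OF ef(1)] by metis
  define c where "c = form e f / \<pi> powi n"
  have c: "absv c = 1" "c \<noteq> 0" using n c_def by auto
  have "form (scale (inverse c) e) f = \<pi> powi n" using ef(1) p_pos by (simp add: form_scale_left c_def)
  moreover have "lat (scale (inverse c) e) (scale 1 f) = lat e f" using ef(1) c by (intro lat_unit) (auto simp: absv_inverse)
  ultimately show ?thesis using that[of "scale (inverse c) e" f] ef by (simp add: Qp_power_int)
qed

lemma semilinear_vc: "semilinear \<beta> \<Longrightarrow> \<beta> (vc e f a b) = vc (\<beta> e) (\<beta> f) (\<sigma> a) (\<sigma> b)"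
  by (simp add: semilinear_def vc_def)

lemma semilinear_lat: "semilinear \<beta> \<Longrightarrow> \<beta> ` lat e f = lat (\<beta> e) (\<beta> f)"
proof (intro equalityI subsetI)
  fix x assume b: "semilinear \<beta>" and "x \<in> lat (\<beta> e) (\<beta> f)"
  then obtain a c where x: "x = vc (\<beta> e) (\<beta> f) a c" "absv a \<le> 1" "absv c \<le> 1" by (auto simp: lat_def)
  then have "x = \<beta> (vc e f (\<sigma> a) (\<sigma> c))" using semilinear_vc[OF b] by simp
  moreover have "vc e f (\<sigma> a) (\<sigma> c) \<in> lat e f" using x by (intro lat_I) simp_all
  ultimately show "x \<in> \<beta> ` lat e f" by blast
next
  fix x assume b: "semilinear \<beta>" and "x \<in> \<beta> ` lat e f"
  then show "x \<in> lat (\<beta> e) (\<beta> f)" by (auto elim!: lat_E simp: semilinear_vc[OF b] intro!: lat_I)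
qed

lemma N_lat: "\<beta> \<in> Vpp \<Longrightarrow> \<beta> \<in> N (lat e f) \<longleftrightarrow> \<beta> e \<in> lat e f \<and> \<beta> f \<in> lat e f"
  by (simp add: N_def Vpp_def semilinear_lat lat_subset_iff)

lemma N_scale:
  assumes "lattice L" "c \<noteq> 0" shows "N (scale c ` L) = N L"
proof -
  obtain e f where ef: "form e f \<noteq> 0" "L = lat e f" using assms lattice_iff by blast
  have m: "scale c x \<in> lat (scale c e) (scale c f) \<longleftrightarrow> x \<in> lat e f" for x
    using assms(2) by (auto simp: scale_lat[symmetric] image_iff)
  have "\<beta> \<in> N (scale c ` L) \<longleftrightarrow> \<beta> \<in> N L" if "\<beta> \<in> Vpp" for \<beta>
  proof -
    have "\<beta> (scale c x) \<in> lat (scale c e) (scale c f) \<longleftrightarrow> \<beta> x \<in> lat e f" for x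
    proof -
      define d where "d = \<sigma> c / c"
      have d: "absv d = 1" using assms(2) absv_pos[of c] by (simp add: d_def absv_divide)
      have "\<beta> (scale c x) = scale c (scale d (\<beta> x))"
        using that assms(2) by (simp add: Vpp_def semilinear_def d_def)
      then show ?thesis by (simp only: m lat_scale_unit[OF d])
    qed
    then show ?thesis unfolding ef scale_lat N_lat[OF that] by simp
  qed
  moreover have "N L' \<subseteq> Vpp" for L' by (auto simp: N_def)
  ultimately show ?thesis by blast
qed

lemma homothety_class_self: "L \<in> homothety_class L"
  unfolding homothety_class_def by (intro CollectI exI[of _ 1]) simp

lemma scale_image: "scale a ` scale c ` L = scale (a * c) ` L"
  by (simp add: image_image)

lemma homothety_class_eqI:
  assumes c: "c \<noteq> 0" shows "homothety_class (scale c ` L) = homothety_class L"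
proof (intro equalityI subsetI)
  fix X assume "X \<in> homothety_class (scale c ` L)"
  then obtain a where "a \<noteq> 0" "X = scale (a * c) ` L" by (auto simp: homothety_class_def scale_image)
  then show "X \<in> homothety_class L" using c unfolding homothety_class_def by (intro CollectI exI[of _ "a * c"]) simp
next
  fix X assume "X \<in> homothety_class L"
  then obtain a where "a \<noteq> 0" "X = scale a ` L" by (auto simp: homothety_class_def)
  then show "X \<in> homothety_class (scale c ` L)"
    using c unfolding homothety_class_def scale_image by (intro CollectI exI[of _ "a / c"]) simp
qed

lemma homothety_class_eq_iff:
  "homothety_class L = homothety_class L' \<longleftrightarrow> (\<exists>c. c \<noteq> 0 \<and> L' = scale c ` L)"
proof
  assume "homothety_class L = homothety_class L'"
  then have "L' \<in> homothety_class L" using homothety_class_self by blast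
  then show "\<exists>c. c \<noteq> 0 \<and> L' = scale c ` L" by (auto simp: homothety_class_def)
qed (auto simp: homothety_class_eqI)

subsection \<open>Coordinates on the space of endomorphisms\<close>

text \<open>With respect to a basis with rational product the quadratic space is the form \<open>q\<close>.\<close>

definition op :: "'u \<Rightarrow> 'u \<Rightarrow> 'k^4 \<Rightarrow> 'u \<Rightarrow> 'u" where
  "op e f x u = (let a = \<sigma> (form u f / form e f); b = \<sigma> (form e u / form e f) in
     vc e f (a * (x$1 + x$2 * \<delta>) + b * (x$3 * \<delta>)) (a * (- (x$4 * inverse \<delta>)) + b * (x$1 - x$2 * \<delta>)))"

definition qvec :: "('k^'n) set" where "qvec = {v. \<forall>i. v$i \<in> Qp}"

lemma op_vc:
  assumes "form e f \<noteq> 0"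
  shows "op e f x (vc e f a b) =
    vc e f (\<sigma> a * (x$1 + x$2 * \<delta>) + \<sigma> b * (x$3 * \<delta>)) (\<sigma> a * (- (x$4 * inverse \<delta>)) + \<sigma> b * (x$1 - x$2 * \<delta>))"
  using form_vc[of e f a b 0 1] form_vc[of e f 1 0 a b] assms by (simp add: op_def Let_def)

lemma \<sigma>_simps: "\<sigma> \<delta> = - \<delta>" "\<sigma> (x / y) = \<sigma> x / \<sigma> y"
  using \<delta>_props(4) by (simp_all add: divide_inverse \<sigma>_mult \<sigma>_inverse)

lemma op_semilinear: "form e f \<noteq> 0 \<Longrightarrow> semilinear (op e f x)"
proof -
  assume ef: "form e f \<noteq> 0"
  have "op e f x (u + v) = op e f x u + op e f x v" for u v
  proof -
    obtain a b c d where uv: "u = vc e f a b" "v = vc e f c d" using vc_exhaust[OF ef] by metis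
    show ?thesis unfolding uv vc_add op_vc[OF ef] vc_eq_iff[OF ef] by (simp add: \<sigma>_add distrib_right)
  qed
  moreover have "op e f x (scale c u) = scale (\<sigma> c) (op e f x u)" for c u
  proof -
    obtain a b where u: "u = vc e f a b" using vc_exhaust[OF ef] by metis
    show ?thesis unfolding u scale_vc op_vc[OF ef] vc_eq_iff[OF ef] by (simp add: \<sigma>_mult algebra_simps)
  qed
  ultimately show ?thesis by (simp add: semilinear_def)
qed

lemma op_Vpp:
  assumes ef: "form e f \<noteq> 0" "form e f \<in> Qp" and x: "x \<in> qvec" shows "op e f x \<in> Vpp"
proof -
  have s: "\<sigma> (form e f) = form e f" "\<sigma> (x$i) = x$i" for i
    using ef x by (auto simp: qvec_def \<sigma>_Qp)
  have "form (op e f x u) v = \<sigma> (form u (op e f x v))" for u v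
  proof -
    obtain a b where u: "u = vc e f a b" using vc_exhaust[OF ef(1)] by blast
    obtain c d where v: "v = vc e f c d" using vc_exhaust[OF ef(1)] by blast
    show ?thesis unfolding u v op_vc[OF ef(1)] form_vc
      by (simp add: \<sigma>_mult \<sigma>_add \<sigma>_diff \<sigma>_simps \<sigma>_inverse s) (simp add: algebra_simps)
  qed
  then show ?thesis using op_semilinear[OF ef(1)] by (simp add: Vpp_def is_adjoint_def)
qed

text \<open>
  For the matrix of \<open>\<beta>\<close> in a basis with rational product, self-adjointness says that the diagonal entries are conjugate and
  the other two entries are rational multiples of \<open>\<delta>\<close>.
\<close>

lemma Vpp_op:
  assumes ef: "form e f \<noteq> 0" "form e f \<in> Qp" and b: "\<beta> \<in> Vpp"
  obtains x where "x \<in> qvec" "\<beta> = op e f x"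
proof -
  have sl: "semilinear \<beta>" and adj: "\<And>u v. form (\<beta> u) v = \<sigma> (form u (\<beta> v))"
    using b by (auto simp: Vpp_def is_adjoint_def)
  obtain a c where e: "\<beta> e = vc e f a c" using vc_exhaust[OF ef(1)] by blast
  obtain b d where f: "\<beta> f = vc e f b d" using vc_exhaust[OF ef(1)] by blast
  have s: "\<sigma> (form e f) = form e f" using ef by (simp add: \<sigma>_Qp)
  have k: "form (vc e f x y) f = x * form e f" "form e (vc e f x y) = y * form e f"
    "form (vc e f x y) e = - y * form e f" "form f (vc e f x y) = - x * form e f" for x y
    using form_vc[of e f x y 0 1] form_vc[of e f 1 0 x y] form_vc[of e f x y 1 0] form_vc[of e f 0 1 x y] by simp_all
  have "\<sigma> d * form e f = a * form e f" using adj[of e f] unfolding e f k by (simp only: \<sigma>_mult s)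
  moreover have "\<sigma> c * form e f = (- c) * form e f" using adj[of e e] unfolding e f k by (simp only: \<sigma>_mult s)
  moreover have "\<sigma> (- b) * form e f = b * form e f" using adj[of f f] unfolding e f k by (simp only: \<sigma>_mult s)
  ultimately have "\<sigma> d = a" "\<sigma> c = - c" "- \<sigma> b = b" using ef(1) by (simp_all only: mult_cancel_right) simp_all
  then have r: "\<sigma> a = d" "\<sigma> c = - c" "\<sigma> b = - b" by (auto simp: minus_equation_iff[of "\<sigma> b"])
  obtain x1 x2 where a: "a = x1 + x2 * \<delta>" "x1 \<in> Qp" "x2 \<in> Qp" using \<delta>_props(5)[of a] by blast
  have "b * inverse \<delta> \<in> Qp" "- c * \<delta> \<in> Qp"
    unfolding \<sigma>_fixed_iff[symmetric] by (simp_all add: \<sigma>_simps \<sigma>_mult \<sigma>_inverse r)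
  moreover define x :: "'k^4" where "x = vector [x1, x2, b * inverse \<delta>, - c * \<delta>]"
  ultimately have x: "x \<in> qvec" using a by (simp add: qvec_def forall_4)
  have "d = x1 - x2 * \<delta>" using r(1) a by (simp add: \<sigma>_coords)
  then have "\<beta> u = op e f x u" for u
  proof -
    obtain y z where u: "u = vc e f y z" using vc_exhaust[OF ef(1)] by blast
    have "\<beta> u = vc e f (\<sigma> y * a + \<sigma> z * b) (\<sigma> y * c + \<sigma> z * d)"
      unfolding u semilinear_vc[OF sl] e f by (simp add: vc_def scale_right_distrib scale_left_distrib algebra_simps)
    moreover have cd: "c * \<delta> * inverse \<delta> = c" "b * inverse \<delta> * \<delta> = b" by simp_all
    ultimately show ?thesis using \<open>d = _\<close> unfolding u op_vc[OF ef(1)] by (simp add: x_def a cd)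
  qed
  then show ?thesis using that[OF x] by auto
qed

lemma op_comb:
  fixes Y :: "'k^4^3"
  assumes "form e f \<noteq> 0" shows "comb v (\<lambda>i. op e f (Y$i)) = op e f (v v* Y)"
proof
  fix u obtain a b where u: "u = vc e f a b" using vc_exhaust[OF assms] by blast
  show "comb v (\<lambda>i. op e f (Y$i)) u = op e f (v v* Y) u"
    unfolding u op_vc[OF assms] comb_def sum_3 scale_vc vc_add vc_eq_iff[OF assms]
    by (simp add: vector_matrix_mult_def sum_3 algebra_simps)
qed

lemma op_square:
  assumes ef: "form e f \<noteq> 0" and x: "x \<in> qvec" shows "op e f x (op e f x u) = scale (q x) u"
proof -
  obtain a b where u: "u = vc e f a b" using vc_exhaust[OF ef] by blast
  have s: "\<sigma> (x$i) = x$i" for i using x by (auto simp: qvec_def \<sigma>_Qp)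
  define i where "i = inverse \<delta>"
  have i: "i * \<delta> = 1" "\<sigma> i = - i" by (simp_all add: i_def \<sigma>_inverse \<sigma>_simps)
  have "(a * (x$1 - x$2 * \<delta>) - b * (x$3 * \<delta>)) * (x$1 + x$2 * \<delta>) + (a * (x$4 * i) + b * (x$1 + x$2 * \<delta>)) * (x$3 * \<delta>)
      = a * (x$1^2 - D * x$2^2) + (i * \<delta>) * (a * (x$3 * x$4))"
    "- ((a * (x$1 - x$2 * \<delta>) - b * (x$3 * \<delta>)) * (x$4 * i)) + (a * (x$4 * i) + b * (x$1 + x$2 * \<delta>)) * (x$1 - x$2 * \<delta>)
      = b * (x$1^2 - D * x$2^2) + (i * \<delta>) * (b * (x$3 * x$4))"
    by (simp_all only: power2_eq_square) (simp_all add: algebra_simps)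
  then have "(a * (x$1 - x$2 * \<delta>) - b * (x$3 * \<delta>)) * (x$1 + x$2 * \<delta>) + (a * (x$4 * i) + b * (x$1 + x$2 * \<delta>)) * (x$3 * \<delta>) = q x * a"
    "- ((a * (x$1 - x$2 * \<delta>) - b * (x$3 * \<delta>)) * (x$4 * i)) + (a * (x$4 * i) + b * (x$1 + x$2 * \<delta>)) * (x$1 - x$2 * \<delta>) = q x * b"
    by (simp_all only: i(1) q_def mult_1_left distrib_right mult.commute[of _ a] mult.commute[of _ b] distrib_left)
  then show ?thesis unfolding u op_vc[OF ef] scale_vc vc_eq_iff[OF ef] i_def[symmetric]
    by (simp add: \<sigma>_mult \<sigma>_add \<sigma>_diff \<sigma>_simps i(2) s add.commute)
qed

lemma Q_unique:
  assumes "c \<in> Qp" "\<And>u. \<beta> (\<beta> u) = scale c u" shows "Q \<beta> = c"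
  unfolding Q_def
proof (rule the_equality)
  fix c' assume c': "c' \<in> Qp \<and> (\<forall>u. \<beta> (\<beta> u) = scale c' u)"
  have "\<exists>u::'u. u \<noteq> 0"
  proof (rule ccontr)
    assume "\<nexists>u::'u. u \<noteq> 0"
    then have "UNIV \<subseteq> span {}" by auto
    then show False using dim_le_card[of UNIV "{}"] dim_2 by simp
  qed
  then obtain u :: 'u where "u \<noteq> 0" by blast
  moreover have "scale c' u = scale c u" using assms(2)[of u] c' by simp
  ultimately show "c' = c" by simp
qed (use assms in blast)

lemma q_Qp: "x \<in> qvec \<Longrightarrow> q x \<in> Qp"
  by (auto simp: q_def qvec_def intro!: Qp_add Qp_diff Qp_mult Qp_power \<delta>_props(2))

lemma Q_op: "form e f \<noteq> 0 \<Longrightarrow> x \<in> qvec \<Longrightarrow> Q (op e f x) = q x"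
  by (rule Q_unique) (auto simp: q_Qp op_square)

lemma op_add: "form e f \<noteq> 0 \<Longrightarrow> (\<lambda>u. op e f x u + op e f y u) = op e f (x + y)"
  unfolding op_def Let_def vc_add by (simp add: algebra_simps)

lemma bil_op:
  assumes "form e f \<noteq> 0" "x \<in> qvec" "y \<in> qvec" shows "bil (op e f x) (op e f y) = 2 * h x y"
proof -
  have "x + y \<in> qvec" using assms by (simp add: qvec_def Qp_add)
  then have "bil (op e f x) (op e f y) = q (x + y) - q x - q y"
    using assms by (simp add: bil_def op_add Q_op)
  then show ?thesis by (simp add: h_self[symmetric] h_add_left h_add_right h_commute[of y x])
qed

lemma Q_matrix_op:
  assumes "form e f \<noteq> 0" "\<And>i. Y$i \<in> qvec" shows "Q_matrix (\<lambda>i. op e f (Y$i)) = gram Y"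
  using assms by (simp add: Q_matrix_def gram_def bil_op)

lemma op_N:
  assumes ef: "form e f \<noteq> 0" "form e f \<in> Qp" and x: "x \<in> qvec"
  shows "op e f x \<in> N (lat e f) \<longleftrightarrow> x \<in> pvec 0"
proof -
  have c: "x$i \<in> Qp" for i using x by (simp add: qvec_def)
  have "absv (x$1 - x$2 * \<delta>) = max (absv (x$1)) (absv (x$2))"
    using absv_coords[of "x$1" "- x$2"] c by (simp add: Qp_uminus)
  then show ?thesis
    unfolding N_lat[OF op_Vpp[OF assms]]
    using op_vc[OF ef(1), of x 1 0] op_vc[OF ef(1), of x 0 1] absv_coords[of "x$1" "x$2"] c
    by (auto simp: vc_lat[OF ef(1)] pvec4_iff pideal_0 Zp_def absv_inverse absv_mult \<delta>_props(1))
qed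

end

section \<open>Counting the lattices stable under three endomorphisms\<close>

context symplectic_plane
begin

lemma semilinear_simps:
  assumes "semilinear g"
  shows "g (x + y) = g x + g y" "g (scale c x) = scale (\<sigma> c) (g x)" "g 0 = 0" "g (- x) = - g x" "g (x - y) = g x - g y"
proof -
  show a: "g (x + y) = g x + g y" for x y using assms by (simp add: semilinear_def)
  show s: "g (scale c x) = scale (\<sigma> c) (g x)" for c x using assms by (simp add: semilinear_def)
  show z: "g 0 = 0" using s[of 0 0] by simp
  show m: "g (- x) = - g x" for x using s[of "-1" x] by simp
  show "g (x - y) = g x - g y" using a[of x "- y"] by (simp add: m)
qed

text \<open>
  The product \<open>J\<close> of the first two of three anticommuting endomorphisms with squares \<open>1\<close>, \<open>- D\<close>, \<open>u\<close> is
  linear with square \<open>D = \<delta>\<^sup>2\<close>.  Its eigenlines for \<open>\<delta>\<close> and \<open>- \<delta>\<close> are kept by the first endomorphism, which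
  is the identity on suitable generators, and exchanged by the third.
\<close>

lemma eigenbasis:
  assumes sl: "semilinear g1" "semilinear g2" "semilinear g3"
    and sq: "\<And>x. g1 (g1 x) = x" "\<And>x. g2 (g2 x) = scale (- D) x" "\<And>x. g3 (g3 x) = scale u x"
    and anti: "\<And>x. g2 (g1 x) = - g1 (g2 x)" "\<And>x. g3 (g1 x) = - g1 (g3 x)" "\<And>x. g3 (g2 x) = - g2 (g3 x)"
    and u: "u \<noteq> 0" and ex: "(w :: 'u) \<noteq> 0"
  obtains e f where "form e f \<noteq> 0" "g1 e = e" "g1 f = f" "g2 e = scale (- \<delta>) e" "g2 f = scale \<delta> f"
    "g3 e = scale \<delta> f" "g3 f = scale (- (u * inverse \<delta>)) e"
proof -
  note s1 = semilinear_simps[OF sl(1)] and s2 = semilinear_simps[OF sl(2)] and s3 = semilinear_simps[OF sl(3)]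
  define J where "J x = g1 (g2 x)" for x
  have J_add: "J (x + y) = J x + J y" "J (x - y) = J x - J y" and J_scale: "J (scale c x) = scale c (J x)" for x y c
    by (simp_all add: J_def s1 s2)
  have JJ: "J (J x) = scale D x" for x
  proof -
    have "J (J x) = - g1 (g1 (g2 (g2 x)))" unfolding J_def anti(1) s1(4) ..
    then show ?thesis by (simp only: sq) simp
  qed
  have J1: "J (g1 x) = - g1 (J x)" for x unfolding J_def anti(1) s1(4) ..
  have J3: "J (g3 x) = g3 (J x)" for x
  proof -
    have "g3 (J x) = - g1 (g3 (g2 x))" unfolding J_def anti(2) ..
    also have "\<dots> = J (g3 x)" unfolding J_def anti(3) s1(4) by simp
    finally show ?thesis ..
  qed
  have g3z: "x = 0" if "g3 x = 0" for x
  proof -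
    have "scale u x = 0" using sq(3)[of x] that s3(3) by simp
    then show ?thesis using u by simp
  qed
  have "\<exists>e0. e0 \<noteq> 0 \<and> J e0 = scale \<delta> e0"
  proof (cases "J w + scale \<delta> w = 0")
    case False
    have "J (J w + scale \<delta> w) = scale \<delta> (J w + scale \<delta> w)"
      unfolding J_add J_scale JJ scale_right_distrib by (simp add: power2_eq_square add.commute)
    then show ?thesis using False by blast
  next
    case True
    then have "J w = scale (- \<delta>) w" by (simp add: add_eq_0_iff)
    \<comment> \<open>If \<open>w\<close> lies in the eigenline for \<open>- \<delta>\<close>, the third endomorphism takes it to the other one.\<close>
    then have "J (g3 w) = scale \<delta> (g3 w)" unfolding J3 by (simp add: s3(4) s3(2) \<sigma>_simps)
    moreover have "g3 w \<noteq> 0" using g3z ex by blast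
    ultimately show ?thesis by blast
  qed
  then obtain e0 where e0: "e0 \<noteq> 0" "J e0 = scale \<delta> e0" by blast
  have Jg1: "J (g1 e0) = scale \<delta> (g1 e0)" unfolding J1 e0(2) by (simp add: s1(4) s1(2) \<sigma>_simps)
  obtain e where e: "e \<noteq> 0" "J e = scale \<delta> e" "g1 e = e"
  proof (cases "e0 + g1 e0 = 0")
    case False
    moreover have "J (e0 + g1 e0) = scale \<delta> (e0 + g1 e0)" unfolding J_add Jg1 e0(2) scale_right_distrib ..
    moreover have "g1 (e0 + g1 e0) = e0 + g1 e0" unfolding s1(1) sq(1) by (rule add.commute)
    ultimately show thesis by (rule that)
  next
    case True
    then have g: "g1 e0 = - e0" by (simp add: eq_neg_iff_add_eq_0 add.commute)
    \<comment> \<open>By semilinearity, \<open>g1\<close> fixes \<open>\<delta> e0\<close> if it negates \<open>e0\<close>.\<close>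
    have "J (scale \<delta> e0) = scale \<delta> (scale \<delta> e0)" unfolding J_scale e0(2) ..
    moreover have "g1 (scale \<delta> e0) = scale \<delta> e0" unfolding s1(2) g by (simp add: \<sigma>_simps)
    moreover have "scale \<delta> e0 \<noteq> 0" using e0(1) by simp
    ultimately show thesis using that by blast
  qed
  have g2e: "g2 e = scale (- \<delta>) e"
  proof -
    have "g2 e = g1 (J e)" by (simp only: J_def sq(1))
    then show ?thesis by (simp add: e(2) s1(2) e(3) \<sigma>_simps)
  qed
  define f where "f = scale (inverse \<delta>) (g3 e)"
  have g3e: "g3 e = scale \<delta> f" by (simp add: f_def)
  have si: "\<sigma> (inverse \<delta>) = - inverse \<delta>" by (simp add: \<sigma>_inverse \<sigma>_simps)
  have g1f: "g1 f = f"
  proof -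
    have "g1 (g3 e) = - g3 e" using anti(2)[of e] e(3) by (metis minus_minus)
    then show ?thesis by (simp add: f_def s1(2) si)
  qed
  have g2f: "g2 f = scale \<delta> f"
  proof -
    have "g2 (g3 e) = - g3 (g2 e)" using anti(3)[of e] by (metis minus_minus)
    also have "\<dots> = - scale \<delta> (g3 e)" by (simp add: g2e s3(2) s3(4) \<sigma>_simps)
    finally show ?thesis by (simp add: f_def s2(2) si mult.commute)
  qed
  have g3f: "g3 f = scale (- (u * inverse \<delta>)) e"
    by (simp add: f_def s3(2) si sq(3) mult.commute)
  have Jf: "J f = scale (- \<delta>) f" unfolding J_def g2f s1(2) g1f by (simp add: \<sigma>_simps)
  have "form e f \<noteq> 0"
  proof
    assume z: "form e f = 0"
    obtain g where g: "form e g \<noteq> 0" using form_nondegenerate e(1) by blast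
    obtain c where c: "f = scale c e"
      using basis_expand[OF g, of f] by (simp add: z vc_def)
    then have "J f = scale \<delta> f" by (simp add: J_scale e(2) mult.commute)
    then have "scale \<delta> f = - scale \<delta> f" using Jf by simp
    then have "scale (\<delta> + \<delta>) f = 0" unfolding scale_left_distrib by (simp only: eq_neg_iff_add_eq_0)
    moreover have "\<delta> + \<delta> \<noteq> 0" using \<delta>_nonzero by (simp flip: mult_2)
    ultimately have "f = 0" by (simp only: scale_eq_0_iff) blast
    then have "g3 e = 0" using g3e by simp
    then show False using g3z e(1) by blast
  qed
  then show thesis using that e(3) g1f g2e g2f g3e g3f by blast
qed

text \<open>
  A lattice stable under \<open>(a, b) \<mapsto> (\<delta> a, - \<delta> b)\<close> is the sum of its intersections with the two eigenlines, since \<open>2\<close>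
  and \<open>\<delta>\<close> are units.
\<close>

lemma split_lattice:
  assumes ef: "form e f \<noteq> 0" and L: "lattice L"
    and J: "\<And>a b. vc e f a b \<in> L \<Longrightarrow> vc e f (\<delta> * a) (- (\<delta> * b)) \<in> L"
  obtains c x where "c \<noteq> 0" "x \<noteq> 0" "L = scale c ` lat e (scale x f)"
proof -
  obtain e1 f1 where L': "form e1 f1 \<noteq> 0" "L = lat e1 f1" using L lattice_iff by blast
  have proj: "vc e f a 0 \<in> L" "vc e f 0 b \<in> L" if m: "vc e f a b \<in> L" for a b
  proof -
    have d: "absv (inverse \<delta>) \<le> 1" "absv (inverse 2) \<le> 1" by (simp_all add: absv_inverse absv_divide \<delta>_props(1))
    have "scale (inverse \<delta>) (vc e f (\<delta> * a) (- (\<delta> * b))) \<in> L" using J[OF m] d lat_scale unfolding L'(2) by blast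
    moreover have "inverse \<delta> * (\<delta> * y) = y" for y by (simp flip: mult.assoc)
    ultimately have m2: "vc e f a (- b) \<in> L" by (simp add: scale_vc)
    have "scale (inverse 2) (vc e f a b + vc e f a (- b)) \<in> L"
      using lat_scale[OF lat_add[OF m[unfolded L'(2)] m2[unfolded L'(2)]] d(2)] L'(2) by simp
    then show a: "vc e f a 0 \<in> L" by (simp add: vc_add scale_vc flip: mult_2)
    have "vc e f a b + scale (- 1) (vc e f a 0) \<in> L"
      using lat_add[OF m[unfolded L'(2)] lat_scale[OF a[unfolded L'(2)], of "- 1"]] L'(2) by simp
    then show "vc e f 0 b \<in> L" by (simp only: vc_add scale_vc) simp
  qed
  obtain a1 b1 where e1: "e1 = vc e f a1 b1" using vc_exhaust[OF ef] by blast
  obtain a2 b2 where f1: "f1 = vc e f a2 b2" using vc_exhaust[OF ef] by blast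
  have m: "vc e f a1 b1 \<in> L" "vc e f a2 b2 \<in> L" using lat_basis[of e1 f1] by (simp_all add: e1 f1 L'(2))
  define a where "a = (if absv a1 \<le> absv a2 then a2 else a1)"
  define b where "b = (if absv b1 \<le> absv b2 then b2 else b1)"
  have a: "absv a1 \<le> absv a" "absv a2 \<le> absv a" by (simp_all add: a_def)
  have b: "absv b1 \<le> absv b" "absv b2 \<le> absv b" by (simp_all add: b_def)
  have ab: "vc e f a 0 \<in> L" "vc e f 0 b \<in> L" unfolding a_def b_def using proj[OF m(1)] proj[OF m(2)] by simp_all
  have nz: "a \<noteq> 0" "b \<noteq> 0"
  proof -
    have "a1 = 0 \<and> a2 = 0" if "a = 0" using a that absv_nonneg[of a1] absv_nonneg[of a2] absv_eq_0 by (metis absv_0 antisym)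
    moreover have "b1 = 0 \<and> b2 = 0" if "b = 0" using b that absv_nonneg[of b1] absv_nonneg[of b2] absv_eq_0 by (metis absv_0 antisym)
    ultimately show "a \<noteq> 0" "b \<noteq> 0" using L'(1) by (auto simp: e1 f1 form_vc)
  qed
  have v: "vc e f x y = vc (scale a e) (scale b f) (x / a) (y / b)" for x y using nz by (simp add: vc_scaled)
  have le: "absv (x / y) \<le> 1" if "absv x \<le> absv y" "y \<noteq> 0" for x y
    using that absv_pos[of y] by (simp add: absv_divide)
  have "e1 \<in> lat (scale a e) (scale b f)" "f1 \<in> lat (scale a e) (scale b f)"
    unfolding e1 f1 v using a b nz by (auto intro!: lat_I le)
  then have "L \<subseteq> lat (scale a e) (scale b f)" by (simp add: L'(2) lat_subset_iff)
  moreover have "lat (scale a e) (scale b f) \<subseteq> L" using ab by (simp add: L'(2) lat_subset_iff vc_def)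
  ultimately have "L = lat (scale a e) (scale b f)" by (rule antisym)
  also have "\<dots> = scale a ` lat e (scale (b / a) f)" using nz by (simp add: scale_lat)
  finally show thesis using that[of a "b / a"] nz by simp
qed

text \<open>The counterpart of \<open>sat\<close> for a lattice: both agree if \<open>Y\<close> holds the coordinates of \<open>\<beta>\<close> in a
  basis of \<open>L\<close> with rational product.\<close>

definition satV :: "(3 \<Rightarrow> 'u \<Rightarrow> 'u) \<Rightarrow> 'u set \<Rightarrow> ('k^3) set" where
  "satV \<beta> L = {v \<in> qvec. comb v \<beta> \<in> N L}"

lemma qvec_mult: "v \<in> qvec \<Longrightarrow> (\<And>i. Y$i \<in> qvec) \<Longrightarrow> v v* Y \<in> qvec"
  unfolding qvec_def by (auto simp: vector_matrix_mult_def intro!: Qp_sum Qp_mult)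

lemma satV_op:
  fixes Y :: "'k^4^3"
  assumes "form e f \<noteq> 0" "form e f \<in> Qp" "\<And>i. Y$i \<in> qvec"
  shows "satV (\<lambda>i. op e f (Y$i)) (lat e f) = sat Y"
proof -
  have "comb v (\<lambda>i. op e f (Y$i)) \<in> N (lat e f) \<longleftrightarrow> v v* Y \<in> pvec 0" if "v \<in> qvec" for v
    unfolding op_comb[OF assms(1)] by (rule op_N[OF assms(1,2) qvec_mult[OF that assms(3)]])
  then have "satV (\<lambda>i. op e f (Y$i)) (lat e f) = {v \<in> qvec. v v* Y \<in> pvec 0}" unfolding satV_def by blast
  then show ?thesis by (simp add: sat_def qvec_def)
qed

lemma satV_class:
  assumes "lattice L" "homothety_class L = homothety_class L'" shows "satV \<beta> L = satV \<beta> L'"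
proof -
  obtain c where "c \<noteq> 0" "L' = scale c ` L" using assms(2) unfolding homothety_class_eq_iff by blast
  then show ?thesis using N_scale[OF assms(1)] by (simp add: satV_def)
qed

definition lclass :: "(3 \<Rightarrow> 'u \<Rightarrow> 'u) \<Rightarrow> ('k^3) set \<Rightarrow> 'u set set set" where
  "lclass \<beta> M = {homothety_class L | L. lattice L \<and> satV \<beta> L = M}"

lemma op_anticommute:
  assumes ef: "form e f \<noteq> 0" and x: "x \<in> qvec" "y \<in> qvec"
  shows "op e f x (op e f y u) + op e f y (op e f x u) = scale (2 * h x y) u"
proof -
  have xy: "x + y \<in> qvec" using x by (simp add: qvec_def Qp_add)
  have a: "op e f (x + y) v = op e f x v + op e f y v" for v using op_add[OF ef, of x y] by metis
  note s = semilinear_simps(1)[OF op_semilinear[OF ef]]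
  have q2: "q (x + y) = q x + q y + 2 * h x y"
    by (simp add: h_self[symmetric] h_add_left h_add_right h_commute[of y x])
  have "op e f (x + y) (op e f (x + y) u) = op e f x (op e f x u) + op e f y (op e f y u)
      + (op e f x (op e f y u) + op e f y (op e f x u))"
    unfolding a s by (simp only: add_ac)
  then have "scale (q x + q y + 2 * h x y) u = scale (q x) u + scale (q y) u
      + (op e f x (op e f y u) + op e f y (op e f x u))"
    unfolding op_square[OF ef x(1)] op_square[OF ef x(2)] op_square[OF ef xy] q2 .
  then show ?thesis by (simp only: scale_left_distrib add_left_cancel)
qed

text \<open>
  In the eigenbasis the stable lattices are \<open>lat e (x f)\<close>; the third endomorphism and its multiples restrict
  the absolute value of \<open>x\<close> to be \<open>1\<close> or that of \<open>1/u\<close>.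
\<close>

lemma card_lclass_dg:
  assumes ef0: "form e0 f0 \<noteq> 0" "form e0 f0 \<in> Qp" and Z: "\<And>i. Z$i \<in> qvec" "gram Z = dg u" and u: "u \<in> Zp" "u \<noteq> 0"
  shows "finite (lclass (\<lambda>i. op e0 f0 (Z$i)) (pvec 0))"
    and "card (lclass (\<lambda>i. op e0 f0 (Z$i)) (pvec 0)) = (if absv u = 1 then 1 else 2)"
proof -
  define g where "g i = op e0 f0 (Z$i)" for i
  have hz: "h (Z$i) (Z$j) = dg u $ i $ j" for i j using Z(2) by (simp add: gram_def vec_eq_iff)
  have gV: "g i \<in> Vpp" for i unfolding g_def by (rule op_Vpp[OF ef0 Z(1)])
  have sl: "semilinear (g i)" for i using gV by (simp add: Vpp_def)
  have sq: "g i (g i x) = scale (dg u $ i $ i) x" for i x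
    unfolding g_def op_square[OF ef0(1) Z(1)] by (simp add: h_self[symmetric] hz)
  have anti: "g i (g j x) = - g j (g i x)" if "dg u $ j $ i = 0" for i j x
  proof -
    have "g i (g j x) + g j (g i x) = 0"
      unfolding g_def op_anticommute[OF ef0(1) Z(1) Z(1)] using that hz[of j i] by (simp add: h_commute)
    then show ?thesis by (simp add: eq_neg_iff_add_eq_0)
  qed
  have e0: "e0 \<noteq> 0" using ef0(1) by auto
  obtain e f where ef: "form e f \<noteq> 0" and ge: "g 1 e = e" "g 1 f = f" "g 2 e = scale (- \<delta>) e" "g 2 f = scale \<delta> f"
    "g 3 e = scale \<delta> f" "g 3 f = scale (- (u * inverse \<delta>)) e"
  proof (rule eigenbasis[OF sl[of 1] sl[of 2] sl[of 3]])
    show "g 1 (g 1 x) = x" "g 2 (g 2 x) = scale (- D) x" "g 3 (g 3 x) = scale u x" for x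
      using sq[of 1 x] sq[of 2 x] sq[of 3 x] by simp_all
    show "g 2 (g 1 x) = - g 1 (g 2 x)" "g 3 (g 1 x) = - g 1 (g 3 x)" "g 3 (g 2 x) = - g 2 (g 3 x)" for x
      by (rule anti; simp)+
    show "u \<noteq> 0" "e0 \<noteq> 0" by (fact u(2) e0)+
  qed (rule that)
  have comb_e: "comb v g e = vc e f (v$1 - v$2 * \<delta>) (v$3 * \<delta>)"
    and comb_f: "comb v g f = vc e f (- (v$3 * (u * inverse \<delta>))) (v$1 + v$2 * \<delta>)" for v
    by (simp_all add: comb_def sum_3 ge vc_def scale_left_diff_distrib scale_left_distrib)
  have combV: "comb v g \<in> Vpp" if "v \<in> qvec" for v
    unfolding g_def op_comb[OF ef0(1)] by (rule op_Vpp[OF ef0 qvec_mult[OF that Z(1)]])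
  have efx: "form e (scale x f) \<noteq> 0" if "x \<noteq> 0" for x using ef that by (simp add: form_scale_right)
  have memx: "vc e f a b \<in> lat e (scale x f) \<longleftrightarrow> absv a \<le> 1 \<and> absv b \<le> absv x" if "x \<noteq> 0" for a b x
  proof -
    have "vc e f a b = vc e (scale x f) a (b / x)" using that by (simp add: vc_def)
    then show ?thesis using vc_lat[OF efx[OF that]] absv_pos[OF that] by (simp add: absv_divide)
  qed
  have sat: "satV g (lat e (scale x f)) = {v \<in> qvec. absv (v$1) \<le> 1 \<and> absv (v$2) \<le> 1 \<and>
      absv (v$3) \<le> absv x \<and> absv x * absv (v$3) * absv u \<le> 1}" if x: "x \<noteq> 0" for x
  proof -
    have "comb v g \<in> N (lat e (scale x f)) \<longleftrightarrow> absv (v$1) \<le> 1 \<and> absv (v$2) \<le> 1 \<and>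
      absv (v$3) \<le> absv x \<and> absv x * absv (v$3) * absv u \<le> 1" if v: "v \<in> qvec" for v
    proof -
      have c: "v$i \<in> Qp" for i using v by (simp add: qvec_def)
      have n1: "absv (v$1 - v$2 * \<delta>) = max (absv (v$1)) (absv (v$2))"
        using absv_coords[of "v$1" "- v$2"] c by (simp add: Qp_uminus)
      have n2: "absv (v$1 + v$2 * \<delta>) = max (absv (v$1)) (absv (v$2))" using absv_coords[of "v$1" "v$2"] c by simp
      have f: "comb v g (scale x f) = vc e f (\<sigma> x * (- (v$3 * (u * inverse \<delta>)))) (\<sigma> x * (v$1 + v$2 * \<delta>))"
        using semilinear_simps(2)[of "comb v g"] combV[OF v] by (simp add: Vpp_def comb_f scale_vc)
      have "comb v g e \<in> lat e (scale x f) \<longleftrightarrow> max (absv (v$1)) (absv (v$2)) \<le> 1 \<and> absv (v$3) \<le> absv x"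
        unfolding comb_e memx[OF x] n1 by (simp add: absv_mult \<delta>_props(1))
      moreover have "comb v g (scale x f) \<in> lat e (scale x f) \<longleftrightarrow>
          absv x * absv (v$3) * absv u \<le> 1 \<and> max (absv (v$1)) (absv (v$2)) \<le> 1"
      proof -
        have "absv (\<sigma> x * (- (v$3 * (u * inverse \<delta>)))) = absv x * absv (v$3) * absv u"
          by (simp only: absv_mult absv_minus absv_inverse \<delta>_props(1) absv_\<sigma>) simp
        moreover have "absv (\<sigma> x * (v$1 + v$2 * \<delta>)) = absv x * max (absv (v$1)) (absv (v$2))"
          by (simp only: absv_mult n2 absv_\<sigma>)
        ultimately show ?thesis unfolding f memx[OF x]
          using mult_le_cancel_left_pos[OF absv_pos[OF x], of "max (absv (v$1)) (absv (v$2))" 1] by simp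
      qed
      ultimately show ?thesis unfolding N_lat[OF combV[OF v]] by auto
    qed
    then show ?thesis unfolding satV_def by blast
  qed
  have u1: "absv u \<le> 1" "0 < absv u" using u absv_pos by (auto simp: Zp_def)
  have prim: "satV g (lat e (scale x f)) = pvec 0 \<longleftrightarrow> absv x = 1 \<or> absv x * absv u = 1" if x: "x \<noteq> 0" for x
  proof
    assume s: "satV g (lat e (scale x f)) = pvec 0"
    \<comment> \<open>Saturation is tested on the multiples \<open>c\<close> of the third endomorphism; \<open>c = 1/p\<close> must fail.\<close>
    have ax: "absv c \<le> absv x \<and> absv x * absv c * absv u \<le> 1 \<longleftrightarrow> absv c \<le> 1" if "c \<in> Qp" for c
    proof -
      have "vector [0, 0, c] \<in> satV g (lat e (scale x f)) \<longleftrightarrow> vector [0, 0, c] \<in> (pvec 0 :: ('k^3) set)" by (simp only: s)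
      then show ?thesis using that by (simp add: sat[OF x] qvec_def pvec_def forall_3 pideal_0 Zp_def)
    qed
    have 1: "1 \<le> absv x" "absv x * absv u \<le> 1" using ax[of 1] Qp_1 by auto
    show "absv x = 1 \<or> absv x * absv u = 1"
    proof (rule ccontr)
      assume "\<not> (absv x = 1 \<or> absv x * absv u = 1)"
      then have "1 < absv x" "absv (x * u) < 1" using 1 by (auto simp: absv_mult)
      then have "absv (inverse x) < 1" "absv (x * u) < 1" by (simp_all add: absv_inverse inverse_less_1_iff)
      then have "absv (inverse x) \<le> 1 / real p" "absv (x * u) \<le> 1 / real p" using absv_lt1_iff by blast+
      then have "real p \<le> absv x" "absv x * real p * absv u \<le> 1"
        using 1(1) p_pos unfolding absv_inverse absv_mult by (simp_all add: field_simps)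
      moreover have "absv (inverse \<pi>) = real p" by (simp add: absv_inverse absv_p)
      ultimately have "real p \<le> 1" using ax[of "inverse \<pi>"] by (simp add: Qp_inverse)
      then show False using p_gt_1 by simp
    qed
  next
    assume a: "absv x = 1 \<or> absv x * absv u = 1"
    have "absv c \<le> absv x \<and> absv x * absv c * absv u \<le> 1 \<longleftrightarrow> absv c \<le> 1" for c
    proof (cases "absv x = 1")
      case True
      then show ?thesis using mult_le_one[of "absv c" "absv u"] u1 by auto
    next
      case False
      then have 1: "absv x * absv u = 1" using a by blast
      then have "absv x * absv c * absv u = absv c" by (simp add: mult.commute mult.left_commute)
      moreover have "1 \<le> absv x"
      proof (rule ccontr)
        assume "\<not> 1 \<le> absv x"
        then have "absv x * absv u < 1 * 1" using u1 absv_nonneg[of x] by (intro mult_less_le_imp_less) auto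
        then show False using 1 by simp
      qed
      ultimately show ?thesis by linarith
    qed
    then show "satV g (lat e (scale x f)) = pvec 0"
      unfolding sat[OF x] by (auto simp: qvec_def pvec_def forall_3 pideal_0 Zp_def)
  qed
  define c where "c x = homothety_class (lat e (scale x f))" for x
  have lx: "lattice (lat e (scale x f))" if "x \<noteq> 0" for x using lattice_lat[OF efx[OF that]] .
  have ceq: "c x = c y" if "x \<noteq> 0" "y \<noteq> 0" "absv x = absv y" for x y
  proof -
    have "lat (scale 1 e) (scale (x / y) (scale y f)) = lat e (scale y f)"
      using that absv_pos[of y] by (intro lat_unit efx) (simp_all add: absv_divide)
    then show ?thesis using that by (simp add: c_def)
  qed
  have iu: "inverse u \<noteq> 0" "absv (inverse u) * absv u = 1" using u(2) u1 by (simp_all add: absv_inverse)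
  have "lclass g (pvec 0) = {c 1, c (inverse u)}"
  proof (intro equalityI subsetI)
    fix v assume "v \<in> lclass g (pvec 0)"
    then obtain L where L: "v = homothety_class L" "lattice L" "satV g L = pvec 0" by (auto simp: lclass_def)
    have gN: "g i \<in> N L" for i
    proof -
      have "axis i 1 \<in> satV g L" unfolding L(3) by (auto simp: pvec_def axis_def pideal_0)
      moreover have "comb (axis i 1) g = g i" using exhaust_3[of i] by (auto simp: comb_def sum_3 axis_def)
      ultimately show ?thesis by (simp add: satV_def)
    qed
    have J: "vc e f (\<delta> * a) (- (\<delta> * b)) \<in> L" if "vc e f a b \<in> L" for a b
    proof -
      have "g 1 (g 2 (vc e f a b)) \<in> L" using that gN[of 1] gN[of 2] by (auto simp: N_def)
      moreover have "g 1 (g 2 (vc e f a b)) = vc e f (\<delta> * a) (- (\<delta> * b))"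
        unfolding semilinear_vc[OF sl] ge
        by (simp add: vc_def semilinear_simps[OF sl] ge \<sigma>_simps \<sigma>_mult mult.commute)
      ultimately show ?thesis by simp
    qed
    obtain k x where kx: "k \<noteq> 0" "x \<noteq> 0" "L = scale k ` lat e (scale x f)" using split_lattice[OF ef L(2) J] .
    then have v: "v = c x" using L(1) by (simp add: c_def homothety_class_eqI)
    then have "satV g L = satV g (lat e (scale x f))" using satV_class[OF L(2), of "lat e (scale x f)"] L(1) by (simp add: c_def)
    then have "absv x = 1 \<or> absv x * absv u = 1" using L(3) prim[OF kx(2)] by simp
    then show "v \<in> {c 1, c (inverse u)}"
    proof
      assume "absv x = 1" then show ?thesis using ceq[OF kx(2), of 1] v by simp
    next
      assume "absv x * absv u = 1"
      then have "absv x = absv (inverse u)" using iu(2) u1 by (metis mult_right_cancel less_irrefl)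
      then show ?thesis using ceq[OF kx(2) iu(1)] v by simp
    qed
  next
    fix v assume "v \<in> {c 1, c (inverse u)}"
    then obtain x where x: "v = c x" "x \<noteq> 0" "absv x = 1 \<or> absv x * absv u = 1" using iu by auto
    then show "v \<in> lclass g (pvec 0)" using lx[OF x(2)] prim[OF x(2)] unfolding lclass_def c_def by blast
  qed
  moreover have "c 1 = c (inverse u) \<longleftrightarrow> absv u = 1"
  proof
    assume "absv u = 1"
    then have "absv (inverse u) = 1" by (simp only: absv_inverse) simp
    then show "c 1 = c (inverse u)" using iu(1) by (intro ceq) simp_all
  next
    assume "c 1 = c (inverse u)"
    then obtain k where k: "k \<noteq> 0" "lat e (scale (inverse u) f) = lat (scale k e) (scale k f)"
      unfolding c_def homothety_class_eq_iff scale_lat by auto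
    have kef: "form (scale k e) (scale k f) \<noteq> 0" using ef k(1) by (simp add: form_scale_left form_scale_right)
    have mk: "vc e f a b \<in> lat (scale k e) (scale k f) \<longleftrightarrow> absv a \<le> absv k \<and> absv b \<le> absv k" for a b
    proof -
      have "vc e f a b = vc (scale k e) (scale k f) (a / k) (b / k)" using k(1) by (simp add: vc_scaled)
      then show ?thesis using vc_lat[OF kef] absv_pos[OF k(1)] by (simp add: absv_divide)
    qed
    have eq: "absv a \<le> 1 \<and> absv b \<le> absv (inverse u) \<longleftrightarrow> absv a \<le> absv k \<and> absv b \<le> absv k" for a b
      unfolding mk[symmetric] memx[OF iu(1), symmetric] k(2) ..
    have "absv k \<le> 1" using eq[of k 0] absv_nonneg[of k] by simp
    moreover have "absv (inverse u) \<le> absv k" using eq[of 0 "inverse u"] by simp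
    ultimately have "absv (inverse u) \<le> 1" by linarith
    then have "absv (inverse u) * absv u \<le> 1 * absv u" using u1 by (intro mult_right_mono) auto
    then show "absv u = 1" using u1 iu(2) by simp
  qed
  ultimately show "finite (lclass (\<lambda>i. op e0 f0 (Z$i)) (pvec 0))"
    "card (lclass (\<lambda>i. op e0 f0 (Z$i)) (pvec 0)) = (if absv u = 1 then 1 else 2)"
    by (simp_all add: g_def[abs_def] card_insert_if)
qed

lemma Vpp_coords:
  assumes ef: "form e f \<noteq> 0" "form e f \<in> Qp" and b: "\<And>i. \<beta> i \<in> Vpp"
  obtains Y where "\<And>i. Y$i \<in> qvec" "\<beta> = (\<lambda>i. op e f (Y$i))"
proof -
  have "\<exists>x. x \<in> qvec \<and> \<beta> i = op e f x" for i using Vpp_op[OF ef b] by metis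
  then obtain y where y: "\<And>i. y i \<in> qvec \<and> \<beta> i = op e f (y i)" by metis
  then show thesis using that[of "\<chi> i. y i"] by (simp add: fun_eq_iff)
qed

lemma comb_axis: "comb (axis i 1) \<beta> = \<beta> i" for \<beta> :: "3 \<Rightarrow> 'u \<Rightarrow> 'u"
  using exhaust_3[of i] by (auto simp: comb_def sum_3 axis_def)

text \<open>
  A solution \<open>Y\<^sub>1\<close> modulo \<open>p\<^sup>t\<close> and a lattice whose saturation is that of \<open>Y\<^sub>1\<close> are both carried to the
  primitive situation by one rational matrix, which makes the Gram matrix \<open>dg u\<close>.
\<close>

lemma ncos_sat_class_lclass:
  assumes ef: "form e f \<noteq> 0" "form e f \<in> Qp" and b: "\<And>i. \<beta> i \<in> Vpp"
    and T: "Q_matrix \<beta> = T" "transpose T = T" "T \<in> pmat 0" "(1 / real p) ^ Suc t < absv (det T)"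
    and Y1: "Y1 \<in> reps (Suc t) T"
  shows "finite (lclass \<beta> (sat Y1))"
    and "ncos (pmat (Suc t)) {Y \<in> reps (Suc t) T. sat Y = sat Y1} = p ^ (6 * t) * (p^2 * (p^4 - 1)) * card (lclass \<beta> (sat Y1))"
proof -
  obtain R R' u where R: "R \<in> qmat" "R' \<in> pmat 0" "R ** R' = mat 1" "R' ** R = mat 1" "prim (R ** Y1)"
    "R ** T ** transpose R = dg u" "u \<in> Zp"
    "ncos (pmat (Suc t)) {Y \<in> reps (Suc t) T. sat Y = sat Y1} =
       p ^ (6 * t) * (p^2 * (p^4 - 1) * (if absv u = 1 then 1 else 2))"
    using ncos_sat_class[OF T(2-4) Y1] .
  have u: "u \<noteq> 0"
  proof
    assume "u = 0"
    then have "det (dg u) = 0" by (simp add: det_3)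
    then have "det R * det T * det R = 0" using arg_cong[OF R(6), of det] by (simp add: det_mul)
    moreover have "det R * det R' = 1" using arg_cong[OF R(3), of det] by (simp add: det_mul)
    ultimately have "det T = 0" by auto
    moreover have "0 < absv (det T)" by (rule less_trans[OF _ T(4)]) simp
    ultimately show False by simp
  qed
  define \<gamma> where "\<gamma> i = comb (R$i) \<beta>" for i
  have coords: "\<gamma> = (\<lambda>i. op e f ((R ** Y)$i))" "\<And>i. (R ** Y)$i \<in> qvec"
    if ef: "form e f \<noteq> 0" and Y: "\<And>i. Y$i \<in> qvec" "\<beta> = (\<lambda>i. op e f (Y$i))" for e f Y
  proof -
    show "\<gamma> = (\<lambda>i. op e f ((R ** Y)$i))" unfolding \<gamma>_def Y(2) op_comb[OF ef] rows_mult ..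
    have "R$i \<in> qvec" for i using R(1) by (simp add: qmat_def qvec_def)
    then show "(R ** Y)$i \<in> qvec" for i unfolding rows_mult using qvec_mult Y(1) by blast
  qed
  have eq: "satV \<beta> L = sat Y1 \<longleftrightarrow> satV \<gamma> L = pvec 0" if L: "lattice L" for L
  proof -
    obtain e f where ef: "form e f \<noteq> 0" "form e f \<in> Qp" "L = lat e f" using lattice_rational_basis[OF L] .
    obtain Y where Y: "\<And>i. Y$i \<in> qvec" "\<beta> = (\<lambda>i. op e f (Y$i))" using Vpp_coords[where \<beta> = \<beta>, OF ef(1,2) b] by blast
    have "satV \<beta> L = sat Y" unfolding Y(2) ef(3) by (rule satV_op[OF ef(1,2) Y(1)])
    moreover have "satV \<gamma> L = sat (R ** Y)"
      unfolding coords(1)[OF ef(1) Y] ef(3) by (rule satV_op[OF ef(1,2) coords(2)[OF ef(1) Y]])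
    ultimately show ?thesis
      using sat_eq_iff_prim[OF R(1) pmat_qmat[OF R(2)] R(4,5)] by (simp add: prim_iff_sat_eq)
  qed
  then have lc: "lclass \<beta> (sat Y1) = lclass \<gamma> (pvec 0)" unfolding lclass_def by blast
  obtain Y where Y: "\<And>i. Y$i \<in> qvec" "\<beta> = (\<lambda>i. op e f (Y$i))" using Vpp_coords[where \<beta> = \<beta>, OF ef b] by blast
  have "gram (R ** Y) = dg u"
    using R(6) Q_matrix_op[OF ef(1) Y(1)] T(1) by (simp add: gram_mult Y(2))
  note C = card_lclass_dg[OF ef coords(2)[OF ef(1) Y] this R(7) u]
  show "finite (lclass \<beta> (sat Y1))" unfolding lc coords(1)[OF ef(1) Y] by (rule C(1))
  show "ncos (pmat (Suc t)) {Y \<in> reps (Suc t) T. sat Y = sat Y1} = p ^ (6 * t) * (p^2 * (p^4 - 1)) * card (lclass \<beta> (sat Y1))"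
    unfolding R(8) lc coords(1)[OF ef(1) Y] C(2) by (simp only: mult.assoc)
qed

definition stable :: "(3 \<Rightarrow> 'u \<Rightarrow> 'u) \<Rightarrow> 'u set set set" where
  "stable \<beta> = {homothety_class L | L. lattice L \<and> (\<forall>i. \<beta> i \<in> N L)}"

text \<open>
  Summation over all saturations.  Conversely, the coordinates of \<open>\<beta>\<close> in a basis of a stable lattice form a
  solution with the saturation of that lattice, so that no lattice is missed.
\<close>

lemma ncos_reps_stable:
  assumes ef: "form e f \<noteq> 0" "form e f \<in> Qp" and b: "\<And>i. \<beta> i \<in> Vpp"
    and T: "Q_matrix \<beta> = T" "transpose T = T" "T \<in> pmat 0" "(1 / real p) ^ Suc t < absv (det T)"
  shows "finite (stable \<beta>)"
    and "ncos (pmat (Suc t)) (reps (Suc t) T) = p ^ (6 * t) * (p^2 * (p^4 - 1)) * card (stable \<beta>)"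
proof -
  let ?X = "reps (Suc t) T"
  note fin = ncos_reps(1)[OF T(3,4)]
  have U: "stable \<beta> = (\<Union>M\<in>sat ` ?X. lclass \<beta> M)"
  proof (intro equalityI subsetI)
    fix v assume "v \<in> stable \<beta>"
    then obtain L where L: "v = homothety_class L" "lattice L" "\<And>i. \<beta> i \<in> N L" by (auto simp: stable_def)
    obtain e f where ef: "form e f \<noteq> 0" "form e f \<in> Qp" "L = lat e f" using lattice_rational_basis[OF L(2)] .
    obtain Y where Y: "\<And>i. Y$i \<in> qvec" "\<beta> = (\<lambda>i. op e f (Y$i))" using Vpp_coords[where \<beta> = \<beta>, OF ef(1,2) b] by blast
    have "Y$i \<in> pvec 0" for i using L(3)[of i] op_N[OF ef(1,2) Y(1)] by (simp add: Y(2) ef(3))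
    then have "Y \<in> pmat 0" by (simp add: pmat_rows)
    moreover have "gram Y = T" using Q_matrix_op[OF ef(1) Y(1)] T(1) by (simp add: Y(2))
    ultimately have "Y \<in> ?X" by (simp add: reps_def subgp_0)
    moreover have "satV \<beta> L = sat Y" unfolding Y(2) ef(3) by (rule satV_op[OF ef(1,2) Y(1)])
    then have "v \<in> lclass \<beta> (sat Y)" using L(1,2) by (auto simp: lclass_def)
    ultimately show "v \<in> (\<Union>M\<in>sat ` ?X. lclass \<beta> M)" by blast
  next
    fix v assume "v \<in> (\<Union>M\<in>sat ` ?X. lclass \<beta> M)"
    then obtain L Y where L: "v = homothety_class L" "lattice L" and Y: "Y \<in> ?X" "satV \<beta> L = sat Y"
      by (auto simp: lclass_def)
    have "\<beta> i \<in> N L" for i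
    proof -
      have "axis i 1 v* Y \<in> pvec 0" using Y(1) by (simp add: axis_mult reps_def pmat_rows)
      moreover have "axis i 1 $ j \<in> Qp" for j :: 3 by (simp add: axis_def Qp_1)
      ultimately have "axis i 1 \<in> sat Y" by (simp add: sat_def)
      then have "comb (axis i 1) \<beta> \<in> N L" unfolding Y(2)[symmetric] by (simp add: satV_def)
      then show ?thesis by (simp add: comb_axis)
    qed
    then show "v \<in> stable \<beta>" using L by (auto simp: stable_def)
  qed
  have fl: "finite (lclass \<beta> M)" if "M \<in> sat ` ?X" for M
    using that by (auto intro: ncos_sat_class_lclass(1)[where \<beta> = \<beta>, OF ef b T])
  have eq: "M = M'" if v: "v \<in> lclass \<beta> M" "v \<in> lclass \<beta> M'" for v M M'
  proof -
    obtain L where L: "v = homothety_class L" "lattice L" "satV \<beta> L = M" using v(1) by (auto simp: lclass_def)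
    obtain L' where L': "v = homothety_class L'" "satV \<beta> L' = M'" using v(2) by (auto simp: lclass_def)
    have "homothety_class L = homothety_class L'" using L(1) L'(1) by simp
    then show ?thesis using satV_class[OF L(2)] L(3) L'(2) by metis
  qed
  have disj: "lclass \<beta> M \<inter> lclass \<beta> M' = {}" if "M \<noteq> M'" for M M'
    using that eq[of _ M M'] by (auto simp: disjoint_iff)
  show "finite (stable \<beta>)" unfolding U using fin fl by blast
  have "card (stable \<beta>) = (\<Sum>M\<in>sat ` ?X. card (lclass \<beta> M))"
    unfolding U using fin fl disj by (intro card_UN_disjoint) auto
  moreover have "ncos (pmat (Suc t)) ?X = (\<Sum>M\<in>sat ` ?X. p ^ (6 * t) * (p^2 * (p^4 - 1)) * card (lclass \<beta> M))"
    unfolding ncos_reps(2)[OF T(3,4)]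
  proof (rule sum.cong)
    fix M assume "M \<in> sat ` ?X"
    then obtain Y1 where Y1: "Y1 \<in> ?X" "M = sat Y1" by blast
    show "ncos (pmat (Suc t)) {Y \<in> ?X. sat Y = M} = p ^ (6 * t) * (p^2 * (p^4 - 1)) * card (lclass \<beta> M)"
      unfolding Y1(2) by (rule ncos_sat_class_lclass(2)[where \<beta> = \<beta>, OF ef b T Y1(1)])
  qed simp
  ultimately show "ncos (pmat (Suc t)) ?X = p ^ (6 * t) * (p^2 * (p^4 - 1)) * card (stable \<beta>)"
    by (simp only: sum_distrib_left)
qed

subsection \<open>The density as a count of cosets\<close>

text \<open>
  A quadratic form determines its symmetric matrix by polarisation, so \<open>S\<close> and \<open>hmat\<close> differ by the
  change of basis between the given basis of the lattice and the standard one.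
\<close>

lemma form_matrix_coords:
  assumes ef: "form e f \<noteq> 0" "form e f \<in> Qp" and S: "form_matrix (N (lat e f)) (S :: 'k^4^4)"
  obtains B C where "B \<in> pmat 0" "C \<in> pmat 0" "C ** B = mat 1" "B ** C = mat 1" "S = B ** hmat ** transpose B"
proof -
  obtain b :: "4 \<Rightarrow> 'u \<Rightarrow> 'u" where b: "transpose S = S" "Zp_basis b (N (lat e f))"
    "\<And>x. (\<forall>i. x $ i \<in> Zp) \<Longrightarrow> Q (comb x b) = (\<Sum>i\<in>UNIV. \<Sum>j\<in>UNIV. x $ i * S $ i $ j * x $ j)"
    using S by (auto simp: form_matrix_def)
  have sp: "Zp_span b = N (lat e f)" using b(2) by (simp add: Zp_basis_def)
  have bax: "comb (axis i 1) b = b i" for i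
    using exhaust_4[of i] by (auto simp: comb_def sum_4 axis_def)
  have bN: "b i \<in> N (lat e f)" for i
  proof -
    have "comb (axis i 1) b \<in> Zp_span b" unfolding Zp_span_def by (rule CollectI, rule exI[of _ "axis i 1"]) (auto simp: axis_def)
    then show ?thesis by (simp add: bax sp)
  qed
  then have bV: "b i \<in> Vpp" for i by (auto simp: N_def)
  have "\<exists>x. x \<in> qvec \<and> b i = op e f x" for i using Vpp_op[OF ef bV] by metis
  then obtain y where y: "\<And>i. y i \<in> qvec \<and> b i = op e f (y i)" by metis
  define B where "B = (\<chi> i. y i)"
  have B: "B$i \<in> qvec" "b i = op e f (B$i)" for i using y by (simp_all add: B_def)
  have B0: "B \<in> pmat 0" using bN op_N[OF ef B(1)] by (simp add: pmat_rows B(2))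
  have comb: "comb x b = op e f (x v* B)" for x
  proof
    fix u
    obtain c d where u: "u = vc e f c d" using vc_exhaust[OF ef(1)] by blast
    show "comb x b u = op e f (x v* B) u"
      unfolding u comb_def B(2) sum_4 op_vc[OF ef(1)] scale_vc vc_add vc_eq_iff[OF ef(1)]
      by (simp add: vector_matrix_mult_def sum_4 algebra_simps)
  qed
  have op_inj: "x = x'" if "op e f x = op e f x'" "x \<in> qvec" "x' \<in> qvec" for x x'
  proof -
    have c: "x$i \<in> Qp" "x'$i \<in> Qp" for i using that(2,3) by (simp_all add: qvec_def)
    have "op e f x (vc e f 1 0) = op e f x' (vc e f 1 0)" "op e f x (vc e f 0 1) = op e f x' (vc e f 0 1)" using that(1) by simp_all
    then have 1: "x$1 + x$2 * \<delta> = x'$1 + x'$2 * \<delta>" "x$3 = x'$3" "x$4 = x'$4"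
      unfolding op_vc[OF ef(1)] vc_eq_iff[OF ef(1)] by simp_all
    have "absv ((x$1 - x'$1) + (x$2 - x'$2) * \<delta>) = 0" using 1(1) by (simp add: algebra_simps)
    then have "max (absv (x$1 - x'$1)) (absv (x$2 - x'$2)) = 0"
      using absv_coords[of "x$1 - x'$1" "x$2 - x'$2"] c by (simp add: Qp_diff)
    then have "absv (x$1 - x'$1) = 0" "absv (x$2 - x'$2) = 0"
      using absv_nonneg[of "x$1 - x'$1"] absv_nonneg[of "x$2 - x'$2"] by (auto simp: max_def split: if_splits)
    then show ?thesis using 1(2,3) by (simp add: vec_eq_iff forall_4 absv_eq_0)
  qed
  have qv: "v \<in> qvec" if "v \<in> pvec 0" for v :: "'k^4" using that by (simp add: pvec_def pideal_0 Zp_def qvec_def)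
  have "\<exists>c. c \<in> pvec 0 \<and> c v* B = axis i 1" for i
  proof -
    have a: "axis i 1 \<in> pvec 0" by (auto simp: pvec_def axis_def pideal_0)
    then have "op e f (axis i 1) \<in> Zp_span b" unfolding sp using op_N[OF ef qv[OF a]] by simp
    then obtain c where c: "op e f (axis i 1) = comb c b" "\<forall>i. c$i \<in> Zp" by (auto simp: Zp_span_def)
    have c0: "c \<in> pvec 0" using c(2) by (simp add: pvec_def pideal_0)
    have "c v* B = axis i 1"
      using c(1) unfolding comb by (intro op_inj[symmetric] qv a pvec_mult_left[OF c0 B0]) simp_all
    then show ?thesis using c0 by blast
  qed
  then obtain c where c: "\<And>i. c i \<in> pvec 0 \<and> c i v* B = axis i 1" by metis
  define C where "C = (\<chi> i. c i)"
  have C0: "C \<in> pmat 0" using c by (simp add: pmat_rows C_def)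
  have "(C ** B)$i = mat 1 $ i" for i using c[of i] by (simp add: rows_mult C_def vec_eq_iff mat_def axis_def)
  then have CB: "C ** B = mat 1" by (simp add: vec_eq_iff)
  then have BC: "B ** C = mat 1" by (simp add: matrix_left_right_inverse)
  have QS: "h (x v* B) (x v* B) = (\<Sum>i\<in>UNIV. \<Sum>j\<in>UNIV. x $ i * S $ i $ j * x $ j)" if x: "x \<in> pvec 0" for x
    using b(3)[of x] x Q_op[OF ef(1) qv[OF pvec_mult_left[OF x B0]]]
    by (simp add: pvec_def pideal_0 comb h_self)
  have e1: "h (B$i) (B$i) = S$i$i" for i
  proof -
    have "h (axis i 1 v* B) (axis i 1 v* B) = (\<Sum>k\<in>UNIV. \<Sum>l\<in>UNIV. axis i 1 $ k * S $ k $ l * axis i 1 $ l)"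
      by (rule QS) (auto simp: pvec_def axis_def pideal_0)
    then show ?thesis
      unfolding axis_mult by (simp add: axis_def if_distrib[of "\<lambda>x. x * _"] if_distrib[of "\<lambda>x. _ * x"] cong: if_cong)
  qed
  have "h (B$i) (B$j) = S$i$j" for i j
  proof (cases "i = j")
    case False
    let ?x = "axis i 1 + axis j 1 :: 'k^4"
    have "h (?x v* B) (?x v* B) = (\<Sum>k\<in>UNIV. \<Sum>l\<in>UNIV. ?x $ k * S $ k $ l * ?x $ l)"
      by (rule QS) (auto simp: pvec_def axis_def pideal_0)
    moreover have "?x v* B = B$i + B$j" by (simp only: vector_matrix_left_distrib axis_mult)
    moreover have "(\<Sum>k\<in>UNIV. \<Sum>l\<in>UNIV. ?x $ k * S $ k $ l * ?x $ l) = S$i$i + S$i$j + S$j$i + S$j$j"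
    proof -
      have "(\<Sum>l\<in>UNIV. ?x $ k * S $ k $ l * ?x $ l) = ?x $ k * (S$k$i + S$k$j)" for k
      proof -
        have "(\<Sum>l\<in>UNIV. ?x $ k * S $ k $ l * ?x $ l) = (\<Sum>l\<in>UNIV. (if l = i then ?x$k * S$k$l else 0) + (if l = j then ?x$k * S$k$l else 0))"
          using False by (intro sum.cong) (auto simp: axis_def)
        then show ?thesis by (simp add: sum.distrib distrib_left)
      qed
      then have "(\<Sum>k\<in>UNIV. \<Sum>l\<in>UNIV. ?x $ k * S $ k $ l * ?x $ l) =
          (\<Sum>k\<in>UNIV. (if k = i then S$k$i + S$k$j else 0) + (if k = j then S$k$i + S$k$j else 0))"
        using False by (simp only:) (intro sum.cong; auto simp: axis_def)
      then show ?thesis by (simp add: sum.distrib)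
    qed
    ultimately have "2 * h (B$i) (B$j) = 2 * S$i$j"
      using symmetric_entry[OF b(1), of i j] by (simp add: h_add_left h_add_right h_commute[of "B$j" "B$i"] e1)
    then show ?thesis by simp
  qed (simp add: e1)
  then have "S = B ** hmat ** transpose B" by (simp add: vec_eq_iff hmat_entry)
  then show thesis using that B0 C0 CB BC by blast
qed

end

section \<open>The tree and the loci\<close>

context symplectic_plane
begin

subsection \<open>Relative position of two lattices\<close>

lemma lat_swap: "form e f \<noteq> 0 \<Longrightarrow> lat f e = lat e f"
  by (rule lat_eqI) (simp_all add: form_skew[of f e])

lemma vc_swap: "vc f e b a = vc e f a b" by (simp add: vc_def add.commute)

text \<open>Elementary divisors of a \<open>2 \<times> 2\<close> matrix, with a coordinate of largest absolute value as pivot.\<close>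

lemma relative_position_pivot:
  assumes nz: "form e0 f0 \<noteq> 0" "form (vc e0 f0 a b) (vc e0 f0 a' b') \<noteq> 0"
    and le: "absv b \<le> absv a" "absv a' \<le> absv a" "absv b' \<le> absv a"
  shows "\<exists>e f c m. form e f \<noteq> 0 \<and> lat e0 f0 = lat e f \<and> c \<noteq> 0 \<and>
    lat (vc e0 f0 a b) (vc e0 f0 a' b') = lat (scale c e) (scale (c * \<pi> ^ m) f)"
proof -
  have a: "a \<noteq> 0"
  proof
    assume "a = 0"
    then have "b = 0" "a' = 0" "b' = 0" using le absv_nonneg[of b] absv_nonneg[of a'] absv_nonneg[of b'] absv_eq_0
      by (metis absv_0 antisym)+
    then show False using nz(2) by (simp add: \<open>a = 0\<close>)
  qed
  define e where "e = vc e0 f0 1 (b / a)"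
  define w where "w = (b' - a' * b / a) / a"
  have ve: "vc e f0 x y = vc e0 f0 x (x * b / a + y)" for x y
    by (simp add: e_def vc_def scale_left_distrib scale_right_distrib)
  have q1: "absv (x / a) \<le> 1" if "absv x \<le> absv a" for x using that absv_pos[OF a] by (simp add: absv_divide)
  have fe: "form e f0 = form e0 f0" using form_vc[of e0 f0 1 "b / a" 0 1] by (simp add: e_def)
  have L: "lat e0 f0 = lat e f0"
  proof (rule lat_eqI[OF nz(1), symmetric])
    show "e \<in> lat e0 f0" unfolding e_def using q1[OF le(1)] by (simp add: lat_I)
    show "absv (form e f0) = absv (form e0 f0)" by (simp only: fe)
  qed simp
  have e1: "vc e0 f0 a b = scale a e" using a by (simp add: e_def scale_vc)
  have f1: "vc e0 f0 a' b' = vc e f0 a' (a * w)" using a by (simp add: ve w_def field_simps)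
  have "absv (b' / a - (a' / a) * (b / a)) \<le> 1" using q1 le absv_mult_le[of "a' / a" 1 "b / a" 1] by (intro absv_diff_le) auto
  then have w1: "absv w \<le> 1" using a by (simp add: w_def diff_divide_distrib)
  have fw: "form (vc e0 f0 a b) (vc e0 f0 a' b') = a * (a * w) * form e0 f0"
    unfolding e1 f1 using form_vc[of e f0 a 0 a' "a * w"] by (simp add: fe vc_def form_scale_left)
  then have w0: "w \<noteq> 0" using nz(2) by auto
  obtain n where n: "absv (w / \<pi> powi n) = 1" "absv w = real p powi (- n)" using p_power_decompose[OF w0] .
  have "0 \<le> n"
  proof (rule ccontr)
    assume "\<not> 0 \<le> n"
    then have "real p powi 1 \<le> real p powi (- n)" using p_gt_1 by (intro power_int_increasing) auto
    then show False using w1 n(2) p_gt_1 by simp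
  qed
  then obtain m where m: "n = int m" using zero_le_imp_eq_int by blast
  have wm: "absv (w / \<pi> ^ m) = 1" using n(1) by (simp add: m)
  then have wm': "absv w = absv (\<pi> ^ m)" by (simp add: absv_divide absv_p_power)
  have nz': "form (scale a e) (scale (a * \<pi> ^ m) f0) \<noteq> 0" using nz(1) a by (simp add: form_scale_left form_scale_right fe)
  have f1': "vc e0 f0 a' b' = vc (scale a e) (scale (a * \<pi> ^ m) f0) (a' / a) (w / \<pi> ^ m)"
    unfolding f1 vc_scaled using a by (simp add: mult.commute)
  have "lat (vc e0 f0 a b) (vc e0 f0 a' b') = lat (scale a e) (scale (a * \<pi> ^ m) f0)"
  proof (rule lat_eqI[OF nz'])
    show "vc e0 f0 a b \<in> lat (scale a e) (scale (a * \<pi> ^ m) f0)" unfolding e1 by (rule lat_basis)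
    show "vc e0 f0 a' b' \<in> lat (scale a e) (scale (a * \<pi> ^ m) f0)"
      unfolding f1' by (rule lat_I) (use q1[OF le(2)] wm in auto)
    show "absv (form (vc e0 f0 a b) (vc e0 f0 a' b')) = absv (form (scale a e) (scale (a * \<pi> ^ m) f0))"
      unfolding fw form_scale_left form_scale_right absv_mult fe wm' by simp
  qed
  then show ?thesis using nz(1) a L fe by (intro exI[of _ e] exI[of _ f0] exI[of _ a] exI[of _ m]) simp
qed

lemma relative_position:
  assumes "lattice L" "lattice L'"
  obtains e f c m where "form e f \<noteq> 0" "L = lat e f" "c \<noteq> 0" "L' = lat (scale c e) (scale (c * \<pi> ^ m) f)"
proof -
  obtain e0 f0 where 0: "form e0 f0 \<noteq> 0" "L = lat e0 f0" using assms lattice_iff by blast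
  obtain e1 f1 where h: "form e1 f1 \<noteq> 0" "L' = lat e1 f1" using assms lattice_iff by blast
  obtain a b where e1: "e1 = vc e0 f0 a b" using vc_exhaust[OF 0(1)] by blast
  obtain a' b' where f1: "f1 = vc e0 f0 a' b'" using vc_exhaust[OF 0(1)] by blast
  have s0: "form f0 e0 \<noteq> 0" "form f1 e1 \<noteq> 0" "lat f0 e0 = L" "lat f1 e1 = L'"
    using 0 h lat_swap form_skew[of e0 f0] form_skew[of e1 f1] by simp_all
  have "\<exists>x\<in>{a, b, a', b'}. \<forall>y\<in>{a, b, a', b'}. absv y \<le> absv x" by (rule finite_max_exists) auto
  then consider (1) "absv b \<le> absv a" "absv a' \<le> absv a" "absv b' \<le> absv a"
    | (2) "absv a \<le> absv b" "absv a' \<le> absv b" "absv b' \<le> absv b"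
    | (3) "absv a \<le> absv a'" "absv b \<le> absv a'" "absv b' \<le> absv a'"
    | (4) "absv a \<le> absv b'" "absv b \<le> absv b'" "absv a' \<le> absv b'" by auto
  then have "\<exists>e f c m. form e f \<noteq> 0 \<and> L = lat e f \<and> c \<noteq> 0 \<and> L' = lat (scale c e) (scale (c * \<pi> ^ m) f)"
  proof cases
    case 1
    show ?thesis unfolding 0(2) h(2) e1 f1
      by (rule relative_position_pivot[OF 0(1) h(1)[unfolded e1 f1] 1])
  next
    case 2
    have h': "form (vc f0 e0 b a) (vc f0 e0 b' a') \<noteq> 0" using h(1) unfolding vc_swap[of f0 e0] by (simp only: e1 f1) simp
    show ?thesis unfolding s0(3)[symmetric] h(2) e1 f1 vc_swap[of f0 e0, symmetric]
      by (rule relative_position_pivot[OF s0(1) h']) (use 2 in auto)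
  next
    case 3
    show ?thesis unfolding 0(2) s0(4)[symmetric] e1 f1
      by (rule relative_position_pivot[OF 0(1) s0(2)[unfolded e1 f1]]) (use 3 in auto)
  next
    case 4
    have h': "form (vc f0 e0 b' a') (vc f0 e0 b a) \<noteq> 0" using s0(2) unfolding vc_swap[of f0 e0] by (simp only: e1 f1) simp
    show ?thesis unfolding s0(3,4)[symmetric] e1 f1 vc_swap[of f0 e0, symmetric]
      by (rule relative_position_pivot[OF s0(1) h']) (use 4 in auto)
  qed
  then show thesis using that by blast
qed

lemma mem_lat_scaled:
  assumes "form e f \<noteq> 0" "x \<noteq> 0" "y \<noteq> 0"
  shows "vc e f a b \<in> lat (scale x e) (scale y f) \<longleftrightarrow> absv a \<le> absv x \<and> absv b \<le> absv y"
proof -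
  have "vc e f a b = vc (scale x e) (scale y f) (a / x) (b / y)" using assms by (simp add: vc_scaled)
  moreover have "form (scale x e) (scale y f) \<noteq> 0" using assms by (simp add: form_scale_left form_scale_right)
  ultimately show ?thesis using vc_lat absv_pos[OF assms(2)] absv_pos[OF assms(3)] by (simp add: absv_divide)
qed

subsection \<open>Paths in the tree\<close>

lemma verticesE: assumes "v \<in> vertices" obtains L where "lattice L" "v = homothety_class L"
  using assms by (auto simp: vertices_def)

lemma in_classE: assumes "L' \<in> homothety_class L" obtains c where "c \<noteq> 0" "L' = scale c ` L"
  using assms by (auto simp: homothety_class_def)

lemma lattice_scale: "lattice L \<Longrightarrow> c \<noteq> 0 \<Longrightarrow> lattice (scale c ` L)"
proof -
  assume "lattice L" "c \<noteq> 0"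
  then obtain e f where "form e f \<noteq> 0" "L = lat e f" unfolding lattice_iff by blast
  then show "lattice (scale c ` L)" using \<open>c \<noteq> 0\<close>
    by (simp add: scale_lat lattice_lat form_scale_left form_scale_right)
qed

lemma vertex_lattice:
  assumes "v \<in> vertices" "L \<in> v" shows "lattice L" "v = homothety_class L"
proof -
  obtain L0 where L0: "lattice L0" "v = homothety_class L0" using assms(1) by (rule verticesE)
  obtain c where c: "c \<noteq> 0" "L = scale c ` L0" using assms(2) unfolding L0(2) by (rule in_classE)
  show "lattice L" unfolding c(2) using lattice_scale L0(1) c(1) .
  show "v = homothety_class L" unfolding c(2) L0(2) using homothety_class_eqI[OF c(1)] by simp
qed

lemma scale_vertex: "v \<in> vertices \<Longrightarrow> L \<in> v \<Longrightarrow> c \<noteq> 0 \<Longrightarrow> scale c ` L \<in> v"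
  using vertex_lattice(2)[of v L] by (auto simp: homothety_class_def)

lemma inj_scale: "c \<noteq> 0 \<Longrightarrow> inj (scale c)" by (simp add: inj_on_def)

lemma scale_commute: "scale a ` scale b ` L = scale b ` scale a ` L"
  by (simp add: image_image mult.commute)

lemma adjacent_sublattice:
  assumes "adjacent v w" "L \<in> v" obtains L' where "L' \<in> w" "scale \<pi> ` L \<subseteq> L'" "L' \<subseteq> L"
proof -
  obtain L1 L2 where L: "v \<in> vertices" "w \<in> vertices" "L1 \<in> v" "L2 \<in> w" "scale \<pi> ` L1 \<subset> L2" "L2 \<subset> L1"
    using assms(1) unfolding adjacent_def by (elim conjE bexE)
  have "L \<in> homothety_class L1" using vertex_lattice(2)[OF L(1,3)] assms(2) by simp
  then obtain c where c: "c \<noteq> 0" "L = scale c ` L1" by (rule in_classE)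
  have "scale c ` L2 \<in> w" using scale_vertex[OF L(2,4) c(1)] .
  moreover have "scale \<pi> ` L \<subseteq> scale c ` L2"
    unfolding c(2) scale_commute[of \<pi> c] using L(5) by (intro image_mono) (rule psubset_imp_subset)
  moreover have "scale c ` L2 \<subseteq> L" unfolding c(2) using L(6) by (intro image_mono) (rule psubset_imp_subset)
  ultimately show thesis by (rule that)
qed

text \<open>Adjacent classes have representatives that differ by a factor of at most \<open>p\<close>.\<close>

lemma path_sublattice:
  assumes "(adjacent ^^ n) v w" "L \<in> v" shows "\<exists>L'\<in>w. scale (\<pi> ^ n) ` L \<subseteq> L' \<and> L' \<subseteq> L"
  using assms(1)
proof (induction n arbitrary: w)
  case 0
  then have "w = v" by simp
  then show ?case using assms(2) by (intro bexI[of _ L]) auto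
next
  case (Suc n)
  then obtain x where x: "(adjacent ^^ n) v x" "adjacent x w" by auto
  obtain L1 where L1: "L1 \<in> x" "scale (\<pi> ^ n) ` L \<subseteq> L1" "L1 \<subseteq> L" using Suc.IH[OF x(1)] by blast
  obtain L2 where L2: "L2 \<in> w" "scale \<pi> ` L1 \<subseteq> L2" "L2 \<subseteq> L1" using adjacent_sublattice[OF x(2) L1(1)] .
  have "scale (\<pi> ^ Suc n) ` L = scale \<pi> ` scale (\<pi> ^ n) ` L" by (simp add: image_image)
  also have "\<dots> \<subseteq> scale \<pi> ` L1" using L1(2) by (rule image_mono)
  finally have "scale (\<pi> ^ Suc n) ` L \<subseteq> L2" using L2(2) by (rule subset_trans)
  then show ?case using subset_trans[OF L2(3) L1(3)] L2(1) by (intro bexI[of _ L2] conjI)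
qed

text \<open>The element \<open>p\<^sup>n f\<close> of the representative obtained from a path of length \<open>n\<close> forces \<open>m \<le> n\<close>.\<close>

lemma path_length_ge:
  assumes ef: "form e f \<noteq> 0" and c: "c \<noteq> 0"
    and path: "(adjacent ^^ n) (homothety_class (lat e f)) (homothety_class (lat (scale c e) (scale (c * \<pi> ^ m) f)))"
  shows "m \<le> n"
proof -
  obtain L' where L': "L' \<in> homothety_class (lat (scale c e) (scale (c * \<pi> ^ m) f))"
    "scale (\<pi> ^ n) ` lat e f \<subseteq> L'" "L' \<subseteq> lat e f"
    using path_sublattice[OF path homothety_class_self] by (elim bexE conjE)
  obtain k where k: "k \<noteq> 0" "L' = scale k ` lat (scale c e) (scale (c * \<pi> ^ m) f)" using L'(1) by (rule in_classE)
  define d where "d = k * c"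
  have d: "d \<noteq> 0" "d * \<pi> ^ m \<noteq> 0" using k(1) c p_pos by (simp_all add: d_def)
  have L: "L' = lat (scale d e) (scale (d * \<pi> ^ m) f)" by (simp add: k(2) scale_lat d_def mult.assoc)
  have "scale d e \<in> lat e f" by (rule subsetD[OF L'(3)[unfolded L] lat_basis(1)])
  then have d1: "absv d \<le> 1" using vc_lat[OF ef, of d 0] by (simp add: vc_def)
  have "scale (\<pi> ^ n) f \<in> L'" by (rule subsetD[OF L'(2) imageI[OF lat_basis(2)]])
  then have "vc e f 0 (\<pi> ^ n) \<in> lat (scale d e) (scale (d * \<pi> ^ m) f)" by (simp add: L vc_def)
  then have "absv (\<pi> ^ n) \<le> absv d * absv (\<pi> ^ m)" unfolding mem_lat_scaled[OF ef d] by (simp only: absv_mult)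
  also have "\<dots> \<le> absv (\<pi> ^ m)" by (rule mult_left_le_one_le[OF absv_nonneg absv_nonneg d1])
  finally have le: "(1 / real p) ^ n \<le> (1 / real p) ^ m" by (simp only: absv_p_power)
  show "m \<le> n"
  proof (rule ccontr)
    assume "\<not> m \<le> n"
    then have "(1 / real p) ^ m < (1 / real p) ^ n" using p_gt_1 by (intro power_strict_decreasing) auto
    then show False using le by simp
  qed
qed

lemma adjacent_chain:
  assumes ef: "form e f \<noteq> 0"
  shows "adjacent (homothety_class (lat e (scale (\<pi> ^ j) f))) (homothety_class (lat e (scale (\<pi> ^ Suc j) f)))"
proof -
  let ?L = "\<lambda>j. lat e (scale (\<pi> ^ j) f)"
  have p: "\<pi> ^ i \<noteq> 0" for i using p_pos by simp
  have lt: "lattice (?L i)" for i using ef p by (intro lattice_lat) (simp add: form_scale_right)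
  have mem: "vc e f a b \<in> ?L i \<longleftrightarrow> absv a \<le> 1 \<and> absv b \<le> (1 / real p) ^ i" for a b i
    using mem_lat_scaled[OF ef one_neq_zero p, of a b i] by (simp add: absv_p_power)
  have mem': "vc e f a b \<in> scale \<pi> ` ?L i \<longleftrightarrow> absv a \<le> 1 / real p \<and> absv b \<le> (1 / real p) ^ Suc i" for a b i
  proof -
    have "scale \<pi> ` ?L i = lat (scale \<pi> e) (scale (\<pi> ^ Suc i) f)" by (simp add: scale_lat)
    then show ?thesis using mem_lat_scaled[OF ef _ p, of \<pi> a b "Suc i"] p_pos by (simp only: absv_p_power absv_p) simp
  qed
  have p1: "1 / real p < 1" using p_gt_1 by simp
  have dec: "(1 / real p) ^ Suc j < (1 / real p) ^ j" using p_gt_1 by (intro power_strict_decreasing) auto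
  have "scale \<pi> ` ?L j \<subseteq> ?L (Suc j)"
  proof
    fix x assume x: "x \<in> scale \<pi> ` ?L j"
    obtain a b where v: "x = vc e f a b" using vc_exhaust[OF ef] by blast
    show "x \<in> ?L (Suc j)" using x p1 unfolding v mem mem' by linarith
  qed
  moreover have "e \<in> ?L (Suc j)" "e \<notin> scale \<pi> ` ?L j" using mem'[of 1 0 j] p1 by simp_all
  ultimately have 1: "scale \<pi> ` ?L j \<subset> ?L (Suc j)" by (metis psubsetI)
  have "?L (Suc j) \<subseteq> ?L j"
  proof
    fix x assume x: "x \<in> ?L (Suc j)"
    obtain a b where v: "x = vc e f a b" using vc_exhaust[OF ef] by blast
    show "x \<in> ?L j" using x dec unfolding v mem by linarith
  qed
  moreover have "vc e f 0 (\<pi> ^ j) \<in> ?L j" "vc e f 0 (\<pi> ^ j) \<notin> ?L (Suc j)" unfolding mem absv_p_power using dec by simp_all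
  ultimately have 2: "?L (Suc j) \<subset> ?L j" by (metis psubsetI)
  have v: "homothety_class (?L i) \<in> vertices" for i using lt by (auto simp: vertices_def)
  show ?thesis unfolding adjacent_def by (intro conjI v bexI[OF _ homothety_class_self] 1 2)
qed

lemma path_chain:
  assumes ef: "form e f \<noteq> 0"
  shows "(adjacent ^^ n) (homothety_class (lat e f)) (homothety_class (lat e (scale (\<pi> ^ n) f)))"
proof (induction n)
  case (Suc n)
  then show ?case using adjacent_chain[OF ef, of n] by (rule relpowp_Suc_I)
qed simp

lemma adjacent_sym: assumes "adjacent v w" shows "adjacent w v"
proof -
  obtain L1 L2 where L: "v \<in> vertices" "w \<in> vertices" "L1 \<in> v" "L2 \<in> w" "scale \<pi> ` L1 \<subset> L2" "L2 \<subset> L1"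
    using assms unfolding adjacent_def by (elim conjE bexE)
  have pi: "\<pi> \<noteq> 0" by simp
  have "scale \<pi> ` L2 \<subset> scale \<pi> ` L1" by (rule image_strict_mono[OF inj_on_subset[OF inj_scale[OF pi] subset_UNIV] L(6)])
  then show ?thesis unfolding adjacent_def
    by (intro conjI bexI[of _ L2] bexI[of _ "scale \<pi> ` L1"] L scale_vertex[OF L(1,3) pi])
qed

lemma path_sym: "(adjacent ^^ n) v w \<Longrightarrow> (adjacent ^^ n) w v"
proof (induction n arbitrary: w)
  case (Suc n)
  then obtain x where x: "(adjacent ^^ n) v x" "adjacent x w" by auto
  show ?case using adjacent_sym[OF x(2)] Suc.IH[OF x(1)] by (rule relpowp_Suc_I2)
qed simp

lemma path_exists:
  assumes "v \<in> vertices" "w \<in> vertices" shows "\<exists>n. (adjacent ^^ n) v w"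
proof -
  obtain L where L: "lattice L" "v = homothety_class L" using assms(1) by (rule verticesE)
  obtain L' where L': "lattice L'" "w = homothety_class L'" using assms(2) by (rule verticesE)
  obtain e f c m where r: "form e f \<noteq> 0" "L = lat e f" "c \<noteq> 0" "L' = lat (scale c e) (scale (c * \<pi> ^ m) f)"
    using relative_position[OF L(1) L'(1)] .
  have "L' = scale c ` lat e (scale (\<pi> ^ m) f)" by (simp add: r(4) scale_lat)
  then have "w = homothety_class (lat e (scale (\<pi> ^ m) f))" using homothety_class_eqI[OF r(3)] by (simp add: L'(2))
  then show ?thesis using path_chain[OF r(1), of m] by (auto simp: L(2) r(2))
qed

lemma vertex_dist_path: "v \<in> vertices \<Longrightarrow> w \<in> vertices \<Longrightarrow> (adjacent ^^ vertex_dist v w) v w"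
  unfolding vertex_dist_def by (rule LeastI_ex) (rule path_exists)

lemma vertex_dist_le: "(adjacent ^^ n) v w \<Longrightarrow> vertex_dist v w \<le> n"
  unfolding vertex_dist_def by (rule Least_le)

subsection \<open>The action of an endomorphism\<close>

lemma Vpp_square:
  assumes b: "\<beta> \<in> Vpp" shows "Q \<beta> \<in> Qp" "\<beta> (\<beta> u) = scale (Q \<beta>) u"
proof -
  obtain e f where ef: "form e f \<noteq> 0" "form e f \<in> Qp"
  proof -
    obtain x :: 'u where "x \<noteq> 0"
    proof (rule ccontr)
      assume "\<not> thesis"
      then have "UNIV \<subseteq> span ({} :: 'u set)" using that by auto
      then show False using dim_le_card[of UNIV "{}"] dim_2 by simp
    qed
    then obtain y where "form x y \<noteq> 0" using form_nondegenerate by blast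
    then show thesis using lattice_rational_basis[OF lattice_lat] that by blast
  qed
  obtain x where x: "x \<in> qvec" "\<beta> = op e f x" using Vpp_op[OF ef b] .
  show "Q \<beta> \<in> Qp" "\<beta> (\<beta> u) = scale (Q \<beta>) u"
    unfolding x(2) Q_op[OF ef(1) x(1)] op_square[OF ef(1) x(1)] by (simp_all add: q_Qp x(1))
qed

end

locale nondegenerate_endomorphism = symplectic_plane +
  fixes \<beta> :: "'b \<Rightarrow> 'b"
  assumes Vpp: "\<beta> \<in> Vpp" and Q_nz: "Q \<beta> \<noteq> 0"
begin

lemma sl: "semilinear \<beta>" using Vpp by (simp add: Vpp_def)

lemma form_endo: "form (\<beta> x) (\<beta> y) = Q \<beta> * \<sigma> (form x y)"
proof -
  have "form (\<beta> x) (\<beta> y) = \<sigma> (form x (\<beta> (\<beta> y)))" using Vpp by (simp add: Vpp_def is_adjoint_def)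
  then show ?thesis using Vpp_square[OF Vpp] by (simp add: form_scale_right \<sigma>_mult \<sigma>_Qp)
qed

lemma inj_endo: "inj \<beta>"
proof (rule injI)
  fix x y assume "\<beta> x = \<beta> y"
  then have "scale (Q \<beta>) x = scale (Q \<beta>) y" by (metis Vpp_square(2)[OF Vpp])
  then show "x = y" using Q_nz by simp
qed

lemma endo_scale_image: "\<beta> ` scale c ` L = scale (\<sigma> c) ` \<beta> ` L"
  by (simp add: image_image semilinear_simps[OF sl])

lemma lattice_endo: "lattice L \<Longrightarrow> lattice (\<beta> ` L)"
proof -
  assume "lattice L"
  then obtain e f where "form e f \<noteq> 0" "L = lat e f" unfolding lattice_iff by blast
  moreover have "\<sigma> x \<noteq> 0" if "x \<noteq> 0" for x using that absv_\<sigma>[of x] absv_eq_0 by metis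
  ultimately show ?thesis using Q_nz by (simp add: semilinear_lat[OF sl] lattice_lat form_endo)
qed

lemma endo_square_image: "\<beta> ` \<beta> ` L = scale (Q \<beta>) ` L"
  by (simp add: image_image Vpp_square(2)[OF Vpp])

lemma \<sigma>_nz: "\<sigma> x = 0 \<longleftrightarrow> x = 0"
  using absv_\<sigma>[of x] absv_eq_0 by metis

lemma act_class: "act_vertex \<beta> (homothety_class L) = homothety_class (\<beta> ` L)"
proof (intro equalityI subsetI)
  fix X assume "X \<in> act_vertex \<beta> (homothety_class L)"
  then obtain c where "c \<noteq> 0" "X = \<beta> ` scale c ` L" by (auto simp: act_vertex_def homothety_class_def)
  then show "X \<in> homothety_class (\<beta> ` L)"
    unfolding endo_scale_image homothety_class_def using \<sigma>_nz by (intro CollectI exI[of _ "\<sigma> c"]) simp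
next
  fix X assume "X \<in> homothety_class (\<beta> ` L)"
  then obtain c where c: "c \<noteq> 0" "X = scale c ` \<beta> ` L" by (rule in_classE)
  then have "X = \<beta> ` scale (\<sigma> c) ` L" by (simp add: endo_scale_image)
  moreover have "scale (\<sigma> c) ` L \<in> homothety_class L"
    unfolding homothety_class_def using c(1) \<sigma>_nz by (intro CollectI exI[of _ "\<sigma> c"]) simp
  ultimately show "X \<in> act_vertex \<beta> (homothety_class L)" unfolding act_vertex_def by (rule image_eqI)
qed

lemma act_vertices: "v \<in> vertices \<Longrightarrow> act_vertex \<beta> v \<in> vertices"
  by (elim verticesE) (auto simp: act_class vertices_def intro: lattice_endo)

lemma act_act: "v \<in> vertices \<Longrightarrow> act_vertex \<beta> (act_vertex \<beta> v) = v"
  by (elim verticesE) (simp add: act_class endo_square_image homothety_class_eqI Q_nz)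

lemma act_adjacent: assumes "adjacent v w" shows "adjacent (act_vertex \<beta> v) (act_vertex \<beta> w)"
proof -
  obtain L1 L2 where L: "v \<in> vertices" "w \<in> vertices" "L1 \<in> v" "L2 \<in> w" "scale \<pi> ` L1 \<subset> L2" "L2 \<subset> L1"
    using assms unfolding adjacent_def by (elim conjE bexE)
  have "\<beta> ` L1 \<in> act_vertex \<beta> v" "\<beta> ` L2 \<in> act_vertex \<beta> w" using L(3,4) by (auto simp: act_vertex_def)
  moreover have "\<beta> ` A \<subset> \<beta> ` B" if "A \<subset> B" for A B
    by (rule image_strict_mono[OF inj_on_subset[OF inj_endo subset_UNIV] that])
  moreover have "scale \<pi> ` \<beta> ` L1 = \<beta> ` scale \<pi> ` L1" by (simp add: endo_scale_image \<sigma>_Qp)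
  ultimately show ?thesis unfolding adjacent_def
    using L(5,6) by (intro conjI act_vertices L bexI[of _ "\<beta> ` L2"] bexI[of _ "\<beta> ` L1"]) simp_all
qed

lemma act_path: "(adjacent ^^ n) v w \<Longrightarrow> (adjacent ^^ n) (act_vertex \<beta> v) (act_vertex \<beta> w)"
proof (induction n arbitrary: w)
  case (Suc n)
  then obtain x where x: "(adjacent ^^ n) v x" "adjacent x w" by auto
  show ?case using Suc.IH[OF x(1)] act_adjacent[OF x(2)] by (rule relpowp_Suc_I)
qed simp

subsection \<open>Distance to the fixed points\<close>

lemma tree_supp:
  assumes "y \<in> tree"
  shows "finite (supp y)" "supp y \<noteq> {}" "supp y \<subseteq> vertices" "\<And>a. 0 \<le> y a" "\<And>a. y a \<le> 1"
    and "\<And>a b. a \<in> supp y \<Longrightarrow> b \<in> supp y \<Longrightarrow> a \<noteq> b \<Longrightarrow> adjacent a b \<and> y a + y b = 1"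
proof -
  obtain s where s: "s \<in> simplices" "supp y \<subseteq> s" and sum: "(\<Sum>v\<in>supp y. y v) = 1" and pos: "\<And>v. 0 \<le> y v"
    using assms by (auto simp: tree_def)
  obtain c d where cd: "s = {c, d}" "c \<in> vertices" "d \<in> vertices" "c \<noteq> d \<longrightarrow> adjacent c d"
  proof -
    have "(\<exists>v. s = {v} \<and> v \<in> vertices) \<or> (\<exists>v w. s = {v, w} \<and> adjacent v w)"
      using s(1) unfolding simplices_def Un_iff mem_Collect_eq .
    then show thesis
    proof (elim disjE exE conjE)
      fix v assume "s = {v}" "v \<in> vertices" then show thesis using that[of v v] by simp
    next
      fix v w assume a: "s = {v, w}" "adjacent v w"
      have "v \<in> vertices" "w \<in> vertices" using a(2) by (simp_all add: adjacent_def)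
      then show thesis using that[of v w] a by simp
    qed
  qed
  show fin: "finite (supp y)" using s(2) unfolding cd(1) by (rule finite_subset) simp
  show "supp y \<noteq> {}" using sum by auto
  show "supp y \<subseteq> vertices" using s(2) cd by auto
  show "0 \<le> y a" for a by (rule pos)
  show "y a \<le> 1" for a
  proof (cases "a \<in> supp y")
    case True
    then have "y a \<le> (\<Sum>v\<in>supp y. y v)" by (intro member_le_sum) (auto simp: pos fin)
    then show ?thesis by (simp add: sum)
  qed (simp add: supp_def)
  fix a b assume ab: "a \<in> supp y" "b \<in> supp y" "a \<noteq> b"
  have "a \<in> {c, d}" "b \<in> {c, d}" using subsetD[OF s(2) ab(1)] subsetD[OF s(2) ab(2)] by (simp_all only: cd(1))
  then have or: "(a = c \<and> b = d) \<or> (a = d \<and> b = c)" using ab(3) by simp metis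
  then have "{c, d} = {a, b}" by (elim disjE conjE) (simp_all add: insert_commute)
  then have e: "supp y = {a, b}" using s(2) ab(1,2) unfolding cd(1) by (intro equalityI) simp_all
  have "adjacent a b" using or cd(4) ab(3) adjacent_sym[of c d] by (elim disjE conjE) simp_all
  then show "adjacent a b \<and> y a + y b = 1" using sum ab(3) by (simp add: e)
qed

lemma vertex_point_simps: "supp (vertex_point v) = {v}" "vertex_point v v = 1" "w \<noteq> v \<Longrightarrow> vertex_point v w = 0"
  by (auto simp: supp_def vertex_point_def indicator_def)

lemma vertex_point_tree: "v \<in> vertices \<Longrightarrow> vertex_point v \<in> tree"
  unfolding tree_def by (auto simp: vertex_point_simps simplices_def) (auto simp: vertex_point_def)

text \<open>A path from \<open>v\<close> to a fixed point, followed by its image, leads from \<open>v\<close> to the image of \<open>v\<close>.\<close>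

lemma fixed_point_path:
  assumes y: "y \<in> fixed_points \<beta>" "w \<in> supp y" and path: "(adjacent ^^ n) v w"
    and m: "\<And>k. (adjacent ^^ k) v (act_vertex \<beta> v) \<Longrightarrow> m \<le> k"
  shows "real m \<le> 2 * real n + 2 * (1 - y w)"
proof -
  have y': "y \<in> tree" "act_point \<beta> y = y" using y(1) by (auto simp: fixed_points_def)
  note t = tree_supp[OF y'(1)]
  have w: "w \<in> vertices" using subsetD[OF t(3) y(2)] .
  have ret: "(adjacent ^^ n) (act_vertex \<beta> w) (act_vertex \<beta> v)" by (rule path_sym[OF act_path[OF path]])
  have yw: "y (act_vertex \<beta> w) = y w"
  proof -
    have inj: "x = w" if x: "x \<in> supp y" "act_vertex \<beta> x = act_vertex \<beta> w" for x
      using act_act[OF subsetD[OF t(3) x(1)]] act_act[OF w] unfolding x(2) by (rule trans[OF sym])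
    have "{x \<in> supp y. act_vertex \<beta> x = act_vertex \<beta> w} = {w}"
    proof (intro equalityI subsetI)
      fix x assume "x \<in> {x \<in> supp y. act_vertex \<beta> x = act_vertex \<beta> w}"
      then show "x \<in> {w}" using inj by simp
    next
      fix x assume "x \<in> {w}"
      then show "x \<in> {x \<in> supp y. act_vertex \<beta> x = act_vertex \<beta> w}" using y(2) by simp
    qed
    then have "act_point \<beta> y (act_vertex \<beta> w) = y w" by (simp add: act_point_def)
    then show ?thesis by (simp add: y'(2))
  qed
  show ?thesis
  proof (cases "act_vertex \<beta> w = w")
    case True
    then have "(adjacent ^^ n) w (act_vertex \<beta> v)" using ret by simp
    then have "(adjacent ^^ (n + n)) v (act_vertex \<beta> v)" unfolding relpowp_add using path by (rule relcomppI[rotated])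
    then have "m \<le> n + n" by (rule m)
    then show ?thesis using t(5)[of w] by simp
  next
    case False
    have "act_vertex \<beta> w \<in> supp y" using y(2) yw by (simp add: supp_def)
    then have a: "adjacent w (act_vertex \<beta> w)" "y w + y (act_vertex \<beta> w) = 1" using t(6)[OF y(2)] False by auto
    have "(adjacent ^^ Suc n) v (act_vertex \<beta> w)" using path a(1) by (rule relpowp_Suc_I)
    then have "(adjacent ^^ (Suc n + n)) v (act_vertex \<beta> v)" unfolding relpowp_add using ret by (rule relcomppI)
    then have "m \<le> Suc n + n" by (rule m)
    then show ?thesis using a(2) yw by simp
  qed
qed

text \<open>
  The way from \<open>v\<close> to a fixed point and on to the image of \<open>v\<close> has twice the length of its first half, also
  when the fixed point lies inside an edge.
\<close>

lemma tree_dist_fixed_ge: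
  assumes v: "v \<in> vertices" and y: "y \<in> fixed_points \<beta>"
    and m: "\<And>k. (adjacent ^^ k) v (act_vertex \<beta> v) \<Longrightarrow> m \<le> k"
  shows "real m / 2 \<le> tree_dist (vertex_point v) y"
proof -
  have y': "y \<in> tree" using y by (simp add: fixed_points_def)
  note t = tree_supp[OF y']
  let ?x = "vertex_point v"
  let ?A = "{\<bar>?x a - y a\<bar> | a b. adjacent a b \<and> supp ?x \<union> supp y \<subseteq> {a, b}}"
  let ?B = "{(1 - ?x a) + real (vertex_dist a b) + (1 - y b) | a b. a \<in> supp ?x \<and> b \<in> supp y}"
  have "?B \<noteq> {}" using t(2) by (auto simp: vertex_point_simps)
  then have ne: "?A \<union> ?B \<noteq> {}" by simp
  have A: "real m / 2 \<le> \<bar>?x a - y a\<bar>" if ab: "adjacent a b" "v \<in> {a, b}" "supp y \<subseteq> {a, b}" for a b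
  proof (cases "v \<in> supp y")
    case True
    have "real m \<le> 2 * (1 - y v)" using fixed_point_path[OF y True, of 0 v, OF _ m] by simp
    moreover have "\<bar>?x a - y a\<bar> = 1 - y v"
    proof (cases "a = v")
      case True then show ?thesis using t(5)[of v] by (simp add: vertex_point_simps)
    next
      case False
      have "y a + y v = 1"
      proof (cases "a \<in> supp y")
        case True then show ?thesis using t(6)[OF True \<open>v \<in> supp y\<close> False] by simp
      next
        case na: False
        then have "supp y = {v}" using ab False \<open>v \<in> supp y\<close> by auto
        moreover have "(\<Sum>v\<in>supp y. y v) = 1" using y' by (simp add: tree_def)
        moreover have "y a = 0" using na by (simp add: supp_def)
        ultimately show ?thesis by simp
      qed
      then show ?thesis using t(4)[of a] False by (simp add: vertex_point_simps)
    qed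
    ultimately show ?thesis by simp
  next
    case False
    obtain w where w: "w \<in> supp y" using t(2) by blast
    then have "w \<noteq> v" using False by auto
    then have aw: "{a, b} = {v, w}" using w ab by auto
    then have s: "supp y = {w}" using ab(3) w False by auto
    moreover have "(\<Sum>v\<in>supp y. y v) = 1" using y' by (simp add: tree_def)
    ultimately have yw: "y w = 1" by simp
    have "adjacent v w" using ab(1) aw adjacent_sym[of a b] by (auto simp: doubleton_eq_iff)
    then have "(adjacent ^^ 1) v w" by (simp only: relpowp_1)
    then have m2: "real m \<le> 2" using fixed_point_path[OF y w, of 1 v, OF _ m] yw by simp
    have "y v = 0" using False by (simp add: supp_def)
    moreover have "vertex_point v w = 0" using \<open>w \<noteq> v\<close> by (rule vertex_point_simps(3))
    ultimately have "\<bar>?x a - y a\<bar> = 1" using aw yw \<open>w \<noteq> v\<close> by (auto simp: doubleton_eq_iff vertex_point_simps(2))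
    then show ?thesis using m2 by simp
  qed
  have B: "real m / 2 \<le> (1 - ?x a) + real (vertex_dist a b) + (1 - y b)" if ab: "a \<in> supp ?x" "b \<in> supp y" for a b
  proof -
    have "a = v" using ab(1) by (simp add: vertex_point_simps)
    moreover have "b \<in> vertices" using ab(2) t(3) by blast
    ultimately show ?thesis
      using fixed_point_path[OF y ab(2) vertex_dist_path[OF v], OF _ m] by (simp add: vertex_point_simps)
  qed
  show ?thesis unfolding tree_dist_def
  proof (rule cInf_greatest[OF ne])
    fix r assume "r \<in> ?A \<union> ?B"
    then show "real m / 2 \<le> r"
    proof
      assume "r \<in> ?A"
      then obtain a b where ab: "r = \<bar>?x a - y a\<bar>" "adjacent a b" "supp ?x \<union> supp y \<subseteq> {a, b}" by blast
      then show ?thesis using A[OF ab(2)] by (simp add: vertex_point_simps(1))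
    next
      assume "r \<in> ?B"
      then obtain a b where ab: "r = (1 - ?x a) + real (vertex_dist a b) + (1 - y b)" "a \<in> supp ?x" "b \<in> supp y" by blast
      show ?thesis unfolding ab(1) by (rule B[OF ab(2,3)])
    qed
  qed
qed

lemma tree_dist_le:
  assumes v: "v \<in> vertices" and y: "y \<in> tree" "w \<in> supp y" "(adjacent ^^ n) v w"
  shows "tree_dist (vertex_point v) y \<le> real n + (1 - y w)"
proof -
  note t = tree_supp[OF y(1)] and tv = tree_supp[OF vertex_point_tree[OF v]]
  let ?x = "vertex_point v"
  let ?A = "{\<bar>?x a - y a\<bar> | a b. adjacent a b \<and> supp ?x \<union> supp y \<subseteq> {a, b}}"
  let ?B = "{(1 - ?x a) + real (vertex_dist a b) + (1 - y b) | a b. a \<in> supp ?x \<and> b \<in> supp y}"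
  have pos: "0 \<le> (1 - ?x a) + real (vertex_dist a b) + (1 - y b)" for a b using t(5)[of b] tv(5)[of a] by simp
  have ge0: "0 \<le> r" if r: "r \<in> ?A \<union> ?B" for r
  proof (cases "r \<in> ?A")
    case False
    then have "r \<in> ?B" using r by (simp only: Un_iff) simp
    then obtain a b where "r = (1 - ?x a) + real (vertex_dist a b) + (1 - y b)" by blast
    then show ?thesis by (simp only: pos)
  next
    case True
    then obtain a b where "r = \<bar>?x a - y a\<bar>" by blast
    then show ?thesis by simp
  qed
  have "(1 - ?x v) + real (vertex_dist v w) + (1 - y w) \<in> ?A \<union> ?B"
    using y(2) vertex_point_simps(1)[of v] by blast
  then have "tree_dist ?x y \<le> (1 - ?x v) + real (vertex_dist v w) + (1 - y w)"
    unfolding tree_dist_def using ge0 by (intro cInf_lower bdd_belowI)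
  then show ?thesis using vertex_dist_le[OF y(3)] by (simp add: vertex_point_simps)
qed

end

context nondegenerate_endomorphism
begin

text \<open>
  Let \<open>\<beta> L = c (e, p\<^sup>m f)\<close> for a suitable basis \<open>e, f\<close> of \<open>L\<close>.  Then \<open>\<beta>\<close> reverses the geodesic from \<open>L\<close> to \<open>\<beta> L\<close>,
  whose midpoint is a fixed point of minimal distance \<open>m/2\<close>; and comparison of the volumes gives
  \<open>\<bar>Q \<beta>\<bar> = \<bar>c\<bar>\<^sup>2 p\<^sup>-\<^sup>m\<close>, so that \<open>\<bar>c\<bar> \<le> 1\<close> if and only if \<open>m \<le> ord Q \<beta>\<close>.
\<close>

lemma vertex_in_locus_iff:
  assumes L: "lattice L" and int: "absv (Q \<beta>) \<le> 1"
  shows "vertex_point (homothety_class L) \<in> tree_locus1 \<beta> \<longleftrightarrow> \<beta> \<in> N L"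
proof -
  obtain e f c m where ef: "form e f \<noteq> 0" and Lef: "L = lat e f" and c: "c \<noteq> 0"
    and bL: "\<beta> ` L = lat (scale c e) (scale (c * \<pi> ^ m) f)"
    using relative_position[OF L lattice_endo[OF L]] .
  have pz: "\<pi> ^ i \<noteq> 0" for i by simp
  have cp: "c * \<pi> ^ i \<noteq> 0" for i using c by simp
  define v where "v = homothety_class L"
  have v: "v \<in> vertices" using L by (auto simp: v_def vertices_def)
  have vol: "absv (Q \<beta>) = absv c * absv c * (1 / real p) ^ m"
  proof -
    have "lat (\<beta> e) (\<beta> f) = lat (scale c e) (scale (c * \<pi> ^ m) f)" using bL by (simp add: Lef semilinear_lat[OF sl])
    then have "absv (Q \<beta> * \<sigma> (form e f)) = absv (c * (c * \<pi> ^ m * form e f))"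
      using lat_eq_form by (metis form_endo form_scale_left form_scale_right)
    then show ?thesis using absv_pos[OF ef] by (simp add: absv_mult absv_p_power)
  qed
  have "Q \<beta> \<in> Zp" using int Vpp_square(1)[OF Vpp] by (simp add: Zp_def)
  then obtain d where d: "absv (Q \<beta>) = (1 / real p) ^ d" using Zp_power_exists[of "Q \<beta>"] Q_nz by metis
  have ord: "ord_p (Q \<beta>) = int d"
    unfolding ord_p_def
  proof (rule the_equality)
    show dd: "absv (Q \<beta>) = real p powi (- int d)"
      by (simp add: d power_int_minus power_one_over inverse_eq_divide)
    fix n assume "absv (Q \<beta>) = real p powi (- n)"
    then have e: "real p powi (- n) = real p powi (- int d)" using dd by simp
    show "n = int d"
    proof (rule ccontr)
      assume "n \<noteq> int d"
      then consider "- n < - int d" | "- int d < - n" by linarith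
      then show False
        using power_int_strict_increasing[of "- n" "- int d" "real p"] power_int_strict_increasing[of "- int d" "- n" "real p"]
          p_gt_1 e by cases simp_all
    qed
  qed
  \<comment> \<open>\<open>p\<^sup>m f\<close> lies in \<open>L\<close>, so only the coefficient of \<open>e\<close> matters.\<close>
  have inN: "\<beta> \<in> N L \<longleftrightarrow> absv c \<le> 1"
  proof -
    have "scale c e \<in> L \<longleftrightarrow> absv c \<le> 1" using vc_lat[OF ef, of c 0] by (simp add: vc_def Lef)
    moreover have "scale (c * \<pi> ^ m) f \<in> L" if "absv c \<le> 1"
    proof -
      have "absv (c * \<pi> ^ m) \<le> 1" using absv_mult_le[OF that, of "\<pi> ^ m" 1] p_gt_1 by (simp add: absv_p_power power_le_one)
      then show ?thesis using lat_scale[OF lat_basis(2)] by (simp add: Lef)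
    qed
    moreover have "\<beta> \<in> N L \<longleftrightarrow> lat (scale c e) (scale (c * \<pi> ^ m) f) \<subseteq> L" using Vpp bL by (simp add: N_def)
    ultimately show ?thesis unfolding Lef lat_subset_iff by blast
  qed
  have cm: "absv c \<le> 1 \<longleftrightarrow> m \<le> d"
  proof
    assume "absv c \<le> 1"
    then have "absv c * absv c \<le> 1" using absv_nonneg[of c] by (simp add: mult_le_one)
    then have "absv c * absv c * (1 / real p) ^ m \<le> 1 * (1 / real p) ^ m" by (rule mult_right_mono) simp
    then have le: "(1 / real p) ^ d \<le> (1 / real p) ^ m" using vol d by simp
    show "m \<le> d"
    proof (rule ccontr)
      assume "\<not> m \<le> d"
      then have "(1 / real p) ^ m < (1 / real p) ^ d" using p_gt_1 by (intro power_strict_decreasing) auto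
      then show False using le by simp
    qed
  next
    assume md: "m \<le> d"
    show "absv c \<le> 1"
    proof (rule ccontr)
      assume "\<not> absv c \<le> 1"
      then have "1 * 1 < absv c * absv c" by (intro mult_strict_mono) auto
      then have "1 * (1 / real p) ^ m < absv c * absv c * (1 / real p) ^ m" using p_gt_1 by (intro mult_strict_right_mono) auto
      moreover have "(1 / real p) ^ d \<le> (1 / real p) ^ m" using md p_gt_1 by (intro power_decreasing) auto
      ultimately show False using vol d by simp
    qed
  qed
  have act_v: "act_vertex \<beta> v = homothety_class (lat (scale c e) (scale (c * \<pi> ^ m) f))"
    by (simp add: v_def act_class bL)
  have len: "m \<le> k" if "(adjacent ^^ k) v (act_vertex \<beta> v)" for k
    using that unfolding act_v unfolding v_def Lef by (rule path_length_ge[OF ef c])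
  define X where "X j = lat e (scale (\<pi> ^ j) f)" for j
  define w where "w j = homothety_class (X j)" for j
  have lX: "lattice (X j)" for j unfolding X_def using ef by (intro lattice_lat) (simp add: form_scale_right)
  have wv: "w j \<in> vertices" for j using lX by (auto simp: w_def vertices_def)
  \<comment> \<open>The classes \<open>w 0, \<dots>, w m\<close> form the path from \<open>v\<close> to its image; \<open>\<beta>\<close> reverses it.\<close>
  have act_w: "act_vertex \<beta> (w j) = w (m - j)" if j: "j \<le> m" for j
  proof -
    have nz: "form (scale (c * \<pi> ^ j) e) (scale (c * \<pi> ^ m) f) \<noteq> 0"
      using ef c by (simp add: form_scale_left form_scale_right)
    have "c * \<pi> ^ j * \<pi> ^ (m - j) = c * \<pi> ^ m" using j by (simp add: mult.assoc flip: power_add)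
    note cj = this
    have "scale (c * \<pi> ^ j) ` X (m - j) = lat (scale (c * \<pi> ^ j) e) (scale (c * \<pi> ^ j * \<pi> ^ (m - j)) f)"
      by (simp add: X_def scale_lat)
    then have X: "scale (c * \<pi> ^ j) ` X (m - j) = lat (scale (c * \<pi> ^ j) e) (scale (c * \<pi> ^ m) f)"
      unfolding cj .
    have mem: "vc e f a b \<in> lat (scale (c * \<pi> ^ j) e) (scale (c * \<pi> ^ m) f) \<longleftrightarrow>
        absv a \<le> absv (c * \<pi> ^ j) \<and> absv b \<le> absv (c * \<pi> ^ m)" for a b
      by (rule mem_lat_scaled[OF ef cp cp])
    have jm: "absv (c * \<pi> ^ m) \<le> absv (c * \<pi> ^ j)"
      using j p_gt_1 absv_nonneg[of c] by (simp add: absv_mult absv_p_power mult_left_mono power_decreasing)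
    \<comment> \<open>Here \<open>c e\<close> is the image of some \<open>x\<close>, so \<open>\<beta> e\<close> is a multiple of \<open>x\<close> by \<open>Q \<beta> / \<sigma> c\<close>, of absolute value \<open>\<bar>c p\<^sup>m\<bar>\<close>.\<close>
    have be: "\<beta> e \<in> lat (scale (c * \<pi> ^ j) e) (scale (c * \<pi> ^ m) f)"
    proof -
      have "scale c e \<in> \<beta> ` L" unfolding bL by (rule lat_basis)
      then obtain x where x: "x \<in> L" "\<beta> x = scale c e" by (rule imageE) (rule that, assumption, erule sym)
      have "scale (\<sigma> c) (\<beta> e) = \<beta> (\<beta> x)" by (simp add: x(2) semilinear_simps[OF sl])
      also have "\<dots> = scale (Q \<beta>) x" by (rule Vpp_square(2)[OF Vpp])
      finally have "scale (inverse (\<sigma> c)) (scale (\<sigma> c) (\<beta> e)) = scale (inverse (\<sigma> c)) (scale (Q \<beta>) x)" by simp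
      then have b: "\<beta> e = scale (inverse (\<sigma> c) * Q \<beta>) x" using c \<sigma>_nz by simp
      have k: "absv (inverse (\<sigma> c) * Q \<beta>) = absv (c * \<pi> ^ m)"
        using absv_pos[OF c] by (simp add: absv_mult absv_inverse vol absv_p_power)
      obtain a b' where ab: "x = vc e f a b'" "absv a \<le> 1" "absv b' \<le> 1" using x(1) unfolding Lef by (rule lat_E)
      have le: "absv (inverse (\<sigma> c) * Q \<beta> * y) \<le> absv (c * \<pi> ^ m)" if "absv y \<le> 1" for y
        using absv_mult_le[of "inverse (\<sigma> c) * Q \<beta>" "absv (c * \<pi> ^ m)" y 1] k that by simp
      show ?thesis unfolding b ab(1) scale_vc mem by (rule conjI[OF order_trans[OF le[OF ab(2)] jm] le[OF ab(3)]])
    qed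
    have bf: "scale (\<pi> ^ j) (\<beta> f) \<in> lat (scale (c * \<pi> ^ j) e) (scale (c * \<pi> ^ m) f)"
    proof -
      have "\<beta> f \<in> lat (scale c e) (scale (c * \<pi> ^ m) f)" unfolding bL[symmetric] Lef by (rule imageI[OF lat_basis(2)])
      moreover obtain a b where ab: "\<beta> f = vc e f a b" using vc_exhaust[OF ef] by blast
      ultimately have "absv a \<le> absv c" "absv b \<le> absv (c * \<pi> ^ m)" using mem_lat_scaled[OF ef c cp] by simp_all
      moreover have "absv (\<pi> ^ j) \<le> 1" using p_gt_1 by (simp add: absv_p_power power_le_one)
      ultimately have "absv (\<pi> ^ j * a) \<le> absv (c * \<pi> ^ j)" "absv (\<pi> ^ j * b) \<le> absv (c * \<pi> ^ m)"
        using absv_mult_le[of "\<pi> ^ j" 1 b "absv (c * \<pi> ^ m)"] absv_mult_le[of "\<pi> ^ j" "absv (\<pi> ^ j)" a "absv c"]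
        by (simp_all add: absv_mult[of c "\<pi> ^ j"] mult.commute[of "absv c"])
      then show ?thesis unfolding ab scale_vc mem by blast
    qed
    have "\<beta> ` X j = lat (\<beta> e) (scale (\<pi> ^ j) (\<beta> f))"
      by (simp add: X_def semilinear_lat[OF sl] semilinear_simps[OF sl] \<sigma>_Qp Qp_power)
    also have "\<dots> = lat (scale (c * \<pi> ^ j) e) (scale (c * \<pi> ^ m) f)"
      by (rule lat_eqI[OF nz be bf])
        (simp add: form_scale_left form_scale_right form_endo absv_mult vol absv_p_power)
    finally show ?thesis unfolding w_def act_class X[symmetric] by (simp add: homothety_class_eqI[OF cp])
  qed
  have path: "(adjacent ^^ j) v (w j)" for j unfolding v_def w_def X_def Lef by (rule path_chain[OF ef])
  have adj: "adjacent (w j) (w (Suc j))" for j unfolding w_def X_def by (rule adjacent_chain[OF ef])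
  obtain y where y: "y \<in> fixed_points \<beta>" "tree_dist (vertex_point v) y \<le> real m / 2"
  proof (cases "even m")
    case True
    then obtain k where k: "m = k + k" by (auto elim!: evenE simp: mult_2)
    have a: "act_vertex \<beta> (w k) = w k" using act_w[of k] by (simp add: k)
    have "act_point \<beta> (vertex_point (w k)) x = vertex_point (w k) x" for x
    proof (cases "x = w k")
      case True
      have "{z \<in> {w k}. act_vertex \<beta> z = x} = {w k}" using a True by auto
      then show ?thesis unfolding act_point_def vertex_point_simps(1) by (simp add: True)
    next
      case False
      have "{z \<in> {w k}. act_vertex \<beta> z = x} = {}" using a False by auto
      then have "act_point \<beta> (vertex_point (w k)) x = 0"
        unfolding act_point_def vertex_point_simps(1) by (simp only: sum.empty)
      then show ?thesis using vertex_point_simps(3)[OF False] by simp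
    qed
    then have "act_point \<beta> (vertex_point (w k)) = vertex_point (w k)" by (rule ext)
    then have "vertex_point (w k) \<in> fixed_points \<beta>" using vertex_point_tree[OF wv] by (simp add: fixed_points_def)
    moreover have "tree_dist (vertex_point v) (vertex_point (w k)) \<le> real m / 2"
      using tree_dist_le[OF v vertex_point_tree[OF wv] _ path, of k] by (simp add: vertex_point_simps k)
    ultimately show thesis by (rule that)
  next
    case False
    then obtain k where k: "m = k + Suc k" by (metis oddE mult_2 add_Suc_right Suc_eq_plus1)
    \<comment> \<open>The midpoint of the middle edge is fixed although its ends are exchanged.\<close>
    let ?a = "w k" and ?b = "w (Suc k)"
    have ab: "act_vertex \<beta> ?a = ?b" "act_vertex \<beta> ?b = ?a" using act_w[of k] act_w[of "Suc k"] by (simp_all add: k)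
    have ne: "?a \<noteq> ?b"
    proof
      assume "?a = ?b"
      moreover have "form e (scale (\<pi> ^ k) f) \<noteq> 0" using ef by (simp add: form_scale_right)
      ultimately have "Suc 0 \<le> 0"
        using path_length_ge[of e "scale (\<pi> ^ k) f" 1 0 "Suc 0"] by (simp add: w_def X_def)
      then show False by simp
    qed
    define y where "y x = (if x = ?a \<or> x = ?b then 1 / 2 else 0 :: real)" for x
    have supp: "supp y = {?a, ?b}" by (auto simp: supp_def y_def)
    have yt: "y \<in> tree"
    proof -
      have "{?a, ?b} \<in> simplices" unfolding simplices_def
        by (intro UnI2 CollectI exI[of _ "?a"] exI[of _ "?b"] conjI refl adj)
      moreover have "(\<Sum>x\<in>supp y. y x) = 1" unfolding supp using ne by (simp add: y_def)
      moreover have "0 \<le> y x" for x by (simp add: y_def)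
      ultimately show ?thesis unfolding tree_def by (intro CollectI conjI allI bexI[of _ "{?a, ?b}"]) (simp_all only: supp order_refl)
    qed
    have "act_point \<beta> y x = y x" for x
    proof -
      consider "x = ?a" | "x = ?b" | "x \<noteq> ?a" "x \<noteq> ?b" by blast
      then show ?thesis
      proof cases
        case 1
        have "{z \<in> supp y. act_vertex \<beta> z = x} = {?b}" 
        proof (rule set_eqI)
          fix z show "z \<in> {z \<in> supp y. act_vertex \<beta> z = x} \<longleftrightarrow> z \<in> {?b}"
            unfolding supp 1 by (cases "z = ?a"; cases "z = ?b") (simp_all add: ab ne ne[symmetric])
        qed
        then show ?thesis by (simp add: act_point_def y_def 1)
      next
        case 2
        have "{z \<in> supp y. act_vertex \<beta> z = x} = {?a}" 
        proof (rule set_eqI)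
          fix z show "z \<in> {z \<in> supp y. act_vertex \<beta> z = x} \<longleftrightarrow> z \<in> {?a}"
            unfolding supp 2 by (cases "z = ?a"; cases "z = ?b") (simp_all add: ab ne ne[symmetric])
        qed
        then show ?thesis by (simp add: act_point_def y_def 2)
      next
        case 3
        have "{z \<in> supp y. act_vertex \<beta> z = x} = {}" 
        proof (rule set_eqI)
          fix z show "z \<in> {z \<in> supp y. act_vertex \<beta> z = x} \<longleftrightarrow> z \<in> {}"
            unfolding supp using 3 by (cases "z = ?a"; cases "z = ?b") (simp_all add: ab 3[symmetric])
        qed
        then have "act_point \<beta> y x = 0" unfolding act_point_def by (simp only: sum.empty)
        then show ?thesis using 3 by (simp add: y_def)
      qed
    qed
    then have "act_point \<beta> y = y" by (rule ext)
    then have "y \<in> fixed_points \<beta>" using yt unfolding fixed_points_def by simp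
    moreover have "tree_dist (vertex_point v) y \<le> real m / 2"
    proof -
      have "?a \<in> supp y" "y ?a = 1 / 2" by (simp_all add: supp y_def)
      moreover have "real m / 2 = real k + 1 / 2" by (simp add: k)
      ultimately show ?thesis using tree_dist_le[OF v yt _ path, of k] by simp
    qed
    ultimately show thesis by (rule that)
  qed
  have ge: "real m / 2 \<le> tree_dist (vertex_point v) z" if "z \<in> fixed_points \<beta>" for z
    using tree_dist_fixed_ge[OF v that len] .
  have bdd: "bdd_below (tree_dist (vertex_point v) ` fixed_points \<beta>)"
    by (rule bdd_belowI2[where m = "real m / 2"]) (rule ge)
  have "(INF z\<in>fixed_points \<beta>. tree_dist (vertex_point v) z) = real m / 2"
  proof (rule antisym)
    show "(INF z\<in>fixed_points \<beta>. tree_dist (vertex_point v) z) \<le> real m / 2"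
      by (rule order_trans[OF cINF_lower[OF bdd y(1)] y(2)])
    show "real m / 2 \<le> (INF z\<in>fixed_points \<beta>. tree_dist (vertex_point v) z)"
      by (rule cINF_greatest[OF _ ge]) (use y(1) in blast)
  qed
  then have "vertex_point v \<in> tree_locus1 \<beta> \<longleftrightarrow> m \<le> d"
    using vertex_point_tree[OF v] by (simp add: tree_locus1_def ord)
  then show ?thesis unfolding v_def[symmetric] inN cm .
qed

end

context symplectic_plane
begin

subsection \<open>Independence of the orthogonal basis\<close>

lemma Zp_span_op_iff:
  fixes Y :: "'k^4^3"
  assumes ef: "form e f \<noteq> 0"
  shows "b \<in> Zp_span (\<lambda>i. op e f (Y$i)) \<longleftrightarrow> (\<exists>c\<in>pvec 0. b = op e f (c v* Y))"
  by (auto simp: Zp_span_def op_comb[OF ef] pvec_def pideal_0)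

lemma span_coords:
  fixes Y :: "'k^4^3"
  assumes ef: "form e f \<noteq> 0" and g: "\<And>i. \<gamma> i \<in> Zp_span (\<lambda>i. op e f (Y$i))"
  obtains C where "C \<in> pmat 0" "\<gamma> = (\<lambda>i. op e f ((C ** Y)$i))"
proof -
  have "\<exists>c. c \<in> pvec 0 \<and> \<gamma> i = op e f (c v* Y)" for i
    using g[of i] unfolding Zp_span_op_iff[OF ef] by (elim bexE) (rule exI, rule conjI)
  then obtain c where c: "\<And>i. c i \<in> pvec 0 \<and> \<gamma> i = op e f (c i v* Y)" by metis
  define C where "C = (\<chi> i. c i)"
  have "C \<in> pmat 0" using c by (simp add: pmat_rows C_def)
  moreover have "\<gamma> = (\<lambda>i. op e f ((C ** Y)$i))" using c by (simp add: fun_eq_iff rows_mult C_def)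
  ultimately show thesis by (rule that)
qed

lemma qvec_rows: "Y \<in> qmat \<longleftrightarrow> (\<forall>i. Y$i \<in> qvec)" by (simp add: qmat_def qvec_def)

lemma Zp_span_member: "\<beta> i \<in> Zp_span \<beta>" for \<beta> :: "3 \<Rightarrow> 'u \<Rightarrow> 'u"
  unfolding Zp_span_def by (intro CollectI exI[of _ "axis i 1"] conjI) (simp add: comb_axis, simp add: axis_def)

text \<open>
  Diagonalising the Gram matrix over \<open>\<int>\<^sub>p\<close> gives an orthogonal family with the same span; it is independent because the
  Gram matrix is regular.
\<close>

lemma orthogonal_basis_exists:
  assumes ef: "form e f \<noteq> 0" "form e f \<in> Qp" and Y: "\<And>i. Y$i \<in> qvec"
    and T: "gram Y \<in> pmat 0" "det (gram Y) \<noteq> 0"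
  shows "\<exists>\<gamma> :: 3 \<Rightarrow> 'u \<Rightarrow> 'u. orthogonal_Zp_basis \<gamma> (Zp_span (\<lambda>i::3. op e f (Y$i)))"
proof -
  have "gram Y $ i $ j \<in> Qp" for i j using T(1) by (simp add: pmat_def pideal_def)
  then obtain G where G: "G \<in> GLz" "\<And>i j. i \<noteq> j \<Longrightarrow> (G ** gram Y ** transpose G) $ i $ j = 0"
    using diagonalise[OF gram_symmetric, of Y] by blast
  obtain H where H: "H \<in> GLz" "H ** G = mat 1" using GLz_inverse[OF G(1)] by blast
  define \<gamma> where "\<gamma> = (\<lambda>i. op e f ((G ** Y)$i))"
  have q: "(G ** Y)$i \<in> qvec" for i
    using qmat_mult[OF pmat_qmat[OF GLz_pmat[OF G(1)]], of Y] Y by (simp add: qvec_rows)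
  have Zp: "(\<forall>i. c$i \<in> Zp) \<longleftrightarrow> c \<in> pvec 0" for c :: "'k^3" by (simp add: pvec_def pideal_0)
  have "Zp_span \<gamma> = Zp_span (\<lambda>i. op e f (Y$i))"
  proof (intro equalityI subsetI)
    fix b assume "b \<in> Zp_span \<gamma>"
    then obtain c where c: "c \<in> pvec 0" "b = op e f (c v* (G ** Y))"
      unfolding \<gamma>_def Zp_span_op_iff[OF ef(1)] by (rule bexE)
    have "b = op e f ((c v* G) v* Y)" by (simp add: c(2) vector_matrix_mul_assoc)
    then show "b \<in> Zp_span (\<lambda>i. op e f (Y$i))"
      unfolding Zp_span_op_iff[OF ef(1)] using pvec_mult_left[OF c(1) GLz_pmat[OF G(1)]] by (rule bexI)
  next
    fix b assume "b \<in> Zp_span (\<lambda>i. op e f (Y$i))"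
    then obtain c where c: "c \<in> pvec 0" "b = op e f (c v* Y)" unfolding Zp_span_op_iff[OF ef(1)] by (rule bexE)
    have "(c v* H) v* (G ** Y) = c v* ((H ** G) ** Y)" by (simp only: vector_matrix_mul_assoc matrix_mul_assoc)
    then have "b = op e f ((c v* H) v* (G ** Y))" by (simp add: c(2) H(2))
    then show "b \<in> Zp_span \<gamma>"
      unfolding \<gamma>_def Zp_span_op_iff[OF ef(1)] using pvec_mult_left[OF c(1) GLz_pmat[OF H(1)]] by (rule bexI)
  qed
  moreover have "c = 0" if c: "c \<in> pvec 0" "comb c \<gamma> = (\<lambda>u. 0)" for c
  proof -
    define z where "z = c v* (G ** Y)"
    have "c \<in> qvec" using c(1) by (simp add: pvec_def pideal_def qvec_def)
    then have z: "z \<in> qvec" unfolding z_def by (rule qvec_mult[OF _ q])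
    have 0: "(0 :: 'k^4) \<in> qvec" by (simp add: qvec_def)
    have "op e f z = (\<lambda>u. 0)" using c(2) by (simp add: \<gamma>_def op_comb[OF ef(1)] z_def)
    moreover have "op e f 0 = (\<lambda>u. 0)" by (simp add: op_def fun_eq_iff)
    ultimately have eq: "op e f z = op e f 0" by simp
    have "2 * h z (Y$j) = 2 * h 0 (Y$j)" for j
      by (rule trans[OF sym[OF bil_op[OF ef(1) z Y[of j], unfolded eq]] bil_op[OF ef(1) 0 Y[of j]]])
    moreover have "h 0 y = 0" for y by (simp add: h_def)
    ultimately have hz: "h z (Y$j) = 0" for j by simp
    have "(c v* G) v* gram Y = 0"
    proof -
      have "((c v* G) v* gram Y)$j = h z (Y$j)" for j
      proof -
        have lin: "h (x v* Y) y = (\<Sum>k\<in>UNIV. x$k * h (Y$k) y)" for x :: "'k^3" and y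
          by (simp add: vector_matrix_mult_def sum_3 h_def algebra_simps add_divide_distrib)
        have zG: "z = (c v* G) v* Y" by (simp add: z_def vector_matrix_mul_assoc)
        have "h z (Y$j) = (\<Sum>k\<in>UNIV. (c v* G)$k * h (Y$k) (Y$j))" unfolding zG by (rule lin)
        then show ?thesis by (simp add: vector_matrix_mult_def gram_def)
      qed
      then show ?thesis by (simp add: vec_eq_iff hz)
    qed
    then have z0: "((c v* G) v* gram Y) v* B = 0 v* B" for B :: "'k^3^3" by (simp only:)
    obtain B where B: "gram Y ** B = mat 1" using T(2) by (meson invertible_det_nz invertible_def)
    have "c v* G = ((c v* G) v* gram Y) v* B" by (simp only: vector_matrix_mul_assoc B matrix_mul_assoc[symmetric] matrix_mul_rid)
    also have "\<dots> = 0 v* B" by (rule z0)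
    also have "\<dots> = 0" by (simp add: vec_eq_iff vector_matrix_mult_def)
    finally show "c = 0" by (rule GLz_vec_eq_0[OF G(1)])
  qed
  moreover have "bil (\<gamma> i) (\<gamma> j) = 0" if "i \<noteq> j" for i j
  proof -
    have "h ((G ** Y)$i) ((G ** Y)$j) = (G ** gram Y ** transpose G) $ i $ j"
      using gram_mult[of G Y] by (simp add: gram_def vec_eq_iff)
    then show ?thesis unfolding \<gamma>_def bil_op[OF ef(1) q q] using G(2)[OF that] by simp
  qed
  ultimately have "orthogonal_Zp_basis \<gamma> (Zp_span (\<lambda>i. op e f (Y$i)))"
    unfolding orthogonal_Zp_basis_def Zp_basis_def Zp by (intro conjI allI impI) (simp_all only:)
  then show ?thesis by (intro exI[of _ \<gamma>])
qed

text \<open>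
  The locus is defined by a chosen orthogonal basis, each of whose members has nonzero integral \<open>Q\<close>.  The endomorphisms
  preserving a lattice form a \<open>\<int>\<^sub>p\<close>-module, so only the span matters.
\<close>

lemma tree_locus_vertices_stable:
  fixes \<beta> :: "3 \<Rightarrow> 'u \<Rightarrow> 'u"
  assumes b: "\<And>i. \<beta> i \<in> Vpp" and T: "Q_matrix \<beta> \<in> pmat 0" "det (Q_matrix \<beta>) \<noteq> 0" and L0: "lattice L0"
  shows "tree_locus_vertices \<beta> = stable \<beta>"
proof -
  define \<gamma> :: "3 \<Rightarrow> 'u \<Rightarrow> 'u" where "\<gamma> = (SOME \<gamma>. orthogonal_Zp_basis \<gamma> (Zp_span \<beta>))"
  obtain e f where ef: "form e f \<noteq> 0" "form e f \<in> Qp" using lattice_rational_basis[OF L0] by metis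
  obtain Y where Y: "\<And>i. Y$i \<in> qvec" "\<beta> = (\<lambda>i. op e f (Y$i))"
    using Vpp_coords[where \<beta> = \<beta>, OF ef b] by blast
  have gY: "gram Y = Q_matrix \<beta>" using Q_matrix_op[OF ef(1) Y(1)] by (simp add: Y(2))
  have "\<exists>\<gamma> :: 3 \<Rightarrow> 'u \<Rightarrow> 'u. orthogonal_Zp_basis \<gamma> (Zp_span \<beta>)"
    unfolding Y(2) by (rule orthogonal_basis_exists[OF ef Y(1)]) (use T gY in simp_all)
  then have orth: "orthogonal_Zp_basis \<gamma> (Zp_span \<beta>)" unfolding \<gamma>_def by (rule someI_ex)
  then have sp: "Zp_span \<gamma> = Zp_span \<beta>" and o: "\<And>i j. i \<noteq> j \<Longrightarrow> bil (\<gamma> i) (\<gamma> j) = 0"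
    by (auto simp: orthogonal_Zp_basis_def Zp_basis_def)
  have "\<gamma> i \<in> Zp_span (\<lambda>i. op e f (Y$i))" for i using Zp_span_member[of \<gamma> i] unfolding sp Y(2) .
  then obtain C where C: "C \<in> pmat 0" "\<gamma> = (\<lambda>i. op e f ((C ** Y)$i))" using span_coords[OF ef(1), of \<gamma> Y] by metis
  define Z where "Z = C ** Y"
  have Z: "Z$i \<in> qvec" for i using qmat_mult[OF pmat_qmat[OF C(1)], of Y] Y(1) by (simp add: qvec_rows Z_def)
  have gZ: "\<gamma> = (\<lambda>i. op e f (Z$i))" using C(2) by (simp add: Z_def)
  have "\<beta> i \<in> Zp_span (\<lambda>i. op e f (Z$i))" for i using Zp_span_member[of \<beta> i] unfolding sp[symmetric] gZ .
  then obtain E where E: "E \<in> pmat 0" "\<beta> = (\<lambda>i. op e f ((E ** Z)$i))" using span_coords[OF ef(1), of \<beta> Z] by metis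
  have EZ: "(E ** Z)$i \<in> qvec" for i using qmat_mult[OF pmat_qmat[OF E(1)], of Z] Z by (simp add: qvec_rows)
  have "Q_matrix \<beta> = gram (E ** Z)" unfolding E(2) by (rule Q_matrix_op[OF ef(1) EZ])
  then have "det (Q_matrix \<beta>) = det E * det (gram Z) * det E" by (simp add: gram_mult det_mul)
  then have dZ: "det (gram Z) \<noteq> 0" using T(2) by auto
  have hZ: "h (Z$i) (Z$j) = 0" if "i \<noteq> j" for i j
    using o[OF that] unfolding gZ bil_op[OF ef(1) Z Z] by simp
  have Qg: "Q (\<gamma> i) = h (Z$i) (Z$i)" for i unfolding gZ Q_op[OF ef(1) Z] by (simp add: h_self)
  have Qnz: "Q (\<gamma> i) \<noteq> 0" for i
  proof
    assume "Q (\<gamma> i) = 0"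
    moreover have "det (gram Z) = h (Z$1) (Z$1) * h (Z$2) (Z$2) * h (Z$3) (Z$3)"
      unfolding det_3 by (simp add: gram_def hZ)
    ultimately show False using dZ exhaust_3[of i] by (auto simp: Qg)
  qed
  have "gram Z \<in> pmat 0"
    unfolding Z_def gram_mult gY using C(1) T(1) by (intro pmat_mult_left) (auto simp: pmat_transpose)
  then have Qint: "absv (Q (\<gamma> i)) \<le> 1" for i by (simp add: Qg pmat_def gram_def pideal_0 Zp_def)
  have V: "\<gamma> i \<in> Vpp" for i unfolding gZ by (rule op_Vpp[OF ef Z])
  have loc: "vertex_point (homothety_class L) \<in> tree_locus1 (\<gamma> i) \<longleftrightarrow> \<gamma> i \<in> N L" if "lattice L" for L i
  proof -
    interpret nondegenerate_endomorphism p absv Qp \<sigma> scale form "\<gamma> i"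
      by unfold_locales (use V Qnz in auto)
    show ?thesis by (rule vertex_in_locus_iff[OF that Qint])
  qed
  have same: "(\<forall>i. \<gamma> i \<in> N L) \<longleftrightarrow> (\<forall>i. \<beta> i \<in> N L)" if L: "lattice L" for L
  proof -
    have comb: "\<And>i. g i \<in> N L" if g': "\<And>i. g' i \<in> N L" and s: "\<And>i. g i \<in> Zp_span g'" for g g' :: "3 \<Rightarrow> 'u \<Rightarrow> 'u"
    proof -
      obtain e f where e: "form e f \<noteq> 0" "form e f \<in> Qp" "L = lat e f" using lattice_rational_basis[OF L] .
      have gV: "g' i \<in> Vpp" for i using g' by (simp add: N_def)
      obtain X where X: "\<And>i. X$i \<in> qvec" "g' = (\<lambda>i. op e f (X$i))"
        using Vpp_coords[where \<beta> = g', OF e(1,2) gV] by blast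
      have "X$i \<in> pvec 0" for i using g'[of i] op_N[OF e(1,2) X(1)] by (simp add: X(2) e(3))
      then have X0: "X \<in> pmat 0" by (simp add: pmat_rows)
      obtain K where K: "K \<in> pmat 0" "g = (\<lambda>i. op e f ((K ** X)$i))"
        using span_coords[OF e(1), of g X] s unfolding X(2) by metis
      have "K ** X \<in> pmat 0" using K(1) X0 by (rule pmat_mult_left)
      then have "(K ** X)$i \<in> pvec 0" "(K ** X)$i \<in> qvec" for i
        using pmat_qmat[of "K ** X"] by (simp_all add: pmat_rows qvec_rows)
      then show "g i \<in> N L" for i unfolding K(2) e(3) using op_N[OF e(1,2)] by simp
    qed
    show ?thesis using comb[of \<gamma> \<beta>] comb[of \<beta> \<gamma>] Zp_span_member[of \<beta>] Zp_span_member[of \<gamma>] sp by auto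
  qed
  have loc': "vertex_point v \<in> tree_locus \<beta> \<longleftrightarrow> (\<forall>i. vertex_point v \<in> tree_locus1 (\<gamma> i))" for v
    unfolding tree_locus_def Let_def \<gamma>_def by simp
  show ?thesis
  proof (intro equalityI subsetI)
    fix v assume v: "v \<in> tree_locus_vertices \<beta>"
    then have "v \<in> vertices" "vertex_point v \<in> tree_locus \<beta>" by (simp_all add: tree_locus_vertices_def)
    then obtain L where L: "lattice L" "v = homothety_class L" by (elim verticesE)
    have "\<forall>i. \<gamma> i \<in> N L" using \<open>vertex_point v \<in> tree_locus \<beta>\<close> loc[OF L(1)] unfolding loc' L(2) by simp
    then show "v \<in> stable \<beta>" using same[OF L(1)] L by (auto simp: stable_def)
  next
    fix v assume "v \<in> stable \<beta>"
    then obtain L where L: "v = homothety_class L" "lattice L" "\<forall>i. \<beta> i \<in> N L" by (auto simp: stable_def)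
    have "vertex_point v \<in> tree_locus1 (\<gamma> i)" for i using same[OF L(2)] L(3) loc[OF L(2)] unfolding L(1) by simp
    then have "vertex_point v \<in> tree_locus \<beta>" unfolding loc' by blast
    then show "v \<in> tree_locus_vertices \<beta>" using L(1,2) by (auto simp: tree_locus_vertices_def vertices_def)
  qed
qed

end

section \<open>The representation density\<close>

context symplectic_plane
begin

text \<open>
  The change of basis is invertible over \<open>\<int>\<^sub>p\<close>, and each coset modulo \<open>p\<^sup>t\<close> contains exactly one matrix with integer
  entries between \<open>0\<close> and \<open>p\<^sup>t - 1\<close>.
\<close>

lemma card_representations:
  assumes B: "B \<in> pmat 0" "C \<in> pmat 0" "C ** B = mat 1" "B ** C = mat 1" and S: "S = B ** hmat ** transpose B"
  shows "card (representations S T t) = ncos (pmat t) (reps t T)"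
proof -
  define f :: "int^3^4 \<Rightarrow> 'k^4^3" where "f x = transpose (map_matrix of_int x) ** B" for x
  have int: "transpose (map_matrix of_int x) \<in> (pmat 0 :: ('k^4^3) set)" for x :: "int^3^4"
    by (simp add: pmat_transpose) (simp add: pmat_def pideal_0 map_matrix_def)
  have f0: "f x \<in> pmat 0" for x unfolding f_def by (rule pmat_mult_left[OF int B(1)])
  have mem: "x \<in> representations S T t \<longleftrightarrow> (\<forall>i j. x$i$j \<in> {0..<int p ^ t}) \<and> f x \<in> reps t T" for x
  proof -
    let ?X = "map_matrix of_int x :: 'k^3^4"
    have "transpose ?X ** S ** ?X = gram (f x)"
      by (simp add: S gram_hmat f_def matrix_transpose_mul matrix_mul_assoc)
    then have "x \<in> representations S T t \<longleftrightarrow> (\<forall>i j. x$i$j \<in> {0..<int p ^ t}) \<and>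
        (\<forall>i j. \<exists>z\<in>Zp. gram (f x) $i$j - T$i$j = \<pi> ^ t * z)"
      by (simp add: representations_def Let_def)
    moreover have "(\<forall>i j. \<exists>z\<in>Zp. gram (f x) $i$j - T$i$j = \<pi> ^ t * z) \<longleftrightarrow> gram (f x) - T \<in> pmat t"
      by (simp add: pmat_def pideal_iff)
    ultimately show ?thesis using f0[of x] by (simp add: reps_def)
  qed
  have fin: "finite (representations S T t)"
  proof (rule finite_subset)
    have "finite {v :: int^3. \<forall>j. v$j \<in> {0..<int p ^ t}}" by (rule finite_vec_box) simp
    then show "finite {x :: int^3^4. \<forall>i. x$i \<in> {v. \<forall>j. v$j \<in> {0..<int p ^ t}}}" by (rule finite_vec_box)
    show "representations S T t \<subseteq> {x. \<forall>i. x$i \<in> {v. \<forall>j. v$j \<in> {0..<int p ^ t}}}" using mem by auto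
  qed
  have inj: "x = x'" if x: "x \<in> representations S T t" "x' \<in> representations S T t" and d: "f x - f x' \<in> pmat t" for x x'
  proof -
    let ?D = "transpose (map_matrix of_int x) - transpose (map_matrix of_int x') :: 'k^4^3"
    have "(f x - f x') ** C = ?D ** (B ** C)"
      by (simp add: f_def matrix_sub_rdistrib matrix_mul_assoc[symmetric])
    then have "?D \<in> pmat t" using pmat_mult_right[OF d B(2)] by (simp add: B(4))
    then have "of_int (x$i$j - x'$i$j) \<in> pideal t" for i j by (simp add: pmat_def map_matrix_def transpose_def)
    then have "int p ^ t dvd x$i$j - x'$i$j" for i j by (simp only: of_int_pideal_iff)
    then have "x$i$j mod int p ^ t = x'$i$j mod int p ^ t" for i j by (simp add: mod_eq_dvd_iff)
    moreover have "x$i$j \<in> {0..<int p ^ t}" "x'$i$j \<in> {0..<int p ^ t}" for i j using x mem by blast+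
    ultimately have "x$i$j = x'$i$j" for i j by (metis atLeastLessThan_iff mod_pos_pos_trivial)
    then show ?thesis by (simp add: vec_eq_iff)
  qed
  have sur: "\<exists>x\<in>representations S T t. f x - A \<in> pmat t" if A: "A \<in> reps t T" for A
  proof -
    have A0: "A \<in> pmat 0" "gram A - T \<in> pmat t" using A by (auto simp: reps_def)
    have AC: "A ** C \<in> pmat 0" using pmat_mult_left[OF A0(1) B(2)] .
    have ex: "\<exists>n. n \<in> {0..<int p ^ t} \<and> (A ** C)$j$i - of_int n \<in> pideal t" for i j
    proof -
      have "(A ** C)$j$i \<in> Zp" using AC by (simp add: pmat_def pideal_0)
      then obtain n where "0 \<le> n" "n < int p ^ t" "(A ** C)$j$i - of_int n \<in> pideal t" by (rule Zp_residue)
      then show ?thesis by (intro exI[of _ n]) simp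
    qed
    define n where "n i j = (SOME n. n \<in> {0..<int p ^ t} \<and> (A ** C)$j$i - of_int n \<in> pideal t)" for i j
    have n: "n i j \<in> {0..<int p ^ t} \<and> (A ** C)$j$i - of_int (n i j) \<in> pideal t" for i j
      unfolding n_def by (rule someI_ex[OF ex])
    define x :: "int^3^4" where "x = (\<chi> i j. n i j)"
    have "A ** C - transpose (map_matrix of_int x) \<in> pmat t"
      using n by (simp add: pmat_def x_def map_matrix_def transpose_def)
    then have "(A ** C - transpose (map_matrix of_int x)) ** B \<in> pmat t" using pmat_mult_right B(1) by blast
    moreover have "(A ** C - transpose (map_matrix of_int x)) ** B = A - f x"
      by (simp add: f_def matrix_sub_rdistrib B(3) flip: matrix_mul_assoc)
    ultimately have d: "f x - A \<in> pmat t" using subgp_commute[OF subgp_pmat] by metis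
    have "gram (f x) - gram A \<in> pmat t" by (rule gram_cong[OF f0 A0(1) d])
    then have "gram (f x) - T \<in> pmat t" using subgp_trans[OF subgp_pmat _ A0(2)] by blast
    then have "x \<in> representations S T t" unfolding mem using n f0 by (simp add: reps_def x_def)
    then show ?thesis using d by blast
  qed
  show ?thesis
    using ncos_transversal(1)[where f = f, OF subgp_pmat fin _ inj sur] mem by simp
qed

text \<open>The factors combine to \<open>p\<^sup>-\<^sup>6 p\<^sup>2 (p\<^sup>4 - 1) = 1 - p\<^sup>-\<^sup>4\<close> as soon as \<open>p\<^sup>t\<close> exceeds the determinant.\<close>

lemma density_seq_limit:
  fixes \<beta> :: "3 \<Rightarrow> 'u \<Rightarrow> 'u"
  assumes L0: "lattice L0" "form_matrix (N L0) S" and b: "\<And>i. \<beta> i \<in> Vpp"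
    and T: "Q_matrix \<beta> = T" "T \<in> Sym_Zp" "det T \<noteq> 0"
  shows "finite (stable \<beta>)"
    and "density_seq S T \<longlonglongrightarrow> (1 - real p powi (-4)) * real (card (stable \<beta>))"
proof -
  have T': "transpose T = T" "T \<in> pmat 0" using T(2) by (auto simp: Sym_Zp_def pmat_def pideal_0)
  obtain e f where ef: "form e f \<noteq> 0" "form e f \<in> Qp" "L0 = lat e f" using lattice_rational_basis[OF L0(1)] .
  obtain B C where B: "B \<in> pmat 0" "C \<in> pmat 0" "C ** B = mat 1" "B ** C = mat 1" "S = B ** hmat ** transpose B"
    using form_matrix_coords[OF ef(1,2) L0(2)[unfolded ef(3)]] .
  have p1: "1 / real p < 1" "0 \<le> 1 / real p" using p_gt_1 by simp_all
  obtain t0 where t0: "(1 / real p) ^ t0 < absv (det T)"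
    using real_arch_pow_inv[OF absv_pos[OF T(3)] p1(1)] by blast
  have big: "(1 / real p) ^ Suc t < absv (det T)" if "t0 \<le> t" for t
  proof -
    have "(1 / real p) ^ Suc t \<le> (1 / real p) ^ t0" using that p1 by (intro power_decreasing) auto
    then show ?thesis using t0 by linarith
  qed
  show "finite (stable \<beta>)" by (rule ncos_reps_stable(1)[where \<beta> = \<beta>, OF ef(1,2) b T(1) T' big[OF order_refl]])
  have val: "density_seq S T (Suc t) = (1 - real p powi (-4)) * real (card (stable \<beta>))" if "t0 \<le> t" for t
  proof -
    define P where "P = real p"
    have P: "0 < P" using p_pos by (simp add: P_def)
    have c: "card (representations S T (Suc t)) = p ^ (6 * t) * (p^2 * (p^4 - 1)) * card (stable \<beta>)"
      unfolding card_representations[OF B]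
      by (rule ncos_reps_stable(2)[where \<beta> = \<beta>, OF ef(1,2) b T(1) T' big[OF that]])
    have "1 \<le> p" using p_pos(2) by linarith
    then have "1 \<le> p ^ 4" by (rule one_le_power)
    then have p4: "real (p ^ 4 - 1) = P ^ 4 - 1" by (simp add: of_nat_diff P_def)
    have "int (Suc t) * (6 - 12) = - int (6 * Suc t)" by simp
    then have "real p powi (int (Suc t) * (6 - 12)) = inverse (P ^ (6 * Suc t))"
      by (simp only: power_int_minus power_int_of_nat P_def)
    then have "density_seq S T (Suc t) = inverse (P ^ (6 * Suc t)) * (P ^ (6 * t) * (P^2 * (P^4 - 1)) * real (card (stable \<beta>)))"
      unfolding density_seq_def c of_nat_mult p4 of_nat_power P_def[symmetric] by (simp only:)
    also have "P ^ (6 * Suc t) = P ^ (6 * t) * (P ^ 2 * P ^ 4)" by (simp add: add.commute flip: power_add)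
    also have "inverse (P ^ (6 * t) * (P ^ 2 * P ^ 4)) * (P ^ (6 * t) * (P^2 * (P^4 - 1)) * real (card (stable \<beta>)))
        = (1 - inverse (P ^ 4)) * real (card (stable \<beta>))"
      using P by (simp add: field_simps)
    also have "inverse (P ^ 4) = real p powi (-4)" by (simp add: P_def power_int_minus)
    finally show ?thesis .
  qed
  have "eventually (\<lambda>t. density_seq S T (Suc t) = (1 - real p powi (-4)) * real (card (stable \<beta>))) sequentially"
    using val by (auto simp: eventually_sequentially)
  then have "(\<lambda>t. density_seq S T (Suc t)) \<longlonglongrightarrow> (1 - real p powi (-4)) * real (card (stable \<beta>))"
    by (rule tendsto_eventually)
  then show "density_seq S T \<longlonglongrightarrow> (1 - real p powi (-4)) * real (card (stable \<beta>))" by (rule LIMSEQ_imp_Suc)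
qed

end

theorem theorem8p15:
  fixes p :: nat
    and absv :: "'k::field_char_0 \<Rightarrow> real"
    and Qp :: "'k set"
    and \<sigma> :: "'k \<Rightarrow> 'k"
    and scale :: "'k \<Rightarrow> 'u::ab_group_add \<Rightarrow> 'u"
    and form :: "'u \<Rightarrow> 'u \<Rightarrow> 'k"
    and \<Lambda>\<^sub>0 :: "'u set"
    and S :: "'k^4^4"
    and T :: "'k^3^3"
    and \<beta> :: "3 \<Rightarrow> 'u \<Rightarrow> 'u"
  assumes "symplectic_plane p absv Qp \<sigma> scale form"
    and "symplectic_plane.lattice absv scale \<Lambda>\<^sub>0"
    and "symplectic_plane.form_matrix absv Qp scale
           (symplectic_plane.N \<sigma> scale form \<Lambda>\<^sub>0) S"
    and "T \<in> map_matrix ((*) (of_nat p)) ` unramified_quadratic_extension.Sym_Zp absv Qp"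
    and "det T \<noteq> 0"
    and "\<forall>i. \<beta> i \<in> symplectic_plane.Vpp \<sigma> scale form"
    and "T = map_matrix ((*) (of_nat p)) (symplectic_plane.Q_matrix Qp scale \<beta>)"
  shows "finite (symplectic_plane.tree_locus_vertices p absv Qp scale \<beta>) \<and>
    convergent (unramified_quadratic_extension.density_seq p absv Qp S
                  (map_matrix ((*) (inverse (of_nat p))) T)) \<and>
    real (card (symplectic_plane.tree_locus_vertices p absv Qp scale \<beta>)) =
      inverse (1 - real p powi (-4)) *
      unramified_quadratic_extension.rep_density p absv Qp S
        (map_matrix ((*) (inverse (of_nat p))) T)"
proof -
  interpret symplectic_plane p absv Qp \<sigma> scale form by fact
  have pi: "\<pi> \<noteq> 0" by simp
  define Z where "Z = Q_matrix \<beta>"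
  have TZ: "T = map_matrix ((*) \<pi>) Z" using assms(7) by (simp add: Z_def)
  have ZT: "map_matrix ((*) (inverse \<pi>)) T = Z" by (simp add: TZ map_matrix_def vec_eq_iff)
  obtain Z' where Z': "Z' \<in> Sym_Zp" "T = map_matrix ((*) \<pi>) Z'" using assms(4) by blast
  have "Z' = Z" using Z'(2) TZ pi by (simp add: map_matrix_def vec_eq_iff)
  then have ZS: "Z \<in> Sym_Zp" using Z'(1) by simp
  have "det T = \<pi> ^ 3 * det Z"
    unfolding det_3 TZ by (simp add: map_matrix_def power3_eq_cube algebra_simps)
  then have dZ: "det Z \<noteq> 0" using assms(5) by auto
  have b: "\<beta> i \<in> Vpp" for i using assms(6) by blast
  have lim: "finite (stable \<beta>)" "density_seq S Z \<longlonglongrightarrow> (1 - real p powi (-4)) * real (card (stable \<beta>))"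
    by (rule density_seq_limit[OF assms(2,3) b _ ZS dZ]; simp add: Z_def)+
  have st: "tree_locus_vertices \<beta> = stable \<beta>"
  proof (rule tree_locus_vertices_stable[OF b _ _ assms(2)])
    show "Q_matrix \<beta> \<in> pmat 0" using ZS by (simp add: Z_def Sym_Zp_def pmat_def pideal_0)
    show "det (Q_matrix \<beta>) \<noteq> 0" using dZ by (simp add: Z_def)
  qed
  have "real p powi (-4) < 1"
    using p_gt_1 by (simp add: power_int_minus inverse_less_1_iff one_less_power)
  then have "inverse (1 - real p powi (-4)) * rep_density S Z = real (card (stable \<beta>))"
    unfolding rep_density_def limI[OF lim(2)] by (simp flip: mult.assoc)
  then show ?thesis unfolding ZT st using lim convergentI[OF lim(2)] by simp
qed

end
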